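(* Let $G_{\mathbf z}=G_\Gamma\rtimes_{\delta_{\mathbf z}}\Delta$ be a $\Delta$-RAAG. For every integer $n\ge 2$, $$G_{\Gamma,n}=G_{\mathbf z,n}.$$ As a consequence, for every integer $n\ge 2$, $$\mathcal L_n(G_{\mathbf z}):=G_{\mathbf z,n}/G_{\mathbf z,n+1}\simeq\mathcal L_{\Gamma,n}.$$
   Context: $\Delta:=\mathbb{Z}/2\mathbb{Z}$ is written multiplicatively with generator $x_0$. For a finite undirected graph $\Gamma=(\mathbf{X},\mathbf{E})$ with vertex set $\{1,\dots,d_\Gamma\}$, $G_\Gamma$ is the pro-$2$ group with generators $x_1,\dots,x_{d_\Gamma}$ and relations $[x_i,x_j]:=x_i^{-1}x_j^{-1}x_ix_j=1$ for $\{i,j\}\in\mathbf{E}$. If $\mathbf{z}=(z_1,\dots,z_{d_\Gamma})\in G_\Gamma^{d_\Gamma}$ is such that there is a well-defined action $\delta_{\mathbf z}:\Delta\to\mathrm{Aut}(G_\Gamma)$ with $\delta_{\mathbf z}(x_0)(x_i)=z_i^{-1}x_i^{-1}z_i$ for all $i$, then $G_{\mathbf z}:=G_\Gamma\rtimes_{\delta_{\mathbf z}}\Delta$ is called a $\Delta$-RAAG; $G_\Gamma$ is viewed as a subgroup of $G_{\mathbf z}$. For a pro-$2$ group $G$, $G_n:=\{g\in G\mid g-1\in E_n(G)\}$ is the Zassenhaus filtration, where $E_n(G)$ is the $n$-th power of the augmentation ideal of the completed group algebra $E(G)=\mathbb F_2[[G]]$. $G_{\Gamma,n}$ and $G_{\mathbf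 z,n}$ denote the $n$-th terms for $G_\Gamma$ and $G_{\mathbf z}$. $\mathcal L_\Gamma=\bigoplus_n\mathcal L_{\Gamma,n}$ is the quotient of the free restricted graded Lie algebra over $\mathbb F_2$ on $X_1,\dots,X_{d_\Gamma}$ (each of degree $1$) by the restricted Lie ideal generated by $[X_u,X_v]$ for $\{u,v\}\in\mathbf E$. *)

theory Defs
  imports
    "HOL-Algebra.Bij"
    "HOL-Algebra.Elementary_Groups"
    "HOL-Algebra.Ideal_Product"
    "HOL-Analysis.Function_Topology"
    "HOL-Analysis.Product_Topology"
    "HOL-Library.Z2"
begin

section \<open>Pro-2 groups given by generators and relations\<close>

text \<open>
  Topological groups are pairs of a group \<open>G\<close> and a topology \<open>T\<close> with
  \<open>topspace T = carrier G\<close>.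
\<close>

subsection \<open>The abstract free group\<close>

text \<open>The letter \<open>(x, True)\<close> stands for \<open>x\<close>, the letter \<open>(x, False)\<close> for its inverse.\<close>

definition letter_inv :: "'x \<times> bool \<Rightarrow> 'x \<times> bool" where
  "letter_inv a = (fst a, \<not> snd a)"

definition reduced_word :: "('x \<times> bool) list \<Rightarrow> bool" where
  "reduced_word w \<longleftrightarrow> successively (\<lambda>a b. b \<noteq> letter_inv a) w"

definition cons_reduce :: "'x \<times> bool \<Rightarrow> ('x \<times> bool) list \<Rightarrow> ('x \<times> bool) list" where
  "cons_reduce a w =
     (case w of [] \<Rightarrow> [a] | b # v \<Rightarrow> if b = letter_inv a then v else a # w)"

definition free_group :: "'x set \<Rightarrow> ('x \<times> bool) list monoid" where
  "free_group S =
     \<lparr>carrier = {w \<in> lists (S \<times> UNIV). reduced_word w},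
      mult = (\<lambda>u v. foldr cons_reduce u v),
      one = []\<rparr>"

subsection \<open>Pro-2 completion\<close>

definition two_power_normal :: "('a, 'm) monoid_scheme \<Rightarrow> 'a set set" where
  "two_power_normal G = {N. N \<lhd> G \<and> (\<exists>k. card (carrier (G Mod N)) = 2 ^ k)}"

text \<open>
  The inverse limit of the finite 2-group quotients \<open>G Mod N\<close>. For \<open>N \<subseteq> M\<close> the transition map sends
  a coset of \<open>N\<close> to the unique coset of \<open>M\<close> containing it, so compatibility of a family is
  \<open>a N \<subseteq> a M\<close>.
\<close>

definition pro2_completion :: "('a, 'm) monoid_scheme \<Rightarrow> ('a set \<Rightarrow> 'a set) monoid" where
  "pro2_completion G =
     \<lparr>carrier = {a \<in> \<Pi>\<^sub>E N \<in> two_power_normal G. carrier (G Mod N).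
                  \<forall>N \<in> two_power_normal G. \<forall>M \<in> two_power_normal G. N \<subseteq> M \<longrightarrow> a N \<subseteq> a M},
      mult = (\<lambda>a b. \<lambda>N \<in> two_power_normal G. a N \<otimes>\<^bsub>G Mod N\<^esub> b N),
      one = (\<lambda>N \<in> two_power_normal G. \<one>\<^bsub>G Mod N\<^esub>)\<rparr>"

definition pro2_completion_topology ::
  "('a, 'm) monoid_scheme \<Rightarrow> ('a set \<Rightarrow> 'a set) topology" where
  "pro2_completion_topology G =
     subtopology
       (product_topology (\<lambda>N. discrete_topology (carrier (G Mod N))) (two_power_normal G))
       (carrier (pro2_completion G))"

definition pro2_completion_map :: "('a, 'm) monoid_scheme \<Rightarrow> 'a \<Rightarrow> 'a set \<Rightarrow> 'a set" where
  "pro2_completion_map G g = (\<lambda>N \<in> two_power_normal G. N #>\<^bsub>G\<^esub> g)"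

text \<open>
  The free pro-2 group on \<open>S\<close>, for finite \<open>S\<close>. (For infinite \<open>S\<close> one would only use those \<open>N\<close>
  that contain all but finitely many elements of \<open>S\<close>.)
\<close>

definition free_pro2 :: "'x set \<Rightarrow> (('x \<times> bool) list set \<Rightarrow> ('x \<times> bool) list set) monoid" where
  "free_pro2 S = pro2_completion (free_group S)"

definition free_pro2_topology ::
  "'x set \<Rightarrow> (('x \<times> bool) list set \<Rightarrow> ('x \<times> bool) list set) topology" where
  "free_pro2_topology S = pro2_completion_topology (free_group S)"

definition free_pro2_gen :: "'x set \<Rightarrow> 'x \<Rightarrow> ('x \<times> bool) list set \<Rightarrow> ('x \<times> bool) list set" where
  "free_pro2_gen S x = pro2_completion_map (free_group S) [(x, True)]"

subsection \<open>Quotients\<close>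

definition closed_normal_closure ::
  "('a, 'm) monoid_scheme \<Rightarrow> 'a topology \<Rightarrow> 'a set \<Rightarrow> 'a set" where
  "closed_normal_closure G T A = \<Inter> {N. N \<lhd> G \<and> closedin T N \<and> A \<subseteq> N}"

text \<open>
  The quotient topology on \<open>G Mod N\<close>: the preimage in \<open>G\<close> of a set \<open>W\<close> of cosets is \<open>\<Union> W\<close>.
\<close>

definition quotient_group_topology ::
  "('a, 'm) monoid_scheme \<Rightarrow> 'a topology \<Rightarrow> 'a set \<Rightarrow> 'a set topology" where
  "quotient_group_topology G T N =
     topology (\<lambda>W. W \<subseteq> carrier (G Mod N) \<and> openin T (\<Union> W))"

definition commutator :: "('a, 'm) monoid_scheme \<Rightarrow> 'a \<Rightarrow> 'a \<Rightarrow> 'a" where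
  "commutator G x y = inv\<^bsub>G\<^esub> x \<otimes>\<^bsub>G\<^esub> inv\<^bsub>G\<^esub> y \<otimes>\<^bsub>G\<^esub> x \<otimes>\<^bsub>G\<^esub> y"

subsection \<open>The pro-2 right-angled Artin group of a graph\<close>

type_synonym 'x pro2_raag_elem = "(('x \<times> bool) list set \<Rightarrow> ('x \<times> bool) list set) set"

definition raag_relators ::
  "'x set \<Rightarrow> 'x set set \<Rightarrow> (('x \<times> bool) list set \<Rightarrow> ('x \<times> bool) list set) set" where
  "raag_relators V E =
     {commutator (free_pro2 V) (free_pro2_gen V u) (free_pro2_gen V v) | u v. {u, v} \<in> E}"

definition raag_kernel ::
  "'x set \<Rightarrow> 'x set set \<Rightarrow> (('x \<times> bool) list set \<Rightarrow> ('x \<times> bool) list set) set" where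
  "raag_kernel V E =
     closed_normal_closure (free_pro2 V) (free_pro2_topology V) (raag_relators V E)"

definition raag :: "'x set \<Rightarrow> 'x set set \<Rightarrow> 'x pro2_raag_elem monoid" where
  "raag V E = free_pro2 V Mod raag_kernel V E"

definition raag_topology :: "'x set \<Rightarrow> 'x set set \<Rightarrow> 'x pro2_raag_elem topology" where
  "raag_topology V E =
     quotient_group_topology (free_pro2 V) (free_pro2_topology V) (raag_kernel V E)"

definition raag_gen :: "'x set \<Rightarrow> 'x set set \<Rightarrow> 'x \<Rightarrow> 'x pro2_raag_elem" where
  "raag_gen V E x = raag_kernel V E #>\<^bsub>free_pro2 V\<^esub> free_pro2_gen V x"


section \<open>Semidirect products with the group of order two\<close>

text \<open>
  \<open>integer_mod_group\<close> is a multiplicative record, so \<open>\<Delta>\<close> has elements \<open>0\<close> (the neutral element)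
  and \<open>1\<close> (the generator).
\<close>

definition Delta :: "int monoid" where
  "Delta = integer_mod_group 2"

definition Delta_gen :: int where
  "Delta_gen = 1"

definition semidirect ::
  "('a, 'm) monoid_scheme \<Rightarrow> ('s, 'k) monoid_scheme \<Rightarrow> ('s \<Rightarrow> 'a \<Rightarrow> 'a) \<Rightarrow> ('a \<times> 's) monoid" where
  "semidirect G H \<delta> =
     \<lparr>carrier = carrier G \<times> carrier H,
      mult = (\<lambda>(g, s) (h, t). (g \<otimes>\<^bsub>G\<^esub> \<delta> s h, s \<otimes>\<^bsub>H\<^esub> t)),
      one = (\<one>\<^bsub>G\<^esub>, \<one>\<^bsub>H\<^esub>)\<rparr>"

text \<open>
  Automorphisms of topological groups are required to be bicontinuous. The last clause is the
  condition relating \<open>\<delta>\<close> to the tuple \<open>z\<close>; it determines \<open>\<delta>\<close>, since the generators of the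
  right-angled Artin group generate it topologically.
\<close>

definition delta_raag_action ::
  "'x set \<Rightarrow> 'x set set \<Rightarrow> ('x \<Rightarrow> 'x pro2_raag_elem) \<Rightarrow>
   (int \<Rightarrow> 'x pro2_raag_elem \<Rightarrow> 'x pro2_raag_elem) \<Rightarrow> bool" where
  "delta_raag_action V E z \<delta> \<longleftrightarrow>
     \<delta> \<in> hom Delta (AutoGroup (raag V E)) \<and>
     (\<forall>s \<in> carrier Delta. homeomorphic_map (raag_topology V E) (raag_topology V E) (\<delta> s)) \<and>
     (\<forall>i \<in> V. \<delta> Delta_gen (raag_gen V E i) =
        inv\<^bsub>raag V E\<^esub> (z i) \<otimes>\<^bsub>raag V E\<^esub> inv\<^bsub>raag V E\<^esub> (raag_gen V E i) \<otimes>\<^bsub>raag V E\<^esub> z i)"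

definition delta_raag ::
  "'x set \<Rightarrow> 'x set set \<Rightarrow> (int \<Rightarrow> 'x pro2_raag_elem \<Rightarrow> 'x pro2_raag_elem) \<Rightarrow>
   ('x pro2_raag_elem \<times> int) monoid" where
  "delta_raag V E \<delta> = semidirect (raag V E) Delta \<delta>"

definition delta_raag_topology ::
  "'x set \<Rightarrow> 'x set set \<Rightarrow> ('x pro2_raag_elem \<times> int) topology" where
  "delta_raag_topology V E =
     prod_topology (raag_topology V E) (discrete_topology (carrier Delta))"

definition raag_embed :: "'x pro2_raag_elem \<Rightarrow> 'x pro2_raag_elem \<times> int" where
  "raag_embed g = (g, \<one>\<^bsub>Delta\<^esub>)"


section \<open>The completed group algebra and the Zassenhaus filtration\<close>

text \<open>The group algebra over the field with two elements of a finite group \<open>H\<close>.\<close>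

definition group_algebra :: "('h, 'm) monoid_scheme \<Rightarrow> ('h \<Rightarrow> bit) ring" where
  "group_algebra H =
     \<lparr>carrier = carrier H \<rightarrow>\<^sub>E UNIV,
      mult = (\<lambda>a b. \<lambda>x \<in> carrier H. \<Sum>y \<in> carrier H. a y * b (inv\<^bsub>H\<^esub> y \<otimes>\<^bsub>H\<^esub> x)),
      one = (\<lambda>x \<in> carrier H. of_bool (x = \<one>\<^bsub>H\<^esub>)),
      zero = (\<lambda>x \<in> carrier H. 0),
      add = (\<lambda>a b. \<lambda>x \<in> carrier H. a x + b x)\<rparr>"

definition open_normal :: "('a, 'm) monoid_scheme \<Rightarrow> 'a topology \<Rightarrow> 'a set set" where
  "open_normal G T = {U. U \<lhd> G \<and> openin T U}"

text \<open>
  The inverse limit of the group algebras of \<open>G Mod U\<close>, for a profinite group \<open>G\<close>. For \<open>U \<subseteq> W\<close> the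
  transition map is the linear extension of the projection \<open>G Mod U \<rightarrow> G Mod W\<close>, which sums
  coefficients over the cosets of \<open>U\<close> inside a given coset of \<open>W\<close>.
\<close>

definition completed_group_algebra ::
  "('a, 'm) monoid_scheme \<Rightarrow> 'a topology \<Rightarrow> ('a set \<Rightarrow> 'a set \<Rightarrow> bit) ring" where
  "completed_group_algebra G T =
     \<lparr>carrier = {a \<in> \<Pi>\<^sub>E U \<in> open_normal G T. carrier (group_algebra (G Mod U)).
                  \<forall>U \<in> open_normal G T. \<forall>W \<in> open_normal G T. U \<subseteq> W \<longrightarrow>
                    (\<forall>C \<in> carrier (G Mod W).
                       a W C = (\<Sum>D \<in> {D \<in> carrier (G Mod U). D \<subseteq> C}. a U D))},
      mult = (\<lambda>a b. \<lambda>U \<in> open_normal G T. a U \<otimes>\<^bsub>group_algebra (G Mod U)\<^esub> b U),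
      one = (\<lambda>U \<in> open_normal G T. \<one>\<^bsub>group_algebra (G Mod U)\<^esub>),
      zero = (\<lambda>U \<in> open_normal G T. \<zero>\<^bsub>group_algebra (G Mod U)\<^esub>),
      add = (\<lambda>a b. \<lambda>U \<in> open_normal G T. a U \<oplus>\<^bsub>group_algebra (G Mod U)\<^esub> b U)\<rparr>"

definition group_like ::
  "('a, 'm) monoid_scheme \<Rightarrow> 'a topology \<Rightarrow> 'a \<Rightarrow> 'a set \<Rightarrow> 'a set \<Rightarrow> bit" where
  "group_like G T g =
     (\<lambda>U \<in> open_normal G T. \<lambda>C \<in> carrier (G Mod U). of_bool (C = U #>\<^bsub>G\<^esub> g))"

text \<open>
  The kernel of the augmentation (sum of coefficients); by compatibility the sum does not depend
  on \<open>U\<close>.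
\<close>

definition augmentation_ideal ::
  "('a, 'm) monoid_scheme \<Rightarrow> 'a topology \<Rightarrow> ('a set \<Rightarrow> 'a set \<Rightarrow> bit) set" where
  "augmentation_ideal G T =
     {a \<in> carrier (completed_group_algebra G T).
        \<forall>U \<in> open_normal G T. (\<Sum>C \<in> carrier (G Mod U). a U C) = 0}"

text \<open>
  Powers are taken in the monoid of two-sided ideals: the zeroth power is the whole ring, and
  products of ideals consist of finite sums of products. No closure is taken; for topologically
  finitely generated pro-2 groups these powers are closed anyway.
\<close>

definition augmentation_power ::
  "('a, 'm) monoid_scheme \<Rightarrow> 'a topology \<Rightarrow> nat \<Rightarrow> ('a set \<Rightarrow> 'a set \<Rightarrow> bit) set" where
  "augmentation_power G T n =
     augmentation_ideal G T [^]\<^bsub>ideals_set (completed_group_algebra G T)\<^esub> n"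

definition zassenhaus :: "('a, 'm) monoid_scheme \<Rightarrow> 'a topology \<Rightarrow> nat \<Rightarrow> 'a set" where
  "zassenhaus G T n =
     {g \<in> carrier G.
        group_like G T g \<ominus>\<^bsub>completed_group_algebra G T\<^esub> \<one>\<^bsub>completed_group_algebra G T\<^esub>
          \<in> augmentation_power G T n}"

definition zassenhaus_quotient ::
  "('a, 'm) monoid_scheme \<Rightarrow> 'a topology \<Rightarrow> nat \<Rightarrow> 'a set monoid" where
  "zassenhaus_quotient G T n =
     (G\<lparr>carrier := zassenhaus G T n\<rparr>) Mod zassenhaus G T (Suc n)"


section \<open>Restricted Lie algebras over the field with two elements\<close>

text \<open>
  The monoid part is the additive group (written multiplicatively); scalar multiplication by
  \<open>0\<close> and \<open>1\<close> is then determined.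
\<close>

record 'a rlie = "'a monoid" +
  bracket :: "'a \<Rightarrow> 'a \<Rightarrow> 'a"
  two_map :: "'a \<Rightarrow> 'a"

subsection \<open>The free restricted Lie algebra\<close>

text \<open>
  The set of formal terms modulo the smallest congruence \<open>rl_eq\<close> that contains all instances
  of the axioms of a restricted Lie algebra in characteristic two. There, the axioms
  \<open>ad (x\<^sup>[\<^sup>p\<^sup>]) = (ad x)\<^sup>p\<close> and \<open>(x + y)\<^sup>[\<^sup>p\<^sup>] = x\<^sup>[\<^sup>p\<^sup>] + y\<^sup>[\<^sup>p\<^sup>] + \<Sum> s\<^sub>i(x, y)\<close> read
  \<open>[x\<^sup>[\<^sup>2\<^sup>], y] = [x, [x, y]]\<close> and \<open>(x + y)\<^sup>[\<^sup>2\<^sup>] = x\<^sup>[\<^sup>2\<^sup>] + y\<^sup>[\<^sup>2\<^sup>] + [x, y]\<close>.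
\<close>

datatype (rl_vars: 'x) rl_term =
    RGen 'x
  | RZero
  | RPlus "'x rl_term" "'x rl_term"
  | RBracket "'x rl_term" "'x rl_term"
  | RSquare "'x rl_term"

inductive rl_eq :: "'x rl_term \<Rightarrow> 'x rl_term \<Rightarrow> bool" where
  refl: "rl_eq a a"
| sym: "rl_eq a b \<Longrightarrow> rl_eq b a"
| trans: "rl_eq a b \<Longrightarrow> rl_eq b c \<Longrightarrow> rl_eq a c"
| cong_plus: "rl_eq a a' \<Longrightarrow> rl_eq b b' \<Longrightarrow> rl_eq (RPlus a b) (RPlus a' b')"
| cong_bracket: "rl_eq a a' \<Longrightarrow> rl_eq b b' \<Longrightarrow> rl_eq (RBracket a b) (RBracket a' b')"
| cong_square: "rl_eq a a' \<Longrightarrow> rl_eq (RSquare a) (RSquare a')"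
| plus_assoc: "rl_eq (RPlus (RPlus a b) c) (RPlus a (RPlus b c))"
| plus_comm: "rl_eq (RPlus a b) (RPlus b a)"
| plus_zero: "rl_eq (RPlus RZero a) a"
| plus_self: "rl_eq (RPlus a a) RZero"
| bracket_left: "rl_eq (RBracket (RPlus a b) c) (RPlus (RBracket a c) (RBracket b c))"
| bracket_right: "rl_eq (RBracket a (RPlus b c)) (RPlus (RBracket a b) (RBracket a c))"
| bracket_self: "rl_eq (RBracket a a) RZero"
| jacobi: "rl_eq (RPlus (RBracket a (RBracket b c))
             (RPlus (RBracket b (RBracket c a)) (RBracket c (RBracket a b)))) RZero"
| square_plus: "rl_eq (RSquare (RPlus a b)) (RPlus (RPlus (RSquare a) (RSquare b)) (RBracket a b))"
| square_bracket: "rl_eq (RBracket (RSquare a) b) (RBracket a (RBracket a b))"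

definition rl_terms :: "'x set \<Rightarrow> 'x rl_term set" where
  "rl_terms S = {t. rl_vars t \<subseteq> S}"

definition rl_rel :: "'x set \<Rightarrow> ('x rl_term \<times> 'x rl_term) set" where
  "rl_rel S = {(s, t). s \<in> rl_terms S \<and> t \<in> rl_terms S \<and> rl_eq s t}"

definition free_rlie :: "'x set \<Rightarrow> 'x rl_term set rlie" where
  "free_rlie S =
     \<lparr>carrier = rl_terms S // rl_rel S,
      mult = (\<lambda>A B. \<Union>a \<in> A. \<Union>b \<in> B. rl_rel S `` {RPlus a b}),
      one = rl_rel S `` {RZero},
      bracket = (\<lambda>A B. \<Union>a \<in> A. \<Union>b \<in> B. rl_rel S `` {RBracket a b}),
      two_map = (\<lambda>A. \<Union>a \<in> A. rl_rel S `` {RSquare a})\<rparr>"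

definition free_rlie_gen :: "'x set \<Rightarrow> 'x \<Rightarrow> 'x rl_term set" where
  "free_rlie_gen S x = rl_rel S `` {RGen x}"

inductive rl_homogeneous :: "nat \<Rightarrow> 'x rl_term \<Rightarrow> bool" where
  "rl_homogeneous 1 (RGen x)"
| "rl_homogeneous n RZero"
| "rl_homogeneous n a \<Longrightarrow> rl_homogeneous n b \<Longrightarrow> rl_homogeneous n (RPlus a b)"
| "rl_homogeneous m a \<Longrightarrow> rl_homogeneous n b \<Longrightarrow> rl_homogeneous (m + n) (RBracket a b)"
| "rl_homogeneous n a \<Longrightarrow> rl_homogeneous (2 * n) (RSquare a)"

definition free_rlie_component :: "'x set \<Rightarrow> nat \<Rightarrow> 'x rl_term set set" where
  "free_rlie_component S n = {rl_rel S `` {t} | t. t \<in> rl_terms S \<and> rl_homogeneous n t}"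

subsection \<open>Quotients by restricted Lie ideals\<close>

definition rlie_ideal :: "('a, 'm) rlie_scheme \<Rightarrow> 'a set \<Rightarrow> bool" where
  "rlie_ideal L J \<longleftrightarrow>
     subgroup J L \<and>
     (\<forall>a \<in> carrier L. \<forall>b \<in> J. bracket L a b \<in> J) \<and>
     (\<forall>b \<in> J. two_map L b \<in> J)"

definition rlie_ideal_generated :: "('a, 'm) rlie_scheme \<Rightarrow> 'a set \<Rightarrow> 'a set" where
  "rlie_ideal_generated L A = \<Inter> {J. rlie_ideal L J \<and> A \<subseteq> J}"

definition rlie_quotient :: "('a, 'm) rlie_scheme \<Rightarrow> 'a set \<Rightarrow> 'a set rlie" where
  "rlie_quotient L J =
     \<lparr>carrier = carrier (L Mod J),
      mult = mult (L Mod J),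
      one = one (L Mod J),
      bracket = (\<lambda>A B. \<Union>a \<in> A. \<Union>b \<in> B. J #>\<^bsub>L\<^esub> bracket L a b),
      two_map = (\<lambda>A. \<Union>a \<in> A. J #>\<^bsub>L\<^esub> two_map L a)\<rparr>"

subsection \<open>The restricted Lie algebra of a graph\<close>

definition raag_lie_kernel :: "'x set \<Rightarrow> 'x set set \<Rightarrow> 'x rl_term set set" where
  "raag_lie_kernel V E =
     rlie_ideal_generated (free_rlie V)
       {bracket (free_rlie V) (free_rlie_gen V u) (free_rlie_gen V v) | u v. {u, v} \<in> E}"

definition raag_lie :: "'x set \<Rightarrow> 'x set set \<Rightarrow> 'x rl_term set set rlie" where
  "raag_lie V E = rlie_quotient (free_rlie V) (raag_lie_kernel V E)"

text \<open>
  The component of degree \<open>n\<close> is the image of the one of the free restricted Lie algebra.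
\<close>

definition raag_lie_component :: "'x set \<Rightarrow> 'x set set \<Rightarrow> nat \<Rightarrow> 'x rl_term set set rlie" where
  "raag_lie_component V E n =
     (raag_lie V E)\<lparr>carrier :=
        (\<lambda>a. raag_lie_kernel V E #>\<^bsub>free_rlie V\<^esub> a) ` free_rlie_component V n\<rparr>"

end

(*
  Let L be the graph Lie algebra. The Poincare-Birkhoff-Witt theorem gives its restricted enveloping
  algebra P a basis of increasing lists over a homogeneous basis of L, on which the generators act by
  operators X_i that commute along edges. Truncated at degree N, the operators 1 + X_i generate a finite
  2-group, so they define a representation of the pro-2 group G of the graph. An element g lies in the n-th
  term of the Zassenhaus filtration iff g [] - [] has degree at least n: powers of the augmentation ideal
  raise the degree, and conversely P maps to the group algebra of every finite quotient of G, by its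
  universal property, so that compactness puts g - 1 into the n-th power. The component of degree n of
  g [] - [] is primitive, hence lies in L; commutators and squares realize all of L in this way.

  The involution of G inverts the generators up to conjugation, so it acts trivially on the
  associated graded algebra in characteristic two. Hence the representation of the semidirect product induced
  from P has a filtration that is raised by one by g - 1 for all group elements g, and no element of the
  second term of the Zassenhaus filtration has a nontrivial component in the group of order two.
*)
theory Submission
  imports Defs "HOL-Algebra.Sylow" "HOL-Algebra.Multiplicative_Group" "HOL-Computational_Algebra.Primes" "HOL-Library.Poly_Mapping"
begin

section \<open>Linear algebra over F_2, with additive maps in the role of linear ones\<close>

section \<open>Vector spaces over the field with two elements\<close>

text \<open>Neither direction of membership in a power of the augmentation ideal is accessible from
  the definition, so everything is reduced to a test on the single vector []. Truncation at N is
  forced: homomorphisms out of the pro-2 group are available only into finite 2-groups. It is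
  harmless up to degree N, hence the recurring condition n \<le> Suc N. Another obstacle is that
  group elements are not words. Modulo any open normal subgroup, however, an element is a positive
  word in the generators, so each argument takes place modulo one subgroup that is small enough for
  all the maps involved. The same test vector then describes the filtration of the semidirect
  product, once the component in the group of order two is excluded. Here n \<ge> 2 is essential:
  the swap of the two copies in the induced representation moves a suitable vector by one filtration
  degree and not by two. Two filtrations of that representation are used, as the one that detects
  the swap loses one degree for the elements of G.\<close>

class char_two = ab_group_add +
  assumes add_self [simp]: "x + x = 0"
begin

lemma add_self_left [simp]: "x + (x + y) = y"
  by (simp flip: add.assoc)

lemma uminus_char_two: "- x = x"
  by (metis add_self add.inverse_unique)

lemma minus_char_two: "x - y = x + y"
  by (metis uminus_char_two diff_conv_add_uminus)

lemma add_eq_zero_iff_char_two: "x + y = 0 \<longleftrightarrow> x = y"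
  by (metis minus_char_two eq_iff_diff_eq_0)

end

instance bit :: char_two
proof
  show "x + x = 0" for x :: bit by (cases x) auto
qed

instance poly_mapping :: (type, char_two) char_two
  by standard (simp add: poly_mapping_eqI lookup_add)

instance prod :: (char_two, char_two) char_two
  by standard (auto simp: plus_prod_def zero_prod_def)

abbreviation pkeys :: "('a \<Rightarrow>\<^sub>0 'b::zero) \<Rightarrow> 'a set" where
  "pkeys \<equiv> Poly_Mapping.keys"

abbreviation plookup :: "('a \<Rightarrow>\<^sub>0 'b::zero) \<Rightarrow> 'a \<Rightarrow> 'b" where
  "plookup \<equiv> Poly_Mapping.lookup"

abbreviation unit_vec :: "'a \<Rightarrow> 'a \<Rightarrow>\<^sub>0 bit" where
  "unit_vec a \<equiv> Poly_Mapping.single a 1"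

text \<open>Over the field with two elements a vector is determined by its support, so the linear
  extension of \<open>f\<close> needs no coefficients.\<close>

definition lin :: "('a \<Rightarrow> 'v) \<Rightarrow> ('a \<Rightarrow>\<^sub>0 bit) \<Rightarrow> 'v::comm_monoid_add" where
  "lin f p = (\<Sum>a\<in>pkeys p. f a)"

text \<open>Additivity amounts to linearity here, the scalars being 0 and 1.\<close>

definition add_map :: "('a::plus \<Rightarrow> 'b::plus) \<Rightarrow> bool" where
  "add_map f \<longleftrightarrow> (\<forall>x y. f (x + y) = f x + f y)"

lemma add_mapD: "add_map f \<Longrightarrow> f (x + y) = f x + f y"
  by (simp add: add_map_def)

lemma add_map_zero: "add_map f \<Longrightarrow> f 0 = 0" for f :: "'a::group_add \<Rightarrow> 'b::group_add"
proof -
  assume "add_map f"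
  then have "f (0 + 0) = f 0 + f 0" by (rule add_mapD)
  then have "f 0 + f 0 = f 0 + 0" by simp
  then show ?thesis by (rule add_left_imp_eq)
qed

lemma add_map_sum: "add_map f \<Longrightarrow> f (sum g A) = (\<Sum>a\<in>A. f (g a))"
  for f :: "'a::ab_group_add \<Rightarrow> 'b::ab_group_add"
  by (induction A rule: infinite_finite_induct) (auto simp: add_map_zero add_mapD)

lemma add_map_comp: "add_map f \<Longrightarrow> add_map g \<Longrightarrow> add_map (\<lambda>x. f (g x))"
  by (simp add: add_map_def)

lemma add_map_plus: "add_map f \<Longrightarrow> add_map g \<Longrightarrow> add_map (\<lambda>x. f x + g x)"
  for f :: "'a::plus \<Rightarrow> 'b::ab_semigroup_add"
  by (simp add: add_map_def algebra_simps)

lemma add_map_ident: "add_map (\<lambda>x. x)"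
  by (simp add: add_map_def)

lemma lin_altdef:
  assumes "finite A" "pkeys p \<subseteq> A"
  shows "lin f p = (\<Sum>a\<in>A. if plookup p a = 1 then f a else 0)"
  unfolding lin_def
  by (rule sum.mono_neutral_cong_left) (use assms in \<open>auto simp: in_keys_iff\<close>)

lemma lin_zero [simp]: "lin f 0 = 0"
  by (simp add: lin_def)

lemma lin_unit_vec [simp]: "lin f (unit_vec a) = f a"
  by (simp add: lin_def)

lemma lin_add: "lin f (p + q) = lin f p + lin f q" for f :: "'a \<Rightarrow> 'v::char_two"
proof -
  let ?A = "pkeys p \<union> pkeys q"
  have "lin f (p + q) = (\<Sum>a\<in>?A. if plookup (p + q) a = 1 then f a else 0)"
    by (rule lin_altdef) (auto simp: Poly_Mapping.keys_add)
  also have "\<dots> = (\<Sum>a\<in>?A. (if plookup p a = 1 then f a else 0)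
      + (if plookup q a = 1 then f a else 0))"
    by (rule sum.cong) (auto simp: lookup_add)
  also have "\<dots> = lin f p + lin f q"
    by (simp add: sum.distrib lin_altdef[of ?A p] lin_altdef[of ?A q])
  finally show ?thesis .
qed

lemma add_map_lin: "add_map (lin f)" for f :: "'a \<Rightarrow> 'v::char_two"
  by (simp add: add_map_def lin_add)

lemma lin_comp: "add_map g \<Longrightarrow> g (lin f p) = lin (\<lambda>a. g (f a)) p"
  for g :: "'v::ab_group_add \<Rightarrow> 'w::ab_group_add"
  by (simp add: lin_def add_map_sum)

lemma lin_lin: "lin g (lin f p) = lin (\<lambda>a. lin g (f a)) p" for g :: "'a \<Rightarrow> 'v::char_two"
  by (rule lin_comp[OF add_map_lin])

lemma lin_cong: "(\<And>a. a \<in> pkeys p \<Longrightarrow> f a = g a) \<Longrightarrow> lin f p = lin g p"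
  by (simp add: lin_def)

lemma lin_plus: "lin (\<lambda>a. f a + g a) p = lin f p + lin g p"
  by (simp add: lin_def sum.distrib)

lemma lin_const_zero: "lin (\<lambda>a. 0) p = 0"
  by (simp add: lin_def)

lemma lin_swap: "lin (\<lambda>a. lin (\<lambda>b. f a b) q) p = lin (\<lambda>b. lin (\<lambda>a. f a b) p) q"
  unfolding lin_def by (rule sum.swap)

lemma lin_unit_vec_ident [simp]: "lin unit_vec p = p"
proof (rule poly_mapping_eqI)
  fix k
  have "plookup (lin unit_vec p) k
      = (\<Sum>a\<in>pkeys p. if a = k then 1 else 0)"
    unfolding lin_def lookup_sum by (rule sum.cong) (auto simp: lookup_single)
  also have "\<dots> = plookup p k"
    by (auto simp: in_keys_iff)
  finally show "plookup (lin unit_vec p) k = plookup p k" .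
qed

lemma add_map_eq_lin: "add_map g \<Longrightarrow> g p = lin (\<lambda>a. g (unit_vec a)) p"
  for g :: "('a \<Rightarrow>\<^sub>0 bit) \<Rightarrow> 'w::ab_group_add"
  using lin_comp[of g unit_vec p] by simp

text \<open>Only basis vectors in the support of \<open>p\<close> are compared. This form matters
  because many identities below hold for increasing lists, while the type contains all
  lists.\<close>

lemma add_map_eqI:
  fixes f g :: "('a \<Rightarrow>\<^sub>0 bit) \<Rightarrow> 'w::ab_group_add"
  assumes "add_map f" "add_map g" "\<And>a. a \<in> pkeys p \<Longrightarrow> f (unit_vec a) = g (unit_vec a)"
  shows "f p = g p"
proof -
  have "f p = lin (\<lambda>a. f (unit_vec a)) p" by (rule add_map_eq_lin[OF assms(1)])
  also have "\<dots> = lin (\<lambda>a. g (unit_vec a)) p" by (rule lin_cong) (rule assms(3))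
  also have "\<dots> = g p" by (rule add_map_eq_lin[OF assms(2), symmetric])
  finally show ?thesis .
qed

lemma keys_add_subset:
  "pkeys p \<subseteq> A \<Longrightarrow> pkeys q \<subseteq> A \<Longrightarrow> pkeys (p + q) \<subseteq> A"
  by (rule order_trans[OF Poly_Mapping.keys_add Un_least])

lemma sum_in: "(\<And>a. a \<in> A \<Longrightarrow> f a \<in> M) \<Longrightarrow> 0 \<in> M \<Longrightarrow> (\<And>x y. x \<in> M \<Longrightarrow> y \<in> M \<Longrightarrow> x + y \<in> M) \<Longrightarrow> sum f A \<in> M"
  by (induction A rule: infinite_finite_induct) auto

lemma lin_in:
  assumes "\<And>a. a \<in> pkeys p \<Longrightarrow> f a \<in> M" "0 \<in> M" "\<And>x y. x \<in> M \<Longrightarrow> y \<in> M \<Longrightarrow> x + y \<in> M"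
  shows "lin f p \<in> M"
  unfolding lin_def by (intro sum_in[where M=M] assms)

lemma keys_lin_subset:
  fixes f :: "'a \<Rightarrow> 'b \<Rightarrow>\<^sub>0 bit"
  assumes "\<And>a. a \<in> pkeys p \<Longrightarrow> pkeys (f a) \<subseteq> A"
  shows "pkeys (lin f p) \<subseteq> A"
proof -
  have "lin f p \<in> {q. pkeys q \<subseteq> A}"
    by (rule lin_in) (use assms in \<open>simp_all add: keys_add_subset\<close>)
  then show ?thesis by simp
qed

lemma finite_vectors: "finite A \<Longrightarrow> finite {p :: 'a \<Rightarrow>\<^sub>0 bit. pkeys p \<subseteq> A}"
proof (rule finite_imageD[of pkeys])
  show "inj_on pkeys {p :: 'a \<Rightarrow>\<^sub>0 bit. pkeys p \<subseteq> A}"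
  proof (rule inj_onI, rule poly_mapping_eqI)
    fix p q :: "'a \<Rightarrow>\<^sub>0 bit" and k
    assume "pkeys p = pkeys q"
    then have "k \<in> pkeys p \<longleftrightarrow> k \<in> pkeys q" by simp
    then show "plookup p k = plookup q k"
      unfolding in_keys_iff by (metis bit_not_zero_iff)
  qed
qed (auto intro: finite_subset[of _ "Pow A"])

section \<open>Left multiplication on ordered monomials, and its commutator and square
  relations\<close>

section \<open>The Poincare--Birkhoff--Witt theorem for restricted Lie algebras\<close>

text \<open>
  A restricted Lie algebra is given by structure constants on a totally ordered basis \<open>B\<close>. As brackets
  and squares only involve larger basis elements, the action on the strictly increasing lists,
  which are a basis of the restricted enveloping algebra, is defined by recursion on the list.
\<close>

locale pbw =
  fixes B :: "'b set" and lt :: "'b \<Rightarrow> 'b \<Rightarrow> bool"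
    and br :: "'b \<Rightarrow> 'b \<Rightarrow> ('b \<Rightarrow>\<^sub>0 bit)" and sq :: "'b \<Rightarrow> ('b \<Rightarrow>\<^sub>0 bit)"
  assumes lt_irrefl: "\<not> lt a a"
    and lt_trans: "lt a b \<Longrightarrow> lt b c \<Longrightarrow> lt a c"
    and lt_total: "a \<in> B \<Longrightarrow> b \<in> B \<Longrightarrow> a \<noteq> b \<Longrightarrow> lt a b \<or> lt b a"
    and br_keys: "a \<in> B \<Longrightarrow> b \<in> B \<Longrightarrow> pkeys (br a b) \<subseteq> {x \<in> B. lt a x \<and> lt b x}"
    and sq_keys: "a \<in> B \<Longrightarrow> pkeys (sq a) \<subseteq> {x \<in> B. lt a x}"
    and br_self: "a \<in> B \<Longrightarrow> br a a = 0"
    and br_sym: "a \<in> B \<Longrightarrow> b \<in> B \<Longrightarrow> br a b = br b a"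
    and br_jacobi: "a \<in> B \<Longrightarrow> b \<in> B \<Longrightarrow> c \<in> B \<Longrightarrow>
      lin (br a) (br b c) + lin (br b) (br c a) + lin (br c) (br a b) = 0"
    and sq_br: "a \<in> B \<Longrightarrow> b \<in> B \<Longrightarrow> lin (br b) (sq a) = lin (br a) (br a b)"
begin

text \<open>Left multiplication by b of an ordered monomial: b b S = b^[2] S; b c S is already
  ordered if b < c; otherwise b c S = c b S + [b, c] S. In the last case prefixing c to b S is
  correct because all letters of b S lie above c.\<close>

primrec act :: "'b list \<Rightarrow> 'b \<Rightarrow> ('b list \<Rightarrow>\<^sub>0 bit)" where
  "act [] b = unit_vec [b]"
| "act (c # S) b =
     (if b = c then lin (act S) (sq b)
      else if lt b c then unit_vec (b # c # S)
      else lin (\<lambda>T. unit_vec (c # T)) (act S b) + lin (act S) (br b c))"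

definition op :: "'b \<Rightarrow> ('b list \<Rightarrow>\<^sub>0 bit) \<Rightarrow> ('b list \<Rightarrow>\<^sub>0 bit)" where
  "op b = lin (\<lambda>S. act S b)"

definition vop :: "('b \<Rightarrow>\<^sub>0 bit) \<Rightarrow> ('b list \<Rightarrow>\<^sub>0 bit) \<Rightarrow> ('b list \<Rightarrow>\<^sub>0 bit)" where
  "vop x v = lin (\<lambda>b. op b v) x"

text \<open>Prefixing is the multiplication by \<open>c\<close> only on lists above \<open>c\<close>
  (\<open>op_eq_cns\<close>). As an additive map of its own it turns the recursion for
  \<open>act\<close> into an identity of operators, \<open>op_cns\<close>.\<close>

definition cns :: "'b \<Rightarrow> ('b list \<Rightarrow>\<^sub>0 bit) \<Rightarrow> ('b list \<Rightarrow>\<^sub>0 bit)" where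
  "cns c = lin (\<lambda>T. unit_vec (c # T))"

definition vlist :: "'b set \<Rightarrow> 'b list set" where
  "vlist D = {S. sorted_wrt lt S \<and> set S \<subseteq> D}"

definition above :: "'b \<Rightarrow> 'b set" where
  "above c = {x \<in> B. lt c x}"

text \<open>Brackets and squares only involve later basis elements, so an up-closed set spans a
  restricted subalgebra; its lists are stable under the action of its elements.\<close>

definition up_closed :: "'b set \<Rightarrow> bool" where
  "up_closed D \<longleftrightarrow> D \<subseteq> B \<and> (\<forall>x\<in>D. \<forall>y\<in>B. lt x y \<longrightarrow> y \<in> D)"

lemma above_subset: "above c \<subseteq> B"
  by (auto simp: above_def)

lemma up_closed_B: "up_closed B"
  by (simp add: up_closed_def)

lemma up_closed_above: "up_closed (above c)"
  unfolding up_closed_def above_def using lt_trans by blast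

lemma up_closed_Int: "up_closed D \<Longrightarrow> up_closed D' \<Longrightarrow> up_closed (D \<inter> D')"
  unfolding up_closed_def by blast

lemma Cons_vlist: "c # T \<in> vlist D \<longleftrightarrow> c \<in> D \<and> T \<in> vlist (D \<inter> {x. lt c x})"
  by (auto simp: vlist_def)

lemma vlist_mono: "D \<subseteq> D' \<Longrightarrow> vlist D \<subseteq> vlist D'"
  by (auto simp: vlist_def)

lemma Nil_vlist [simp]: "[] \<in> vlist D"
  by (simp add: vlist_def)

lemma vlist_tail: "c # S \<in> vlist D \<Longrightarrow> S \<in> vlist D"
  by (auto simp: vlist_def)

text \<open>The set \<open>D\<close> has to vary: when b passes c, the induction hypothesis is
  applied to the elements of \<open>D\<close> above c, so that prefixing c to the result gives an
  increasing list again.\<close>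

lemma act_keys: "up_closed D \<Longrightarrow> S \<in> vlist D \<Longrightarrow> b \<in> D \<Longrightarrow> pkeys (act S b) \<subseteq> vlist D"
proof (induction S arbitrary: D b)
  case Nil
  then show ?case by (auto simp: vlist_def)
next
  case (Cons c S)
  have DB: "D \<subseteq> B" using Cons.prems by (auto simp: up_closed_def)
  have c: "c \<in> D" and S: "S \<in> vlist (D \<inter> {x. lt c x})" using Cons.prems by (auto simp: Cons_vlist)
  then have S1: "S \<in> vlist (D \<inter> above c)" using DB by (auto simp: vlist_def above_def)
  have SD: "S \<in> vlist D" using Cons.prems(2) by (rule vlist_tail)
  have uc: "up_closed (D \<inter> above c)" using Cons.prems(1) up_closed_above up_closed_Int by blast
  consider "b = c" | "b \<noteq> c" "lt b c" | "b \<noteq> c" "\<not> lt b c" by blast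
  then show ?case
  proof cases
    case 1
    have "pkeys (lin (act S) (sq b)) \<subseteq> vlist D"
    proof (rule keys_lin_subset)
      fix x assume "x \<in> pkeys (sq b)"
      then have "x \<in> D" using sq_keys[of b] 1 c DB Cons.prems(1) by (auto simp: up_closed_def)
      then show "pkeys (act S x) \<subseteq> vlist D" using Cons.IH Cons.prems(1) SD by blast
    qed
    then show ?thesis using 1 by simp
  next
    case 2
    have cS: "\<forall>x\<in>set S. lt c x" using S by (auto simp: vlist_def)
    have "lt b x" if "x \<in> set S" for x using lt_trans[OF 2(2)] cS that by blast
    then have "b # c # S \<in> vlist D"
      using 2 Cons.prems(2,3) by (simp add: vlist_def)
    then show ?thesis using 2 by simp
  next
    case 3
    then have bc: "lt c b" using lt_total[of b c] subsetD[OF DB c] subsetD[OF DB Cons.prems(3)] by simp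
    then have b: "b \<in> D \<inter> above c" using Cons.prems(3) subsetD[OF DB Cons.prems(3)] by (simp add: above_def)
    have k1: "pkeys (lin (\<lambda>T. unit_vec (c # T)) (act S b)) \<subseteq> vlist D"
    proof (rule keys_lin_subset)
      fix T assume "T \<in> pkeys (act S b)"
      with Cons.IH[OF uc S1 b] have "T \<in> vlist (D \<inter> above c)" by (rule subsetD)
      then show "pkeys (unit_vec (c # T)) \<subseteq> vlist D"
        using c by (auto simp: vlist_def above_def)
    qed
    have k2: "pkeys (lin (act S) (br b c)) \<subseteq> vlist D"
    proof (rule keys_lin_subset)
      fix x assume "x \<in> pkeys (br b c)"
      then have "x \<in> D" using br_keys[of b c] c Cons.prems(3) DB Cons.prems(1) by (auto simp: up_closed_def)
      then show "pkeys (act S x) \<subseteq> vlist D" using Cons.IH Cons.prems(1) SD by blast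
    qed
    show ?thesis using 3 keys_add_subset[OF k1 k2] by simp
  qed
qed

lemma op_unit_vec [simp]: "op b (unit_vec S) = act S b"
  by (simp add: op_def)

lemma add_map_op: "add_map (op b)"
  by (simp add: op_def add_map_lin)

lemma add_map_vop: "add_map (vop x)"
  by (simp add: add_map_def vop_def op_def lin_add lin_plus)

lemma add_map_cns: "add_map (cns c)"
  by (simp add: cns_def add_map_lin)

lemma vop_add: "vop (x + y) v = vop x v + vop y v"
  by (simp add: vop_def lin_add)

lemma vop_zero [simp]: "vop 0 v = 0"
  by (simp add: vop_def)

lemma vop_unit_vec [simp]: "vop (unit_vec b) v = op b v"
  by (simp add: vop_def)

lemma vop_of_unit_vec: "vop x (unit_vec S) = lin (act S) x"
  by (simp add: vop_def)

lemma vop_lin: "vop (lin f x) v = lin (\<lambda>a. vop (f a) v) x"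
  by (simp add: vop_def lin_lin)

lemma op_keys:
  assumes "up_closed D" "b \<in> D" "pkeys v \<subseteq> vlist D"
  shows "pkeys (op b v) \<subseteq> vlist D"
  unfolding op_def using assms act_keys by (intro keys_lin_subset) blast

lemma vop_keys:
  assumes "up_closed D" "pkeys x \<subseteq> D" "pkeys v \<subseteq> vlist D"
  shows "pkeys (vop x v) \<subseteq> vlist D"
  unfolding vop_def using assms op_keys by (intro keys_lin_subset) blast

lemma op_eq_cns:
  assumes "pkeys v \<subseteq> vlist (above c)"
  shows "op c v = cns c v"
proof (rule add_map_eqI[OF add_map_op add_map_cns])
  fix T assume "T \<in> pkeys v"
  then have "T \<in> vlist (above c)" using assms by blast
  then show "op c (unit_vec T) = cns c (unit_vec T)"
    using lt_irrefl by (cases T) (auto simp: cns_def vlist_def above_def)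
qed

lemma op_cns:
  assumes "lt c b"
  shows "op b (cns c v) = cns c (op b v) + vop (br b c) v"
proof -
  have [simp]: "b \<noteq> c" "\<not> lt b c" using assms lt_irrefl lt_trans by blast+
  have "add_map (\<lambda>v. op b (cns c v))" "add_map (\<lambda>v. cns c (op b v) + vop (br b c) v)"
    by (rule add_map_comp[OF add_map_op add_map_cns]
        add_map_plus[OF add_map_comp[OF add_map_cns add_map_op] add_map_vop])+
  then show ?thesis
    by (rule add_map_eqI[of "\<lambda>v. op b (cns c v)"]) (simp add: cns_def vop_of_unit_vec)
qed

lemma vop_cns:
  assumes "pkeys x \<subseteq> above c"
  shows "vop x (cns c v) = cns c (vop x v) + vop (lin (\<lambda>b. br b c) x) v"
proof -
  have "vop x (cns c v) = lin (\<lambda>b. cns c (op b v) + vop (br b c) v) x"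
    unfolding vop_def[of x] using assms by (intro lin_cong op_cns) (auto simp: above_def)
  also have "\<dots> = lin (\<lambda>b. cns c (op b v)) x + lin (\<lambda>b. vop (br b c) v) x"
    by (rule lin_plus)
  also have "lin (\<lambda>b. cns c (op b v)) x = cns c (vop x v)"
    unfolding vop_def by (rule lin_comp[OF add_map_cns, symmetric])
  also have "lin (\<lambda>b. vop (br b c) v) x = vop (lin (\<lambda>b. br b c) x) v"
    by (rule vop_lin[symmetric])
  finally show ?thesis .
qed

definition brv :: "('b \<Rightarrow>\<^sub>0 bit) \<Rightarrow> ('b \<Rightarrow>\<^sub>0 bit) \<Rightarrow> ('b \<Rightarrow>\<^sub>0 bit)" where
  "brv x y = lin (\<lambda>a. lin (br a) y) x"

text \<open>Both sides are bilinear in x and y. The vector \<open>v\<close> is fixed, so the lemma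
  also applies to an induction hypothesis that is known for one list only.\<close>

lemma op_commutator_vec:
  assumes "\<And>a b. a \<in> B \<Longrightarrow> b \<in> B \<Longrightarrow> op a (op b v) + op b (op a v) = vop (br a b) v"
    and "pkeys x \<subseteq> B" "pkeys y \<subseteq> B"
  shows "vop x (vop y v) + vop y (vop x v) = vop (brv x y) v"
proof -
  have "vop x (vop y v) = lin (\<lambda>a. lin (\<lambda>b. op a (op b v)) y) x"
    by (simp add: vop_def lin_comp[OF add_map_op])
  moreover have "vop y (vop x v) = lin (\<lambda>a. lin (\<lambda>b. op b (op a v)) y) x"
    by (subst lin_swap) (simp add: vop_def lin_comp[OF add_map_op])
  ultimately have "vop x (vop y v) + vop y (vop x v)
      = lin (\<lambda>a. lin (\<lambda>b. op a (op b v) + op b (op a v)) y) x"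
    by (simp add: lin_plus)
  also have "\<dots> = lin (\<lambda>a. lin (\<lambda>b. vop (br a b) v) y) x"
    using assms by (intro lin_cong) blast
  also have "\<dots> = vop (brv x y) v"
    by (simp add: brv_def vop_lin)
  finally show ?thesis .
qed

lemma brv_unit_vec [simp]: "brv (unit_vec a) y = lin (br a) y" "brv x (unit_vec b) = lin (\<lambda>a. br a b) x"
  by (simp_all add: brv_def)

lemma lin_br_sym: "pkeys x \<subseteq> B \<Longrightarrow> c \<in> B \<Longrightarrow> lin (\<lambda>b. br b c) x = lin (br c) x"
  by (intro lin_cong br_sym) auto

lemma br_subset: "a \<in> B \<Longrightarrow> b \<in> B \<Longrightarrow> pkeys (br a b) \<subseteq> B"
  using br_keys by blast

lemma sq_subset: "a \<in> B \<Longrightarrow> pkeys (sq a) \<subseteq> B"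
  using sq_keys by blast

text \<open>The consistency check behind the Poincare-Birkhoff-Witt theorem, according to the
  position of a < b relative to the head c. If a < c, then a acts by prefixing and the recursion
  yields the commutator. If a = c, the rule for the bracket with a square is needed, and if a > c
  the Jacobi identity.\<close>

lemma op_commutator_lt:
  assumes S: "c # S \<in> vlist B" and ab: "a \<in> B" "b \<in> B" "lt a b"
    and IH: "\<And>a b. a \<in> B \<Longrightarrow> b \<in> B \<Longrightarrow>
      op a (op b (unit_vec S)) + op b (op a (unit_vec S)) = vop (br a b) (unit_vec S)"
  shows "op a (op b (unit_vec (c # S))) + op b (op a (unit_vec (c # S)))
    = vop (br a b) (unit_vec (c # S))"
proof -
  have c: "c \<in> B" and S': "S \<in> vlist (above c)" and SB: "S \<in> vlist B"
    using S by (auto simp: vlist_def above_def)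
  have nab: "a \<noteq> b" "\<not> lt b a" using ab lt_irrefl lt_trans by blast+
  have uS: "unit_vec (c # S) = cns c (unit_vec S)" by (simp add: cns_def)
  note IHv = op_commutator_vec[of "unit_vec S", OF IH]
  consider "lt a c" | "a = c" | "lt c a" using lt_total[of a c] c ab by blast
  then show ?thesis
  proof cases
    case 1
    have S1: "c # S \<in> vlist (above a)" using S 1 lt_trans by (auto simp: vlist_def above_def)
    have ba: "b \<in> above a" using ab by (auto simp: above_def)
    have k: "pkeys (op b (unit_vec (c # S))) \<subseteq> vlist (above a)"
      by (rule op_keys[OF up_closed_above ba]) (use S1 in simp)
    have e1: "op a (unit_vec (c # S)) = cns a (unit_vec (c # S))"
      by (rule op_eq_cns) (use S1 in simp)
    have "op a (op b (unit_vec (c # S))) = cns a (op b (unit_vec (c # S)))"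
      by (rule op_eq_cns[OF k])
    moreover have "op b (op a (unit_vec (c # S)))
        = cns a (op b (unit_vec (c # S))) + vop (br b a) (unit_vec (c # S))"
      unfolding e1 by (rule op_cns[OF ab(3)])
    ultimately show ?thesis
      using br_sym[of a b] ab by (simp add: algebra_simps)
  next
    case 2
    have ba: "b \<in> above a" using ab by (auto simp: above_def)
    have k: "pkeys (op b (unit_vec S)) \<subseteq> vlist (above a)"
      by (rule op_keys[OF up_closed_above ba]) (use S' 2 in simp)
    have kb: "pkeys (br a b) \<subseteq> above a" using br_keys[of a b] ab by (auto simp: above_def)
    have kv: "pkeys (vop (br a b) (unit_vec S)) \<subseteq> vlist (above a)"
      by (rule vop_keys[OF up_closed_above kb]) (use S' 2 in simp)
    have e1: "op a (unit_vec (c # S)) = vop (sq a) (unit_vec S)"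
      using 2 by (simp add: vop_of_unit_vec)
    have e2: "op b (unit_vec (c # S)) = op a (op b (unit_vec S)) + vop (br a b) (unit_vec S)"
      unfolding uS using 2 op_cns[of a b "unit_vec S"] ab br_sym[of a b] op_eq_cns[OF k] by simp
    \<comment> \<open>The first a is merely prefixed to lists above a, so the second one meets it as
      the head and triggers the square case of the recursion.\<close>
    have aa: "op a (op a v) = vop (sq a) v" if "pkeys v \<subseteq> vlist (above a)" for v
    proof -
      have "op a (op a v) = op a (cns a v)" using op_eq_cns[OF that] by simp
      also have "\<dots> = vop (sq a) v"
        by (rule add_map_eqI[OF add_map_comp[OF add_map_op add_map_cns] add_map_vop])
          (simp add: cns_def vop_of_unit_vec)
      finally show ?thesis .
    qed
    have "op a (op b (unit_vec (c # S))) + op b (op a (unit_vec (c # S)))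
      = vop (sq a) (op b (unit_vec S)) + op b (vop (sq a) (unit_vec S)) + op a (vop (br a b) (unit_vec S))"
      by (simp only: e1 e2 add_mapD[OF add_map_op] aa[OF k] add_ac)
    \<comment> \<open>The commutator of a^[2] and b on the shorter list S, together with [a^[2], b]
      = [a, [a, b]].\<close>
    also have "vop (sq a) (op b (unit_vec S)) + op b (vop (sq a) (unit_vec S))
      = vop (lin (br a) (br a b)) (unit_vec S)"
      using IHv[of "sq a" "unit_vec b"] ab sq_subset lin_br_sym[of "sq a" b] sq_br[of a b] by simp
    also have "op a (vop (br a b) (unit_vec S)) = cns c (vop (br a b) (unit_vec S))"
      using op_eq_cns[OF kv] 2 by simp
    finally have "op a (op b (unit_vec (c # S))) + op b (op a (unit_vec (c # S))) =
      vop (lin (br a) (br a b)) (unit_vec S) + cns c (vop (br a b) (unit_vec S))" .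
    moreover have "vop (br a b) (unit_vec (c # S)) = cns c (vop (br a b) (unit_vec S)) + vop (lin (br a) (br a b)) (unit_vec S)"
      unfolding uS using vop_cns[of "br a b" a "unit_vec S"] kb 2 lin_br_sym[of "br a b" a] br_subset[of a b] ab
      by simp
    ultimately show ?thesis by (simp add: add_ac)
  next
    case 3
    then have cb: "lt c b" using ab lt_trans by blast
    have e: "op x (op y (unit_vec (c # S))) = cns c (op x (op y (unit_vec S)))
        + vop (br x c) (op y (unit_vec S)) + op x (vop (br y c) (unit_vec S))"
      if "lt c x" "lt c y" for x y
      unfolding uS using that by (simp add: op_cns add_mapD[OF add_map_op])
    have I1: "vop (br x c) (op y (unit_vec S)) + op y (vop (br x c) (unit_vec S))
        = vop (lin (br y) (br x c)) (unit_vec S)" if "x \<in> B" "y \<in> B" for x y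
      using IHv[of "br x c" "unit_vec y"] that c br_subset[of x c] lin_br_sym[of "br x c" y] by simp
    have "op a (op b (unit_vec (c # S))) + op b (op a (unit_vec (c # S)))
      = cns c (op a (op b (unit_vec S)) + op b (op a (unit_vec S)))
        + (vop (br a c) (op b (unit_vec S)) + op b (vop (br a c) (unit_vec S)))
        + (vop (br b c) (op a (unit_vec S)) + op a (vop (br b c) (unit_vec S)))"
      by (simp only: e[OF 3 cb] e[OF cb 3] add_mapD[OF add_map_cns] add_ac)
    also have "\<dots> = cns c (vop (br a b) (unit_vec S))
        + (vop (lin (br b) (br a c)) (unit_vec S) + vop (lin (br a) (br b c)) (unit_vec S))"
      unfolding IH[OF ab(1,2)] I1[OF ab(1,2)] I1[OF ab(2,1)] by (rule add.assoc)
    \<comment> \<open>By the Jacobi identity the two cross terms combine to [[a, b], c], the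
      correction that arises when [a, b] passes c.\<close>
    also have "vop (lin (br b) (br a c)) (unit_vec S) + vop (lin (br a) (br b c)) (unit_vec S)
      = vop (lin (\<lambda>x. br x c) (br a b)) (unit_vec S)"
    proof -
      have "lin (br b) (br a c) + lin (br a) (br b c) = lin (br c) (br a b)"
        using br_jacobi[OF ab(1,2) c] br_sym[of a c] ab c
        by (metis add_eq_zero_iff_char_two add.commute)
      then show ?thesis
        using lin_br_sym[of "br a b" c] br_subset[of a b] ab c by (simp flip: vop_add)
    qed
    also have "cns c (vop (br a b) (unit_vec S)) + \<dots> = vop (br a b) (unit_vec (c # S))"
    proof -
      have "pkeys (br a b) \<subseteq> above c"
        using br_keys[of a b] ab 3 lt_trans by (auto simp: above_def)
      then show ?thesis unfolding uS by (rule vop_cns[symmetric])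
    qed
    finally show ?thesis .
  qed
qed

lemma op_commutator_list:
  "S \<in> vlist B \<Longrightarrow> a \<in> B \<Longrightarrow> b \<in> B \<Longrightarrow>
    op a (op b (unit_vec S)) + op b (op a (unit_vec S)) = vop (br a b) (unit_vec S)"
proof (induction S arbitrary: a b)
  case Nil
  have "op a (op b (unit_vec [])) + op b (op a (unit_vec [])) = vop (br a b) (unit_vec [])"
    if "a \<in> B" "b \<in> B" "lt a b" for a b
  proof -
    have "a \<noteq> b" "\<not> lt b a" using that lt_irrefl lt_trans by blast+
    then show ?thesis using that br_sym[of a b] by (simp add: vop_of_unit_vec algebra_simps)
  qed
  then show ?case
    using lt_total[of a b] Nil br_self br_sym[of a b] by (metis add.commute add_self vop_zero)
next
  case (Cons c S)
  have SB: "S \<in> vlist B" using Cons.prems(1) by (rule vlist_tail)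
  have "op a (op b (unit_vec (c # S))) + op b (op a (unit_vec (c # S))) = vop (br a b) (unit_vec (c # S))"
    if "a \<in> B" "b \<in> B" "lt a b" for a b
    using op_commutator_lt[OF Cons.prems(1) that] Cons.IH[OF SB] by blast
  then show ?case
    using lt_total[of a b] Cons.prems br_self br_sym[of a b] by (metis add.commute add_self vop_zero)
qed

lemma op_commutator:
  assumes "pkeys v \<subseteq> vlist B" "a \<in> B" "b \<in> B"
  shows "op a (op b v) + op b (op a v) = vop (br a b) v"
proof (rule add_map_eqI[where f = "\<lambda>v. op a (op b v) + op b (op a v)" and g = "vop (br a b)"])
  show "add_map (\<lambda>v. op a (op b v) + op b (op a v))"
    by (rule add_map_plus[OF add_map_comp[OF add_map_op add_map_op] add_map_comp[OF add_map_op add_map_op]])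
next
  show "add_map (vop (br a b))" by (rule add_map_vop)
next
  fix S assume "S \<in> pkeys v"
  then show "op a (op b (unit_vec S)) + op b (op a (unit_vec S)) = vop (br a b) (unit_vec S)"
    using assms by (intro op_commutator_list) auto
qed

text \<open>For a < c this is the recursion itself. For a = c the element a^[2] has to commute with
  c, which holds as [a^[2], a] = [a, [a, a]] = 0; for a > c the commutators with c are collected by
  \<open>sq_br\<close>.\<close>

lemma op_square_list: "S \<in> vlist B \<Longrightarrow> a \<in> B \<Longrightarrow> op a (op a (unit_vec S)) = vop (sq a) (unit_vec S)"
proof (induction S)
  case Nil
  then show ?case by (simp add: vop_of_unit_vec)
next
  case (Cons c S)
  have c: "c \<in> B" and S': "S \<in> vlist (above c)" and SB: "S \<in> vlist B"
    using Cons.prems by (auto simp: vlist_def above_def)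
  have uS: "unit_vec (c # S) = cns c (unit_vec S)" by (simp add: cns_def)
  consider "lt a c" | "a = c" | "lt c a" using lt_total[of a c] c Cons.prems by blast
  then show ?case
  proof cases
    case 1
    then have "a \<noteq> c" using lt_irrefl by blast
    then show ?thesis using 1 by (simp add: vop_of_unit_vec)
  next
    case 2
    have k: "pkeys (sq a) \<subseteq> above a" using sq_keys Cons.prems by (auto simp: above_def)
    have kv: "pkeys (vop (sq a) (unit_vec S)) \<subseteq> vlist (above a)"
      by (rule vop_keys[OF up_closed_above k]) (use S' 2 in simp)
    have "lin (\<lambda>b. br b a) (sq a) = 0"
      using lin_br_sym[of "sq a" a] sq_subset[of a] sq_br[of a a] br_self[of a] Cons.prems by simp
    then have "vop (sq a) (unit_vec (c # S)) = cns a (vop (sq a) (unit_vec S))"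
      unfolding uS using vop_cns[OF k, of "unit_vec S"] 2 by simp
    moreover have "op a (op a (unit_vec (c # S))) = op a (vop (sq a) (unit_vec S))"
      using 2 by (simp add: vop_of_unit_vec)
    ultimately show ?thesis using op_eq_cns[OF kv] by simp
  next
    case 3
    have k: "pkeys (sq a) \<subseteq> above c"
      using sq_keys[of a] Cons.prems 3 lt_trans by (auto simp: above_def)
    have "op a (op a (unit_vec (c # S))) = cns c (op a (op a (unit_vec S)))
        + (vop (br a c) (op a (unit_vec S)) + op a (vop (br a c) (unit_vec S)))"
      unfolding uS using 3 by (simp add: op_cns add_mapD[OF add_map_op] add_ac)
    also have "\<dots> = cns c (vop (sq a) (unit_vec S)) + vop (lin (br a) (br a c)) (unit_vec S)"
      using op_commutator_vec[of "unit_vec S" "br a c" "unit_vec a"] op_commutator_list[OF SB]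
        Cons.IH[OF SB] Cons.prems c br_subset[of a c] lin_br_sym[of "br a c" a] by simp
    also have "lin (br a) (br a c) = lin (\<lambda>b. br b c) (sq a)"
      using sq_br[of a c] lin_br_sym[of "sq a" c] sq_subset[of a] Cons.prems c by simp
    finally show ?thesis unfolding uS using vop_cns[OF k, of "unit_vec S"] by simp
  qed
qed

lemma op_square:
  assumes "pkeys v \<subseteq> vlist B" "a \<in> B"
  shows "op a (op a v) = vop (sq a) v"
  by (rule add_map_eqI[OF add_map_comp[OF add_map_op add_map_op] add_map_vop])
    (use assms op_square_list in auto)

text \<open>The recursion for \<open>act\<close> only rewrites by the bracket and square relations,
  which the operators \<open>J\<close> satisfy. Hence sending a list to the product of its operators
  applied to m is a module map, the one determined by mapping [] to m.\<close>

lemma pbw_universal: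
  fixes J :: "'b \<Rightarrow> 'm::char_two \<Rightarrow> 'm"
  assumes J: "\<And>b. b \<in> B \<Longrightarrow> add_map (J b)"
    and J_br: "\<And>a b m. a \<in> B \<Longrightarrow> b \<in> B \<Longrightarrow> J a (J b m) + J b (J a m) = lin (\<lambda>x. J x m) (br a b)"
    and J_sq: "\<And>a m. a \<in> B \<Longrightarrow> J a (J a m) = lin (\<lambda>x. J x m) (sq a)"
  shows "S \<in> vlist B \<Longrightarrow> b \<in> B \<Longrightarrow> lin (\<lambda>T. foldr J T m) (act S b) = J b (foldr J S m)"
proof (induction S arbitrary: b)
  case Nil
  then show ?case by simp
next
  case (Cons c S)
  have c: "c \<in> B" and SB: "S \<in> vlist B" using Cons.prems by (auto simp: vlist_def)
  note IH = Cons.IH[OF SB]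
  have IHv: "lin (\<lambda>T. foldr J T m) (lin (act S) x) = lin (\<lambda>b. J b (foldr J S m)) x"
    if "pkeys x \<subseteq> B" for x
    using that unfolding lin_lin by (intro lin_cong IH) blast
  consider "b = c" | "b \<noteq> c" "lt b c" | "b \<noteq> c" "\<not> lt b c" by blast
  then show ?case
  proof cases
    case 1
    then show ?thesis using IHv[OF sq_subset] c J_sq[OF c] by simp
  next
    case 2
    then show ?thesis by simp
  next
    case 3
    have "lin (\<lambda>T. foldr J T m) (lin (\<lambda>T. unit_vec (c # T)) (act S b)) = J c (J b (foldr J S m))"
      by (simp add: lin_lin IH[OF Cons.prems(2), symmetric] lin_comp[OF J[OF c]])
    then show ?thesis
      using 3 IHv[OF br_subset[OF Cons.prems(2) c]] J_br[OF Cons.prems(2) c, of "foldr J S m", symmetric]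
      by (simp add: lin_add)
  qed
qed

end

\<comment> \<open>Structure constants of the graph Lie algebra on a homogeneous basis\<close>
section \<open>The free restricted Lie algebra and its quotient by the graph relations\<close>

\<comment> \<open>Terms over the whole type \<open>'x\<close> are used, so that the quotient is a
  type and can be made an instance of \<open>char_two\<close>. The elements represented by terms
  over V are singled out later as \<open>FV\<close>.\<close>
quotient_type 'x frl = "'x rl_term" / rl_eq
  by (rule equivpI) (auto intro!: reflpI sympI transpI intro: rl_eq.refl rl_eq.sym rl_eq.trans)

lift_definition fbr :: "'x frl \<Rightarrow> 'x frl \<Rightarrow> 'x frl" is RBracket by (rule rl_eq.cong_bracket)
lift_definition fsq :: "'x frl \<Rightarrow> 'x frl" is RSquare by (rule rl_eq.cong_square)
lift_definition fgen :: "'x \<Rightarrow> 'x frl" is RGen .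

instantiation frl :: (type) ab_group_add
begin

lift_definition zero_frl :: "'a frl" is RZero .
lift_definition plus_frl :: "'a frl \<Rightarrow> 'a frl \<Rightarrow> 'a frl" is RPlus by (rule rl_eq.cong_plus)
definition uminus_frl :: "'a frl \<Rightarrow> 'a frl" where "uminus_frl x = x"
definition minus_frl :: "'a frl \<Rightarrow> 'a frl \<Rightarrow> 'a frl" where "minus_frl x y = x + y"

instance
proof
  fix a b c :: "'a frl"
  show "a + b + c = a + (b + c)" by transfer (rule rl_eq.plus_assoc)
  show "a + b = b + a" by transfer (rule rl_eq.plus_comm)
  show "0 + a = a" by transfer (rule rl_eq.plus_zero)
  show "- a + a = 0" unfolding uminus_frl_def by transfer (rule rl_eq.plus_self)
  show "a - b = a + - b" by (simp add: minus_frl_def uminus_frl_def)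
qed

end

instance frl :: (type) char_two
proof
  show "x + x = 0" for x :: "'a frl" by transfer (rule rl_eq.plus_self)
qed

lemma fbr_left: "fbr (a + b) c = fbr a c + fbr b c"
  by transfer (rule rl_eq.bracket_left)

lemma fbr_right: "fbr a (b + c) = fbr a b + fbr a c"
  by transfer (rule rl_eq.bracket_right)

lemma fbr_self [simp]: "fbr a a = 0"
  by transfer (rule rl_eq.bracket_self)

lemma fbr_sym: "fbr a b = fbr b a"
proof -
  have "fbr (a + b) (a + b) = fbr a b + fbr b a"
    unfolding fbr_left fbr_right by simp
  then show ?thesis by (simp add: add_eq_zero_iff_char_two)
qed

lemma fbr_jacobi: "fbr a (fbr b c) + fbr b (fbr c a) + fbr c (fbr a b) = 0"
  unfolding add.assoc by transfer (rule rl_eq.jacobi)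

lemma fsq_plus: "fsq (a + b) = fsq a + fsq b + fbr a b"
  by transfer (rule rl_eq.square_plus)

lemma fbr_fsq: "fbr (fsq a) b = fbr a (fbr a b)"
  by transfer (rule rl_eq.square_bracket)

lemma add_map_fbr: "add_map (fbr a)" "add_map (\<lambda>b. fbr b a)"
  by (simp_all add: add_map_def fbr_left fbr_right)

lemma fbr_zero [simp]: "fbr a 0 = 0" "fbr 0 a = 0"
  using add_map_zero[OF add_map_fbr(1)] add_map_zero[OF add_map_fbr(2)] by auto

lemma fsq_zero [simp]: "fsq 0 = (0 :: 'x frl)"
proof -
  have "fsq (0 + 0) = fsq (0 :: 'x frl) + fsq 0 + fbr 0 0" by (rule fsq_plus)
  then show ?thesis by simp
qed

lemma abs_frl_simps:
  "abs_frl RZero = 0" "abs_frl (RPlus s t) = abs_frl s + abs_frl t"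
  "abs_frl (RBracket s t) = fbr (abs_frl s) (abs_frl t)" "abs_frl (RSquare s) = fsq (abs_frl s)"
  "abs_frl (RGen x) = fgen x"
  by (simp_all add: zero_frl_def plus_frl.abs_eq fbr.abs_eq fsq.abs_eq fgen.abs_eq)

lemma abs_rep_frl: "abs_frl (rep_frl a) = a"
  by (rule Quotient_abs_rep[OF Quotient_frl])

lemma rl_eq_iff: "rl_eq s t \<longleftrightarrow> abs_frl s = abs_frl t"
  by (simp add: frl.abs_eq_iff)

subsection \<open>Representations by additive operators\<close>

primrec intp :: "('x \<Rightarrow> 'm \<Rightarrow> 'm) \<Rightarrow> 'x rl_term \<Rightarrow> 'm::char_two \<Rightarrow> 'm" where
  "intp Y (RGen x) m = Y x m"
| "intp Y RZero m = 0"
| "intp Y (RPlus s t) m = intp Y s m + intp Y t m"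
| "intp Y (RBracket s t) m = intp Y s (intp Y t m) + intp Y t (intp Y s m)"
| "intp Y (RSquare s) m = intp Y s (intp Y s m)"

definition fintp :: "('x \<Rightarrow> 'm \<Rightarrow> 'm) \<Rightarrow> 'x frl \<Rightarrow> 'm::char_two \<Rightarrow> 'm" where
  "fintp Y a = intp Y (rep_frl a)"

context
  fixes Y :: "'x \<Rightarrow> 'm::char_two \<Rightarrow> 'm"
  assumes Y: "\<And>x. add_map (Y x)"
begin

lemma intp_add: "intp Y t (m + m') = intp Y t m + intp Y t m'"
proof (induction t arbitrary: m m')
  case (RGen x)
  then show ?case using Y by (simp add: add_map_def)
qed (simp_all add: add_ac)

text \<open>Additive operators form a restricted Lie algebra under A B + B A and A A, so each axiom
  becomes a cancellation of equal composites.\<close>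

lemma intp_rl_eq: "rl_eq s t \<Longrightarrow> intp Y s m = intp Y t m"
proof (induction arbitrary: m rule: rl_eq.induct)
qed (simp_all add: intp_add add_ac)

lemma fintp_abs: "fintp Y (abs_frl t) m = intp Y t m"
  unfolding fintp_def by (rule intp_rl_eq) (simp add: rl_eq_iff abs_rep_frl)

lemma fintp_simps:
  "fintp Y 0 m = 0" "fintp Y (a + b) m = fintp Y a m + fintp Y b m"
  "fintp Y (fbr a b) m = fintp Y a (fintp Y b m) + fintp Y b (fintp Y a m)"
  "fintp Y (fsq a) m = fintp Y a (fintp Y a m)" "fintp Y (fgen x) m = Y x m"
proof -
  obtain s t where [simp]: "a = abs_frl s" "b = abs_frl t" by (metis abs_rep_frl)
  show "fintp Y 0 m = 0" "fintp Y (a + b) m = fintp Y a m + fintp Y b m"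
    "fintp Y (fbr a b) m = fintp Y a (fintp Y b m) + fintp Y b (fintp Y a m)"
    "fintp Y (fsq a) m = fintp Y a (fintp Y a m)" "fintp Y (fgen x) m = Y x m"
    by (simp_all add: fintp_abs flip: abs_frl_simps)
qed

lemma add_map_fintp: "add_map (fintp Y a)" "add_map (\<lambda>a. fintp Y a m)"
  by (simp_all add: add_map_def fintp_def intp_add) (simp add: fintp_simps flip: fintp_def)

end

subsection \<open>Bases of quotients\<close>

text \<open>A basis of \<open>K\<close> is extended to one of the span of \<open>H\<close>. The
  added vectors lift a basis of the quotient, and \<open>crd\<close> forgets the coordinates along
  the basis of \<open>K\<close>.\<close>

lemma quotient_basis:
  fixes K H :: "'v::char_two set"
  assumes K: "0 \<in> K" "\<And>x y. x \<in> K \<Longrightarrow> y \<in> K \<Longrightarrow> x + y \<in> K" and KH: "K \<subseteq> H"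
  obtains B and crd :: "'v \<Rightarrow> ('v \<Rightarrow>\<^sub>0 bit)"
  where "B \<subseteq> H" "\<And>a. a \<in> H \<Longrightarrow> pkeys (crd a) \<subseteq> B"
    "\<And>a. a \<in> H \<Longrightarrow> a + lin (\<lambda>b. b) (crd a) \<in> K"
    "\<And>a b. a \<in> H \<Longrightarrow> b \<in> H \<Longrightarrow> crd (a + b) = crd a + crd b"
    "\<And>b. b \<in> B \<Longrightarrow> crd b = unit_vec b" "\<And>a. a \<in> K \<Longrightarrow> crd a = 0"
proof -
  define scl where "scl = (\<lambda>(c::bit) (x::'v). if c = 1 then x else 0)"
  interpret vs: vector_space scl
    by standard (auto simp: scl_def)
  obtain BK where BK: "BK \<subseteq> K" "vs.independent BK" "K \<subseteq> vs.span BK"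
    using vs.maximal_independent_subset[of K] by blast
  obtain BH where BH: "BK \<subseteq> BH" "BH \<subseteq> H" "vs.independent BH" "H \<subseteq> vs.span BH"
    using vs.maximal_independent_subset_extend[of BK H] BK KH by (metis subset_trans)
  define B where "B = BH - BK"
  define r where "r = (\<lambda>a b. if b \<in> B then vs.representation BH a b else 0)"
  have fin: "finite {b. r a b \<noteq> 0}" for a
    by (rule finite_subset[OF _ vs.finite_representation[of BH a]]) (auto simp: r_def)
  define crd where "crd = (\<lambda>a. Abs_poly_mapping (r a))"
  have lk: "plookup (crd a) = r a" for a
    unfolding crd_def using fin by simp
  have keys: "pkeys (crd a) = {b \<in> B. vs.representation BH a b \<noteq> 0}" for a
    by (auto simp: in_keys_iff lk r_def split: if_splits)
  show thesis
  proof (rule that)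
    show "B \<subseteq> H" using BH by (auto simp: B_def)
    show "pkeys (crd a) \<subseteq> B" for a by (auto simp: keys)
    show "crd (a + b) = crd a + crd b" if "a \<in> H" "b \<in> H" for a b
    proof (rule poly_mapping_eqI)
      fix k
      have "vs.representation BH (a + b) = (\<lambda>k. vs.representation BH a k + vs.representation BH b k)"
        using that BH by (intro vs.representation_add) auto
      then show "plookup (crd (a + b)) k = plookup (crd a + crd b) k"
        by (simp add: lk lookup_add r_def)
    qed
    show "crd b = unit_vec b" if "b \<in> B" for b
    proof (rule poly_mapping_eqI)
      fix k
      have "vs.representation BH b k = (if k = b then 1 else 0)"
        using that BH vs.representation_basis[of BH b] by (auto simp: B_def)
      then show "plookup (crd b) k = plookup (unit_vec b) k"
        using that by (auto simp: lk r_def lookup_single)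
    qed
    show "crd a = 0" if "a \<in> K" for a
    proof (rule poly_mapping_eqI)
      fix k
      have "vs.representation BH a = vs.representation BK a"
        using that BK BH by (intro vs.representation_extend) auto
      moreover have "vs.representation BK a k = 0" if "k \<notin> BK"
        using that vs.representation_ne_zero[of BK a k] by blast
      ultimately show "plookup (crd a) k = plookup 0 k"
        by (auto simp: lk r_def B_def)
    qed
    show "a + lin (\<lambda>b. b) (crd a) \<in> K" if a: "a \<in> H" for a
    proof -
      let ?S = "{b. vs.representation BH a b \<noteq> 0}"
      have S: "finite ?S" "?S \<subseteq> BH"
        using vs.finite_representation vs.representation_ne_zero by blast+
      have "a = (\<Sum>b\<in>?S. scl (vs.representation BH a b) b)"
        using a BH by (intro vs.sum_nonzero_representation_eq[symmetric]) auto
      also have "\<dots> = (\<Sum>b\<in>?S. b)"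
        by (rule sum.cong) (auto simp: scl_def)
      also have "\<dots> = (\<Sum>b\<in>{b \<in> B. vs.representation BH a b \<noteq> 0} \<union> ?S \<inter> BK. b)"
        using S BH by (intro sum.cong) (auto simp: B_def)
      also have "\<dots> = lin (\<lambda>b. b) (crd a) + (\<Sum>b\<in>?S \<inter> BK. b)"
        unfolding lin_def keys using S(1) by (intro sum.union_disjoint) (auto simp: B_def)
      finally have "a + lin (\<lambda>b. b) (crd a) = (\<Sum>b\<in>?S \<inter> BK. b)"
        by (metis add.commute add_self_left)
      moreover have "(\<Sum>b\<in>?S \<inter> BK. b) \<in> K"
        using BK K by (intro sum_in) auto
      ultimately show ?thesis by simp
    qed
  qed
qed

subsection \<open>The enveloping algebra of the restricted Lie algebra of a graph\<close>

locale graph =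
  fixes V :: "'x set" and E :: "'x set set"
  assumes finite_V: "finite V" and edges: "E \<subseteq> {e. e \<subseteq> V \<and> card e = 2}"
begin

definition FV :: "'x frl set" where
  "FV = abs_frl ` rl_terms V"

definition Hom :: "nat \<Rightarrow> 'x frl set" where
  "Hom n = abs_frl ` {t \<in> rl_terms V. rl_homogeneous n t}"

text \<open>The restricted ideal of the edge relations, generated from below, so that vanishing on
  it can be shown by rule induction. \<open>KL_eq\<close> identifies it with the intersection of all
  such ideals.\<close>

inductive_set KE :: "'x frl set" where
  zero: "0 \<in> KE"
| plus: "a \<in> KE \<Longrightarrow> b \<in> KE \<Longrightarrow> a + b \<in> KE"
| edge: "{u, v} \<in> E \<Longrightarrow> fbr (fgen u) (fgen v) \<in> KE"
| br: "a \<in> FV \<Longrightarrow> b \<in> KE \<Longrightarrow> fbr a b \<in> KE"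
| sq: "a \<in> KE \<Longrightarrow> fsq a \<in> KE"

lemma Hom_subset: "Hom n \<subseteq> FV"
  by (auto simp: Hom_def FV_def)

lemma Hom_zero: "0 \<in> Hom n"
  unfolding Hom_def by (rule image_eqI[of _ _ RZero])
    (auto simp: abs_frl_simps rl_terms_def intro: rl_homogeneous.intros)

lemma Hom_plus: "a \<in> Hom n \<Longrightarrow> b \<in> Hom n \<Longrightarrow> a + b \<in> Hom n"
proof -
  assume "a \<in> Hom n" "b \<in> Hom n"
  then obtain s t where "a = abs_frl s" "b = abs_frl t" "s \<in> rl_terms V" "t \<in> rl_terms V"
    "rl_homogeneous n s" "rl_homogeneous n t" by (auto simp: Hom_def)
  then show ?thesis unfolding Hom_def
    by (intro image_eqI[of _ _ "RPlus s t"]) (auto simp: abs_frl_simps rl_terms_def intro: rl_homogeneous.intros)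
qed

lemma Hom_br: "a \<in> Hom m \<Longrightarrow> b \<in> Hom n \<Longrightarrow> fbr a b \<in> Hom (m + n)"
proof -
  assume "a \<in> Hom m" "b \<in> Hom n"
  then obtain s t where "a = abs_frl s" "b = abs_frl t" "s \<in> rl_terms V" "t \<in> rl_terms V"
    "rl_homogeneous m s" "rl_homogeneous n t" by (auto simp: Hom_def)
  then show ?thesis unfolding Hom_def
    by (intro image_eqI[of _ _ "RBracket s t"]) (auto simp: abs_frl_simps rl_terms_def intro: rl_homogeneous.intros)
qed

lemma Hom_sq: "a \<in> Hom n \<Longrightarrow> fsq a \<in> Hom (2 * n)"
proof -
  assume "a \<in> Hom n"
  then obtain s where "a = abs_frl s" "s \<in> rl_terms V" "rl_homogeneous n s" by (auto simp: Hom_def)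
  then show ?thesis unfolding Hom_def
    by (intro image_eqI[of _ _ "RSquare s"]) (auto simp: abs_frl_simps rl_terms_def intro: rl_homogeneous.intros)
qed

lemma Hom_gen: "x \<in> V \<Longrightarrow> fgen x \<in> Hom 1"
  unfolding Hom_def by (rule image_eqI[of _ _ "RGen x"])
    (use rl_homogeneous.intros(1)[of x] in \<open>auto simp: abs_frl_simps rl_terms_def\<close>)

text \<open>
  \<open>hb n\<close> consists of lifts of a basis of the component of degree \<open>n\<close> of the quotient by \<open>KE\<close>, together with
  coordinates. Basis elements are tagged with their degree, so that it does not matter whether the
  sum of the \<open>Hom n\<close> is direct.
\<close>

definition hb :: "nat \<Rightarrow> 'x frl set \<times> ('x frl \<Rightarrow> ('x frl \<Rightarrow>\<^sub>0 bit))" where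
  "hb n = (SOME (B, crd). B \<subseteq> Hom n \<and> (\<forall>a\<in>Hom n. pkeys (crd a) \<subseteq> B \<and> a + lin (\<lambda>b. b) (crd a) \<in> KE)
     \<and> (\<forall>a\<in>Hom n. \<forall>b\<in>Hom n. crd (a + b) = crd a + crd b) \<and> (\<forall>b\<in>B. crd b = unit_vec b)
     \<and> (\<forall>a\<in>KE \<inter> Hom n. crd a = 0))"

definition crd :: "nat \<Rightarrow> 'x frl \<Rightarrow> (nat \<times> 'x frl \<Rightarrow>\<^sub>0 bit)" where
  "crd n a = lin (\<lambda>b. unit_vec (n, b)) (snd (hb n) a)"

text \<open>With degrees at least 1, brackets and squares have strictly larger degree than their
  arguments.\<close>

definition BB :: "(nat \<times> 'x frl) set" where
  "BB = {(n, b). 1 \<le> n \<and> b \<in> fst (hb n)}"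

definition val :: "(nat \<times> 'x frl \<Rightarrow>\<^sub>0 bit) \<Rightarrow> 'x frl" where
  "val p = lin snd p"

lemma hb_props:
  "fst (hb n) \<subseteq> Hom n \<and> (\<forall>a\<in>Hom n. pkeys (snd (hb n) a) \<subseteq> fst (hb n) \<and> a + lin (\<lambda>b. b) (snd (hb n) a) \<in> KE)
     \<and> (\<forall>a\<in>Hom n. \<forall>b\<in>Hom n. snd (hb n) (a + b) = snd (hb n) a + snd (hb n) b) \<and> (\<forall>b\<in>fst (hb n). snd (hb n) b = unit_vec b)
     \<and> (\<forall>a\<in>KE \<inter> Hom n. snd (hb n) a = 0)"
proof -
  obtain B and c :: "'x frl \<Rightarrow> ('x frl \<Rightarrow>\<^sub>0 bit)" where "B \<subseteq> Hom n" "\<And>a. a \<in> Hom n \<Longrightarrow> pkeys (c a) \<subseteq> B"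
    "\<And>a. a \<in> Hom n \<Longrightarrow> a + lin (\<lambda>b. b) (c a) \<in> KE \<inter> Hom n"
    "\<And>a b. a \<in> Hom n \<Longrightarrow> b \<in> Hom n \<Longrightarrow> c (a + b) = c a + c b"
    "\<And>b. b \<in> B \<Longrightarrow> c b = unit_vec b" "\<And>a. a \<in> KE \<inter> Hom n \<Longrightarrow> c a = 0"
    by (rule quotient_basis[of "KE \<inter> Hom n" "Hom n"])
      (auto intro: KE.zero KE.plus Hom_zero Hom_plus)
  then have "\<exists>p. case p of (B, c) \<Rightarrow> B \<subseteq> Hom n \<and> (\<forall>a\<in>Hom n. pkeys (c a) \<subseteq> B \<and> a + lin (\<lambda>b. b) (c a) \<in> KE)
     \<and> (\<forall>a\<in>Hom n. \<forall>b\<in>Hom n. c (a + b) = c a + c b) \<and> (\<forall>b\<in>B. c b = unit_vec b)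
     \<and> (\<forall>a\<in>KE \<inter> Hom n. c a = 0)"
    by (intro exI[of _ "(B, c)"]) auto
  from someI_ex[OF this] show ?thesis
    unfolding hb_def[symmetric] by (simp add: case_prod_beta)
qed

lemma val_crd: "a \<in> Hom n \<Longrightarrow> a + val (crd n a) \<in> KE"
  using hb_props[of n] by (simp add: val_def crd_def lin_lin)

lemma crd_plus: "a \<in> Hom n \<Longrightarrow> b \<in> Hom n \<Longrightarrow> crd n (a + b) = crd n a + crd n b"
  using hb_props[of n] by (simp add: crd_def lin_add)

lemma crd_KE: "a \<in> Hom n \<Longrightarrow> a \<in> KE \<Longrightarrow> crd n a = 0"
  using hb_props[of n] by (simp add: crd_def)

lemma crd_zero: "crd n 0 = 0"
  by (rule crd_KE[OF Hom_zero KE.zero])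

lemma crd_cong: "a \<in> Hom n \<Longrightarrow> b \<in> Hom n \<Longrightarrow> a + b \<in> KE \<Longrightarrow> crd n a = crd n b"
  using crd_KE[OF Hom_plus] crd_plus by (metis add_eq_zero_iff_char_two)

lemma BB_Hom: "(n, b) \<in> BB \<Longrightarrow> b \<in> Hom n"
  using hb_props[of n] by (auto simp: BB_def)

lemma crd_BB: "(n, b) \<in> BB \<Longrightarrow> crd n b = unit_vec (n, b)"
  using hb_props[of n] by (auto simp: BB_def crd_def)

lemma crd_keys: "1 \<le> n \<Longrightarrow> a \<in> Hom n \<Longrightarrow> pkeys (crd n a) \<subseteq> {x \<in> BB. fst x = n}"
  unfolding crd_def using hb_props[of n] by (intro keys_lin_subset) (auto simp: BB_def)

lemma val_add: "val (p + q) = val p + val q"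
  by (simp add: val_def lin_add)

lemma val_Hom: "pkeys p \<subseteq> {x \<in> BB. fst x = n} \<Longrightarrow> val p \<in> Hom n"
  unfolding val_def using BB_Hom by (intro lin_in Hom_zero Hom_plus) fastforce+

lemma crd_val: "pkeys p \<subseteq> {x \<in> BB. fst x = n} \<Longrightarrow> crd n (val p) = p"
proof -
  assume p: "pkeys p \<subseteq> {x \<in> BB. fst x = n}"
  have "crd n (sum snd A) = sum unit_vec A" if "A \<subseteq> {x \<in> BB. fst x = n}" "finite A" for A
    using that(2,1)
  proof (induction A rule: finite_induct)
    case empty
    then show ?case by (simp add: crd_zero)
  next
    case (insert x A)
    have "sum snd A \<in> Hom n" using insert.prems BB_Hom by (intro sum_in Hom_zero Hom_plus) fastforce+
    moreover have "snd x \<in> Hom n" "crd n (snd x) = unit_vec x"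
      using insert.prems BB_Hom[of n "snd x"] crd_BB[of n "snd x"] by (cases x; auto)+
    ultimately show ?case using insert by (simp add: crd_plus)
  qed
  then have "crd n (val p) = lin unit_vec p"
    unfolding val_def lin_def using p finite_keys by blast
  then show ?thesis by simp
qed

definition wo :: "'x frl rel" where
  "wo = (SOME r. well_order_on UNIV r)"

lemma wo: "linear_order wo"
proof -
  have "well_order_on UNIV wo" unfolding wo_def by (rule someI_ex) (rule well_order_on)
  then show ?thesis by (simp add: well_order_on_def)
qed

text \<open>The degree decides, so brackets and squares lie above their arguments, as the recursion
  for the action demands. The order \<open>wo\<close> breaks ties within a degree.\<close>

definition ltB :: "nat \<times> 'x frl \<Rightarrow> nat \<times> 'x frl \<Rightarrow> bool" where
  "ltB a b \<longleftrightarrow> fst a < fst b \<or> fst a = fst b \<and> snd a \<noteq> snd b \<and> (snd a, snd b) \<in> wo"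

definition bbr :: "nat \<times> 'x frl \<Rightarrow> nat \<times> 'x frl \<Rightarrow> (nat \<times> 'x frl \<Rightarrow>\<^sub>0 bit)" where
  "bbr a b = crd (fst a + fst b) (fbr (snd a) (snd b))"

definition bsq :: "nat \<times> 'x frl \<Rightarrow> (nat \<times> 'x frl \<Rightarrow>\<^sub>0 bit)" where
  "bsq a = crd (2 * fst a) (fsq (snd a))"

text \<open>An element and the lift of its coordinates differ by an element of \<open>KE\<close>,
  which is an ideal; so coordinates can be taken before or after bracketing with
  \<open>a\<close>.\<close>

lemma lin_bbr:
  assumes "a \<in> Hom m" "y \<in> Hom n" "1 \<le> n"
  shows "lin (\<lambda>x. crd (m + fst x) (fbr a (snd x))) (crd n y) = crd (m + n) (fbr a y)"
proof -
  have k: "pkeys (crd n y) \<subseteq> {x \<in> BB. fst x = n}" by (rule crd_keys[OF assms(3,2)])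
  have "(\<Sum>x\<in>A. crd (m + n) (fbr a (snd x))) = crd (m + n) (fbr a (\<Sum>x\<in>A. snd x))"
    if "A \<subseteq> {x \<in> BB. fst x = n}" "finite A" for A
    using that(2,1)
  proof (induction A rule: finite_induct)
    case empty
    then show ?case by (simp add: crd_zero)
  next
    case (insert x A)
    have "sum snd A \<in> Hom n" using insert.prems BB_Hom by (intro sum_in Hom_zero Hom_plus) fastforce+
    moreover have "snd x \<in> Hom n"
      using insert.prems BB_Hom[of n "snd x"] by (cases x; auto)
    ultimately show ?case using insert assms by (simp add: crd_plus fbr_right Hom_br)
  qed
  note eq = this[OF k finite_keys]
  have "lin (\<lambda>x. crd (m + fst x) (fbr a (snd x))) (crd n y) = lin (\<lambda>x. crd (m + n) (fbr a (snd x))) (crd n y)"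
    by (rule lin_cong) (use k in auto)
  also have "\<dots> = crd (m + n) (fbr a (val (crd n y)))"
    unfolding lin_def val_def by (rule eq)
  also have "\<dots> = crd (m + n) (fbr a y)"
  proof (rule crd_cong)
    show "fbr a (val (crd n y)) \<in> Hom (m + n)" "fbr a y \<in> Hom (m + n)"
      using assms val_Hom[OF k] by (auto intro: Hom_br)
    have "fbr a (y + val (crd n y)) \<in> KE"
      using KE.br val_crd assms Hom_subset by blast
    then show "fbr a (val (crd n y)) + fbr a y \<in> KE" by (simp add: fbr_right add_ac)
  qed
  finally show ?thesis .
qed

lemma bbr_of_crd:
  assumes "a \<in> BB" "y \<in> Hom n" "1 \<le> n"
  shows "lin (bbr a) (crd n y) = crd (fst a + n) (fbr (snd a) y)"
  unfolding bbr_def using lin_bbr[of "snd a" "fst a" y n] assms BB_Hom[of "fst a" "snd a"] by simp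

text \<open>Each axiom is an identity between elements of a single degree, on which the coordinate
  map is additive; iterated brackets are evaluated by \<open>bbr_of_crd\<close>.\<close>

sublocale pbw BB ltB bbr bsq
proof
  show "\<not> ltB a a" for a by (simp add: ltB_def)
  show "ltB a c" if "ltB a b" "ltB b c" for a b c
    using that wo unfolding ltB_def order_on_defs trans_def antisym_def
    by (smt (verit) order.strict_trans)
  show "ltB a b \<or> ltB b a" if "a \<noteq> b" for a b
    using that wo unfolding ltB_def order_on_defs total_on_def
    by (metis UNIV_I linorder_neqE_nat prod_eqI)
next
  fix a b assume a: "a \<in> BB" and b: "b \<in> BB"
  note H = BB_Hom[of "fst a" "snd a"] BB_Hom[of "fst b" "snd b"]
  have n: "1 \<le> fst a" "1 \<le> fst b" using a b by (auto simp: BB_def)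
  have [simp]: "snd a \<in> Hom (fst a)" "snd b \<in> Hom (fst b)" using H a b by auto
  show "pkeys (bbr a b) \<subseteq> {x \<in> BB. ltB a x \<and> ltB b x}"
    unfolding bbr_def using crd_keys[of "fst a + fst b" "fbr (snd a) (snd b)"] n
    by (auto simp: Hom_br ltB_def)
  show "pkeys (bsq a) \<subseteq> {x \<in> BB. ltB a x}"
    unfolding bsq_def using crd_keys[of "2 * fst a" "fsq (snd a)"] n
    by (auto simp: Hom_sq ltB_def)
  show "bbr a a = 0" by (simp add: bbr_def crd_zero)
  show "bbr a b = bbr b a" by (simp add: bbr_def fbr_sym add.commute)
  have "lin (bbr b) (bsq a) = crd (fst b + 2 * fst a) (fbr (snd b) (fsq (snd a)))"
    unfolding bsq_def using n by (intro bbr_of_crd b Hom_sq) auto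
  also have "\<dots> = crd (fst a + (fst a + fst b)) (fbr (snd a) (fbr (snd a) (snd b)))"
    by (simp add: fbr_sym[of "snd b"] fbr_fsq mult_2 add_ac)
  also have "\<dots> = lin (bbr a) (bbr a b)"
    unfolding bbr_def[of a b] using n by (intro bbr_of_crd[symmetric] a Hom_br) auto
  finally show "lin (bbr b) (bsq a) = lin (bbr a) (bbr a b)" .
  fix c assume c: "c \<in> BB"
  have [simp]: "snd c \<in> Hom (fst c)" using BB_Hom[of "fst c" "snd c"] c by auto
  let ?n = "fst a + fst b + fst c"
  have e: "lin (bbr x) (bbr y z) = crd (fst x + (fst y + fst z)) (fbr (snd x) (fbr (snd y) (snd z)))"
    if "x \<in> BB" "y \<in> BB" "z \<in> BB" for x y z
    unfolding bbr_def[of y z] using that BB_Hom[of "fst y" "snd y"] BB_Hom[of "fst z" "snd z"]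
    by (intro bbr_of_crd Hom_br) (auto simp: BB_def)
  have h: "fbr (snd a) (fbr (snd b) (snd c)) \<in> Hom ?n" "fbr (snd b) (fbr (snd c) (snd a)) \<in> Hom ?n"
     "fbr (snd c) (fbr (snd a) (snd b)) \<in> Hom ?n"
    using Hom_br[of "snd a" "fst a" "fbr (snd b) (snd c)" "fst b + fst c"]
     Hom_br[of "snd b" "fst b" "fbr (snd c) (snd a)" "fst c + fst a"]
     Hom_br[of "snd c" "fst c" "fbr (snd a) (snd b)" "fst a + fst b"]
     Hom_br[of "snd a" "fst a" "snd b" "fst b"] Hom_br[of "snd b" "fst b" "snd c" "fst c"]
     Hom_br[of "snd c" "fst c" "snd a" "fst a"]
    by (auto simp: add_ac)
  have "crd ?n (fbr (snd a) (fbr (snd b) (snd c))) + crd ?n (fbr (snd b) (fbr (snd c) (snd a)))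
    + crd ?n (fbr (snd c) (fbr (snd a) (snd b))) = crd ?n 0"
    using h by (simp only: Hom_plus fbr_jacobi flip: crd_plus)
  then show "lin (bbr a) (bbr b c) + lin (bbr b) (bbr c a) + lin (bbr c) (bbr a b) = 0"
    by (simp add: e a b c crd_zero add_ac)
qed

end

section \<open>Operators raising a filtration, and the finite 2-group generated by unipotent
  operators\<close>

section \<open>Filtrations and words in unipotent operators\<close>

locale filt =
  fixes F :: "nat \<Rightarrow> 'm::char_two set"
  assumes F_zero: "0 \<in> F k" and F_add: "x \<in> F k \<Longrightarrow> y \<in> F k \<Longrightarrow> x + y \<in> F k"
    and F_Suc: "F (Suc k) \<subseteq> F k"
begin

definition raises :: "nat \<Rightarrow> ('m \<Rightarrow> 'm) \<Rightarrow> bool" where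
  "raises n A \<longleftrightarrow> (\<forall>k. \<forall>v\<in>F k. A v \<in> F (k + n))"

lemma F_mono: "m \<le> n \<Longrightarrow> F n \<subseteq> F m"
  by (rule lift_Suc_antimono_le[of F, OF F_Suc])

lemma raisesD: "raises n A \<Longrightarrow> v \<in> F k \<Longrightarrow> A v \<in> F (k + n)"
  by (simp add: raises_def)

lemma raises_mono: "raises n A \<Longrightarrow> m \<le> n \<Longrightarrow> raises m A"
  unfolding raises_def using F_mono by (meson add_left_mono subsetD)

lemma raises_comp: "raises m A \<Longrightarrow> raises n B \<Longrightarrow> raises (m + n) (\<lambda>v. A (B v))"
  unfolding raises_def by (metis add.assoc add.commute)

lemma raises_add: "raises n A \<Longrightarrow> raises n B \<Longrightarrow> raises n (\<lambda>v. A v + B v)"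
  unfolding raises_def using F_add by blast

lemma raises_zero: "raises n (\<lambda>v. 0)"
  unfolding raises_def using F_zero by blast

lemma raises_ident: "raises 0 (\<lambda>v. v)"
  by (simp add: raises_def)

lemma raises_sum_cancel: "raises n (\<lambda>v. A v + B v) \<Longrightarrow> raises n B \<Longrightarrow> raises n A"
  using raises_add[of n "\<lambda>v. A v + B v" B] by (simp add: add_ac)

text \<open>A B + A' B' = (A + A') B + A' (B + B'), so the leading part of a composite depends only
  on the leading parts of its factors.\<close>

lemma raises_comp_cong:
  assumes A': "add_map A'" and AA: "raises (Suc m) (\<lambda>v. A v + A' v)" and B: "raises n B"
    and rA: "raises m A'" and BB: "raises (Suc n) (\<lambda>v. B v + B' v)"
  shows "raises (Suc (m + n)) (\<lambda>v. A (B v) + A' (B' v))"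
proof -
  have "raises (Suc m + n) (\<lambda>v. (\<lambda>v. A v + A' v) (B v))" by (rule raises_comp[OF AA B])
  moreover have "raises (m + Suc n) (\<lambda>v. A' (B v + B' v))" by (rule raises_comp[OF rA BB])
  ultimately have "raises (Suc (m + n)) (\<lambda>v. (A (B v) + A' (B v)) + A' (B v + B' v))"
    using raises_add by fastforce
  then show ?thesis by (simp add: add_mapD[OF A'] add_ac)
qed

lemma intp_raises:
  assumes "\<And>x. raises 1 (Y x)"
  shows "rl_homogeneous n t \<Longrightarrow> raises n (intp Y t)"
proof (induction rule: rl_homogeneous.induct)
  case (1 x)
  then show ?case using assms[of x] by (simp add: raises_def)
next
  case (2 n)
  then show ?case by (simp add: raises_def F_zero)
next
  case (3 n a b)
  then show ?case by (simp add: raises_def F_add)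
next
  case (4 m a n b)
  have "raises (m + n) (\<lambda>v. intp Y b (intp Y a v))"
    using raises_comp[OF 4(4,3)] by (simp add: add.commute)
  from raises_add[OF raises_comp[OF 4(3,4)] this] show ?case by (simp add: raises_def)
next
  case (5 n a)
  then show ?case using raises_comp[of n "intp Y a" n "intp Y a"] by (simp add: raises_def mult_2)
qed

text \<open>In degree n the term is a sum of n-fold composites of the operators. Replacing one
  factor \<open>Y x\<close> by \<open>Y' x\<close> at a time changes a composite by something that
  raises the filtration by n + 1.\<close>

lemma intp_raises_cong:
  assumes Y: "\<And>x. raises 1 (Y x)" "\<And>x. raises 1 (Y' x)" "\<And>x. raises 2 (\<lambda>v. Y x v + Y' x v)"
    and aY: "\<And>x. add_map (Y' x)"
  shows "rl_homogeneous n t \<Longrightarrow> raises (Suc n) (\<lambda>v. intp Y t v + intp Y' t v)"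
proof (induction rule: rl_homogeneous.induct)
  case (1 x)
  then show ?case using Y(3)[of x] by (simp add: numeral_2_eq_2)
next
  case (2 n)
  then show ?case by (simp add: raises_zero)
next
  case (3 n a b)
  have "raises (Suc n) (\<lambda>v. (intp Y a v + intp Y' a v) + (intp Y b v + intp Y' b v))"
    by (rule raises_add) (use 3 in auto)
  then show ?case by (simp add: add_ac)
next
  case (4 m a n b)
  have add: "add_map (intp Y' s)" for s using intp_add[of Y'] aY by (simp add: add_map_def)
  note r = intp_raises[of Y, OF Y(1)] intp_raises[of Y', OF Y(2)]
  have 1: "raises (Suc (m + n)) (\<lambda>v. intp Y a (intp Y b v) + intp Y' a (intp Y' b v))"
    by (rule raises_comp_cong) (use 4 add r in auto)
  have "raises (Suc (n + m)) (\<lambda>v. intp Y b (intp Y a v) + intp Y' b (intp Y' a v))"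
    by (rule raises_comp_cong) (use 4 add r in auto)
  from raises_add[OF 1 this[unfolded add.commute[of n m]]] show ?case by (simp add: add_ac)
next
  case (5 n a)
  have add: "add_map (intp Y' s)" for s using intp_add[of Y'] aY by (simp add: add_map_def)
  note r = intp_raises[of Y, OF Y(1)] intp_raises[of Y', OF Y(2)]
  have "raises (Suc (n + n)) (\<lambda>v. intp Y a (intp Y a v) + intp Y' a (intp Y' a v))"
    by (rule raises_comp_cong) (use 5 add r in auto)
  then show ?case by (simp add: mult_2)
qed

end

text \<open>Serves to compare the truncated operators with those of the enveloping algebra:
  \<open>S\<close> will be the valid vectors and \<open>A\<close> those of degree above N.\<close>

lemma intp_cong_mod:
  assumes Y: "\<And>x v. v \<in> S \<Longrightarrow> Y x v \<in> S" "\<And>x v. v \<in> S \<Longrightarrow> Y' x v \<in> S"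
    "\<And>x v. v \<in> A \<Longrightarrow> Y' x v \<in> A" "\<And>x v. v \<in> S \<Longrightarrow> Y x v + Y' x v \<in> A" "\<And>x. add_map (Y' x)"
    and SA: "0 \<in> S" "\<And>x y. x \<in> S \<Longrightarrow> y \<in> S \<Longrightarrow> x + y \<in> S" "0 \<in> A" "\<And>x y. x \<in> A \<Longrightarrow> y \<in> A \<Longrightarrow> x + y \<in> A"
  shows "v \<in> S \<Longrightarrow> intp Y t v + intp Y' t v \<in> A"
proof -
  have inS: "v \<in> S \<Longrightarrow> intp Y t v \<in> S" for t v
    by (induction t arbitrary: v) (auto simp: Y SA)
  have inA: "v \<in> A \<Longrightarrow> intp Y' t v \<in> A" for t v
    by (induction t arbitrary: v) (auto simp: Y SA)
  have add: "add_map (intp Y' s)" for s using intp_add[of Y'] Y(5) by (simp add: add_map_def)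
  have comp: "intp Y s (intp Y t v) + intp Y' s (intp Y' t v) \<in> A"
    if "v \<in> S" "\<And>v. v \<in> S \<Longrightarrow> intp Y s v + intp Y' s v \<in> A" "\<And>v. v \<in> S \<Longrightarrow> intp Y t v + intp Y' t v \<in> A" for s t v
  proof -
    have "(intp Y s (intp Y t v) + intp Y' s (intp Y t v)) + intp Y' s (intp Y t v + intp Y' t v) \<in> A"
      by (rule SA(4)) (use that inS inA in auto)
    then show ?thesis by (simp add: add_mapD[OF add] add_ac)
  qed
  show "v \<in> S \<Longrightarrow> intp Y t v + intp Y' t v \<in> A"
  proof (induction t arbitrary: v)
    case (RGen x)
    then show ?case using Y by simp
  next
    case RZero
    then show ?case using SA by simp
  next
    case (RPlus s t)
    have "(intp Y s v + intp Y' s v) + (intp Y t v + intp Y' t v) \<in> A"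
      by (rule SA(4)) (use RPlus in auto)
    then show ?case by (simp add: add_ac)
  next
    case (RBracket s t)
    have "(intp Y s (intp Y t v) + intp Y' s (intp Y' t v)) + (intp Y t (intp Y s v) + intp Y' t (intp Y' s v)) \<in> A"
      by (rule SA(4); rule comp) (use RBracket in auto)
    then show ?case by (simp add: add_ac)
  next
    case (RSquare s)
    then show ?case using comp by simp
  qed
qed

text \<open>Generators have degree 1, so a term of degree 0 is built from \<open>RZero\<close>
  alone.\<close>

lemma rl_homogeneous_zero: "rl_homogeneous n t \<Longrightarrow> n = 0 \<Longrightarrow> abs_frl t = 0"
  by (induction rule: rl_homogeneous.induct) (auto simp: abs_frl_simps)

text \<open>A word acts as the product of the operators 1 + Y i. Positive letters are enough,
  because inverses in a finite group are powers.\<close>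

primrec wop :: "('x \<Rightarrow> 'm \<Rightarrow> 'm) \<Rightarrow> 'x list \<Rightarrow> 'm::char_two \<Rightarrow> 'm" where
  "wop Y [] v = v"
| "wop Y (i # w) v = wop Y w v + Y i (wop Y w v)"

lemma wop_append: "wop Y (u @ w) v = wop Y u (wop Y w v)"
  by (induction u) auto

lemma wop_Nil: "wop Y [] = id"
  by (rule ext) simp

lemma add_map_wop: "(\<And>i. add_map (Y i)) \<Longrightarrow> add_map (wop Y w)"
  by (induction w) (auto simp: add_map_def add_ac)

lemma wop_replicate: "wop Y (concat (replicate k w)) = wop Y w ^^ k"
  by (induction k) (auto simp: wop_append)

text \<open>The Frobenius map of the commutative ring generated by \<open>Z\<close>.\<close>

lemma unipotent_power:
  fixes Z :: "'m::char_two \<Rightarrow> 'm"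
  assumes "add_map Z"
  shows "((\<lambda>v. v + Z v) ^^ (2 ^ m)) v = v + (Z ^^ (2 ^ m)) v"
proof (induction m arbitrary: v)
  case (Suc m)
  have aZ: "add_map (Z ^^ k)" for k
    using assms by (induction k) (auto simp: add_map_def)
  have e: "(2::nat) ^ Suc m = 2 ^ m + 2 ^ m" by simp
  show ?case
    unfolding e funpow_add comp_apply by (simp add: Suc.IH add_mapD[OF aZ] add_ac)
qed simp

lemma two_power_times_odd: "0 < n \<Longrightarrow> \<exists>k q. n = 2 ^ k * q \<and> \<not> 2 dvd q" for n :: nat
proof (induction n rule: less_induct)
  case (less n)
  show ?case
  proof (cases "2 dvd n")
    case True
    then obtain m where m: "n = 2 * m" by auto
    then obtain k q where "m = 2 ^ k * q" "\<not> 2 dvd q" using less by (metis mult_2 less_add_same_cancel1 nat_0_less_mult_iff)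
    then show ?thesis using m by (intro exI[of _ "Suc k"] exI[of _ q]) auto
  next
    case False
    then show ?thesis by (intro exI[of _ 0] exI[of _ n]) simp
  qed
qed

text \<open>An odd prime divisor p of the order gives, by the theorem of Sylow with exponent 1, a
  subgroup of order p. The order of a nontrivial element in it would divide both p and 2^m.\<close>

lemma card_two_power_if_exponent:
  assumes "group G" "finite (carrier G)" and ex: "\<And>x. x \<in> carrier G \<Longrightarrow> x [^]\<^bsub>G\<^esub> (2 ^ m :: nat) = \<one>\<^bsub>G\<^esub>"
  shows "\<exists>k. card (carrier G) = 2 ^ k"
proof -
  interpret group G by fact
  define n where "n = card (carrier G)"
  have "n > 0" unfolding n_def using assms(2) one_closed by (auto simp: card_gt_0_iff)
  then obtain k q where kq: "n = 2 ^ k * q" "\<not> 2 dvd q"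
    using two_power_times_odd by blast
  have "q = 1"
  proof (rule ccontr)
    assume "q \<noteq> 1"
    then obtain p where p: "prime p" "p dvd q" using prime_factor_nat by blast
    then have p2: "p \<noteq> 2" using kq by auto
    obtain r where r: "n = p ^ 1 * r" using p kq by (metis dvd_mult dvd_def power_one_right)
    obtain H where H: "subgroup H G" "card H = p"
      using sylow_thm[of p G 1 r] p r assms by (auto simp: order_def n_def)
    interpret H: group "G\<lparr>carrier := H\<rparr>" using H subgroup.subgroup_is_group assms(1) by blast
    have HG: "H \<subseteq> carrier G" using H subgroup.subset by blast
    have finH: "finite H" using HG assms(2) finite_subset by blast
    have "H \<noteq> {\<one>\<^bsub>G\<^esub>}" using H p by auto
    then obtain h where h: "h \<in> H" "h \<noteq> \<one>\<^bsub>G\<^esub>" using H.one_closed by auto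
    have "h [^]\<^bsub>G\<lparr>carrier := H\<rparr>\<^esub> p = \<one>\<^bsub>G\<lparr>carrier := H\<rparr>\<^esub>"
      using H.pow_order_eq_1[of h] h H by (simp add: order_def)
    then have "h [^]\<^bsub>G\<^esub> p = \<one>\<^bsub>G\<^esub>" by (simp add: nat_pow_def)
    moreover have "h [^]\<^bsub>G\<^esub> (2 ^ m :: nat) = \<one>\<^bsub>G\<^esub>" using ex HG h by blast
    ultimately have "ord h dvd p" "ord h dvd 2 ^ m" using pow_eq_id h HG by blast+
    moreover have "coprime p (2 ^ m)" using p(1) p2
      by (metis coprime_commute coprime_power_left_iff primes_coprime two_is_prime_nat)
    ultimately have "ord h = 1" by (meson coprime_common_divisor_nat nat_dvd_1_iff_1)
    then show False using h HG ord_eq_1 by blast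
  qed
  then show ?thesis using kq n_def by auto
qed

definition word_group :: "'x set \<Rightarrow> ('x \<Rightarrow> 'm \<Rightarrow> 'm) \<Rightarrow> ('m::char_two \<Rightarrow> 'm) monoid" where
  "word_group V Y = \<lparr>carrier = wop Y ` lists V, monoid.mult = (\<circ>), one = id\<rparr>"

locale nilpotent_ops = filt F for F :: "nat \<Rightarrow> 'm::char_two set" +
  fixes V :: "'x set" and Y :: "'x \<Rightarrow> 'm \<Rightarrow> 'm" and M :: nat
  assumes fin_V: "finite V" and Y_add: "\<And>i. add_map (Y i)" and Y_raises: "\<And>i. raises 1 (Y i)"
    and F_UNIV: "F 0 = UNIV" and F_M: "F M = {0}"
begin

lemma monomial_raises: "raises (length u) (foldr Y u)"
proof (induction u)
  case (Cons i u)
  then show ?case using raises_comp[OF Y_raises[of i] Cons] by (simp add: raises_def)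
qed (simp add: raises_def)

lemma monomial_zero: "M \<le> length u \<Longrightarrow> foldr Y u v = 0"
  using raisesD[OF monomial_raises, of v 0 u] F_UNIV F_M F_mono[of M "length u"] by auto

text \<open>Expanding the product of the 1 + Y i gives a sum of monomials in the Y i, and long
  monomials vanish. As the letters come from the finite set V, only finitely many operators
  arise.\<close>

lemma wop_monomials: "w \<in> lists V \<Longrightarrow>
  \<exists>p. pkeys p \<subseteq> {u. set u \<subseteq> V \<and> length u \<le> M} \<and> (\<forall>v. wop Y w v = lin (\<lambda>u. foldr Y u v) p)"
proof (induction w)
  case Nil
  then show ?case by (intro exI[of _ "unit_vec []"]) auto
next
  case (Cons i w)
  then obtain p where p: "pkeys p \<subseteq> {u. set u \<subseteq> V \<and> length u \<le> M}"
    "\<And>v. wop Y w v = lin (\<lambda>u. foldr Y u v) p" by auto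
  \<comment> \<open>When the length bound is reached, prefixing \<open>i\<close> gives a monomial
    that acts as zero; it is dropped so that the support of \<open>q\<close> stays within the
    bound.\<close>
  define q where "q = lin (\<lambda>u. if length u < M then unit_vec (i # u) else 0) p"
  have "pkeys q \<subseteq> {u. set u \<subseteq> V \<and> length u \<le> M}"
    unfolding q_def using p(1) Cons.prems by (intro keys_lin_subset) (auto split: if_splits)
  moreover have "Y i (wop Y w v) = lin (\<lambda>u. foldr Y u v) q" for v
    unfolding q_def p(2) lin_lin lin_comp[OF Y_add]
    using monomial_zero[of "i # _" v] by (intro lin_cong) auto
  ultimately show ?case
    using p by (intro exI[of _ "p + q"]) (simp add: keys_add_subset lin_add)
qed

lemma finite_words: "finite (wop Y ` lists V)"
proof (rule finite_subset)
  let ?K = "{p :: 'x list \<Rightarrow>\<^sub>0 bit. pkeys p \<subseteq> {u. set u \<subseteq> V \<and> length u \<le> M}}"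
  show "wop Y ` lists V \<subseteq> (\<lambda>p v. lin (\<lambda>u. foldr Y u v) p) ` ?K"
  proof
    fix f assume "f \<in> wop Y ` lists V"
    then obtain w where "w \<in> lists V" "f = wop Y w" by blast
    with wop_monomials[of w] obtain p where "p \<in> ?K" "\<And>v. f v = lin (\<lambda>u. foldr Y u v) p" by blast
    then show "f \<in> (\<lambda>p v. lin (\<lambda>u. foldr Y u v) p) ` ?K" by (auto intro!: image_eqI[of _ _ p])
  qed
  show "finite ((\<lambda>p v. lin (\<lambda>u. foldr Y u v) p) ` ?K)"
    using finite_vectors[OF finite_lists_length_le[OF fin_V, of M]] by simp
qed

lemma wop_minus_one_raises: "raises 1 (\<lambda>v. v + wop Y w v)"
proof (induction w)
  case Nil
  then show ?case by (simp add: raises_zero)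
next
  case (Cons i w)
  have r: "raises 0 (wop Y w)"
    using raises_add[OF raises_ident raises_mono[OF Cons, of 0]] by (simp add: raises_def)
  have "raises 1 (\<lambda>v. (v + wop Y w v) + Y i (wop Y w v))"
    using raises_comp[OF Y_raises r, of i] by (intro raises_add Cons) simp
  then show ?case by (simp add: add_ac)
qed

text \<open>Write the word as 1 + Z with Z raising the filtration by one. Then (1 + Z)^(2^M) = 1 +
  Z^(2^M), and Z^(2^M) = 0 because 2^M > M.\<close>

lemma wop_exponent: "wop Y w ^^ (2 ^ M) = id"
proof
  fix v
  define Z where "Z = (\<lambda>v. v + wop Y w v)"
  have aZ: "add_map Z" unfolding Z_def by (intro add_map_plus add_map_ident add_map_wop Y_add)
  have Zk: "raises k (Z ^^ k)" for k
  proof (induction k)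
    case (Suc k)
    then show ?case using raises_comp[OF wop_minus_one_raises Suc, of w] by (simp add: Z_def comp_def)
  qed (simp add: raises_def)
  have "(Z ^^ (2 ^ M)) v \<in> F (2 ^ M)" using raisesD[OF Zk, of v 0] F_UNIV by simp
  then have "(Z ^^ (2 ^ M)) v = 0" using F_M F_mono[of M "2 ^ M"] less_exp[of M] by auto
  moreover have "wop Y w = (\<lambda>v. v + Z v)" by (simp add: Z_def)
  ultimately show "(wop Y w ^^ (2 ^ M)) v = id v" using unipotent_power[OF aZ] by simp
qed

text \<open>As the operator of w has exponent 2^M, the positive word w^(2^M - 1) provides the
  inverse.\<close>

lemma word_inverse: "w \<in> lists V \<Longrightarrow> \<exists>w'\<in>lists V. (\<forall>v. wop Y w' (wop Y w v) = v) \<and> (\<forall>v. wop Y w (wop Y w' v) = v)"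
proof (intro bexI conjI allI)
  let ?w' = "concat (replicate (2 ^ M - 1) w)"
  have e: "Suc (2 ^ M - 1) = 2 ^ M" by simp
  show "wop Y w (wop Y ?w' v) = v" for v
    using wop_exponent[of w] funpow.simps(2)[of "2 ^ M - 1" "wop Y w"] e
    unfolding wop_replicate by (metis comp_apply id_apply)
  show "wop Y ?w' (wop Y w v) = v" for v
    using wop_exponent[of w] funpow_Suc_right[of "2 ^ M - 1" "wop Y w"] e
    unfolding wop_replicate by (metis comp_apply id_apply)
qed auto

lemma group_word_group: "group (word_group V Y)"
proof (rule groupI)
  fix f g h assume fgh: "f \<in> carrier (word_group V Y)" "g \<in> carrier (word_group V Y)"
  then obtain u w where uw: "u \<in> lists V" "w \<in> lists V" "f = wop Y u" "g = wop Y w"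
    by (auto simp: word_group_def)
  show "f \<otimes>\<^bsub>word_group V Y\<^esub> g \<in> carrier (word_group V Y)"
    unfolding word_group_def using uw by (auto intro!: image_eqI[of _ _ "u @ w"] simp: wop_append)
  show "f \<otimes>\<^bsub>word_group V Y\<^esub> g \<otimes>\<^bsub>word_group V Y\<^esub> h = f \<otimes>\<^bsub>word_group V Y\<^esub> (g \<otimes>\<^bsub>word_group V Y\<^esub> h)"
    by (simp add: word_group_def comp_assoc)
next
  show "\<one>\<^bsub>word_group V Y\<^esub> \<in> carrier (word_group V Y)"
    unfolding word_group_def by (auto intro!: image_eqI[of _ _ "[]"])
  fix f assume "f \<in> carrier (word_group V Y)"
  then obtain w where w: "w \<in> lists V" "f = wop Y w" by (auto simp: word_group_def)
  show "\<one>\<^bsub>word_group V Y\<^esub> \<otimes>\<^bsub>word_group V Y\<^esub> f = f" by (simp add: word_group_def)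
  obtain w' where "w' \<in> lists V" "\<forall>v. wop Y w' (wop Y w v) = v" using word_inverse[OF w(1)] by blast
  then show "\<exists>g\<in>carrier (word_group V Y). g \<otimes>\<^bsub>word_group V Y\<^esub> f = \<one>\<^bsub>word_group V Y\<^esub>"
    unfolding word_group_def using w by (auto simp: fun_eq_iff intro!: bexI[of _ w'])
qed

lemma word_group_card: "\<exists>k. card (carrier (word_group V Y)) = 2 ^ k"
proof (rule card_two_power_if_exponent[OF group_word_group])
  show "finite (carrier (word_group V Y))" using finite_words by (simp add: word_group_def)
  fix f assume "f \<in> carrier (word_group V Y)"
  then obtain w where w: "f = wop Y w" by (auto simp: word_group_def)
  have "f [^]\<^bsub>word_group V Y\<^esub> (k::nat) = f ^^ k" for k
    by (induction k) (auto simp: word_group_def funpow_swap1 fun_eq_iff nat_pow_def)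
  then show "f [^]\<^bsub>word_group V Y\<^esub> (2 ^ M :: nat) = \<one>\<^bsub>word_group V Y\<^esub>"
    using wop_exponent[of w] w by (simp add: word_group_def)
qed

end

section \<open>Module maps out of the enveloping algebra, its grading and its truncations\<close>

section \<open>The enveloping algebra as a module\<close>

definition deg :: "(nat \<times> 'a) list \<Rightarrow> nat" where
  "deg S = sum_list (map fst S)"

lemma deg_simps [simp]: "deg [] = 0" "deg (b # S) = fst b + deg S"
  by (simp_all add: deg_def)

context graph
begin

lemma FV_abs: "t \<in> rl_terms V \<Longrightarrow> abs_frl t \<in> FV"
  by (simp add: FV_def)

lemma Hom_abs: "t \<in> rl_terms V \<Longrightarrow> rl_homogeneous n t \<Longrightarrow> abs_frl t \<in> Hom n"
  by (auto simp: Hom_def)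

lemma edge_V: "{u, v} \<in> E \<Longrightarrow> u \<in> V \<and> v \<in> V"
  using edges by auto

subsection \<open>The universal property\<close>

lemma fintp_KE:
  fixes Y :: "'x \<Rightarrow> 'm::char_two \<Rightarrow> 'm"
  assumes Y: "\<And>i. add_map (Y i)" and c: "\<And>u v m. {u, v} \<in> E \<Longrightarrow> Y u (Y v m) = Y v (Y u m)"
  shows "a \<in> KE \<Longrightarrow> fintp Y a m = 0"
proof (induction arbitrary: m rule: KE.induct)
  case (br a b)
  then show ?case
    using add_map_zero[OF add_map_fintp(1)[of Y a]] Y by (simp add: fintp_simps[OF Y])
next
  case (edge u v)
  then show ?case using c[OF edge] by (simp add: fintp_simps[OF Y])
qed (simp_all add: fintp_simps[OF Y])

text \<open>The module homomorphism from the enveloping algebra that sends [] to \<open>m\<close>,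
  given on basis lists.\<close>

definition phi :: "('x \<Rightarrow> 'm \<Rightarrow> 'm) \<Rightarrow> 'm \<Rightarrow> (nat \<times> 'x frl) list \<Rightarrow> 'm::char_two" where
  "phi Y m S = foldr (\<lambda>b. fintp Y (snd b)) S m"

context
  fixes Y :: "'x \<Rightarrow> 'm::char_two \<Rightarrow> 'm"
  assumes Y: "\<And>i. add_map (Y i)" and c: "\<And>u v m. {u, v} \<in> E \<Longrightarrow> Y u (Y v m) = Y v (Y u m)"
begin

lemma fintp_crd: "a \<in> Hom n \<Longrightarrow> lin (\<lambda>x. fintp Y (snd x) m) (crd n a) = fintp Y a m"
proof -
  assume "a \<in> Hom n"
  then have "fintp Y (a + val (crd n a)) m = 0"
    by (intro fintp_KE val_crd Y c)
  moreover have "fintp Y (val (crd n a)) m = lin (\<lambda>x. fintp Y (snd x) m) (crd n a)"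
    unfolding val_def by (rule lin_comp[OF add_map_fintp(2)[OF Y]])
  ultimately show ?thesis by (simp add: fintp_simps[OF Y] add_eq_zero_iff_char_two)
qed

lemma phi_act:
  assumes "S \<in> vlist BB" "b \<in> BB"
  shows "lin (phi Y m) (act S b) = fintp Y (snd b) (phi Y m S)"
  unfolding phi_def
proof (rule pbw_universal[OF _ _ _ assms])
  show "add_map (fintp Y (snd b))" for b by (rule add_map_fintp(1)[OF Y])
  fix a b :: "nat \<times> 'x frl" and m assume a: "a \<in> BB"
  then have ha: "snd a \<in> Hom (fst a)" using BB_Hom[of "fst a" "snd a"] by simp
  show "fintp Y (snd a) (fintp Y (snd a) m) = lin (\<lambda>x. fintp Y (snd x) m) (bsq a)"
    unfolding bsq_def fintp_crd[OF Hom_sq[OF ha]] by (simp add: fintp_simps[OF Y])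
  assume "b \<in> BB"
  then have hb: "snd b \<in> Hom (fst b)" using BB_Hom[of "fst b" "snd b"] by simp
  show "fintp Y (snd a) (fintp Y (snd b) m) + fintp Y (snd b) (fintp Y (snd a) m)
      = lin (\<lambda>x. fintp Y (snd x) m) (bbr a b)"
    unfolding bbr_def fintp_crd[OF Hom_br[OF ha hb]] by (simp add: fintp_simps[OF Y])
qed

lemma phi_op:
  assumes "pkeys v \<subseteq> vlist BB" "b \<in> BB"
  shows "lin (phi Y m) (op b v) = fintp Y (snd b) (lin (phi Y m) v)"
proof -
  have "lin (phi Y m) (op b v) = lin (\<lambda>S. fintp Y (snd b) (phi Y m S)) v"
    unfolding op_def lin_lin by (rule lin_cong) (use assms phi_act in blast)
  also have "\<dots> = fintp Y (snd b) (lin (phi Y m) v)"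
    by (rule lin_comp[OF add_map_fintp(1)[OF Y], symmetric])
  finally show ?thesis .
qed

lemma phi_vop:
  assumes "pkeys v \<subseteq> vlist BB" "a \<in> Hom n" "1 \<le> n"
  shows "lin (phi Y m) (vop (crd n a) v) = fintp Y a (lin (phi Y m) v)"
proof -
  have "lin (phi Y m) (vop (crd n a) v) = lin (\<lambda>b. fintp Y (snd b) (lin (phi Y m) v)) (crd n a)"
    unfolding vop_def lin_lin
    by (rule lin_cong) (use crd_keys[OF assms(3,2)] in \<open>auto intro: phi_op[OF assms(1)]\<close>)
  then show ?thesis by (simp add: fintp_crd[OF assms(2)])
qed

end

subsection \<open>Grading and generators\<close>

abbreviation valid :: "((nat \<times> 'x frl) list \<Rightarrow>\<^sub>0 bit) \<Rightarrow> bool" where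
  "valid v \<equiv> pkeys v \<subseteq> vlist BB"

definition Fil :: "nat \<Rightarrow> ((nat \<times> 'x frl) list \<Rightarrow>\<^sub>0 bit) set" where
  "Fil k = {v. pkeys v \<subseteq> {S \<in> vlist BB. k \<le> deg S}}"

sublocale Fil: filt Fil
proof
  show "x + y \<in> Fil k" if "x \<in> Fil k" "y \<in> Fil k" for x y k
    using that keys_add_subset unfolding Fil_def by blast
qed (auto simp: Fil_def)

lemma unit_vec_Fil: "S \<in> vlist BB \<Longrightarrow> k \<le> deg S \<Longrightarrow> unit_vec S \<in> Fil k"
  by (simp add: Fil_def)

lemma Fil_valid: "v \<in> Fil k \<Longrightarrow> valid v"
  by (auto simp: Fil_def)

lemma Fil_0: "v \<in> Fil 0 \<longleftrightarrow> valid v"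
  by (auto simp: Fil_def)

lemma deg_act: "S \<in> vlist BB \<Longrightarrow> b \<in> BB \<Longrightarrow> T \<in> pkeys (act S b) \<Longrightarrow> deg T = deg S + fst b"
proof (induction S arbitrary: b T)
  case Nil
  then show ?case by simp
next
  case (Cons c S)
  have SB: "S \<in> vlist BB" using Cons.prems(1) by (rule vlist_tail)
  have cB: "c \<in> BB" using Cons.prems(1) by (simp add: Cons_vlist)
  have n: "1 \<le> fst b" "1 \<le> fst c" using cB Cons.prems by (auto simp: BB_def)
  have h: "snd b \<in> Hom (fst b)" "snd c \<in> Hom (fst c)"
    using BB_Hom[of "fst b" "snd b"] BB_Hom[of "fst c" "snd c"] cB Cons.prems by auto
  have lact: "deg T = deg S + k"
    if x: "pkeys x \<subseteq> {y \<in> BB. fst y = k}" and T: "T \<in> pkeys (lin (act S) x)" for x k T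
  proof -
    have "pkeys (lin (act S) x) \<subseteq> {T. deg T = deg S + k}"
      by (rule keys_lin_subset) (use x Cons.IH[OF SB] in auto)
    then show ?thesis using T by blast
  qed
  consider "b = c" | "b \<noteq> c" "ltB b c" | "b \<noteq> c" "\<not> ltB b c" by blast
  then show ?case
  proof cases
    case 1
    have k: "pkeys (bsq b) \<subseteq> {y \<in> BB. fst y = 2 * fst b}"
      unfolding bsq_def using n h by (intro crd_keys Hom_sq) auto
    show ?thesis
      using 1 Cons.prems lact[OF k] by auto
  next
    case 2
    then show ?thesis using Cons.prems by simp
  next
    case 3
    have "pkeys (act (c # S) b) \<subseteq> {T. deg T = deg (c # S) + fst b}"
    proof -
      have k: "pkeys (bbr b c) \<subseteq> {y \<in> BB. fst y = fst b + fst c}"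
        unfolding bbr_def using n h by (intro crd_keys Hom_br) auto
      have "pkeys (lin (\<lambda>T. unit_vec (c # T)) (act S b)) \<subseteq> {T. deg T = deg (c # S) + fst b}"
        by (rule keys_lin_subset) (use Cons.IH[OF SB Cons.prems(2)] in auto)
      moreover have "pkeys (lin (act S) (bbr b c)) \<subseteq> {T. deg T = deg (c # S) + fst b}"
        using lact[OF k] by auto
      ultimately show ?thesis using 3 keys_add_subset by simp
    qed
    then show ?thesis using Cons.prems by blast
  qed
qed

lemma op_Fil: "v \<in> Fil k \<Longrightarrow> b \<in> BB \<Longrightarrow> op b v \<in> Fil (k + fst b)"
proof -
  assume v: "v \<in> Fil k" and b: "b \<in> BB"
  have "pkeys (op b v) \<subseteq> {S \<in> vlist BB. k + fst b \<le> deg S}"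
    unfolding op_def
  proof (rule keys_lin_subset)
    fix S assume "S \<in> pkeys v"
    then have S: "S \<in> vlist BB" "k \<le> deg S" using v by (auto simp: Fil_def)
    show "pkeys (act S b) \<subseteq> {S \<in> vlist BB. k + fst b \<le> deg S}"
      using act_keys[OF up_closed_B S(1) b] deg_act[OF S(1) b] S(2) by auto
  qed
  then show ?thesis by (simp add: Fil_def)
qed

lemma vop_Fil: "v \<in> Fil k \<Longrightarrow> a \<in> Hom n \<Longrightarrow> 1 \<le> n \<Longrightarrow> vop (crd n a) v \<in> Fil (k + n)"
  unfolding vop_def
  by (rule lin_in) (use op_Fil crd_keys[of n a] Fil.F_zero Fil.F_add in fastforce)+

definition cut :: "((nat \<times> 'x frl) list \<Rightarrow> bool) \<Rightarrow> ((nat \<times> 'x frl) list \<Rightarrow>\<^sub>0 bit) \<Rightarrow> ((nat \<times> 'x frl) list \<Rightarrow>\<^sub>0 bit)" where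
  "cut P = lin (\<lambda>S. if S \<in> vlist BB \<and> P S then unit_vec S else 0)"

text \<open>
  The operators \<open>Xop (\<lambda>_. True)\<close> are those of the enveloping algebra; invalid lists are sent to \<open>0\<close>.
  For \<open>P S = (deg S < N)\<close> one obtains the action on the quotient by all elements of degree \<open>> N\<close>.
\<close>

definition Xop :: "((nat \<times> 'x frl) list \<Rightarrow> bool) \<Rightarrow> 'x \<Rightarrow> ((nat \<times> 'x frl) list \<Rightarrow>\<^sub>0 bit) \<Rightarrow> ((nat \<times> 'x frl) list \<Rightarrow>\<^sub>0 bit)" where
  "Xop P i v = (if i \<in> V then vop (crd 1 (fgen i)) (cut P v) else 0)"

abbreviation X :: "'x \<Rightarrow> ((nat \<times> 'x frl) list \<Rightarrow>\<^sub>0 bit) \<Rightarrow> ((nat \<times> 'x frl) list \<Rightarrow>\<^sub>0 bit)" where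
  "X \<equiv> Xop (\<lambda>_. True)"

abbreviation XN :: "nat \<Rightarrow> 'x \<Rightarrow> ((nat \<times> 'x frl) list \<Rightarrow>\<^sub>0 bit) \<Rightarrow> ((nat \<times> 'x frl) list \<Rightarrow>\<^sub>0 bit)" where
  "XN N \<equiv> Xop (\<lambda>S. deg S < N)"

lemma add_map_cut: "add_map (cut P)"
  unfolding cut_def by (rule add_map_lin)

lemma add_map_Xop: "add_map (Xop P i)"
  using add_mapD[OF add_map_vop[of "crd 1 (fgen i)"]] add_mapD[OF add_map_cut]
  by (simp add: add_map_def Xop_def)

lemma cut_keys: "pkeys (cut P v) \<subseteq> {S \<in> vlist BB. P S \<and> S \<in> pkeys v}"
  unfolding cut_def by (rule keys_lin_subset) auto

lemma cut_ident: "pkeys v \<subseteq> {S \<in> vlist BB. P S} \<Longrightarrow> cut P v = v"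
proof -
  assume "pkeys v \<subseteq> {S \<in> vlist BB. P S}"
  then have "cut P v = lin unit_vec v" unfolding cut_def by (intro lin_cong) auto
  then show ?thesis by simp
qed

lemma cut_zero: "pkeys v \<inter> {S \<in> vlist BB. P S} = {} \<Longrightarrow> cut P v = 0"
proof -
  assume "pkeys v \<inter> {S \<in> vlist BB. P S} = {}"
  then have "pkeys (cut P v) = {}" using cut_keys[of P v] by fastforce
  then show ?thesis by simp
qed

lemma cut_Fil: "v \<in> Fil k \<Longrightarrow> cut P v \<in> Fil k" "cut P v \<in> Fil 0"
  using cut_keys[of P v] by (auto simp: Fil_def)

lemma Xop_Fil: "v \<in> Fil k \<Longrightarrow> Xop P i v \<in> Fil (Suc k)" "Xop P i v \<in> Fil 1"
  using vop_Fil[of "cut P v" k "fgen i" 1] vop_Fil[of "cut P v" 0 "fgen i" 1] cut_Fil(1)[of v k P] cut_Fil(2)[of P v] Hom_gen[of i]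
    Fil.F_zero
  by (auto simp: Xop_def)

lemma X_valid: "valid v \<Longrightarrow> i \<in> V \<Longrightarrow> X i v = vop (crd 1 (fgen i)) v"
  by (simp add: Xop_def cut_ident)

lemma cut_cong_Fil: "valid v \<Longrightarrow> v + cut (\<lambda>S. deg S < N) v \<in> Fil N"
proof -
  assume v: "valid v"
  have "v + cut (\<lambda>S. deg S < N) v = lin (\<lambda>S. unit_vec S + (if S \<in> vlist BB \<and> deg S < N then unit_vec S else 0)) v"
    by (simp add: lin_plus cut_def)
  also have "\<dots> \<in> Fil N"
    by (rule lin_in) (use v Fil.F_zero Fil.F_add in \<open>auto intro!: unit_vec_Fil\<close>)
  finally show ?thesis .
qed

text \<open>The operators differ only on lists of degree at least N, which are sent to zero by
  \<open>XN N i\<close> and to degree above N by \<open>X i\<close>.\<close>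

lemma X_XN: "valid v \<Longrightarrow> X i v + XN N i v \<in> Fil (Suc N)"
proof (cases "i \<in> V")
  case True
  assume v: "valid v"
  have "X i v + XN N i v = vop (crd 1 (fgen i)) (v + cut (\<lambda>S. deg S < N) v)"
    using True v by (simp add: X_valid Xop_def[of "\<lambda>S. deg S < N"] add_mapD[OF add_map_vop])
  also have "\<dots> \<in> Fil (N + 1)"
    using True v by (intro vop_Fil cut_cong_Fil Hom_gen) auto
  finally show ?thesis by simp
qed (simp add: Xop_def Fil.F_zero)

lemma XN_zero: "v \<in> Fil N \<Longrightarrow> XN N i v = 0"
proof -
  assume "v \<in> Fil N"
  then have "cut (\<lambda>S. deg S < N) v = 0" by (intro cut_zero) (auto simp: Fil_def)
  then show ?thesis using add_map_zero[OF add_map_vop] by (simp add: Xop_def)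
qed

lemma vop_fbr:
  assumes a: "a \<in> Hom m" "1 \<le> m" and b: "b \<in> Hom n" "1 \<le> n" and v: "valid v"
  shows "vop (crd (m + n) (fbr a b)) v
    = vop (crd m a) (vop (crd n b) v) + vop (crd n b) (vop (crd m a) v)"
proof -
  have k: "pkeys (crd m a) \<subseteq> BB" "pkeys (crd n b) \<subseteq> BB"
    using crd_keys a b by blast+
  have "brv (crd m a) (crd n b) = lin (\<lambda>x. crd (n + fst x) (fbr b (snd x))) (crd m a)"
    unfolding brv_def using k(1) bbr_of_crd[OF _ b]
    by (intro lin_cong) (auto simp: fbr_sym[of b] add.commute subset_iff)
  also have "\<dots> = crd (m + n) (fbr a b)"
    using lin_bbr[OF b(1) a] by (simp add: add.commute fbr_sym)
  finally show ?thesis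
    using op_commutator_vec[of v, OF op_commutator[OF v] k] by simp
qed

lemma crd_gen_commute:
  assumes e: "{u, v} \<in> E" and w: "valid w"
  shows "vop (crd 1 (fgen u)) (vop (crd 1 (fgen v)) w) = vop (crd 1 (fgen v)) (vop (crd 1 (fgen u)) w)"
proof -
  have g: "fgen u \<in> Hom 1" "fgen v \<in> Hom 1" using edge_V[OF e] Hom_gen by auto
  have "crd (1 + 1) (fbr (fgen u) (fgen v)) = 0"
    by (rule crd_KE[OF Hom_br[OF g] KE.edge[OF e]])
  then show ?thesis
    using vop_fbr[OF g(1) le_refl g(2) le_refl w] by (simp add: add_eq_zero_iff_char_two)
qed

lemma deg_op: "valid v \<Longrightarrow> b \<in> BB \<Longrightarrow> T \<in> pkeys (op b v) \<Longrightarrow> \<exists>S\<in>pkeys v. deg T = deg S + fst b"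
proof -
  assume v: "valid v" and b: "b \<in> BB" and T: "T \<in> pkeys (op b v)"
  have "pkeys (op b v) \<subseteq> {T. \<exists>S\<in>pkeys v. deg T = deg S + fst b}"
    unfolding op_def by (rule keys_lin_subset) (use v b deg_act in blast)
  then show ?thesis using T by blast
qed

lemma X_commute: "{u, v} \<in> E \<Longrightarrow> X u (X v m) = X v (X u m)"
proof -
  assume e: "{u, v} \<in> E"
  have val: "valid (cut (\<lambda>_. True) m)" using cut_keys[of "\<lambda>_. True" m] by blast
  have "X i (X j m) = vop (crd 1 (fgen i)) (vop (crd 1 (fgen j)) (cut (\<lambda>_. True) m))" if "i \<in> V" "j \<in> V" for i j
  proof -
    have "X j m \<in> Fil 1" by (rule Xop_Fil(2))
    then have "X i (X j m) = vop (crd 1 (fgen i)) (X j m)" using that Fil_valid by (intro X_valid) auto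
    then show ?thesis using that by (simp add: Xop_def)
  qed
  then show ?thesis using crd_gen_commute[OF e val] edge_V[OF e] by simp
qed

text \<open>On a list whose degree is still below N after one step no truncation takes place; every
  other list is killed by both composites.\<close>

lemma XN_commute: "{u, v} \<in> E \<Longrightarrow> XN N u (XN N v m) = XN N v (XN N u m)"
proof -
  assume e: "{u, v} \<in> E"
  have comm: "XN N u (XN N v (unit_vec S)) = XN N v (XN N u (unit_vec S))" for S
  proof (cases "S \<in> vlist BB \<and> Suc (deg S) < N")
    case True
    have "XN N i (XN N j (unit_vec S)) = vop (crd 1 (fgen i)) (vop (crd 1 (fgen j)) (unit_vec S))"
      if "i \<in> V" "j \<in> V" for i j
    proof -
      have g: "pkeys (crd 1 (fgen j)) \<subseteq> {x \<in> BB. fst x = 1}"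
        using crd_keys[of 1 "fgen j"] Hom_gen that by auto
      have 1: "XN N j (unit_vec S) = vop (crd 1 (fgen j)) (unit_vec S)"
        using that True by (simp add: Xop_def cut_def)
      have "pkeys (vop (crd 1 (fgen j)) (unit_vec S)) \<subseteq> {T \<in> vlist BB. deg T < N}"
        unfolding vop_def
      proof (rule keys_lin_subset)
        fix b assume "b \<in> pkeys (crd 1 (fgen j))"
        then have b: "b \<in> BB" "fst b = 1" using g by auto
        show "pkeys (op b (unit_vec S)) \<subseteq> {T \<in> vlist BB. deg T < N}"
          using op_keys[OF up_closed_B b(1), of "unit_vec S"] deg_op[of "unit_vec S", OF _ b(1)] True b by auto
      qed
      then have "cut (\<lambda>S. deg S < N) (vop (crd 1 (fgen j)) (unit_vec S)) = vop (crd 1 (fgen j)) (unit_vec S)"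
        by (rule cut_ident)
      then show ?thesis using that 1 by (simp add: Xop_def)
    qed
    then show ?thesis using crd_gen_commute[OF e, of "unit_vec S"] edge_V[OF e] True by simp
  next
    case False
    have "XN N i (XN N j (unit_vec S)) = 0" for i j
    proof (cases "S \<in> vlist BB")
      case True
      then have "unit_vec S \<in> Fil (N - 1)" using False by (intro unit_vec_Fil) auto
      then have "XN N j (unit_vec S) \<in> Fil (Suc (N - 1))" by (rule Xop_Fil(1))
      moreover have "Fil (Suc (N - 1)) \<subseteq> Fil N" by (rule Fil.F_mono) simp
      ultimately have "XN N j (unit_vec S) \<in> Fil N" by blast
      then show ?thesis by (rule XN_zero)
    next
      case False
      then have "XN N j (unit_vec S) = 0" using add_map_zero[OF add_map_vop] by (simp add: Xop_def cut_def)
      then show ?thesis using add_map_zero[OF add_map_Xop] by simp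
    qed
    then show ?thesis by simp
  qed
  show ?thesis
    by (rule add_map_eqI[OF add_map_comp[OF add_map_Xop add_map_Xop] add_map_comp[OF add_map_Xop add_map_Xop]]) (rule comm)
qed

lemma phi_X:
  fixes Y :: "'x \<Rightarrow> 'm::char_two \<Rightarrow> 'm"
  assumes Y: "\<And>i. add_map (Y i)" and c: "\<And>u v m. {u, v} \<in> E \<Longrightarrow> Y u (Y v m) = Y v (Y u m)"
    and v: "valid v" and i: "i \<in> V"
  shows "lin (phi Y m) (X i v) = Y i (lin (phi Y m) v)"
  using phi_vop[OF Y c v Hom_gen[OF i]] X_valid[OF v i] by (simp add: fintp_simps[OF Y])

lemma wop_Fil: "v \<in> Fil k \<Longrightarrow> wop (Xop P) w v \<in> Fil k"
  by (induction w) (use Xop_Fil(1) Fil.F_add Fil.F_Suc in \<open>auto, blast\<close>)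

lemma phi_wop:
  fixes Y :: "'x \<Rightarrow> 'm::char_two \<Rightarrow> 'm"
  assumes Y: "\<And>i. add_map (Y i)" and c: "\<And>u v m. {u, v} \<in> E \<Longrightarrow> Y u (Y v m) = Y v (Y u m)"
    and w: "w \<in> lists V"
  shows "lin (phi Y m) (wop X w (unit_vec [])) = wop Y w m"
  using w
proof (induction w)
  case Nil
  then show ?case by (simp add: phi_def)
next
  case (Cons i w)
  have "valid (wop X w (unit_vec []))" using wop_Fil[of "unit_vec []" 0] by (simp add: Fil_0)
  then show ?case using Cons by (simp add: lin_add phi_X[OF Y c])
qed

lemma wop_X_XN: "valid v \<Longrightarrow> wop X w v + wop (XN N) w v \<in> Fil (Suc N)"
proof (induction w)
  case Nil
  then show ?case by (simp add: Fil.F_zero)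
next
  case (Cons i w)
  let ?a = "wop X w v" and ?b = "wop (XN N) w v"
  have ab: "?a + ?b \<in> Fil (Suc N)" using Cons by simp
  have b: "valid ?b" using wop_Fil Cons.prems by (simp flip: Fil_0)
  have "X i (?a + ?b) \<in> Fil (Suc N)" using Xop_Fil(1)[OF ab] Fil.F_Suc by blast
  with ab X_XN[OF b, of i N] have "(?a + ?b) + X i (?a + ?b) + (X i ?b + XN N i ?b) \<in> Fil (Suc N)"
    using Fil.F_add by blast
  then show ?case by (simp add: add_mapD[OF add_map_Xop] add_ac)
qed

text \<open>A filtration exhausting the type, so that the truncated operators are nilpotent on all vectors, including invalid ones.\<close>

definition FilN :: "nat \<Rightarrow> nat \<Rightarrow> ((nat \<times> 'x frl) list \<Rightarrow>\<^sub>0 bit) set" where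
  "FilN N k = (if k = 0 then UNIV else if k \<le> N then Fil k else {0})"

lemma nilpotent_XN: "nilpotent_ops (FilN N) V (XN N) (Suc N)"
proof
  show "0 \<in> FilN N k" for k by (simp add: FilN_def Fil.F_zero)
  show "x + y \<in> FilN N k" if "x \<in> FilN N k" "y \<in> FilN N k" for x y k
    using that Fil.F_add by (auto simp: FilN_def split: if_splits)
  show "FilN N (Suc k) \<subseteq> FilN N k" for k
    using Fil.F_zero Fil.F_Suc[of k] by (auto simp: FilN_def)
  show "finite V" by (rule finite_V)
  show "add_map (XN N i)" for i by (rule add_map_Xop)
  show "FilN N 0 = UNIV" "FilN N (Suc N) = {0}" by (auto simp: FilN_def)
  interpret f: filt "FilN N"
    by standard (use Fil.F_zero Fil.F_add Fil.F_Suc in \<open>auto simp: FilN_def split: if_splits\<close>)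
  show "f.raises 1 (XN N i)" for i
  proof -
    \<comment> \<open>For N = 0 the filtration drops from everything to zero at once; fortunately
      the cut then removes every list.\<close>
    have "XN N i v = 0" if "N = 0" for v
    proof -
      have "cut (\<lambda>S. deg S < N) v = 0" using that by (intro cut_zero) auto
      then show ?thesis using add_map_zero[OF add_map_vop] by (simp add: Xop_def)
    qed
    then show ?thesis
      unfolding f.raises_def FilN_def
      using Xop_Fil(1)[of _ _ "\<lambda>S. deg S < N" i] Xop_Fil(2)[of "\<lambda>S. deg S < N" i] XN_zero[of _ N i] add_map_zero[OF add_map_Xop, of "\<lambda>S. deg S < N" i]
      by (auto simp: not_less_eq_eq Suc_le_eq le_Suc_eq)
  qed
qed

end

section \<open>Lie elements as leading terms of words, and primitivity of leading terms\<close>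

section \<open>Leading terms\<close>

subsection \<open>Tensor products\<close>

definition ten :: "('a \<Rightarrow>\<^sub>0 bit) \<Rightarrow> ('b \<Rightarrow>\<^sub>0 bit) \<Rightarrow> ('a \<times> 'b \<Rightarrow>\<^sub>0 bit)" where
  "ten u v = lin (\<lambda>S. lin (\<lambda>T. unit_vec (S, T)) v) u"

definition tmap :: "(('a \<Rightarrow>\<^sub>0 bit) \<Rightarrow> ('a \<Rightarrow>\<^sub>0 bit)) \<Rightarrow> (('b \<Rightarrow>\<^sub>0 bit) \<Rightarrow> ('b \<Rightarrow>\<^sub>0 bit)) \<Rightarrow>
  ('a \<times> 'b \<Rightarrow>\<^sub>0 bit) \<Rightarrow> ('a \<times> 'b \<Rightarrow>\<^sub>0 bit)" where
  "tmap f g = lin (\<lambda>(S, T). ten (f (unit_vec S)) (g (unit_vec T)))"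

lemma ten_add: "ten (u + u') v = ten u v + ten u' v" "ten u (v + v') = ten u v + ten u v'"
  by (simp_all add: ten_def lin_add lin_plus)

lemma ten_unit_vec: "ten (unit_vec S) (unit_vec T) = unit_vec (S, T)"
  by (simp add: ten_def)

lemma ten_zero [simp]: "ten 0 v = 0" "ten u 0 = 0"
  by (simp_all add: ten_def lin_const_zero)

lemma add_map_tmap: "add_map (tmap f g)"
  unfolding tmap_def by (rule add_map_lin)

lemma add_map_ten: "add_map (\<lambda>u. ten u v)" "add_map (ten u)"
  by (simp_all add: add_map_def ten_add)

lemma tmap_unit_vec: "tmap f g (unit_vec (S, T)) = ten (f (unit_vec S)) (g (unit_vec T))"
  by (simp add: tmap_def)

lemma tmap_ten:
  assumes "add_map f" "add_map g"
  shows "tmap f g (ten u v) = ten (f u) (g v)"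
proof -
  have 1: "tmap f g (ten (unit_vec S) v) = ten (f (unit_vec S)) (g v)" for S
    by (rule add_map_eqI[where p = v and f = "\<lambda>v. tmap f g (ten (unit_vec S) v)"])
      (auto intro!: add_map_comp[OF add_map_tmap add_map_ten(2)] add_map_comp[OF add_map_ten(2) assms(2)] simp: ten_unit_vec tmap_unit_vec)
  show ?thesis
    by (rule add_map_eqI[where p = u and f = "\<lambda>u. tmap f g (ten u v)"])
      (auto intro!: add_map_comp[OF add_map_tmap add_map_ten(1)] add_map_comp[OF add_map_ten(1) assms(1)] simp: 1)
qed

lemma ten_ext:
  fixes f g :: "('a \<times> 'b \<Rightarrow>\<^sub>0 bit) \<Rightarrow> 'w::ab_group_add"
  assumes "add_map f" "add_map g" "\<And>S T. f (ten (unit_vec S) (unit_vec T)) = g (ten (unit_vec S) (unit_vec T))"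
  shows "f p = g p"
proof (rule add_map_eqI[OF assms(1,2)])
  show "f (unit_vec a) = g (unit_vec a)" for a
    using assms(3)[of "fst a" "snd a"] by (simp add: ten_unit_vec)
qed

lemma add_map_lookup: "add_map (\<lambda>p. plookup p k)"
  by (simp add: add_map_def lookup_add)

lemma lookup_lin: "plookup (lin f p) k = lin (\<lambda>a. plookup (f a) k) p"
  for f :: "'a \<Rightarrow> 'b \<Rightarrow>\<^sub>0 bit"
  by (rule lin_comp[OF add_map_lookup])

lemma lookup_eqI: "k \<notin> pkeys (p + q) \<Longrightarrow> plookup p k = plookup q k"
  for p q :: "'a \<Rightarrow>\<^sub>0 'b::char_two"
  by (metis add_eq_zero_iff_char_two lookup_add not_in_keys_iff_lookup_eq_zero)

lemma lin_indicator: "lin (\<lambda>a. if a = k then 1 else 0) p = plookup p k"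
proof -
  have "plookup (lin unit_vec p) k = lin (\<lambda>a. if a = k then 1 else 0) p"
    unfolding lookup_lin by (rule lin_cong) (simp add: lookup_single)
  then show ?thesis by simp
qed

lemma lookup_ten: "plookup (ten u v) (S, T) = plookup u S * plookup v T"
proof -
  have "plookup (ten u v) (S, T) = lin (\<lambda>S'. lin (\<lambda>T'. if S' = S \<and> T' = T then 1 else 0) v) u"
    unfolding ten_def lookup_lin by (intro lin_cong) (simp add: lookup_single)
  also have "\<dots> = lin (\<lambda>S'. (if S' = S then 1 else 0) * plookup v T) u"
  proof (rule lin_cong)
    fix S' show "lin (\<lambda>T'. if S' = S \<and> T' = T then 1 else 0) v = (if S' = S then 1 else 0) * plookup v T"
      using lin_indicator[of T v] by (cases "S' = S") (auto simp: lin_const_zero)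
  qed
  also have "\<dots> = lin (\<lambda>S'. if S' = S then 1 else 0) u * plookup v T"
    by (simp add: lin_def sum_distrib_right)
  finally show ?thesis by (simp add: lin_indicator)
qed

context graph
begin

subsection \<open>Elements of the Lie algebra as operators\<close>

lemma vop_crd_add: "a \<in> Hom n \<Longrightarrow> b \<in> Hom n \<Longrightarrow> vop (crd n (a + b)) v = vop (crd n a) v + vop (crd n b) v"
  by (simp add: crd_plus vop_add)

lemma vop_valid: "a \<in> Hom n \<Longrightarrow> 1 \<le> n \<Longrightarrow> valid v \<Longrightarrow> valid (vop (crd n a) v)"
  using vop_Fil[of v 0 a n] Fil_valid by (simp add: Fil_0)

text \<open>Squaring is not additive, so a sum of basis elements is built up one by one: the cross
  term [x, s] of the square matches the commutator of the operators. Then \<open>a\<close> is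
  replaced by the lift of its coordinates.\<close>

lemma vop_fsq:
  assumes a: "a \<in> Hom n" "1 \<le> n" and v: "valid v"
  shows "vop (crd (2 * n) (fsq a)) v = vop (crd n a) (vop (crd n a) v)"
proof -
  have "sum snd A \<in> Hom n \<and> vop (crd (2 * n) (fsq (sum snd A))) v
      = vop (crd n (sum snd A)) (vop (crd n (sum snd A)) v)"
    if "finite A" "A \<subseteq> {x \<in> BB. fst x = n}" for A
    using that
  proof (induction A rule: finite_induct)
    case empty
    then show ?case by (simp add: crd_zero Hom_zero)
  next
    case (insert x A)
    let ?s = "sum snd A"
    have x: "x \<in> BB" "fst x = n" "snd x \<in> Hom n" "crd n (snd x) = unit_vec x"
      using insert.prems BB_Hom[of n "snd x"] crd_BB[of n "snd x"] by (cases x; auto)+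
    have s: "?s \<in> Hom n" and IH: "vop (crd (2 * n) (fsq ?s)) v = vop (crd n ?s) (vop (crd n ?s) v)"
      using insert by auto
    have sq: "vop (crd (2 * n) (fsq (snd x))) v = vop (crd n (snd x)) (vop (crd n (snd x)) v)"
      using op_square[OF v x(1)] x by (simp add: bsq_def)
    have h: "fsq (snd x) \<in> Hom (2 * n)" "fsq ?s \<in> Hom (2 * n)" "fbr (snd x) ?s \<in> Hom (2 * n)"
      using x s Hom_sq Hom_br[of "snd x" n ?s n] by (auto simp: mult_2)
    have "vop (crd (2 * n) (fsq (snd x + ?s))) v
      = vop (crd (2 * n) (fsq (snd x))) v + vop (crd (2 * n) (fsq ?s)) v + vop (crd (2 * n) (fbr (snd x) ?s)) v"
      using h by (simp add: fsq_plus vop_crd_add Hom_plus)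
    also have "vop (crd (2 * n) (fbr (snd x) ?s)) v
      = vop (crd n (snd x)) (vop (crd n ?s) v) + vop (crd n ?s) (vop (crd n (snd x)) v)"
      using vop_fbr[OF x(3) a(2) s a(2) v] by (simp add: mult_2)
    finally have "vop (crd (2 * n) (fsq (snd x + ?s))) v = vop (crd n (snd x + ?s)) (vop (crd n (snd x + ?s)) v)"
      by (simp add: sq IH vop_crd_add[OF x(3) s] add_mapD[OF add_map_vop] add_ac)
    then show ?case using insert x s by (simp add: Hom_plus)
  qed
  from this[OF finite_keys crd_keys[OF a(2,1)]]
  have b: "val (crd n a) \<in> Hom n" "vop (crd (2 * n) (fsq (val (crd n a)))) v
      = vop (crd n (val (crd n a))) (vop (crd n (val (crd n a))) v)"
    by (auto simp: val_def lin_def)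
  have k: "a + val (crd n a) \<in> KE" by (rule val_crd[OF a(1)])
  have 1: "crd n (val (crd n a)) = crd n a" by (rule crd_val[OF crd_keys[OF a(2,1)]])
  \<comment> \<open>With v the lift and k = a + v in the ideal, a^[2] + v^[2] = k^[2] + [a, k] is in
    the ideal as well.\<close>
  have "crd (2 * n) (fsq a) = crd (2 * n) (fsq (val (crd n a)))"
  proof (rule crd_cong[OF Hom_sq[OF a(1)] Hom_sq[OF b(1)]])
    have "fsq (a + val (crd n a)) + fbr a (a + val (crd n a)) \<in> KE"
      using KE.plus[OF KE.sq[OF k] KE.br[OF subsetD[OF Hom_subset a(1)] k]] .
    moreover have "fsq (a + val (crd n a)) + fbr a (a + val (crd n a)) = fsq a + fsq (val (crd n a))"
      by (simp add: fsq_plus fbr_right add_ac)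
    ultimately show "fsq a + fsq (val (crd n a)) \<in> KE" by simp
  qed
  then show ?thesis using b(2) unfolding 1 by simp
qed

text \<open>Brackets and squares are respected by \<open>vop_fbr\<close> and \<open>vop_fsq\<close>,
  which need positive degrees; a factor of degree 0 represents 0 and is treated apart.\<close>

lemma vop_eq_intp:
  "rl_homogeneous n t \<Longrightarrow> t \<in> rl_terms V \<Longrightarrow> valid v \<Longrightarrow> vop (crd n (abs_frl t)) v = intp X t v"
proof (induction arbitrary: v rule: rl_homogeneous.induct)
  case (1 x)
  then show ?case by (simp add: abs_frl_simps X_valid rl_terms_def)
next
  case (2 n)
  then show ?case by (simp add: abs_frl_simps crd_zero)
next
  case (3 n a b)
  then have "a \<in> rl_terms V" "b \<in> rl_terms V" by (auto simp: rl_terms_def)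
  then show ?case using 3 Hom_abs by (simp add: abs_frl_simps vop_crd_add)
next
  case (4 m a n b)
  have ab: "a \<in> rl_terms V" "b \<in> rl_terms V" using 4 by (auto simp: rl_terms_def)
  note fa = fintp_abs[of X, OF add_map_Xop]
  show ?case
  proof (cases "m = 0 \<or> n = 0")
    case True
    then have "abs_frl a = 0 \<or> abs_frl b = 0" using 4 rl_homogeneous_zero by blast
    then have "abs_frl (RBracket a b) = 0" by (auto simp: abs_frl_simps)
    then show ?thesis using fa[of "RBracket a b" v] by (simp add: crd_zero fintp_simps[of X, OF add_map_Xop])
  next
    case False
    have h: "abs_frl a \<in> Hom m" "abs_frl b \<in> Hom n" using 4 ab Hom_abs by auto
    have "valid (vop (crd m (abs_frl a)) v)" "valid (vop (crd n (abs_frl b)) v)"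
      using vop_valid[OF h(1) _ 4(6)] vop_valid[OF h(2) _ 4(6)] False by auto
    then show ?thesis using False 4 ab h by (simp add: abs_frl_simps vop_fbr)
  qed
next
  case (5 n a)
  have a: "a \<in> rl_terms V" using 5 by (auto simp: rl_terms_def)
  note fa = fintp_abs[of X, OF add_map_Xop]
  show ?case
  proof (cases "n = 0")
    case True
    then have "abs_frl a = 0" using 5 rl_homogeneous_zero by blast
    then have "abs_frl (RSquare a) = 0" by (auto simp: abs_frl_simps)
    then show ?thesis using fa[of "RSquare a" v] by (simp add: crd_zero fintp_simps[of X, OF add_map_Xop])
  next
    case False
    have h: "abs_frl a \<in> Hom n" using 5 a Hom_abs by auto
    have "valid (vop (crd n (abs_frl a)) v)"
      using vop_valid[OF h _ 5(4)] False by auto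
    then show ?thesis using False 5 a h by (simp add: abs_frl_simps vop_fsq)
  qed
qed

lemma fintp_X_BB: "b \<in> BB \<Longrightarrow> valid v \<Longrightarrow> fintp X (snd b) v = op b v"
proof -
  assume b: "b \<in> BB" and v: "valid v"
  then have "snd b \<in> Hom (fst b)" using BB_Hom[of "fst b" "snd b"] by simp
  then obtain t where t: "snd b = abs_frl t" "t \<in> rl_terms V" "rl_homogeneous (fst b) t" by (auto simp: Hom_def)
  have "fintp X (snd b) v = intp X t v" unfolding t(1) by (rule fintp_abs[OF add_map_Xop])
  also have "\<dots> = vop (crd (fst b) (snd b)) v" using vop_eq_intp[OF t(3,2) v] t(1) by simp
  finally show ?thesis using crd_BB[of "fst b" "snd b"] b by simp
qed

subsection \<open>Every homogeneous element is a leading term\<close>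

lemma raises_XN: "Fil.raises 1 (Xop P i)"
  using Xop_Fil(1) by (simp add: Fil.raises_def)

lemma wop_filtered: "Fil.raises 1 (\<lambda>v. v + wop (Xop P) w v)"
proof (induction w)
  case Nil
  then show ?case by (simp add: Fil.raises_zero)
next
  case (Cons i w)
  have r: "Fil.raises 0 (wop (Xop P) w)" using wop_Fil by (simp add: Fil.raises_def)
  have "Fil.raises 1 (\<lambda>v. (v + wop (Xop P) w v) + Xop P i (wop (Xop P) w v))"
    using Fil.raises_comp[OF raises_XN r] by (intro Fil.raises_add Cons) simp
  then show ?case by (simp add: add_ac)
qed

text \<open>Brackets are realized by group commutators, as \<open>u\<inverse> w\<inverse> u w - 1 = u\<inverse> w\<inverse> (u w - w u)\<close>.\<close>

lemma realize_leading_term: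
  "rl_homogeneous n t \<Longrightarrow> t \<in> rl_terms V \<Longrightarrow> \<exists>w\<in>lists V. Fil.raises n (\<lambda>v. v + wop (XN N) w v)
    \<and> Fil.raises (Suc n) (\<lambda>v. v + wop (XN N) w v + intp (XN N) t v)"
proof (induction rule: rl_homogeneous.induct)
  case (1 i)
  then show ?case
    using raises_XN by (intro bexI[of _ "[i]"]) (auto simp: rl_terms_def Fil.raises_zero)
next
  case (2 n)
  then show ?case by (intro bexI[of _ "[]"]) (auto simp: Fil.raises_zero)
next
  case (3 n s t)
  \<comment> \<open>In degree 0 the product (u - 1)(w - 1) below would not be of higher order. The
    term represents 0 there, so the empty word does.\<close>
  show ?case
  proof (cases "n = 0")
    case True
    then have "abs_frl (RPlus s t) = 0" using 3 by (auto simp: abs_frl_simps rl_homogeneous_zero)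
    then have "intp (XN N) (RPlus s t) v = 0" for v
      using fintp_abs[of "XN N", OF add_map_Xop] fintp_simps(1)[of "XN N", OF add_map_Xop] by metis
    then show ?thesis using True by (intro bexI[of _ "[]"]) (auto simp: Fil.raises_zero simp del: intp.simps)
  next
    case False
    obtain u w where u: "u \<in> lists V" "Fil.raises n (\<lambda>v. v + wop (XN N) u v)" "Fil.raises (Suc n) (\<lambda>v. v + wop (XN N) u v + intp (XN N) s v)"
      and w: "w \<in> lists V" "Fil.raises n (\<lambda>v. v + wop (XN N) w v)" "Fil.raises (Suc n) (\<lambda>v. v + wop (XN N) w v + intp (XN N) t v)"
      using 3 by (auto simp: rl_terms_def)
    note wadd = add_mapD[OF add_map_wop[of "XN N", OF add_map_Xop]]
    \<comment> \<open>u w - 1 = (u - 1) + (w - 1) + (u - 1)(w - 1).\<close>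
    have e: "v + wop (XN N) (u @ w) v = (v + wop (XN N) u v) + (v + wop (XN N) w v)
        + ((v + wop (XN N) w v) + wop (XN N) u (v + wop (XN N) w v))" for v
      by (simp add: wop_append wadd add_ac)
    have r: "Fil.raises (n + n) (\<lambda>v. (v + wop (XN N) w v) + wop (XN N) u (v + wop (XN N) w v))"
      by (rule Fil.raises_comp[OF u(2) w(2)])
    have "Fil.raises n (\<lambda>v. v + wop (XN N) (u @ w) v)"
      unfolding e by (intro Fil.raises_add u w Fil.raises_mono[OF r]) simp
    moreover have "Fil.raises (Suc n) (\<lambda>v. (v + wop (XN N) u v + intp (XN N) s v)
        + (v + wop (XN N) w v + intp (XN N) t v) + ((v + wop (XN N) w v) + wop (XN N) u (v + wop (XN N) w v)))"
      using False by (intro Fil.raises_add u w Fil.raises_mono[OF r]) simp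
    then have "Fil.raises (Suc n) (\<lambda>v. v + wop (XN N) (u @ w) v + intp (XN N) (RPlus s t) v)"
      unfolding e by (simp add: add_ac)
    ultimately show ?thesis using u w by (intro bexI[of _ "u @ w"]) auto
  qed
next
  case (4 m s n t)
  obtain u w where u: "u \<in> lists V" "Fil.raises m (\<lambda>v. v + wop (XN N) u v)" "Fil.raises (Suc m) (\<lambda>v. v + wop (XN N) u v + intp (XN N) s v)"
    and w: "w \<in> lists V" "Fil.raises n (\<lambda>v. v + wop (XN N) w v)" "Fil.raises (Suc n) (\<lambda>v. v + wop (XN N) w v + intp (XN N) t v)"
    using 4 by (auto simp: rl_terms_def)
  note wadd = add_mapD[OF add_map_wop[of "XN N", OF add_map_Xop]]
  obtain u' where u': "u' \<in> lists V" "\<And>v. wop (XN N) u' (wop (XN N) u v) = v"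
    using nilpotent_ops.word_inverse[OF nilpotent_XN u(1)] by blast
  obtain w' where w': "w' \<in> lists V" "\<And>v. wop (XN N) w' (wop (XN N) w v) = v"
    using nilpotent_ops.word_inverse[OF nilpotent_XN w(1)] by blast
  define A where "A = (\<lambda>v. v + wop (XN N) u v)"
  define B where "B = (\<lambda>v. v + wop (XN N) w v)"
  define C where "C = (\<lambda>v. A (B v) + B (A v))"
  have ad: "add_map A" "add_map B" unfolding A_def B_def
    using add_map_wop[of "XN N", OF add_map_Xop] by (auto intro!: add_map_plus add_map_ident)
  have adi: "add_map (intp (XN N) r)" for r
    using intp_add[of "XN N", OF add_map_Xop] by (simp add: add_map_def)
  have ri: "Fil.raises m (intp (XN N) s)" "Fil.raises n (intp (XN N) t)"
    using Fil.intp_raises[of "XN N"] raises_XN 4 by auto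
  have "Fil.raises (m + n) (\<lambda>v. B (A v))"
    using Fil.raises_comp[OF w(2) u(2)] by (simp add: A_def B_def add.commute)
  then have rC: "Fil.raises (m + n) C"
    unfolding C_def using Fil.raises_comp[OF u(2) w(2)] by (intro Fil.raises_add) (simp_all add: A_def B_def)
  have "C v = wop (XN N) u (wop (XN N) w v) + wop (XN N) w (wop (XN N) u v)" for v
    by (simp add: C_def A_def B_def wadd add_ac)
  \<comment> \<open>With C = u w - w u, the commutator minus 1 is u' w' C = C + (u' w' - 1) C, whose
    last term is of higher order.\<close>
  then have e: "v + wop (XN N) (u' @ w' @ u @ w) v = C v + (C v + wop (XN N) (u' @ w') (C v))" for v
    by (simp add: wop_append wadd u' w' add_ac)
  have r1: "Fil.raises (1 + (m + n)) (\<lambda>v. C v + wop (XN N) (u' @ w') (C v))"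
    by (rule Fil.raises_comp[OF wop_filtered rC])
  have c1: "Fil.raises (Suc (m + n)) (\<lambda>v. A (B v) + intp (XN N) s (intp (XN N) t v))"
    by (rule Fil.raises_comp_cong[OF adi _ _ ri(1)]) (use u w in \<open>simp_all add: A_def B_def\<close>)
  have "Fil.raises (Suc (n + m)) (\<lambda>v. B (A v) + intp (XN N) t (intp (XN N) s v))"
    by (rule Fil.raises_comp_cong[OF adi _ _ ri(2)]) (use u w in \<open>simp_all add: A_def B_def\<close>)
  from Fil.raises_add[OF c1 this[unfolded add.commute[of n m]]]
  have c3: "Fil.raises (Suc (m + n)) (\<lambda>v. C v + intp (XN N) (RBracket s t) v)"
    by (simp add: C_def add_ac)
  have "Fil.raises (m + n) (\<lambda>v. v + wop (XN N) (u' @ w' @ u @ w) v)"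
    unfolding e by (intro Fil.raises_add rC Fil.raises_mono[OF r1]) simp
  moreover have "Fil.raises (Suc (m + n)) (\<lambda>v. (C v + intp (XN N) (RBracket s t) v) + (C v + wop (XN N) (u' @ w') (C v)))"
    by (intro Fil.raises_add c3 Fil.raises_mono[OF r1]) simp
  then have "Fil.raises (Suc (m + n)) (\<lambda>v. v + wop (XN N) (u' @ w' @ u @ w) v + intp (XN N) (RBracket s t) v)"
    unfolding e by (simp add: add_ac)
  ultimately show ?case using u w u' w' by (intro bexI[of _ "u' @ w' @ u @ w"]) auto
next
  case (5 n s)
  obtain u where u: "u \<in> lists V" "Fil.raises n (\<lambda>v. v + wop (XN N) u v)" "Fil.raises (Suc n) (\<lambda>v. v + wop (XN N) u v + intp (XN N) s v)"
    using 5 by (auto simp: rl_terms_def)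
  note wadd = add_mapD[OF add_map_wop[of "XN N", OF add_map_Xop]]
  define A where "A = (\<lambda>v. v + wop (XN N) u v)"
  have adi: "add_map (intp (XN N) r)" for r
    using intp_add[of "XN N", OF add_map_Xop] by (simp add: add_map_def)
  have ri: "Fil.raises n (intp (XN N) s)"
    using Fil.intp_raises[of "XN N"] raises_XN 5 by auto
  \<comment> \<open>In characteristic two, u u - 1 = (u - 1)(u - 1).\<close>
  have e: "v + wop (XN N) (u @ u) v = A (A v)" for v
    by (simp add: A_def wop_append wadd add_ac)
  have "Fil.raises (n + n) (\<lambda>v. A (A v))"
    unfolding A_def by (rule Fil.raises_comp[OF u(2,2)])
  moreover have "Fil.raises (Suc (n + n)) (\<lambda>v. A (A v) + intp (XN N) s (intp (XN N) s v))"
    by (rule Fil.raises_comp_cong[OF adi _ _ ri]) (use u in \<open>simp_all add: A_def\<close>)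
  ultimately show ?case using u by (intro bexI[of _ "u @ u"]) (auto simp: e mult_2)
qed

lemma intp_XN_Fil: "valid v \<Longrightarrow> intp X t v + intp (XN N) t v \<in> Fil (Suc N)"
proof -
  assume "valid v"
  then have v: "v \<in> Fil 0" by (simp add: Fil_0)
  have X0: "Xop P x v \<in> Fil 0" for P x v
    using Xop_Fil(2)[of P x v] Fil.F_mono[of 0 1] by blast
  from v have "intp (XN N) t v + intp X t v \<in> Fil (Suc N)"
  proof (rule intp_cong_mod[where S = "Fil 0" and A = "Fil (Suc N)", rotated -1])
    show "X x v \<in> Fil (Suc N)" if "v \<in> Fil (Suc N)" for x v
      using Xop_Fil(1)[OF that] Fil.F_Suc by blast
    show "XN N x v + X x v \<in> Fil (Suc N)" if "v \<in> Fil 0" for x v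
      using X_XN[of v x N] that by (simp add: Fil_0 add.commute)
  qed (use X0 Fil.F_zero Fil.F_add add_map_Xop in auto)
  then show ?thesis by (simp add: add.commute)
qed

subsection \<open>Leading terms of group elements are primitive\<close>

definition Fil2 :: "nat \<Rightarrow> ((nat \<times> 'x frl) list \<times> (nat \<times> 'x frl) list \<Rightarrow>\<^sub>0 bit) set" where
  "Fil2 k = {p. pkeys p \<subseteq> {(S, T). S \<in> vlist BB \<and> T \<in> vlist BB \<and> k \<le> deg S + deg T}}"

sublocale Fil2: filt Fil2
proof
  show "x + y \<in> Fil2 k" if "x \<in> Fil2 k" "y \<in> Fil2 k" for x y k
    using that keys_add_subset unfolding Fil2_def by blast
qed (auto simp: Fil2_def)

lemma ten_Fil2: "u \<in> Fil j \<Longrightarrow> v \<in> Fil k \<Longrightarrow> ten u v \<in> Fil2 (j + k)"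
  unfolding ten_def
proof (intro lin_in Fil2.F_zero Fil2.F_add)
  fix S T assume "u \<in> Fil j" "v \<in> Fil k" "S \<in> pkeys u" "T \<in> pkeys v"
  then show "unit_vec (S, T) \<in> Fil2 (j + k)" by (fastforce simp: Fil_def Fil2_def)
qed

lemma tmap_raises:
  assumes f: "Fil.raises m f" and g: "Fil.raises n g"
  shows "Fil2.raises (m + n) (tmap f g)"
  unfolding Fil2.raises_def
proof (intro allI ballI)
  fix k p assume p: "p \<in> Fil2 k"
  show "tmap f g p \<in> Fil2 (k + (m + n))"
    unfolding tmap_def
  proof (intro lin_in Fil2.F_zero Fil2.F_add)
    fix q assume q: "q \<in> pkeys p"
    obtain S T where [simp]: "q = (S, T)" by force
    have "S \<in> vlist BB" "T \<in> vlist BB" and k: "k \<le> deg S + deg T" using p q by (auto simp: Fil2_def)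
    then have "ten (f (unit_vec S)) (g (unit_vec T)) \<in> Fil2 ((deg S + m) + (deg T + n))"
      using f g by (intro ten_Fil2 Fil.raisesD unit_vec_Fil) auto
    then show "(case q of (S, T) \<Rightarrow> ten (f (unit_vec S)) (g (unit_vec T))) \<in> Fil2 (k + (m + n))"
      using k Fil2.F_mono[of "k + (m + n)" "(deg S + m) + (deg T + n)"] by auto
  qed
qed

text \<open>\<open>GL i\<close> extends \<open>(1 + X i) \<otimes> (1 + X i) - 1\<close>: with these operators the action of a word is group-like, and
  up to higher terms they agree with the usual primitive coproduct \<open>PR i\<close>.\<close>

definition GL :: "'x \<Rightarrow> ((nat \<times> 'x frl) list \<times> (nat \<times> 'x frl) list \<Rightarrow>\<^sub>0 bit) \<Rightarrow> ((nat \<times> 'x frl) list \<times> (nat \<times> 'x frl) list \<Rightarrow>\<^sub>0 bit)" where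
  "GL i p = tmap (\<lambda>v. v + X i v) (\<lambda>v. v + X i v) p + p"

definition PR :: "'x \<Rightarrow> ((nat \<times> 'x frl) list \<times> (nat \<times> 'x frl) list \<Rightarrow>\<^sub>0 bit) \<Rightarrow> ((nat \<times> 'x frl) list \<times> (nat \<times> 'x frl) list \<Rightarrow>\<^sub>0 bit)" where
  "PR i p = tmap (X i) (\<lambda>v. v) p + tmap (\<lambda>v. v) (X i) p"

lemma add_map_GL: "add_map (GL i)"
  unfolding GL_def by (intro add_map_plus add_map_tmap add_map_ident)

lemma add_map_PR: "add_map (PR i)"
  unfolding PR_def by (intro add_map_plus add_map_tmap)

lemma add_map_1X: "add_map (\<lambda>v. v + X i v)"
  by (intro add_map_plus add_map_ident add_map_Xop)

lemma GL_ten: "GL i (ten u v) = ten (u + X i u) (v + X i v) + ten u v"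
  by (simp add: GL_def tmap_ten[OF add_map_1X add_map_1X])

lemma PR_ten: "PR i (ten u v) = ten (X i u) v + ten u (X i v)"
  by (simp add: PR_def tmap_ten add_map_Xop add_map_ident)

lemma GL_commute:
  assumes "{i, j} \<in> E"
  shows "GL i (GL j p) = GL j (GL i p)"
proof (rule ten_ext[OF add_map_comp[OF add_map_GL add_map_GL] add_map_comp[OF add_map_GL add_map_GL]])
  show "GL i (GL j (ten (unit_vec S) (unit_vec T))) = GL j (GL i (ten (unit_vec S) (unit_vec T)))" for S T
    using X_commute[OF assms]
    by (simp add: GL_ten add_mapD[OF add_map_GL] add_mapD[OF add_map_Xop] ten_add add_ac)
qed

text \<open>(1 + X) \<otimes> (1 + X) - 1 = X \<otimes> 1 + 1 \<otimes> X + X \<otimes> X. The last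
  term raises the total degree by two, so \<open>GL\<close> and \<open>PR\<close> have the same
  leading part.\<close>

lemma GL_PR: "GL i p + PR i p = tmap (X i) (X i) p"
proof (rule ten_ext[where f = "\<lambda>p. GL i p + PR i p"])
  show "add_map (\<lambda>p. GL i p + PR i p)" by (intro add_map_plus add_map_GL add_map_PR)
  show "add_map (tmap (X i) (X i))" by (rule add_map_tmap)
  show "GL i (ten (unit_vec S) (unit_vec T)) + PR i (ten (unit_vec S) (unit_vec T))
      = tmap (X i) (X i) (ten (unit_vec S) (unit_vec T))" for S T
    by (simp add: GL_ten PR_ten tmap_ten add_map_Xop ten_add add_ac)
qed

lemma raises_PR: "Fil2.raises 1 (PR i)"
proof -
  have "Fil2.raises (1 + 0) (tmap (X i) (\<lambda>v. v))" "Fil2.raises (0 + 1) (tmap (\<lambda>v. v) (X i))"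
    by (intro tmap_raises raises_XN Fil.raises_ident)+
  then have "Fil2.raises 1 (\<lambda>p. tmap (X i) (\<lambda>v. v) p + tmap (\<lambda>v. v) (X i) p)"
    by (intro Fil2.raises_add) simp_all
  then show ?thesis by (simp add: PR_def[abs_def])
qed

lemma raises_GL_PR: "Fil2.raises 2 (\<lambda>p. GL i p + PR i p)"
  unfolding GL_PR using tmap_raises[OF raises_XN raises_XN, of "\<lambda>_. True" i "\<lambda>_. True" i]
  by (simp add: numeral_2_eq_2)

lemma raises_GL: "Fil2.raises 1 (GL i)"
  by (rule Fil2.raises_sum_cancel[OF Fil2.raises_mono[OF raises_GL_PR] raises_PR]) simp

text \<open>Operators of the form A \<otimes> 1 + 1 \<otimes> A are closed under commutators and, in
  characteristic two, under squares: every Lie element is primitive.\<close>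

lemma intp_PR_ten: "intp PR t (ten u v) = ten (intp X t u) v + ten u (intp X t v)"
proof (induction t arbitrary: u v)
  case (RGen x)
  then show ?case by (simp add: PR_ten)
qed (simp_all add: ten_add add_ac intp_add[of PR, OF add_map_PR])

lemma fintp_PR_ten: "fintp PR a (ten u v) = ten (fintp X a u) v + ten u (fintp X a v)"
  unfolding fintp_def by (rule intp_PR_ten)

text \<open>\<open>shuf S\<close> is the coproduct of the basis element \<open>S\<close>.\<close>

primrec shuf :: "(nat \<times> 'x frl) list \<Rightarrow> ((nat \<times> 'x frl) list \<times> (nat \<times> 'x frl) list \<Rightarrow>\<^sub>0 bit)" where
  "shuf [] = unit_vec ([], [])"
| "shuf (b # S) = lin (\<lambda>(A, B). unit_vec (b # A, B) + unit_vec (A, b # B)) (shuf S)"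

lemma shuf_keys:
  "S \<in> vlist D \<Longrightarrow> pkeys (shuf S)
     \<subseteq> {(A, B). A \<in> vlist D \<and> B \<in> vlist D \<and> deg A + deg B = deg S \<and> set A \<union> set B = set S}"
proof (induction S arbitrary: D)
  case Nil
  then show ?case by simp
next
  case (Cons b S)
  have b: "b \<in> D" and S: "S \<in> vlist (D \<inter> {x. ltB b x})" using Cons.prems by (auto simp: Cons_vlist)
  show ?case
    unfolding shuf.simps
  proof (rule keys_lin_subset)
    fix q assume q: "q \<in> pkeys (shuf S)"
    obtain A B where [simp]: "q = (A, B)" by force
    have AB: "A \<in> vlist (D \<inter> {x. ltB b x})" "B \<in> vlist (D \<inter> {x. ltB b x})" "deg A + deg B = deg S" "set A \<union> set B = set S"
      using Cons.IH[OF S] q by auto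
    have "A \<in> vlist D" "B \<in> vlist D" using AB vlist_mono[of "D \<inter> {x. ltB b x}" D] by auto
    then have "(b # A, B) \<in> {(A, B). A \<in> vlist D \<and> B \<in> vlist D \<and> deg A + deg B = deg (b # S) \<and> set A \<union> set B = set (b # S)}"
      "(A, b # B) \<in> {(A, B). A \<in> vlist D \<and> B \<in> vlist D \<and> deg A + deg B = deg (b # S) \<and> set A \<union> set B = set (b # S)}"
      using AB b by (auto simp: Cons_vlist)
    then show "pkeys (case q of (A, B) \<Rightarrow> unit_vec (b # A, B) + unit_vec (A, b # B))
      \<subseteq> {(A, B). A \<in> vlist D \<and> B \<in> vlist D \<and> deg A + deg B = deg (b # S) \<and> set A \<union> set B = set (b # S)}"
      unfolding \<open>q = (A, B)\<close> prod.case by (intro keys_add_subset) auto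
  qed
qed

text \<open>All lists in the coproduct of S lie above b, so b acts on either tensor factor by
  prefixing.\<close>

lemma shuf_Cons:
  assumes S: "b # S \<in> vlist BB"
  shows "fintp PR (snd b) (shuf S) = shuf (b # S)"
proof -
  have b: "b \<in> BB" and S: "S \<in> vlist (above b)" using S by (auto simp: vlist_def above_def)
  have "fintp PR (snd b) (shuf S) = lin (\<lambda>q. fintp PR (snd b) (unit_vec q)) (shuf S)"
    by (rule add_map_eq_lin[OF add_map_fintp(1)[OF add_map_PR]])
  also have "\<dots> = shuf (b # S)"
    unfolding shuf.simps
  proof (rule lin_cong)
    fix q assume q: "q \<in> pkeys (shuf S)"
    obtain A B where [simp]: "q = (A, B)" by force
    have AB: "A \<in> vlist (above b)" "B \<in> vlist (above b)" using shuf_keys[OF S] q by auto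
    have o: "fintp X (snd b) (unit_vec A) = unit_vec (b # A)" if "A \<in> vlist (above b)" for A
    proof -
      have "A \<in> vlist BB" using that vlist_mono[OF above_subset] by blast
      then have "fintp X (snd b) (unit_vec A) = op b (unit_vec A)" using b by (intro fintp_X_BB) auto
      also have "\<dots> = cns b (unit_vec A)" using that by (intro op_eq_cns) auto
      finally show ?thesis by (simp add: cns_def)
    qed
    show "fintp PR (snd b) (unit_vec q) = (case q of (A, B) \<Rightarrow> unit_vec (b # A, B) + unit_vec (A, b # B))"
      using fintp_PR_ten[of "snd b" "unit_vec A" "unit_vec B"] o AB by (simp add: ten_unit_vec)
  qed
  finally show ?thesis .
qed

text \<open>Along S the operators of \<open>GL\<close> may be replaced by those of
  \<open>PR\<close>, each time at the cost of terms of higher degree. The product of the latter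
  applied to [] \<otimes> [] is the coproduct \<open>shuf S\<close>.\<close>

lemma phi_shuf:
  "S \<in> vlist BB \<Longrightarrow> phi GL (unit_vec ([], [])) S + shuf S \<in> Fil2 (Suc (deg S)) \<and> shuf S \<in> Fil2 (deg S)"
proof (induction S)
  case Nil
  then show ?case by (simp add: phi_def Fil2.F_zero Fil2_def)
next
  case (Cons b S)
  have b: "b \<in> BB" and SB: "S \<in> vlist BB" using Cons.prems by (auto simp: vlist_def)
  note IH = Cons.IH[OF SB]
  let ?p = "phi GL (unit_vec ([], [])) S"
  have "snd b \<in> Hom (fst b)" using BB_Hom[of "fst b" "snd b"] b by simp
  then obtain t where t: "snd b = abs_frl t" "rl_homogeneous (fst b) t" by (auto simp: Hom_def)
  have f: "fintp Y (snd b) = intp Y t" if "\<And>i. add_map (Y i)" for Y :: "'x \<Rightarrow> 'm::char_two \<Rightarrow> 'm"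
    unfolding t(1) using fintp_abs[of Y, OF that] by (intro ext) simp
  have r: "Fil2.raises (Suc (fst b)) (\<lambda>p. fintp GL (snd b) p + fintp PR (snd b) p)"
    using Fil2.intp_raises_cong[of GL PR, OF raises_GL raises_PR raises_GL_PR add_map_PR t(2)]
    by (simp add: f add_map_GL add_map_PR)
  have r2: "Fil2.raises (fst b) (fintp GL (snd b))"
    using Fil2.intp_raises[of GL, OF raises_GL t(2)] by (simp add: f add_map_GL)
  have "fintp GL (snd b) (?p + shuf S) \<in> Fil2 (Suc (deg S) + fst b)"
    using Fil2.raisesD[OF r2] IH by blast
  moreover have "fintp GL (snd b) (shuf S) + fintp PR (snd b) (shuf S) \<in> Fil2 (deg S + Suc (fst b))"
    using Fil2.raisesD[OF r] IH by blast
  ultimately have "fintp GL (snd b) (?p + shuf S) + (fintp GL (snd b) (shuf S) + fintp PR (snd b) (shuf S)) \<in> Fil2 (Suc (deg (b # S)))"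
    by (rule_tac Fil2.F_add) (simp_all add: add_ac)
  then have "fintp GL (snd b) ?p + shuf (b # S) \<in> Fil2 (Suc (deg (b # S)))"
    by (simp add: add_mapD[OF add_map_fintp(1)[OF add_map_GL]] shuf_Cons[OF Cons.prems] add_ac del: shuf.simps)
  moreover have "phi GL (unit_vec ([], [])) (b # S) = fintp GL (snd b) ?p" by (simp add: phi_def)
  moreover have "shuf (b # S) \<in> Fil2 (deg (b # S))"
    using shuf_keys[OF Cons.prems] by (auto simp: Fil2_def simp del: shuf.simps)
  ultimately show ?case by (simp del: shuf.simps)
qed

lemma lookup_shuf_Nil: "plookup (shuf S) ([], S) = 1"
proof (induction S)
  case (Cons b S)
  have "plookup (shuf (b # S)) ([], b # S) = lin (\<lambda>q. if q = ([], S) then 1 else 0) (shuf S)"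
    unfolding shuf.simps lookup_lin
    by (rule lin_cong) (auto simp: lookup_add lookup_single split: prod.splits)
  then show ?case using Cons by (simp add: lin_indicator)
qed simp

text \<open>As s does not occur in S, the pair ([s], S) arises in one way only: s goes to the left
  and all the rest to the right.\<close>

lemma lookup_shuf_Cons:
  assumes "s # S \<in> vlist BB"
  shows "plookup (shuf (s # S)) ([s], S) = 1"
proof -
  have "\<forall>x\<in>set S. ltB s x" using assms by (auto simp: vlist_def)
  then have "s \<notin> set S" using lt_irrefl by blast
  then have "s # B \<noteq> S" for B by auto
  then have "plookup (shuf (s # S)) ([s], S) = lin (\<lambda>q. if q = ([], S) then 1 else 0) (shuf S)"
    unfolding shuf.simps lookup_lin
    by (intro lin_cong) (auto simp: lookup_add lookup_single split: prod.splits)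
  then show ?thesis using lookup_shuf_Nil by (simp add: lin_indicator)
qed

lemma vlist_eqI: "S \<in> vlist D \<Longrightarrow> T \<in> vlist D' \<Longrightarrow> set S = set T \<Longrightarrow> S = T"
proof (induction S arbitrary: T D D')
  case Nil
  then show ?case by simp
next
  case (Cons s S)
  then obtain t T' where T: "T = t # T'" by (cases T) auto
  have s: "\<forall>x\<in>set S. ltB s x" and S: "S \<in> vlist D" using Cons.prems(1) by (auto simp: vlist_def)
  have t: "\<forall>x\<in>set T'. ltB t x" and T': "T' \<in> vlist D'" using Cons.prems(2) T by (auto simp: vlist_def)
  have "s = t"
  proof (rule ccontr)
    assume "s \<noteq> t"
    then have "s \<in> set T'" "t \<in> set S" using Cons.prems(3) T by auto
    then have "ltB s t" "ltB t s" using s t by auto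
    then show False using lt_trans lt_irrefl by blast
  qed
  moreover have "s \<notin> set S" "t \<notin> set T'" using s t lt_irrefl by blast+
  then have "set S = set T'" using Cons.prems(3) T \<open>s = t\<close> by auto
  ultimately show ?case using Cons.IH[OF S T'] T by simp
qed

lemma wop_GL_ten: "wop GL w (ten u v) = ten (wop X w u) (wop X w v)"
  by (induction w) (auto simp: GL_ten)

lemma deg_pos: "S \<in> vlist BB \<Longrightarrow> S \<noteq> [] \<Longrightarrow> 0 < deg S"
  by (cases S) (auto simp: vlist_def BB_def)

text \<open>If \<open>s # S'\<close> with \<open>S' \<noteq> []\<close> occurred in the leading term, then \<open>[s] \<otimes> S'\<close> would occur in its coproduct, as
  no other basis element has this term in its coproduct; but the leading term of a group-like element is primitive.\<close>

lemma leading_term_primitive: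
  assumes w: "w \<in> lists V" and u: "unit_vec [] + wop X w (unit_vec []) \<in> Fil n" and n: "1 \<le> n"
    and S: "S \<in> pkeys (unit_vec [] + wop X w (unit_vec []))" "deg S = n"
  shows "\<exists>b\<in>BB. S = [b]"
proof -
  define u where "u = unit_vec [] + wop X w (unit_vec [])"
  have un: "u \<in> Fil n" using assms by (simp add: u_def)
  have SB: "S \<in> vlist BB" using un S by (auto simp: u_def Fil_def)
  obtain s S' where s: "S = s # S'" using n S by (cases S) auto
  have sB: "s \<in> BB" "S' \<in> vlist BB" using SB s by (auto simp: vlist_def)
  have "S' = []"
  proof (rule ccontr)
    assume ne: "S' \<noteq> []"
    then have d: "deg [s] < n" using deg_pos[OF sB(2)] S s by auto
    let ?e = "unit_vec ([], []) :: ((nat \<times> 'x frl) list \<times> (nat \<times> 'x frl) list \<Rightarrow>\<^sub>0 bit)"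
    let ?q = "([s], S')"
    \<comment> \<open>The module map into the tensor square that sends [] to [] \<otimes> []. On w
      [] it can be computed by the action of w through \<open>GL\<close>, which gives w [] \<otimes>
      w [].\<close>
    have "lin (phi GL ?e) (wop X w (unit_vec [])) = wop GL w ?e"
      by (rule phi_wop[OF add_map_GL GL_commute w])
    also have "\<dots> = ten (wop X w (unit_vec [])) (wop X w (unit_vec []))"
      using wop_GL_ten[of w "unit_vec []" "unit_vec []"] by (simp add: ten_unit_vec)
    also have "wop X w (unit_vec []) = u + unit_vec []" by (simp add: u_def add_ac)
    finally have "lin (phi GL ?e) (u + unit_vec []) = ten (u + unit_vec []) (u + unit_vec [])" .
    then have "lin (phi GL ?e) u + ?e = ten u u + ten u (unit_vec []) + ten (unit_vec []) u + ?e"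
      by (simp add: lin_add phi_def ten_add ten_unit_vec add_ac)
    then have "lin (phi GL ?e) u = ten u u + ten u (unit_vec []) + ten (unit_vec []) u" by simp
    \<comment> \<open>The coefficient of [s] \<otimes> S' in \<open>ten u u\<close> has the factor
      u([s]), which is zero since [s] has degree below n. The other two terms have [] as a
      factor.\<close>
    moreover have "plookup u [s] = 0"
      using un d by (auto simp: Fil_def in_keys_iff)
    ultimately have 0: "plookup (lin (phi GL ?e) u) ?q = 0"
      using ne by (simp add: lookup_add lookup_ten lookup_single)
    have "plookup (lin (phi GL ?e) u) ?q = lin (\<lambda>T. if T = S then 1 else 0) u"
      unfolding lookup_lin
    proof (rule lin_cong)
      fix T assume "T \<in> pkeys u"
      then have T: "T \<in> vlist BB" "n \<le> deg T" using un by (auto simp: Fil_def)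
      \<comment> \<open>The pair has total degree n, whereas the two coproducts of T differ only in
        degrees above deg T, hence above n.\<close>
      have "?q \<notin> pkeys (phi GL ?e T + shuf T)"
        using phi_shuf[OF T(1)] T(2) S s by (auto simp: Fil2_def)
      then have "plookup (phi GL ?e T) ?q = plookup (shuf T) ?q"
        by (rule lookup_eqI)
      also have "\<dots> = (if T = S then 1 else 0)"
      proof (cases "T = S")
        case True
        then show ?thesis using lookup_shuf_Cons[of s S'] SB s by simp
      next
        case False
        have "?q \<notin> pkeys (shuf T)"
        proof
          assume "?q \<in> pkeys (shuf T)"
          then have "?q \<in> {(A, B). A \<in> vlist BB \<and> B \<in> vlist BB \<and> deg A + deg B = deg T \<and> set A \<union> set B = set T}"
            using shuf_keys[OF T(1)] by (rule rev_subsetD)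
          then have "set T = set S" using s by auto
          then show False using vlist_eqI[OF T(1) SB] False by simp
        qed
        then show ?thesis using False by (simp add: in_keys_iff)
      qed
      finally show "plookup (phi GL ?e T) ?q = (if T = S then 1 else 0)" .
    qed
    also have "\<dots> = 1" using S by (simp add: lin_indicator u_def in_keys_iff)
    finally show False using 0 by simp
  qed
  then show ?thesis using s sB by blast
qed

lemma leading_term_primitive_XN:
  assumes w: "w \<in> lists V" and u: "unit_vec [] + wop (XN N) w (unit_vec []) \<in> Fil n" and n: "1 \<le> n" "n \<le> N"
    and S: "S \<in> pkeys (unit_vec [] + wop (XN N) w (unit_vec []))" "deg S = n"
  shows "\<exists>b\<in>BB. S = [b]"
proof (rule leading_term_primitive[OF w _ n(1) _ S(2)])
  have e: "wop X w (unit_vec []) + wop (XN N) w (unit_vec []) \<in> Fil (Suc N)"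
    by (rule wop_X_XN) simp
  then have "wop X w (unit_vec []) + wop (XN N) w (unit_vec []) \<in> Fil n"
    using Fil.F_mono[of n "Suc N"] n by auto
  from Fil.F_add[OF u this] show "unit_vec [] + wop X w (unit_vec []) \<in> Fil n" by (simp add: add_ac)
  have "S \<notin> pkeys (wop X w (unit_vec []) + wop (XN N) w (unit_vec []))"
    using e S n by (auto simp: Fil_def)
  then have "plookup (wop X w (unit_vec [])) S = plookup (wop (XN N) w (unit_vec [])) S"
    by (rule lookup_eqI)
  then show "S \<in> pkeys (unit_vec [] + wop X w (unit_vec []))"
    using S(1) by (simp add: in_keys_iff lookup_add)
qed

end

section \<open>Normal form model of the free group and neighbourhoods in the completion\<close>

section \<open>Free groups and pro-2 completions\<close>

subsection \<open>The free group\<close>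

lemma letter_inv_letter_inv [simp]: "letter_inv (letter_inv a) = a"
  by (simp add: letter_inv_def)

lemma reduced_word_Nil [simp]: "reduced_word []"
  by (simp add: reduced_word_def)

lemma reduced_word_Cons: "reduced_word (a # w) \<longleftrightarrow> reduced_word w \<and> (w = [] \<or> hd w \<noteq> letter_inv a)"
  by (auto simp: reduced_word_def successively_Cons)

lemma reduced_cons_reduce: "reduced_word w \<Longrightarrow> reduced_word (cons_reduce a w)"
  by (auto simp: cons_reduce_def reduced_word_Cons split: list.splits)

lemma cons_reduce_cancel: "reduced_word w \<Longrightarrow> cons_reduce (letter_inv a) (cons_reduce a w) = w"
  by (cases w) (auto simp: cons_reduce_def reduced_word_Cons split: list.splits)

lemma cons_reduce_cancel': "reduced_word w \<Longrightarrow> cons_reduce a (cons_reduce (letter_inv a) w) = w"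
  using cons_reduce_cancel[of w "letter_inv a"] by simp

lemma reduced_foldr: "reduced_word w \<Longrightarrow> reduced_word (foldr cons_reduce u w)"
  by (induction u) (auto intro: reduced_cons_reduce)

lemma cons_reduce_eq: "reduced_word (a # w) \<Longrightarrow> cons_reduce a w = a # w"
  by (auto simp: cons_reduce_def reduced_word_Cons split: list.splits)

lemma cons_reduce_simps [simp]:
  "cons_reduce a [] = [a]" "cons_reduce a (letter_inv a # v) = v"
  "b \<noteq> letter_inv a \<Longrightarrow> cons_reduce a (b # v) = a # b # v"
  by (simp_all add: cons_reduce_def)

text \<open>A letter and its inverse act on reduced words by mutually inverse permutations, so it
  does not matter whether a cancellation in the left factor is carried out before or after
  multiplying. Associativity follows.\<close>

lemma foldr_cons_reduce:
  assumes "reduced_word w"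
  shows "foldr cons_reduce (cons_reduce a v) w = cons_reduce a (foldr cons_reduce v w)"
proof (cases v)
  case (Cons b v')
  then show ?thesis
    using cons_reduce_cancel'[OF reduced_foldr[OF assms], of a v'] by (cases "b = letter_inv a") simp_all
qed simp

lemma foldr_cons_reduce_assoc:
  "reduced_word w \<Longrightarrow> foldr cons_reduce (foldr cons_reduce u v) w = foldr cons_reduce u (foldr cons_reduce v w)"
  by (induction u) (auto simp: foldr_cons_reduce)

lemma foldr_cons_reduce_inverse:
  "reduced_word u \<Longrightarrow> foldr cons_reduce (rev (map letter_inv u)) u = []"
  by (induction u) (auto simp: reduced_word_Cons cons_reduce_def)

lemma cons_reduce_lists: "a \<in> A \<Longrightarrow> w \<in> lists A \<Longrightarrow> cons_reduce a w \<in> lists A"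
  by (auto simp: cons_reduce_def split: list.splits)

lemma foldr_cons_reduce_lists: "u \<in> lists A \<Longrightarrow> w \<in> lists A \<Longrightarrow> foldr cons_reduce u w \<in> lists A"
  by (induction u) (simp_all add: cons_reduce_lists del: in_lists_conv_set)

lemma group_free_group: "group (free_group S)"
proof (rule groupI)
  show "\<one>\<^bsub>free_group S\<^esub> \<in> carrier (free_group S)" by (simp add: free_group_def)
  fix u v w assume u: "u \<in> carrier (free_group S)" and v: "v \<in> carrier (free_group S)"
  show "u \<otimes>\<^bsub>free_group S\<^esub> v \<in> carrier (free_group S)"
    using u v foldr_cons_reduce_lists[of u "S \<times> UNIV" v] by (simp add: free_group_def reduced_foldr)
  assume w: "w \<in> carrier (free_group S)"
  show "u \<otimes>\<^bsub>free_group S\<^esub> v \<otimes>\<^bsub>free_group S\<^esub> w = u \<otimes>\<^bsub>free_group S\<^esub> (v \<otimes>\<^bsub>free_group S\<^esub> w)"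
    using w by (simp add: free_group_def foldr_cons_reduce_assoc)
next
  fix u assume u: "u \<in> carrier (free_group S)"
  show "\<one>\<^bsub>free_group S\<^esub> \<otimes>\<^bsub>free_group S\<^esub> u = u" by (simp add: free_group_def)
  let ?v = "foldr cons_reduce (rev (map letter_inv u)) []"
  have r: "reduced_word u" "u \<in> lists (S \<times> UNIV)" using u by (auto simp: free_group_def)
  have "rev (map letter_inv u) \<in> lists (S \<times> UNIV)" using r(2) by (fastforce simp: letter_inv_def)
  then have "?v \<in> carrier (free_group S)"
    using foldr_cons_reduce_lists[of _ "S \<times> UNIV" "[]"] reduced_foldr[of "[]"] by (simp add: free_group_def)
  moreover have "?v \<otimes>\<^bsub>free_group S\<^esub> u = \<one>\<^bsub>free_group S\<^esub>"
    using foldr_cons_reduce_assoc[OF r(1), of "rev (map letter_inv u)" "[]"] foldr_cons_reduce_inverse[OF r(1)]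
    by (simp add: free_group_def)
  ultimately show "\<exists>v\<in>carrier (free_group S). v \<otimes>\<^bsub>free_group S\<^esub> u = \<one>\<^bsub>free_group S\<^esub>" by blast
qed

lemma free_group_gen: "x \<in> S \<Longrightarrow> [(x, b)] \<in> carrier (free_group S)"
  by (simp add: free_group_def reduced_word_Cons)

lemma free_group_inv_gen: "x \<in> S \<Longrightarrow> [(x, False)] = inv\<^bsub>free_group S\<^esub> [(x, True)]"
  by (rule group.inv_equality[OF group_free_group, symmetric])
    (auto simp: free_group_gen, simp add: free_group_def cons_reduce_def letter_inv_def)

lemma free_group_induct [consumes 1, case_names Nil Cons]:
  assumes "g \<in> carrier (free_group S)" "P []"
    "\<And>x b g. x \<in> S \<Longrightarrow> g \<in> carrier (free_group S) \<Longrightarrow> P g \<Longrightarrow> P ([(x, b)] \<otimes>\<^bsub>free_group S\<^esub> g)"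
  shows "P g"
  using assms(1)
proof (induction g)
  case Nil
  show ?case by (rule assms(2))
next
  case (Cons a g)
  obtain x b where a: "a = (x, b)" by force
  have g: "g \<in> carrier (free_group S)" and x: "x \<in> S" and r: "reduced_word (a # g)"
    using Cons.prems a by (auto simp: free_group_def reduced_word_Cons)
  have "[(x, b)] \<otimes>\<^bsub>free_group S\<^esub> g = a # g"
    using cons_reduce_eq[OF r] a by (simp add: free_group_def)
  then show ?case using assms(3)[OF x g Cons.IH[OF g], of b] by simp
qed

definition free_lift :: "('q, 'm) monoid_scheme \<Rightarrow> ('x \<Rightarrow> 'q) \<Rightarrow> ('x \<times> bool) list \<Rightarrow> 'q" where
  "free_lift Q f w = foldr (\<lambda>a q. (if snd a then f (fst a) else inv\<^bsub>Q\<^esub> (f (fst a))) \<otimes>\<^bsub>Q\<^esub> q) w \<one>\<^bsub>Q\<^esub>"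

lemma free_lift_hom:
  assumes "group Q" and f: "\<And>x. x \<in> S \<Longrightarrow> f x \<in> carrier Q"
  shows "free_lift Q f \<in> hom (free_group S) Q" "\<And>x. x \<in> S \<Longrightarrow> free_lift Q f [(x, True)] = f x"
proof -
  interpret Q: group Q by fact
  define L where "L = (\<lambda>a. if snd a then f (fst a) else inv\<^bsub>Q\<^esub> (f (fst a)))"
  have L: "L a \<in> carrier Q" if "a \<in> S \<times> UNIV" for a using f that by (auto simp: L_def)
  have Linv: "L (letter_inv a) = inv\<^bsub>Q\<^esub> (L a)" if "a \<in> S \<times> UNIV" for a
    using f that by (auto simp: L_def letter_inv_def)
  have lN: "free_lift Q f [] = \<one>\<^bsub>Q\<^esub>" and lC: "free_lift Q f (a # w) = L a \<otimes>\<^bsub>Q\<^esub> free_lift Q f w" for a w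
    by (simp_all add: free_lift_def L_def)
  have c: "free_lift Q f w \<in> carrier Q" if "w \<in> lists (S \<times> UNIV)" for w
    using that by (induction w) (auto simp: lN lC L)
  have cr: "free_lift Q f (cons_reduce a w) = L a \<otimes>\<^bsub>Q\<^esub> free_lift Q f w"
    if a: "a \<in> S \<times> UNIV" and w: "w \<in> lists (S \<times> UNIV)" for a w
  proof (cases "\<exists>v. w = letter_inv a # v")
    case True
    then obtain v where v: "w = letter_inv a # v" by blast
    then have "L a \<otimes>\<^bsub>Q\<^esub> free_lift Q f w = free_lift Q f v"
      using L[OF a] Linv[OF a] c[of v] w by (simp add: lC flip: Q.m_assoc)
    then show ?thesis using v by (simp add: cons_reduce_def)
  next
    case False
    then have "cons_reduce a w = a # w" by (auto simp: cons_reduce_def split: list.splits)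
    then show ?thesis by (simp add: lC)
  qed
  have m: "free_lift Q f (foldr cons_reduce u w) = free_lift Q f u \<otimes>\<^bsub>Q\<^esub> free_lift Q f w"
    if "u \<in> lists (S \<times> UNIV)" "w \<in> lists (S \<times> UNIV)" for u w
    using that(1)
  proof (induction u)
    case Nil
    then show ?case using c that by (simp add: lN)
  next
    case (Cons a u)
    then show ?case using that c cr L foldr_cons_reduce_lists[of u "S \<times> UNIV" w] by (simp add: lC Q.m_assoc)
  qed
  show "free_lift Q f \<in> hom (free_group S) Q"
    by (rule homI) (use c m in \<open>auto simp: free_group_def\<close>)
  show "free_lift Q f [(x, True)] = f x" if "x \<in> S" for x
    using f that by (simp add: lN lC L_def)
qed

subsection \<open>Normal subgroups of 2-power index\<close>

lemma (in normal) coset_eq_iff: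
  "x \<in> carrier G \<Longrightarrow> y \<in> carrier G \<Longrightarrow> H #> x = H #> y \<longleftrightarrow> x \<otimes> inv y \<in> H"
proof
  assume xy: "x \<in> carrier G" "y \<in> carrier G" "H #> x = H #> y"
  then have "x \<in> H #> y" using rcos_self[OF _ subgroup_axioms] by blast
  then obtain h where "h \<in> H" "x = h \<otimes> y" by (auto simp: r_coset_def)
  then show "x \<otimes> inv y \<in> H" using xy by (simp add: m_assoc subset[THEN subsetD])
next
  assume xy: "x \<in> carrier G" "y \<in> carrier G" "x \<otimes> inv y \<in> H"
  then have "x = (x \<otimes> inv y) \<otimes> y" by (simp add: m_assoc)
  then have "x \<in> H #> y" unfolding r_coset_def using xy(3) by blast
  then show "H #> x = H #> y" using repr_independence[OF _ xy(2) subgroup_axioms] by simp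
qed

lemma (in normal) coset_eq_self_iff: "x \<in> carrier G \<Longrightarrow> H #> x = H \<longleftrightarrow> x \<in> H"
  using coset_join1[OF _ _ subgroup_axioms] coset_join2[OF _ subgroup_axioms] by blast

lemma kernel_two_power_normal:
  assumes h: "h \<in> hom G Q" and G: "group G" and Q: "group Q" "card (carrier Q) = 2 ^ k"
  shows "kernel G Q h \<in> two_power_normal G"
proof -
  interpret h: group_hom G Q h using assms by (simp add: group_hom_def group_hom_axioms_def)
  have fin: "finite (carrier Q)" using Q(2) by (intro card_ge_0_finite) simp
  have sub: "subgroup (h ` carrier G) Q" by (rule h.img_is_subgroup)
  then have "card (h ` carrier G) dvd 2 ^ k"
    using h.H.lagrange[OF sub] Q by (metis dvd_triv_right order_def)
  then obtain j where j: "card (h ` carrier G) = 2 ^ j"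
    using divides_primepow_nat[OF two_is_prime_nat] by blast
  have "(\<lambda>X. the_elem (h ` X)) ` carrier (G Mod kernel G Q h) = h ` carrier G"
  proof -
    have "the_elem (h ` (kernel G Q h #>\<^bsub>G\<^esub> g)) = h g" if "g \<in> carrier G" for g
    proof -
      have "h ` (kernel G Q h #>\<^bsub>G\<^esub> g) = {h g}"
        using that by (auto simp: kernel_def r_coset_def intro!: imageI)
      then show ?thesis by simp
    qed
    then show ?thesis by (auto simp: carrier_FactGroup image_image)
  qed
  then have "card (carrier (G Mod kernel G Q h)) = 2 ^ j"
    using card_image[OF h.FactGroup_inj_on] j by simp
  then show ?thesis using h.normal_kernel by (auto simp: two_power_normal_def)
qed

context group
begin

lemma two_power_normalD: "N \<in> two_power_normal G \<Longrightarrow> N \<lhd> G" "N \<in> two_power_normal G \<Longrightarrow> finite (carrier (G Mod N))"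
proof -
  assume "N \<in> two_power_normal G"
  then obtain k where k: "N \<lhd> G" "card (carrier (G Mod N)) = 2 ^ k" by (auto simp: two_power_normal_def)
  then show "N \<lhd> G" "finite (carrier (G Mod N))" by (auto intro: card_ge_0_finite)
qed

lemma two_power_normal_carrier: "carrier G \<in> two_power_normal G"
proof -
  let ?Q = "\<lparr>carrier = {()}, monoid.mult = \<lambda>_ _. (), one = ()\<rparr>"
  have Q: "group ?Q" by (rule groupI) auto
  have "(\<lambda>_. ()) \<in> hom G ?Q" by (simp add: hom_def)
  from kernel_two_power_normal[OF this is_group Q, of 0] show ?thesis by (simp add: kernel_def)
qed

text \<open>The intersection is the kernel of the map into the product of the two quotients.\<close>

lemma two_power_normal_Int:
  assumes N: "N \<in> two_power_normal G" and M: "M \<in> two_power_normal G"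
  shows "N \<inter> M \<in> two_power_normal G"
proof -
  interpret N: normal N G using two_power_normalD(1)[OF N] .
  interpret M: normal M G using two_power_normalD(1)[OF M] .
  obtain i j where ij: "card (carrier (G Mod N)) = 2 ^ i" "card (carrier (G Mod M)) = 2 ^ j"
    using N M by (auto simp: two_power_normal_def)
  have h: "(\<lambda>g. (N #> g, M #> g)) \<in> hom G ((G Mod N) \<times>\<times> (G Mod M))"
    using N.r_coset_hom_Mod M.r_coset_hom_Mod by (simp add: hom_paired)
  have "kernel G ((G Mod N) \<times>\<times> (G Mod M)) (\<lambda>g. (N #> g, M #> g)) = N \<inter> M"
    using N.coset_eq_self_iff M.coset_eq_self_iff N.subset by (auto simp: kernel_def DirProd_def)
  moreover have "card (carrier ((G Mod N) \<times>\<times> (G Mod M))) = 2 ^ (i + j)"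
    by (simp add: DirProd_def card_cartesian_product ij power_add)
  ultimately show ?thesis
    using kernel_two_power_normal[OF h is_group DirProd_group] N.factorgroup_is_group M.factorgroup_is_group by metis
qed

lemma two_power_normal_finite_Int:
  "finite A \<Longrightarrow> A \<subseteq> two_power_normal G \<Longrightarrow> \<exists>M\<in>two_power_normal G. \<forall>N\<in>A. M \<subseteq> N"
proof (induction A rule: finite_induct)
  case empty
  then show ?case using two_power_normal_carrier by blast
next
  case (insert N A)
  then obtain M where "M \<in> two_power_normal G" "\<forall>N\<in>A. M \<subseteq> N" by auto
  then show ?case using two_power_normal_Int[of N M] insert.prems by (intro bexI[of _ "N \<inter> M"]) auto
qed

subsection \<open>The pro-2 completion\<close>

abbreviation "PC \<equiv> pro2_completion G"
abbreviation "PT \<equiv> pro2_completion_topology G"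
abbreviation "PM \<equiv> pro2_completion_map G"

lemma PC_carrier_D:
  "a \<in> carrier PC \<Longrightarrow> N \<in> two_power_normal G \<Longrightarrow> a N \<in> carrier (G Mod N)"
  "a \<in> carrier PC \<Longrightarrow> N \<in> two_power_normal G \<Longrightarrow> M \<in> two_power_normal G \<Longrightarrow> N \<subseteq> M \<Longrightarrow> a N \<subseteq> a M"
  by (auto simp: pro2_completion_def)

lemma PC_carrier_I:
  assumes "\<And>N. N \<in> two_power_normal G \<Longrightarrow> f N \<in> carrier (G Mod N)"
    "\<And>N M. N \<in> two_power_normal G \<Longrightarrow> M \<in> two_power_normal G \<Longrightarrow> N \<subseteq> M \<Longrightarrow> f N \<subseteq> f M"
  shows "(\<lambda>N\<in>two_power_normal G. f N) \<in> carrier PC"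
  using assms by (auto simp: pro2_completion_def)

lemma PC_ext: "a \<in> carrier PC \<Longrightarrow> b \<in> carrier PC \<Longrightarrow> (\<And>N. N \<in> two_power_normal G \<Longrightarrow> a N = b N) \<Longrightarrow> a = b"
  by (auto simp: pro2_completion_def intro: PiE_ext)

lemma PC_mult: "N \<in> two_power_normal G \<Longrightarrow> (a \<otimes>\<^bsub>PC\<^esub> b) N = a N <#> b N"
  by (simp add: pro2_completion_def)

lemma PC_one: "N \<in> two_power_normal G \<Longrightarrow> \<one>\<^bsub>PC\<^esub> N = N"
  by (simp add: pro2_completion_def)

lemma group_Mod: "N \<in> two_power_normal G \<Longrightarrow> group (G Mod N)"
  using normal.factorgroup_is_group two_power_normalD(1) by blast

lemma group_PC: "group PC"
proof (rule groupI)
  show one: "\<one>\<^bsub>PC\<^esub> \<in> carrier PC"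
  proof -
    have "N \<in> carrier (G Mod N)" if "N \<in> two_power_normal G" for N
      using monoid.one_closed[OF group.is_monoid[OF group_Mod[OF that]]] by simp
    then have "(\<lambda>N\<in>two_power_normal G. N) \<in> carrier PC" by (rule PC_carrier_I)
    then show ?thesis by (simp add: pro2_completion_def)
  qed
  fix a b c assume a: "a \<in> carrier PC" and b: "b \<in> carrier PC"
  have *: "(\<lambda>N\<in>two_power_normal G. a N <#> b N) \<in> carrier PC"
  proof (rule PC_carrier_I)
    show "a N <#> b N \<in> carrier (G Mod N)" if "N \<in> two_power_normal G" for N
      using monoid.m_closed[OF group.is_monoid[OF group_Mod[OF that]]] PC_carrier_D(1) a b that by fastforce
    show "a N <#> b N \<subseteq> a M <#> b M" if "N \<in> two_power_normal G" "M \<in> two_power_normal G" "N \<subseteq> M" for N M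
      using PC_carrier_D(2)[OF a that] PC_carrier_D(2)[OF b that] by (fastforce simp: set_mult_def)
  qed
  then show ab: "a \<otimes>\<^bsub>PC\<^esub> b \<in> carrier PC" by (simp add: pro2_completion_def)
  show "\<one>\<^bsub>PC\<^esub> \<otimes>\<^bsub>PC\<^esub> a = a"
  proof (rule PC_ext[OF _ a])
    have "(\<lambda>N\<in>two_power_normal G. \<one>\<^bsub>PC\<^esub> N <#> a N) \<in> carrier PC"
    proof (rule PC_carrier_I)
      show "\<one>\<^bsub>PC\<^esub> N <#> a N \<in> carrier (G Mod N)" if "N \<in> two_power_normal G" for N
        using monoid.m_closed[OF group.is_monoid[OF group_Mod[OF that]]] PC_carrier_D(1) one a that by fastforce
      show "\<one>\<^bsub>PC\<^esub> N <#> a N \<subseteq> \<one>\<^bsub>PC\<^esub> M <#> a M" if "N \<in> two_power_normal G" "M \<in> two_power_normal G" "N \<subseteq> M" for N M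
        using PC_carrier_D(2)[OF one that] PC_carrier_D(2)[OF a that] by (fastforce simp: set_mult_def)
    qed
    then show "\<one>\<^bsub>PC\<^esub> \<otimes>\<^bsub>PC\<^esub> a \<in> carrier PC" by (simp add: pro2_completion_def)
    show "(\<one>\<^bsub>PC\<^esub> \<otimes>\<^bsub>PC\<^esub> a) N = a N" if "N \<in> two_power_normal G" for N
      using monoid.l_one[OF group.is_monoid[OF group_Mod[OF that]], of "a N"] PC_carrier_D(1)[OF a that] that
      by (simp add: PC_mult PC_one)
  qed
  show "\<exists>b\<in>carrier PC. b \<otimes>\<^bsub>PC\<^esub> a = \<one>\<^bsub>PC\<^esub>"
  proof
    let ?b = "\<lambda>N\<in>two_power_normal G. inv\<^bsub>G Mod N\<^esub> (a N)"
    show b: "?b \<in> carrier PC"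
    proof (rule PC_carrier_I)
      show "inv\<^bsub>G Mod N\<^esub> (a N) \<in> carrier (G Mod N)" if "N \<in> two_power_normal G" for N
        using group.inv_closed[OF group_Mod[OF that]] PC_carrier_D(1)[OF a that] .
      show "inv\<^bsub>G Mod N\<^esub> (a N) \<subseteq> inv\<^bsub>G Mod M\<^esub> (a M)"
        if "N \<in> two_power_normal G" "M \<in> two_power_normal G" "N \<subseteq> M" for N M
        using normal.inv_FactGroup[OF two_power_normalD(1)] PC_carrier_D(1)[OF a] PC_carrier_D(2)[OF a that] that
        by (auto simp: SET_INV_def)
    qed
    show "?b \<otimes>\<^bsub>PC\<^esub> a = \<one>\<^bsub>PC\<^esub>"
    proof -
      have "inv\<^bsub>G Mod N\<^esub> (a N) <#> a N = N" if "N \<in> two_power_normal G" for N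
        using group.l_inv[OF group_Mod[OF that] PC_carrier_D(1)[OF a that]] by simp
      then show ?thesis by (simp add: pro2_completion_def cong: restrict_cong)
    qed
  qed
  assume c: "c \<in> carrier PC"
  show "a \<otimes>\<^bsub>PC\<^esub> b \<otimes>\<^bsub>PC\<^esub> c = a \<otimes>\<^bsub>PC\<^esub> (b \<otimes>\<^bsub>PC\<^esub> c)"
  proof -
    have "a N <#> b N <#> c N = a N <#> (b N <#> c N)" if "N \<in> two_power_normal G" for N
      using monoid.m_assoc[OF group.is_monoid[OF group_Mod[OF that]]] PC_carrier_D(1) a b c that by fastforce
    then show ?thesis by (simp add: pro2_completion_def cong: restrict_cong)
  qed
qed

lemma PC_proj_hom: "N \<in> two_power_normal G \<Longrightarrow> (\<lambda>a. a N) \<in> hom PC (G Mod N)"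
  by (rule homI) (auto simp: PC_carrier_D PC_mult)

lemma PM_hom: "PM \<in> hom G PC"
proof (rule homI)
  show PMc: "PM g \<in> carrier PC" if "g \<in> carrier G" for g
    unfolding pro2_completion_map_def
    by (rule PC_carrier_I) (use that in \<open>auto simp: carrier_FactGroup r_coset_def\<close>)
  fix g h assume g: "g \<in> carrier G" and h: "h \<in> carrier G"
  have "(N #> g) <#> (N #> h) = N #> (g \<otimes> h)" if "N \<in> two_power_normal G" for N
    using normal.rcos_sum[OF two_power_normalD(1)[OF that] g h] .
  then show "PM (g \<otimes> h) = PM g \<otimes>\<^bsub>PC\<^esub> PM h"
    by (simp add: pro2_completion_def pro2_completion_map_def cong: restrict_cong)
qed

text \<open>The kernel of the projection to the coordinate \<open>M\<close>. By
  \<open>PT_nbhd\<close> these clopen normal subgroups form a base of neighbourhoods of the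
  identity.\<close>

definition cyl :: "'a set \<Rightarrow> ('a set \<Rightarrow> 'a set) set" where
  "cyl M = {a \<in> carrier PC. a M = M}"

lemma cyl_normal: "M \<in> two_power_normal G \<Longrightarrow> cyl M \<lhd> PC"
proof -
  assume M: "M \<in> two_power_normal G"
  interpret p: group_hom PC "G Mod M" "\<lambda>a. a M"
    using group_PC group_Mod[OF M] PC_proj_hom[OF M] by (simp add: group_hom_def group_hom_axioms_def)
  show ?thesis using p.normal_kernel by (simp add: kernel_def cyl_def)
qed

lemma topspace_PT: "topspace PT = carrier PC"
  by (auto simp: pro2_completion_topology_def pro2_completion_def)

lemma openin_PT_proj: "M \<in> two_power_normal G \<Longrightarrow> openin PT {a \<in> carrier PC. a M \<in> C}"
proof -
  assume M: "M \<in> two_power_normal G"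
  let ?T = "product_topology (\<lambda>N. discrete_topology (carrier (G Mod N))) (two_power_normal G)"
  have "continuous_map ?T (discrete_topology (carrier (G Mod M))) (\<lambda>a. a M)"
    by (rule continuous_map_product_projection[OF M])
  then have "openin ?T {a \<in> topspace ?T. a M \<in> C \<inter> carrier (G Mod M)}"
    by (rule openin_continuous_map_preimage) simp
  then have "openin PT (carrier PC \<inter> {a \<in> topspace ?T. a M \<in> C \<inter> carrier (G Mod M)})"
    unfolding pro2_completion_topology_def openin_subtopology_Int2 by (rule openin_subtopology_Int2)
  moreover have "carrier PC \<inter> {a \<in> topspace ?T. a M \<in> C \<inter> carrier (G Mod M)} = {a \<in> carrier PC. a M \<in> C}"
    using M by (auto simp: pro2_completion_def)
  ultimately show ?thesis by simp
qed

lemma openin_cyl: "M \<in> two_power_normal G \<Longrightarrow> openin PT (cyl M)"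
  using openin_PT_proj[of M "{M}"] by (simp add: cyl_def)

lemma closedin_cyl: "M \<in> two_power_normal G \<Longrightarrow> closedin PT (cyl M)"
proof -
  assume M: "M \<in> two_power_normal G"
  have "topspace PT - cyl M = {a \<in> carrier PC. a M \<in> - {M}}" by (auto simp: topspace_PT cyl_def)
  then show ?thesis
    using openin_PT_proj[OF M, of "- {M}"] by (auto simp: closedin_def topspace_PT cyl_def)
qed

text \<open>A basic open set constrains finitely many coordinates. One subgroup M of 2-power index
  below all of them suffices, as the value at M determines the values at larger subgroups.\<close>

lemma PT_nbhd:
  assumes U: "openin PT U" "\<one>\<^bsub>PC\<^esub> \<in> U"
  shows "\<exists>M\<in>two_power_normal G. cyl M \<subseteq> U"
proof -
  let ?X = "\<lambda>N. discrete_topology (carrier (G Mod N))"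
  let ?I = "two_power_normal G"
  obtain W where W: "openin (product_topology ?X ?I) W" "U = W \<inter> carrier PC"
    using U(1) by (auto simp: pro2_completion_topology_def openin_subtopology)
  then obtain B where B: "finite {i \<in> ?I. B i \<noteq> topspace (?X i)}" "\<one>\<^bsub>PC\<^esub> \<in> Pi\<^sub>E ?I B" "Pi\<^sub>E ?I B \<subseteq> W"
  proof -
    have "\<one>\<^bsub>PC\<^esub> \<in> W" using U(2) W(2) by simp
    then show thesis using W(1) that unfolding openin_product_topology_alt by fast
  qed
  obtain M where M: "M \<in> ?I" "\<forall>N\<in>{i \<in> ?I. B i \<noteq> topspace (?X i)}. M \<subseteq> N"
    using two_power_normal_finite_Int[OF B(1)] by auto
  have "a \<in> Pi\<^sub>E ?I B" if a: "a \<in> cyl M" for a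
  proof (rule PiE_I)
    have aP: "a \<in> carrier PC" "a M = M" using a by (auto simp: cyl_def)
    show "a N = undefined" if "N \<notin> ?I" for N using aP that by (auto simp: pro2_completion_def PiE_def extensional_def)
    fix N assume N: "N \<in> ?I"
    show "a N \<in> B N"
    proof (cases "B N = topspace (?X N)")
      case True
      then show ?thesis using PC_carrier_D(1)[OF aP(1) N] by simp
    next
      case False
      then have "M \<subseteq> N" using M N by blast
      then have "M \<subseteq> a N" using PC_carrier_D(2)[OF aP(1) M(1) N] aP(2) by simp
      moreover have "\<one> \<in> M" using two_power_normalD(1)[OF M(1)] by (simp add: normal_imp_subgroup subgroup.one_closed)
      moreover obtain g where g: "g \<in> carrier G" "a N = N #> g" using PC_carrier_D(1)[OF aP(1) N] by (auto simp: carrier_FactGroup)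
      ultimately have "N #> g = N #> \<one>"
        using repr_independence[of \<one> N g] normal_imp_subgroup[OF two_power_normalD(1)[OF N]] by blast
      then have "a N = \<one>\<^bsub>PC\<^esub> N" using g N subgroup.subset[OF normal_imp_subgroup[OF two_power_normalD(1)[OF N]]]
        by (simp add: PC_one coset_mult_one)
      then show ?thesis using B(2) N by auto
    qed
  qed
  then have "cyl M \<subseteq> W" using B(3) by blast
  then show ?thesis using M(1) W(2) by (intro bexI[of _ M]) (auto simp: cyl_def)
qed

lemma PC_dense:
  assumes a: "a \<in> carrier PC" and M: "M \<in> two_power_normal G" and g: "g \<in> carrier G" "a M = M #> g"
  shows "a \<otimes>\<^bsub>PC\<^esub> inv\<^bsub>PC\<^esub> (PM g) \<in> cyl M"
proof -
  interpret M: normal M G using two_power_normalD(1)[OF M] .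
  interpret p: group_hom PC "G Mod M" "\<lambda>a. a M"
    using group_PC group_Mod[OF M] PC_proj_hom[OF M] by (simp add: group_hom_def group_hom_axioms_def)
  have PMg: "PM g \<in> carrier PC" using PM_hom g by (auto simp: hom_def)
  have "PM g M = a M" using M g by (simp add: pro2_completion_map_def)
  then have "(a \<otimes>\<^bsub>PC\<^esub> inv\<^bsub>PC\<^esub> (PM g)) M = \<one>\<^bsub>G Mod M\<^esub>"
    using a PMg p.hom_closed[OF a] by (simp del: one_FactGroup mult_FactGroup)
  then show ?thesis using a PMg by (simp add: cyl_def)
qed

end

section \<open>Homomorphisms from the pro-2 group to finite 2-groups, and its finite
  quotients\<close>

section \<open>The pro-2 right-angled Artin group\<close>

definition word_prod :: "('g, 'm) monoid_scheme \<Rightarrow> ('x \<Rightarrow> 'g) \<Rightarrow> 'x list \<Rightarrow> 'g" where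
  "word_prod G f w = foldr (\<lambda>x g. f x \<otimes>\<^bsub>G\<^esub> g) w \<one>\<^bsub>G\<^esub>"

lemma (in group) word_prod_closed: "w \<in> lists S \<Longrightarrow> (\<And>x. x \<in> S \<Longrightarrow> f x \<in> carrier G) \<Longrightarrow> word_prod G f w \<in> carrier G"
  by (induction w) (auto simp: word_prod_def)

lemma word_prod_simps [simp]: "word_prod G f [] = \<one>\<^bsub>G\<^esub>" "word_prod G f (x # w) = f x \<otimes>\<^bsub>G\<^esub> word_prod G f w"
  by (simp_all add: word_prod_def)

lemma (in group) word_prod_append:
  "u \<in> lists S \<Longrightarrow> w \<in> lists S \<Longrightarrow> (\<And>x. x \<in> S \<Longrightarrow> f x \<in> carrier G) \<Longrightarrow>
    word_prod G f (u @ w) = word_prod G f u \<otimes> word_prod G f w"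
proof (induction u)
  case (Cons a u)
  then show ?case using word_prod_closed[of u S f] word_prod_closed[of w S f] by (simp add: m_assoc)
qed (simp add: word_prod_closed)

lemma (in group_hom) word_prod_hom:
  "w \<in> lists S \<Longrightarrow> (\<And>x. x \<in> S \<Longrightarrow> f x \<in> carrier G) \<Longrightarrow> h (word_prod G f w) = word_prod H (\<lambda>x. h (f x)) w"
proof (induction w)
  case (Cons a w)
  then show ?case using G.word_prod_closed[of w S f] by simp
qed simp

lemma (in group) normal_Inter:
  assumes "\<And>N. N \<in> A \<Longrightarrow> N \<lhd> G" "A \<noteq> {}"
  shows "\<Inter>A \<lhd> G"
  unfolding normal_inv_iff
proof
  show "subgroup (\<Inter>A) G" using assms by (intro subgroups_Inter) (auto intro: normal_imp_subgroup)
  show "\<forall>x\<in>carrier G. \<forall>h\<in>\<Inter>A. x \<otimes> h \<otimes> inv x \<in> \<Inter>A"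
    using assms normal_inv_iff by blast
qed

context graph
begin

sublocale FG: group "free_group V"
  by (rule group_free_group)

abbreviation "GP \<equiv> free_pro2 V"
abbreviation "TP \<equiv> free_pro2_topology V"
abbreviation "GK \<equiv> raag_kernel V E"
abbreviation "GV \<equiv> raag V E"
abbreviation "TV \<equiv> raag_topology V E"

sublocale GP: group GP
  unfolding free_pro2_def by (rule FG.group_PC)

lemma gen_GP: "x \<in> V \<Longrightarrow> free_pro2_gen V x \<in> carrier GP"
  using FG.PM_hom free_group_gen[of x V True] by (auto simp: free_pro2_gen_def free_pro2_def hom_def)

lemma relators_GP: "raag_relators V E \<subseteq> carrier GP"
  using gen_GP edge_V by (fastforce simp: raag_relators_def commutator_def)

lemma topspace_TP: "topspace TP = carrier GP"
  by (simp add: free_pro2_topology_def free_pro2_def FG.topspace_PT)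

lemma carrier_normal_GP: "carrier GP \<lhd> GP"
  by (simp add: GP.normal_inv_iff GP.subgroup_self)

sublocale GK: normal GK GP
  unfolding raag_kernel_def closed_normal_closure_def
proof (rule GP.normal_Inter)
  have "closedin TP (carrier GP)" using topspace_TP by (metis closedin_topspace)
  then show "{N. N \<lhd> GP \<and> closedin TP N \<and> raag_relators V E \<subseteq> N} \<noteq> {}"
    using carrier_normal_GP relators_GP by blast
qed auto

lemma relators_GK: "raag_relators V E \<subseteq> GK"
  by (auto simp: raag_kernel_def closed_normal_closure_def)

sublocale GV: group GV
  unfolding raag_def by (rule GK.factorgroup_is_group)

lemma carrier_GV: "carrier GV = (\<lambda>a. GK #>\<^bsub>GP\<^esub> a) ` carrier GP"
  by (simp add: raag_def carrier_FactGroup)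

lemma proj_hom: "(\<lambda>a. GK #>\<^bsub>GP\<^esub> a) \<in> hom GP GV"
  unfolding raag_def by (rule GK.r_coset_hom_Mod)

sublocale proj: group_hom GP GV "\<lambda>a. GK #>\<^bsub>GP\<^esub> a"
  using proj_hom by unfold_locales

lemma Union_carrier_GV: "\<Union>(carrier GV) = carrier GP"
  unfolding carrier_GV using GP.rcos_self[OF _ GK.subgroup_axioms] GP.r_coset_subset_G[OF GK.subset] by blast

lemma coset_disjoint: "Z \<in> carrier GV \<Longrightarrow> Y \<in> carrier GV \<Longrightarrow> a \<in> Z \<Longrightarrow> a \<in> Y \<Longrightarrow> Z = Y"
  unfolding carrier_GV using GP.repr_independence[OF _ _ GK.subgroup_axioms] by blast

text \<open>The predicate defining the quotient topology is a topology because distinct cosets are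
  disjoint, so that unions of cosets are compatible with intersections.\<close>

lemma openin_TV: "openin TV W \<longleftrightarrow> W \<subseteq> carrier GV \<and> openin TP (\<Union>W)"
proof -
  have "istopology (\<lambda>W. W \<subseteq> carrier GV \<and> openin TP (\<Union>W))"
    unfolding istopology_def
  proof (intro conjI allI impI)
    fix S T assume S: "S \<subseteq> carrier GV \<and> openin TP (\<Union>S)" and T: "T \<subseteq> carrier GV \<and> openin TP (\<Union>T)"
    then have "\<Union>(S \<inter> T) = \<Union>S \<inter> \<Union>T" using coset_disjoint by blast
    then show "S \<inter> T \<subseteq> carrier GV" "openin TP (\<Union>(S \<inter> T))" using S T by auto
  next
    fix K assume K: "\<forall>S\<in>K. S \<subseteq> carrier GV \<and> openin TP (\<Union>S)"
    then show "\<Union>K \<subseteq> carrier GV" by blast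
    have "\<Union>(\<Union>K) = (\<Union>S\<in>K. \<Union>S)" by blast
    then show "openin TP (\<Union>(\<Union>K))" using K by auto
  qed
  then show ?thesis
    by (simp add: raag_topology_def quotient_group_topology_def raag_def topology_inverse')
qed

lemma topspace_TV: "topspace TV = carrier GV"
proof -
  have "openin TV (carrier GV)" using openin_topspace[of TP] by (simp add: openin_TV Union_carrier_GV topspace_TP)
  then show ?thesis using openin_subset openin_topspace openin_TV by blast
qed

abbreviation "gen \<equiv> raag_gen V E"

lemma gen_closed: "x \<in> V \<Longrightarrow> gen x \<in> carrier GV"
  unfolding raag_gen_def using gen_GP proj.hom_closed by blast

lemma gen_commute:
  assumes "{u, v} \<in> E"
  shows "gen u \<otimes>\<^bsub>GV\<^esub> gen v = gen v \<otimes>\<^bsub>GV\<^esub> gen u"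
proof -
  have uv: "gen u \<in> carrier GV" "gen v \<in> carrier GV" "free_pro2_gen V u \<in> carrier GP" "free_pro2_gen V v \<in> carrier GP"
    using edge_V[OF assms] gen_closed gen_GP by auto
  let ?c = "commutator GP (free_pro2_gen V u) (free_pro2_gen V v)"
  have "?c \<in> GK" using relators_GK assms by (auto simp: raag_relators_def)
  then have "GK #>\<^bsub>GP\<^esub> ?c = \<one>\<^bsub>GV\<^esub>"
    using GP.coset_join2[OF _ GK.subgroup_axioms] GK.subset by (simp add: raag_def subset_iff)
  moreover have "GK #>\<^bsub>GP\<^esub> ?c = inv\<^bsub>GV\<^esub> (gen u) \<otimes>\<^bsub>GV\<^esub> inv\<^bsub>GV\<^esub> (gen v) \<otimes>\<^bsub>GV\<^esub> gen u \<otimes>\<^bsub>GV\<^esub> gen v"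
    using uv by (simp add: commutator_def raag_gen_def)
  ultimately have "inv\<^bsub>GV\<^esub> (gen v \<otimes>\<^bsub>GV\<^esub> gen u) \<otimes>\<^bsub>GV\<^esub> (gen u \<otimes>\<^bsub>GV\<^esub> gen v) = \<one>\<^bsub>GV\<^esub>"
    using uv by (simp add: GV.inv_mult_group GV.m_assoc)
  then show ?thesis using uv by (metis GV.inv_equality GV.inv_inv GV.m_closed GV.inv_closed)
qed

subsection \<open>The universal property\<close>

text \<open>The map on the free group has a kernel M of 2-power index, so it factors through the
  coordinate M of the completion. The resulting kernel is \<open>cyl M\<close>; it is closed, normal
  and contains the relators, hence it contains their closed normal closure. As it is open too, the
  kernel in the quotient is open.\<close>

lemma GV_universal:
  assumes Q: "group Q" "card (carrier Q) = 2 ^ k" and f: "\<And>x. x \<in> V \<Longrightarrow> f x \<in> carrier Q"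
    and c: "\<And>u v. {u, v} \<in> E \<Longrightarrow> f u \<otimes>\<^bsub>Q\<^esub> f v = f v \<otimes>\<^bsub>Q\<^esub> f u"
  obtains R where "R \<in> hom GV Q" "\<And>x. x \<in> V \<Longrightarrow> R (gen x) = f x" "kernel GV Q R \<in> open_normal GV TV"
proof -
  interpret Q: group Q by fact
  define h where "h = free_lift Q f"
  have h: "h \<in> hom (free_group V) Q" "\<And>x. x \<in> V \<Longrightarrow> h [(x, True)] = f x"
    unfolding h_def using free_lift_hom[OF Q(1), of V f] f by auto
  interpret h: group_hom "free_group V" Q h using h(1) by unfold_locales
  define M where "M = kernel (free_group V) Q h"
  have M: "M \<in> two_power_normal (free_group V)"
    unfolding M_def by (rule kernel_two_power_normal[OF h(1) group_free_group Q])
  define R0 where "R0 = (\<lambda>a. the_elem (h ` (a M)))"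
  have R0: "R0 \<in> hom GP Q"
    using hom_compose[OF FG.PC_proj_hom[OF M] h.FactGroup_hom[folded M_def]]
    by (simp add: R0_def[abs_def] comp_def free_pro2_def)
  interpret R0: group_hom GP Q R0 using R0 by unfold_locales
  have R0_gen: "R0 (free_pro2_gen V x) = f x" if x: "x \<in> V" for x
  proof -
    have g: "[(x, True)] \<in> carrier (free_group V)" using x by (rule free_group_gen)
    have "h ` (M #>\<^bsub>free_group V\<^esub> [(x, True)]) = {h [(x, True)]}"
      using g by (auto simp: M_def kernel_def r_coset_def intro!: imageI)
    then show ?thesis using M h(2)[OF x] by (simp add: R0_def free_pro2_gen_def pro2_completion_map_def)
  qed
  have ker: "kernel GP Q R0 = FG.cyl M"
  proof -
    have "R0 a = \<one>\<^bsub>Q\<^esub> \<longleftrightarrow> a M = M" if a: "a \<in> carrier GP" for a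
    proof -
      have aM: "a M \<in> carrier (free_group V Mod M)" using FG.PC_carrier_D(1) a M by (simp add: free_pro2_def)
      have MM: "M \<in> carrier (free_group V Mod M)" using monoid.one_closed[OF group.is_monoid[OF FG.group_Mod[OF M]]] by simp
      have "the_elem (h ` M) = \<one>\<^bsub>Q\<^esub>"
      proof -
        have "h ` M = {\<one>\<^bsub>Q\<^esub>}" using FG.one_closed h.hom_one by (auto simp: M_def kernel_def intro!: image_eqI[of _ _ "\<one>\<^bsub>free_group V\<^esub>"])
        then show ?thesis by simp
      qed
      then show ?thesis using inj_onD[OF h.FactGroup_inj_on[folded M_def] _ aM MM] by (auto simp: R0_def)
    qed
    then show ?thesis by (auto simp: kernel_def FG.cyl_def free_pro2_def)
  qed
  have "raag_relators V E \<subseteq> kernel GP Q R0"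
  proof
    fix r assume "r \<in> raag_relators V E"
    then obtain u v where uv: "r = commutator GP (free_pro2_gen V u) (free_pro2_gen V v)" "{u, v} \<in> E"
      by (auto simp: raag_relators_def)
    have V: "u \<in> V" "v \<in> V" using edge_V[OF uv(2)] by auto
    have "R0 r = inv\<^bsub>Q\<^esub> (f u) \<otimes>\<^bsub>Q\<^esub> inv\<^bsub>Q\<^esub> (f v) \<otimes>\<^bsub>Q\<^esub> f u \<otimes>\<^bsub>Q\<^esub> f v"
      using V gen_GP by (simp add: uv(1) commutator_def R0_gen)
    also have "\<dots> = inv\<^bsub>Q\<^esub> (f v \<otimes>\<^bsub>Q\<^esub> f u) \<otimes>\<^bsub>Q\<^esub> (f u \<otimes>\<^bsub>Q\<^esub> f v)"
      using V f by (simp add: Q.inv_mult_group Q.m_assoc)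
    also have "\<dots> = \<one>\<^bsub>Q\<^esub>" using V f c[OF uv(2)] by simp
    finally show "r \<in> kernel GP Q R0"
      using relators_GP \<open>r \<in> raag_relators V E\<close> by (auto simp: kernel_def)
  qed
  moreover have "FG.cyl M \<lhd> GP" "closedin TP (FG.cyl M)" "openin TP (FG.cyl M)"
    using FG.cyl_normal[OF M] FG.closedin_cyl[OF M] FG.openin_cyl[OF M]
    by (simp_all add: free_pro2_def free_pro2_topology_def)
  ultimately have GKM: "GK \<subseteq> kernel GP Q R0"
    unfolding ker raag_kernel_def closed_normal_closure_def by blast
  obtain R where R: "R \<in> hom GV Q" "\<And>a. a \<in> carrier GP \<Longrightarrow> R (GK #>\<^bsub>GP\<^esub> a) = R0 a"
    using R0.FactGroup_universal_kernel[OF GK.normal_axioms GKM] unfolding raag_def by blast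
  interpret R: group_hom GV Q R using R(1) by unfold_locales
  have "kernel GV Q R \<lhd> GV" by (rule R.normal_kernel)
  moreover have "\<Union>(kernel GV Q R) = FG.cyl M"
  proof -
    have "\<Union>(kernel GV Q R) = kernel GP Q R0"
    proof (intro equalityI subsetI)
      fix b assume "b \<in> \<Union>(kernel GV Q R)"
      then obtain a where a: "a \<in> carrier GP" "b \<in> GK #>\<^bsub>GP\<^esub> a" "R (GK #>\<^bsub>GP\<^esub> a) = \<one>\<^bsub>Q\<^esub>"
        by (auto simp: kernel_def carrier_GV)
      have b: "b \<in> carrier GP" using a GP.r_coset_subset_G[OF GK.subset a(1)] by blast
      have "GK #>\<^bsub>GP\<^esub> a = GK #>\<^bsub>GP\<^esub> b" using GP.repr_independence[OF a(2,1) GK.subgroup_axioms] .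
      then show "b \<in> kernel GP Q R0" using a b R(2)[OF b] by (simp add: kernel_def)
    next
      fix b assume "b \<in> kernel GP Q R0"
      then have b: "b \<in> carrier GP" "R0 b = \<one>\<^bsub>Q\<^esub>" by (auto simp: kernel_def)
      then have "GK #>\<^bsub>GP\<^esub> b \<in> kernel GV Q R" using R(2)[OF b(1)] by (simp add: kernel_def)
      then show "b \<in> \<Union>(kernel GV Q R)" using GP.rcos_self[OF b(1) GK.subgroup_axioms] by blast
    qed
    then show ?thesis by (simp add: ker)
  qed
  ultimately have "kernel GV Q R \<in> open_normal GV TV"
    using \<open>openin TP (FG.cyl M)\<close> by (auto simp: open_normal_def openin_TV kernel_def)
  moreover have "R (gen x) = f x" if "x \<in> V" for x
    using R(2)[OF gen_GP[OF that]] R0_gen[OF that] by (simp add: raag_gen_def)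
  ultimately show thesis using that R(1) by blast
qed

subsection \<open>Finite quotients\<close>

text \<open>The preimage of U in the free pro-2 group contains some \<open>cyl M\<close>, so the
  class modulo U depends on the single finite coordinate M.\<close>

lemma open_normal_nbhd:
  assumes U: "U \<in> open_normal GV TV"
  obtains M where "M \<in> two_power_normal (free_group V)"
    "\<And>a g. a \<in> carrier GP \<Longrightarrow> g \<in> carrier (free_group V) \<Longrightarrow> a M = M #>\<^bsub>free_group V\<^esub> g \<Longrightarrow>
       U #>\<^bsub>GV\<^esub> (GK #>\<^bsub>GP\<^esub> a) = U #>\<^bsub>GV\<^esub> (GK #>\<^bsub>GP\<^esub> pro2_completion_map (free_group V) g)"
proof -
  interpret U: normal U GV using U by (simp add: open_normal_def)
  have "openin TP (\<Union>U)" using U by (simp add: open_normal_def openin_TV)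
  moreover have "GK \<in> U" using U.one_closed by (simp add: raag_def)
  then have "\<one>\<^bsub>GP\<^esub> \<in> \<Union>U" using GK.one_closed by blast
  ultimately obtain M where M: "M \<in> two_power_normal (free_group V)" "FG.cyl M \<subseteq> \<Union>U"
    using FG.PT_nbhd[of "\<Union>U"] by (auto simp: free_pro2_def free_pro2_topology_def)
  show thesis
  proof (rule that[OF M(1)])
    fix a g assume a: "a \<in> carrier GP" and g: "g \<in> carrier (free_group V)" and e: "a M = M #>\<^bsub>free_group V\<^esub> g"
    let ?i = "pro2_completion_map (free_group V) g"
    have i: "?i \<in> carrier GP" using FG.PM_hom g by (auto simp: hom_def free_pro2_def)
    have "a \<otimes>\<^bsub>GP\<^esub> inv\<^bsub>GP\<^esub> ?i \<in> \<Union>U"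
      using FG.PC_dense[of a M g] g e a M by (auto simp: free_pro2_def)
    then obtain Z where Z: "Z \<in> U" "a \<otimes>\<^bsub>GP\<^esub> inv\<^bsub>GP\<^esub> ?i \<in> Z" by blast
    have c: "a \<otimes>\<^bsub>GP\<^esub> inv\<^bsub>GP\<^esub> ?i \<in> carrier GP" using a i by simp
    have "Z = GK #>\<^bsub>GP\<^esub> (a \<otimes>\<^bsub>GP\<^esub> inv\<^bsub>GP\<^esub> ?i)"
    proof (rule coset_disjoint[OF _ _ Z(2) GP.rcos_self[OF c GK.subgroup_axioms]])
      show "Z \<in> carrier GV" using Z(1) U.subset by blast
      show "GK #>\<^bsub>GP\<^esub> (a \<otimes>\<^bsub>GP\<^esub> inv\<^bsub>GP\<^esub> ?i) \<in> carrier GV" using c proj.hom_closed by blast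
    qed
    then have "(GK #>\<^bsub>GP\<^esub> a) \<otimes>\<^bsub>GV\<^esub> inv\<^bsub>GV\<^esub> (GK #>\<^bsub>GP\<^esub> ?i) \<in> U" using Z(1) a i by simp
    then show "U #>\<^bsub>GV\<^esub> (GK #>\<^bsub>GP\<^esub> a) = U #>\<^bsub>GV\<^esub> (GK #>\<^bsub>GP\<^esub> ?i)"
      using U.coset_eq_iff a i proj.hom_closed by blast
  qed
qed

lemma finite_GV_quotient:
  assumes U: "U \<in> open_normal GV TV"
  shows "finite (carrier (GV Mod U))"
proof -
  obtain M where M: "M \<in> two_power_normal (free_group V)"
    "\<And>a g. a \<in> carrier GP \<Longrightarrow> g \<in> carrier (free_group V) \<Longrightarrow> a M = M #>\<^bsub>free_group V\<^esub> g \<Longrightarrow>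
       U #>\<^bsub>GV\<^esub> (GK #>\<^bsub>GP\<^esub> a) = U #>\<^bsub>GV\<^esub> (GK #>\<^bsub>GP\<^esub> pro2_completion_map (free_group V) g)"
    using open_normal_nbhd[OF U] by blast
  define r where "r = (\<lambda>C. SOME g. g \<in> carrier (free_group V) \<and> C = M #>\<^bsub>free_group V\<^esub> g)"
  have "carrier (GV Mod U) \<subseteq> (\<lambda>C. U #>\<^bsub>GV\<^esub> (GK #>\<^bsub>GP\<^esub> pro2_completion_map (free_group V) (r C))) ` carrier (free_group V Mod M)"
  proof
    fix Y assume "Y \<in> carrier (GV Mod U)"
    then obtain a where a: "a \<in> carrier GP" "Y = U #>\<^bsub>GV\<^esub> (GK #>\<^bsub>GP\<^esub> a)" by (auto simp: carrier_FactGroup carrier_GV)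
    have aM: "a M \<in> carrier (free_group V Mod M)" using FG.PC_carrier_D(1) a M by (simp add: free_pro2_def)
    then have "\<exists>g. g \<in> carrier (free_group V) \<and> a M = M #>\<^bsub>free_group V\<^esub> g" by (auto simp: carrier_FactGroup)
    then have "r (a M) \<in> carrier (free_group V) \<and> a M = M #>\<^bsub>free_group V\<^esub> r (a M)" unfolding r_def by (rule someI_ex)
    then show "Y \<in> (\<lambda>C. U #>\<^bsub>GV\<^esub> (GK #>\<^bsub>GP\<^esub> pro2_completion_map (free_group V) (r C))) ` carrier (free_group V Mod M)"
      using aM M(2)[OF a(1)] a(2) by blast
  qed
  then show ?thesis using FG.two_power_normalD(2)[OF M(1)] finite_subset by blast
qed

text \<open>The image of the abstract free group is dense, which gives words with inverse letters.
  In a finite quotient these can be traded for positive words.\<close>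

lemma GV_dense:
  assumes U: "U \<in> open_normal GV TV" and Z: "Z \<in> carrier GV"
  shows "\<exists>w\<in>lists V. U #>\<^bsub>GV\<^esub> Z = U #>\<^bsub>GV\<^esub> word_prod GV gen w"
proof -
  interpret U: normal U GV using U by (simp add: open_normal_def)
  interpret Q: group "GV Mod U" by (rule U.factorgroup_is_group)
  interpret p: group_hom GV "GV Mod U" "\<lambda>Z. U #>\<^bsub>GV\<^esub> Z"
    using U.r_coset_hom_Mod by unfold_locales
  have wc: "word_prod GV gen w \<in> carrier GV" if "w \<in> lists V" for w
    using GV.word_prod_closed[OF that] gen_closed by blast
  have pw: "U #>\<^bsub>GV\<^esub> word_prod GV gen w = word_prod (GV Mod U) (\<lambda>x. U #>\<^bsub>GV\<^esub> gen x) w" if "w \<in> lists V" for w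
    by (rule p.word_prod_hom[OF that gen_closed])
  have pc: "U #>\<^bsub>GV\<^esub> gen x \<in> carrier (GV Mod U)" if "x \<in> V" for x
    using that gen_closed p.hom_closed by blast
  let ?P = "\<lambda>y. \<exists>w\<in>lists V. y = word_prod (GV Mod U) (\<lambda>x. U #>\<^bsub>GV\<^esub> gen x) w"
  have Pmult: "?P (a \<otimes>\<^bsub>GV Mod U\<^esub> b)" if ab: "?P a" "?P b" for a b
  proof -
    obtain u w where "u \<in> lists V" "w \<in> lists V" "a = word_prod (GV Mod U) (\<lambda>x. U #>\<^bsub>GV\<^esub> gen x) u"
      "b = word_prod (GV Mod U) (\<lambda>x. U #>\<^bsub>GV\<^esub> gen x) w" using ab by blast
    then show ?thesis using Q.word_prod_append[of u V w, OF _ _ pc] by (intro bexI[of _ "u @ w"]) auto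
  qed
  have Pgen: "?P (U #>\<^bsub>GV\<^esub> gen x)" if "x \<in> V" for x
    using that pc[OF that] by (intro bexI[of _ "[x]"]) (auto simp del: mult_FactGroup one_FactGroup)
  have Ppow: "?P (a [^]\<^bsub>GV Mod U\<^esub> (n::nat))" if "?P a" for a n
  proof (induction n)
    case 0
    show ?case by (intro bexI[of _ "[]"]) auto
  next
    case (Suc n)
    then show ?case using Pmult[OF Suc that] by simp
  qed
  \<comment> \<open>In a group of order n the inverse of y is y^(n - 1).\<close>
  have Pinv: "?P (inv\<^bsub>GV Mod U\<^esub> (U #>\<^bsub>GV\<^esub> gen x))" if x: "x \<in> V" for x
  proof -
    let ?y = "U #>\<^bsub>GV\<^esub> gen x" and ?n = "order (GV Mod U)"
    have "?n > 0" using Q.order_gt_0_iff_finite finite_GV_quotient[OF U] by simp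
    then have "?y [^]\<^bsub>GV Mod U\<^esub> (?n - 1) \<otimes>\<^bsub>GV Mod U\<^esub> ?y = \<one>\<^bsub>GV Mod U\<^esub>"
      using Q.pow_order_eq_1[OF pc[OF x]] Q.nat_pow_Suc[of ?y "?n - 1"] by simp
    then have "inv\<^bsub>GV Mod U\<^esub> ?y = ?y [^]\<^bsub>GV Mod U\<^esub> (?n - 1)"
      using pc[OF x] by (intro Q.inv_equality) auto
    then show ?thesis using Ppow[OF Pgen[OF x]] by simp
  qed
  let ?i = "\<lambda>g. GK #>\<^bsub>GP\<^esub> pro2_completion_map (free_group V) g"
  have ih: "?i \<in> hom (free_group V) GV"
    using hom_compose[OF FG.PM_hom proj_hom[unfolded free_pro2_def]] by (simp add: comp_def free_pro2_def)
  interpret i: group_hom "free_group V" GV ?i using ih by unfold_locales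
  have gen_i: "?i [(x, True)] = gen x" for x by (simp add: raag_gen_def free_pro2_gen_def)
  have Pi: "?P (U #>\<^bsub>GV\<^esub> ?i g)" if "g \<in> carrier (free_group V)" for g
    using that
  proof (induction g rule: free_group_induct)
    case Nil
    have "[] = \<one>\<^bsub>free_group V\<^esub>" by (simp add: free_group_def)
    then have "?i [] = \<one>\<^bsub>GV\<^esub>" using i.hom_one by metis
    then show ?case using p.hom_one by (intro bexI[of _ "[]"]) auto
  next
    case (Cons x b g)
    have xb: "[(x, b)] \<in> carrier (free_group V)" using Cons by (intro free_group_gen)
    have "U #>\<^bsub>GV\<^esub> ?i ([(x, b)] \<otimes>\<^bsub>free_group V\<^esub> g) = (U #>\<^bsub>GV\<^esub> ?i [(x, b)]) \<otimes>\<^bsub>GV Mod U\<^esub> (U #>\<^bsub>GV\<^esub> ?i g)"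
      using i.hom_mult[OF xb Cons(2)] i.hom_closed[OF xb] i.hom_closed[OF Cons(2)] p.hom_mult by metis
    moreover have "?P (U #>\<^bsub>GV\<^esub> ?i [(x, b)])"
    proof (cases b)
      case True
      then show ?thesis using Pgen[OF Cons(1)] gen_i by simp
    next
      case False
      have "?i [(x, b)] = inv\<^bsub>GV\<^esub> (gen x)"
        using False free_group_inv_gen[OF Cons(1)] i.hom_inv[OF free_group_gen[OF Cons(1), of True]] gen_i by simp
      then have "U #>\<^bsub>GV\<^esub> ?i [(x, b)] = inv\<^bsub>GV Mod U\<^esub> (U #>\<^bsub>GV\<^esub> gen x)"
        using p.hom_inv[OF gen_closed[OF Cons(1)]] by simp
      then show ?thesis using Pinv[OF Cons(1)] by simp
    qed
    ultimately show ?case using Pmult[OF _ Cons(3)] by simp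
  qed
  obtain M where M: "M \<in> two_power_normal (free_group V)"
    "\<And>a g. a \<in> carrier GP \<Longrightarrow> g \<in> carrier (free_group V) \<Longrightarrow> a M = M #>\<^bsub>free_group V\<^esub> g \<Longrightarrow>
       U #>\<^bsub>GV\<^esub> (GK #>\<^bsub>GP\<^esub> a) = U #>\<^bsub>GV\<^esub> ?i g"
    using open_normal_nbhd[OF U] by blast
  obtain a where a: "a \<in> carrier GP" "Z = GK #>\<^bsub>GP\<^esub> a" using Z by (auto simp: carrier_GV)
  have "a M \<in> carrier (free_group V Mod M)" using FG.PC_carrier_D(1) a M by (simp add: free_pro2_def)
  then obtain g where "g \<in> carrier (free_group V)" "a M = M #>\<^bsub>free_group V\<^esub> g" by (auto simp: carrier_FactGroup)
  then show ?thesis using M(2)[OF a(1)] Pi a(2) pw by metis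
qed

end

section \<open>Actions of the completed group algebra, and closedness of the ideal powers by
  compactness\<close>

section \<open>Completed group algebras\<close>

text \<open>The product of the finite discrete sets is compact, and compatibility along one
  inclusion is a closed condition. Finitely many of these conditions are met by taking a point over
  a common lower bound V and pushing it forward.\<close>

lemma finite_inverse_limit:
  fixes I :: "'i set set" and Z :: "'i set \<Rightarrow> 'a set" and \<pi> :: "'i set \<Rightarrow> 'a \<Rightarrow> 'a"
  assumes I: "I \<noteq> {}" "\<And>U W. U \<in> I \<Longrightarrow> W \<in> I \<Longrightarrow> U \<inter> W \<in> I"
    and Z: "\<And>U. U \<in> I \<Longrightarrow> finite (Z U)" "\<And>U. U \<in> I \<Longrightarrow> Z U \<noteq> {}"
    and \<pi>: "\<And>U W x. U \<in> I \<Longrightarrow> W \<in> I \<Longrightarrow> U \<subseteq> W \<Longrightarrow> x \<in> Z U \<Longrightarrow> \<pi> W x \<in> Z W"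
    and comp: "\<And>U W W' x. U \<in> I \<Longrightarrow> W \<in> I \<Longrightarrow> W' \<in> I \<Longrightarrow> U \<subseteq> W \<Longrightarrow> W \<subseteq> W' \<Longrightarrow> x \<in> Z U \<Longrightarrow> \<pi> W' (\<pi> W x) = \<pi> W' x"
  obtains x where "\<And>U. U \<in> I \<Longrightarrow> x U \<in> Z U" "\<And>U W. U \<in> I \<Longrightarrow> W \<in> I \<Longrightarrow> U \<subseteq> W \<Longrightarrow> \<pi> W (x U) = x W"
proof -
  let ?T = "product_topology (\<lambda>U. discrete_topology (Z U)) I"
  define C where "C = (\<lambda>(U, W). {x \<in> Pi\<^sub>E I Z. \<pi> W (x U) = x W})"
  define P where "P = {(U, W). U \<in> I \<and> W \<in> I \<and> U \<subseteq> W}"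
  have top: "topspace ?T = Pi\<^sub>E I Z" by simp
  have "compact_space ?T"
    using Z(1) by (simp add: compact_space_product_topology compact_space_discrete_topology)
  moreover have "closedin ?T (C p)" if p: "p \<in> P" for p
  proof -
    obtain U W where p: "p = (U, W)" "U \<in> I" "W \<in> I" "U \<subseteq> W" using p by (auto simp: P_def)
    have proj: "closedin ?T {x \<in> topspace ?T. x V \<in> {a}}" if "V \<in> I" "a \<in> Z V" for V a
      by (rule closedin_continuous_map_preimage[OF continuous_map_product_projection[OF that(1)]])
        (use that in \<open>simp\<close>)
    have "C p = (\<Union>a\<in>Z U. {x \<in> topspace ?T. x U \<in> {a}} \<inter> {x \<in> topspace ?T. x W \<in> {\<pi> W a}})"
      using p by (auto simp: C_def)
    also have "closedin ?T \<dots>"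
      using p Z(1) \<pi> proj by (intro closedin_Union closedin_Int) auto
    finally show ?thesis .
  qed
  moreover have "\<Inter>F \<noteq> {}" if F: "finite F" "F \<subseteq> C ` P" for F
  proof -
    obtain Q where Q: "finite Q" "Q \<subseteq> P" "F = C ` Q" using finite_subset_image[OF F] by blast
    have "\<exists>V\<in>I. \<forall>(U, W)\<in>Q. V \<subseteq> U"
      using Q(1,2)
    proof (induction Q rule: finite_induct)
      case empty
      then show ?case using I(1) by auto
    next
      case (insert q Q)
      then obtain V where "V \<in> I" "\<forall>(U, W)\<in>Q. V \<subseteq> U" by auto
      then show ?case using I(2)[of V "fst q"] insert.prems by (intro bexI[of _ "V \<inter> fst q"]) (auto simp: P_def)
    qed
    then obtain V where V: "V \<in> I" "\<And>U W. (U, W) \<in> Q \<Longrightarrow> V \<subseteq> U" by blast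
    obtain v where v: "v \<in> Z V" using Z(2)[OF V(1)] by blast
    \<comment> \<open>Coordinates that are not above V occur in none of the chosen conditions, so
      any value will do there.\<close>
    define x where "x = (\<lambda>U\<in>I. if V \<subseteq> U then \<pi> U v else (SOME a. a \<in> Z U))"
    have xZ: "x \<in> Pi\<^sub>E I Z"
      unfolding x_def using \<pi>[OF V(1) _ _ v] Z(2) by (auto simp: some_in_eq)
    have "x \<in> C q" if q: "q \<in> Q" for q
    proof -
      obtain U W where q: "q = (U, W)" "U \<in> I" "W \<in> I" "U \<subseteq> W" "V \<subseteq> U"
        using q Q(2) V(2) by (auto simp: P_def)
      then have "V \<subseteq> W" by blast
      then have "\<pi> W (x U) = x W" using comp[OF V(1) q(2,3,5,4) v] q by (simp add: x_def)
      then show ?thesis using xZ q by (simp add: C_def)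
    qed
    then show ?thesis using Q(3) by blast
  qed
  ultimately have "\<Inter>(C ` P) \<noteq> {}" unfolding compact_space_fip by blast
  then obtain x where x: "\<And>p. p \<in> P \<Longrightarrow> x \<in> C p" by blast
  show thesis
  proof (rule that)
    show "x U \<in> Z U" if "U \<in> I" for U using x[of "(U, U)"] that by (auto simp: P_def C_def)
    show "\<pi> W (x U) = x W" if "U \<in> I" "W \<in> I" "U \<subseteq> W" for U W
      using x[of "(U, W)"] that by (auto simp: P_def C_def)
  qed
qed

definition vec_of :: "'a set \<Rightarrow> ('a \<Rightarrow> bit) \<Rightarrow> ('a \<Rightarrow>\<^sub>0 bit)" where
  "vec_of S f = (\<Sum>a\<in>S. if f a = 1 then unit_vec a else 0)"

lemma lookup_vec_of: "finite S \<Longrightarrow> plookup (vec_of S f) a = (if a \<in> S then f a else 0)"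
proof -
  assume S: "finite S"
  have "plookup (vec_of S f) a = (\<Sum>b\<in>S. if b = a then f b else 0)"
    unfolding vec_of_def lookup_sum by (rule sum.cong) (auto simp: lookup_single when_def)
  then show ?thesis using S by simp
qed

lemma keys_vec_of: "finite S \<Longrightarrow> pkeys (vec_of S f) \<subseteq> S"
  by (auto simp: in_keys_iff lookup_vec_of split: if_splits)

lemma lin_bit: "finite S \<Longrightarrow> pkeys v \<subseteq> S \<Longrightarrow> lin f v = (\<Sum>a\<in>S. plookup v a * f a)" for f :: "'a \<Rightarrow> bit"
proof -
  assume "finite S" "pkeys v \<subseteq> S"
  then have "lin f v = (\<Sum>a\<in>S. if plookup v a = 1 then f a else 0)" by (rule lin_altdef)
  also have "\<dots> = (\<Sum>a\<in>S. plookup v a * f a)" by (rule sum.cong) auto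
  finally show ?thesis .
qed

lemma lin_vec_of_bit: "finite S \<Longrightarrow> lin g (vec_of S f) = (\<Sum>a\<in>S. f a * g a)" for g :: "'a \<Rightarrow> bit"
  by (simp add: lin_bit keys_vec_of lookup_vec_of)

locale top_group = group G for G :: "('g, 'm) monoid_scheme" (structure) +
  fixes T :: "'g topology"
  assumes topspace_T: "topspace T = carrier G"
    and finite_quotient: "U \<in> open_normal G T \<Longrightarrow> finite (carrier (G Mod U))"
begin

abbreviation "ON \<equiv> open_normal G T"
abbreviation "CA \<equiv> completed_group_algebra G T"
abbreviation "AI \<equiv> augmentation_ideal G T"
abbreviation "AP \<equiv> augmentation_power G T"

lemma ON_normal: "U \<in> ON \<Longrightarrow> U \<lhd> G"
  by (simp add: open_normal_def)

lemma ON_Int: "U \<in> ON \<Longrightarrow> W \<in> ON \<Longrightarrow> U \<inter> W \<in> ON"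
proof -
  assume U: "U \<in> ON" and W: "W \<in> ON"
  have "\<Inter>{U, W} \<lhd> G" by (rule normal_Inter) (use U W ON_normal in auto)
  then show ?thesis using U W by (auto simp: open_normal_def)
qed

lemma ON_carrier: "carrier G \<in> ON"
  using openin_topspace[of T] by (simp add: open_normal_def topspace_T normal_inv_iff subgroup_self)

definition cvec :: "'g set \<Rightarrow> ('g set \<Rightarrow> 'g set \<Rightarrow> bit) \<Rightarrow> ('g set \<Rightarrow>\<^sub>0 bit)" where
  "cvec U a = vec_of (carrier (G Mod U)) (a U)"

text \<open>The transition map of group algebras: for U contained in W and a coset C of U,
  \<open>W <#> C\<close> is the coset of W that contains C.\<close>

definition push :: "'g set \<Rightarrow> ('g set \<Rightarrow>\<^sub>0 bit) \<Rightarrow> ('g set \<Rightarrow>\<^sub>0 bit)" where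
  "push W = lin (\<lambda>C. unit_vec (W <#> C))"

lemma add_map_push: "add_map (push W)"
  unfolding push_def by (rule add_map_lin)

lemma coset_carrier: "U \<in> ON \<Longrightarrow> g \<in> carrier G \<Longrightarrow> U #> g \<in> carrier (G Mod U)"
  by (auto simp: carrier_FactGroup)

lemma coset_cases:
  assumes "C \<in> carrier (G Mod U)"
  obtains g where "g \<in> carrier G" "C = U #> g"
  using assms by (auto simp: carrier_FactGroup)

lemma set_mult_coset:
  assumes U: "U \<in> ON" and W: "W \<in> ON" and UW: "U \<subseteq> W" and g: "g \<in> carrier G"
  shows "W <#> (U #> g) = W #> g"
proof -
  interpret U: normal U G by (rule ON_normal[OF U])
  interpret W: normal W G by (rule ON_normal[OF W])
  have "W <#> U = W"
  proof
    show "W <#> U \<subseteq> W" using UW W.m_closed by (auto simp: set_mult_def)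
    show "W \<subseteq> W <#> U" unfolding set_mult_def using W.mem_carrier by (force intro: bexI[of _ \<one>] simp: U.one_closed)
  qed
  moreover have "W <#> (U #> g) = (W <#> U) #> g"
    by (rule setmult_rcos_assoc[OF W.subset U.subset g])
  ultimately show ?thesis by simp
qed

lemma push_comp:
  assumes "U \<in> ON" "W \<in> ON" "W' \<in> ON" "U \<subseteq> W" "W \<subseteq> W'" "pkeys v \<subseteq> carrier (G Mod U)"
  shows "push W' (push W v) = push W' v"
  unfolding push_def lin_lin
proof (rule lin_cong)
  fix C assume "C \<in> pkeys v"
  then obtain g where "g \<in> carrier G" "C = U #> g" using assms(6) coset_cases by blast
  then show "lin (\<lambda>C. unit_vec (W' <#> C)) (unit_vec (W <#> C)) = unit_vec (W' <#> C)"
    using assms set_mult_coset by simp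
qed

lemma push_keys:
  assumes "U \<in> ON" "W \<in> ON" "U \<subseteq> W" "pkeys v \<subseteq> carrier (G Mod U)"
  shows "pkeys (push W v) \<subseteq> carrier (G Mod W)"
  unfolding push_def
proof (rule keys_lin_subset)
  fix C assume "C \<in> pkeys v"
  then obtain g where "g \<in> carrier G" "C = U #> g" using assms(4) coset_cases by blast
  then show "pkeys (unit_vec (W <#> C)) \<subseteq> carrier (G Mod W)"
    using assms set_mult_coset coset_carrier by simp
qed

lemma lookup_cvec: "U \<in> ON \<Longrightarrow> C \<in> carrier (G Mod U) \<Longrightarrow> plookup (cvec U a) C = a U C"
  by (simp add: cvec_def lookup_vec_of finite_quotient)

lemma cvec_keys: "U \<in> ON \<Longrightarrow> pkeys (cvec U a) \<subseteq> carrier (G Mod U)"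
  by (simp add: cvec_def keys_vec_of finite_quotient)

lemma lookup_push:
  assumes U: "U \<in> ON" and W: "W \<in> ON" and UW: "U \<subseteq> W" and C: "C \<in> carrier (G Mod W)"
  shows "plookup (push W (cvec U a)) C = (\<Sum>D\<in>{D \<in> carrier (G Mod U). D \<subseteq> C}. a U D)"
proof -
  interpret W: normal W G by (rule ON_normal[OF W])
  interpret U: normal U G by (rule ON_normal[OF U])
  have iff: "W <#> D = C \<longleftrightarrow> D \<subseteq> C" if D: "D \<in> carrier (G Mod U)" for D
  proof -
    obtain g where g: "g \<in> carrier G" "D = U #> g" using D coset_cases by blast
    obtain c where c: "c \<in> carrier G" "C = W #> c" using C coset_cases by blast
    have "D \<subseteq> W #> g" using g UW by (auto simp: r_coset_def)
    moreover have "g \<in> D" using g rcos_self U.subgroup_axioms by blast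
    ultimately show ?thesis
      using set_mult_coset[OF U W UW g(1)] g(2) repr_independence[of g W c] c W.subgroup_axioms by auto
  qed
  have "plookup (push W (cvec U a)) C = lin (\<lambda>D. if W <#> D = C then 1 else 0) (cvec U a)"
    unfolding push_def lookup_lin by (rule lin_cong) (simp add: lookup_single when_def)
  also have "\<dots> = (\<Sum>D\<in>carrier (G Mod U). a U D * (if W <#> D = C then 1 else 0))"
    unfolding cvec_def by (rule lin_vec_of_bit[OF finite_quotient[OF U]])
  also have "\<dots> = (\<Sum>D\<in>carrier (G Mod U). if D \<subseteq> C then a U D else 0)"
    using iff by (intro sum.cong) auto
  also have "\<dots> = (\<Sum>D\<in>{D \<in> carrier (G Mod U). D \<subseteq> C}. a U D)"
    using finite_quotient[OF U] by (simp add: sum.inter_filter)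
  finally show ?thesis .
qed

lemma CA_carrier_iff:
  "a \<in> carrier CA \<longleftrightarrow> a \<in> (\<Pi>\<^sub>E U\<in>ON. carrier (G Mod U) \<rightarrow>\<^sub>E UNIV) \<and>
     (\<forall>U\<in>ON. \<forall>W\<in>ON. U \<subseteq> W \<longrightarrow> cvec W a = push W (cvec U a))"
proof -
  have "(\<forall>C\<in>carrier (G Mod W). a W C = (\<Sum>D\<in>{D \<in> carrier (G Mod U). D \<subseteq> C}. a U D))
     \<longleftrightarrow> cvec W a = push W (cvec U a)" if UW: "U \<in> ON" "W \<in> ON" "U \<subseteq> W" for U W
  proof
    assume *: "\<forall>C\<in>carrier (G Mod W). a W C = (\<Sum>D\<in>{D \<in> carrier (G Mod U). D \<subseteq> C}. a U D)"
    show "cvec W a = push W (cvec U a)"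
    proof (rule poly_mapping_eqI)
      fix C show "plookup (cvec W a) C = plookup (push W (cvec U a)) C"
      proof (cases "C \<in> carrier (G Mod W)")
        case True
        then show ?thesis using * UW lookup_push lookup_cvec by simp
      next
        case False
        then show ?thesis using cvec_keys[OF UW(2)] push_keys[OF UW cvec_keys[OF UW(1)]]
          by (metis not_in_keys_iff_lookup_eq_zero subsetD)
      qed
    qed
  next
    assume e: "cvec W a = push W (cvec U a)"
    show "\<forall>C\<in>carrier (G Mod W). a W C = (\<Sum>D\<in>{D \<in> carrier (G Mod U). D \<subseteq> C}. a U D)"
    proof
      fix C assume C: "C \<in> carrier (G Mod W)"
      have "plookup (cvec W a) C = plookup (push W (cvec U a)) C" by (simp only: e)
      then show "a W C = (\<Sum>D\<in>{D \<in> carrier (G Mod U). D \<subseteq> C}. a U D)"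
        unfolding lookup_push[OF UW C] lookup_cvec[OF UW(2) C] .
    qed
  qed
  then show ?thesis by (auto simp: completed_group_algebra_def group_algebra_def)
qed

lemma CA_carrier_ext: "a \<in> carrier CA \<Longrightarrow> a \<in> (\<Pi>\<^sub>E U\<in>ON. carrier (G Mod U) \<rightarrow>\<^sub>E UNIV)"
  unfolding CA_carrier_iff by (rule conjunct1)

lemma CA_carrier_push: "a \<in> carrier CA \<Longrightarrow> U \<in> ON \<Longrightarrow> W \<in> ON \<Longrightarrow> U \<subseteq> W \<Longrightarrow> cvec W a = push W (cvec U a)"
  unfolding CA_carrier_iff by blast

lemma CA_ext:
  assumes "a \<in> (\<Pi>\<^sub>E U\<in>ON. carrier (G Mod U) \<rightarrow>\<^sub>E UNIV)" "b \<in> (\<Pi>\<^sub>E U\<in>ON. carrier (G Mod U) \<rightarrow>\<^sub>E UNIV)"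
    and "\<And>U. U \<in> ON \<Longrightarrow> cvec U a = cvec U b"
  shows "a = b"
proof (rule PiE_ext[OF assms(1,2)])
  fix U assume U: "U \<in> ON"
  have aU: "a U \<in> carrier (G Mod U) \<rightarrow>\<^sub>E UNIV" "b U \<in> carrier (G Mod U) \<rightarrow>\<^sub>E UNIV" using assms U by auto
  show "a U = b U"
    by (rule PiE_ext[OF aU]) (metis lookup_cvec[OF U] assms(3)[OF U])
qed

lemma cvec_add: "U \<in> ON \<Longrightarrow> cvec U (a \<oplus>\<^bsub>CA\<^esub> b) = cvec U a + cvec U b"
  by (rule poly_mapping_eqI)
    (simp add: cvec_def lookup_vec_of finite_quotient lookup_add completed_group_algebra_def group_algebra_def)

lemma add_ext: "a \<oplus>\<^bsub>CA\<^esub> b \<in> (\<Pi>\<^sub>E U\<in>ON. carrier (G Mod U) \<rightarrow>\<^sub>E UNIV)"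
  by (auto simp: completed_group_algebra_def group_algebra_def)

lemma mult_ext: "a \<otimes>\<^bsub>CA\<^esub> b \<in> (\<Pi>\<^sub>E U\<in>ON. carrier (G Mod U) \<rightarrow>\<^sub>E UNIV)"
  by (auto simp: completed_group_algebra_def group_algebra_def)

lemma CA_add_closed: "a \<in> carrier CA \<Longrightarrow> b \<in> carrier CA \<Longrightarrow> a \<oplus>\<^bsub>CA\<^esub> b \<in> carrier CA"
proof -
  assume a: "a \<in> carrier CA" and b: "b \<in> carrier CA"
  have "cvec W (a \<oplus>\<^bsub>CA\<^esub> b) = push W (cvec U (a \<oplus>\<^bsub>CA\<^esub> b))" if "U \<in> ON" "W \<in> ON" "U \<subseteq> W" for U W
    unfolding cvec_add[OF that(1)] cvec_add[OF that(2)] add_mapD[OF add_map_push]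
      CA_carrier_push[OF a that] CA_carrier_push[OF b that] ..
  then show ?thesis unfolding CA_carrier_iff by (intro conjI ballI impI add_ext)
qed

lemma cvec_zero: "U \<in> ON \<Longrightarrow> cvec U \<zero>\<^bsub>CA\<^esub> = 0"
  by (rule poly_mapping_eqI)
    (simp add: cvec_def lookup_vec_of finite_quotient completed_group_algebra_def group_algebra_def)

lemma CA_zero_closed: "\<zero>\<^bsub>CA\<^esub> \<in> carrier CA"
proof -
  have ext: "\<zero>\<^bsub>CA\<^esub> \<in> (\<Pi>\<^sub>E U\<in>ON. carrier (G Mod U) \<rightarrow>\<^sub>E UNIV)"
    by (auto simp: completed_group_algebra_def group_algebra_def)
  have "cvec W \<zero>\<^bsub>CA\<^esub> = push W (cvec U \<zero>\<^bsub>CA\<^esub>)" if "U \<in> ON" "W \<in> ON" for U W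
    using that by (simp add: cvec_zero add_map_zero[OF add_map_push])
  then show ?thesis unfolding CA_carrier_iff by (intro conjI ballI impI ext)
qed

text \<open>Evaluated from the definite description behind \<open>a_inv\<close>: in characteristic
  two, b + c = 0 exactly if b = c.\<close>

lemma CA_uminus: "a \<in> carrier CA \<Longrightarrow> \<ominus>\<^bsub>CA\<^esub> a = a"
proof -
  assume a: "a \<in> carrier CA"
  have z: "\<zero>\<^bsub>CA\<^esub> \<in> (\<Pi>\<^sub>E U\<in>ON. carrier (G Mod U) \<rightarrow>\<^sub>E UNIV)"
    by (rule CA_carrier_ext[OF CA_zero_closed])
  have 1: "b \<oplus>\<^bsub>CA\<^esub> c = \<zero>\<^bsub>CA\<^esub> \<longleftrightarrow> b = c" if bc: "b \<in> carrier CA" "c \<in> carrier CA" for b c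
  proof
    assume "b \<oplus>\<^bsub>CA\<^esub> c = \<zero>\<^bsub>CA\<^esub>"
    then have "cvec U b = cvec U c" if "U \<in> ON" for U
      using cvec_add[OF that, of b c] cvec_zero[OF that] by (simp add: add_eq_zero_iff_char_two)
    then show "b = c" by (intro CA_ext CA_carrier_ext bc)
  next
    assume "b = c"
    then show "b \<oplus>\<^bsub>CA\<^esub> c = \<zero>\<^bsub>CA\<^esub>" by (intro CA_ext[OF add_ext z]) (simp add: cvec_add cvec_zero)
  qed
  show ?thesis
    unfolding a_inv_def m_inv_def using 1 a by (intro the_equality) auto
qed

lemma cvec_one: "U \<in> ON \<Longrightarrow> cvec U \<one>\<^bsub>CA\<^esub> = unit_vec U"
proof (rule poly_mapping_eqI)
  fix C assume U: "U \<in> ON"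
  have "U \<in> carrier (G Mod U)"
    using monoid.one_closed[OF group.is_monoid[OF normal.factorgroup_is_group[OF ON_normal[OF U]]]] by simp
  then show "plookup (cvec U \<one>\<^bsub>CA\<^esub>) C = plookup (unit_vec U) C"
    using U by (auto simp: cvec_def lookup_vec_of finite_quotient completed_group_algebra_def group_algebra_def lookup_single)
qed

lemma cvec_group_like: "U \<in> ON \<Longrightarrow> g \<in> carrier G \<Longrightarrow> cvec U (group_like G T g) = unit_vec (U #> g)"
  by (rule poly_mapping_eqI)
    (auto simp: cvec_def lookup_vec_of finite_quotient group_like_def lookup_single coset_carrier)

lemma push_unit_vec: "U \<in> ON \<Longrightarrow> W \<in> ON \<Longrightarrow> U \<subseteq> W \<Longrightarrow> g \<in> carrier G \<Longrightarrow> push W (unit_vec (U #> g)) = unit_vec (W #> g)"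
  by (simp add: push_def set_mult_coset)

lemma coset_one: "U \<in> ON \<Longrightarrow> U #> \<one> = U"
  by (rule coset_mult_one[OF subgroup.subset[OF normal_imp_subgroup[OF ON_normal]]])

lemma group_like_closed: "g \<in> carrier G \<Longrightarrow> group_like G T g \<in> carrier CA"
  unfolding CA_carrier_iff
proof (intro conjI ballI impI)
  show "group_like G T g \<in> (\<Pi>\<^sub>E U\<in>ON. carrier (G Mod U) \<rightarrow>\<^sub>E UNIV)"
    by (auto simp: group_like_def)
qed (simp add: cvec_group_like push_unit_vec)

lemma group_like_one: "group_like G T \<one> = \<one>\<^bsub>CA\<^esub>"
proof (rule CA_ext)
  show "group_like G T \<one> \<in> (\<Pi>\<^sub>E U\<in>ON. carrier (G Mod U) \<rightarrow>\<^sub>E UNIV)"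
    by (auto simp: group_like_def)
  show "\<one>\<^bsub>CA\<^esub> \<in> (\<Pi>\<^sub>E U\<in>ON. carrier (G Mod U) \<rightarrow>\<^sub>E UNIV)"
    by (auto simp: completed_group_algebra_def group_algebra_def)
qed (simp add: cvec_group_like cvec_one coset_one)

definition glm :: "'g \<Rightarrow> 'g set \<Rightarrow> 'g set \<Rightarrow> bit" where
  "glm g = group_like G T g \<ominus>\<^bsub>CA\<^esub> \<one>\<^bsub>CA\<^esub>"

lemma glm_altdef: "g \<in> carrier G \<Longrightarrow> glm g = group_like G T g \<oplus>\<^bsub>CA\<^esub> \<one>\<^bsub>CA\<^esub>"
  using CA_uminus[OF group_like_closed[OF one_closed]] by (simp add: glm_def a_minus_def group_like_one)

lemma glm_closed: "g \<in> carrier G \<Longrightarrow> glm g \<in> carrier CA"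
  using CA_add_closed[OF group_like_closed group_like_closed[OF one_closed]] by (simp add: glm_altdef group_like_one)

lemma cvec_glm: "U \<in> ON \<Longrightarrow> g \<in> carrier G \<Longrightarrow> cvec U (glm g) = unit_vec (U #> g) + unit_vec U"
  by (simp add: glm_altdef cvec_add cvec_group_like cvec_one)

lemma augmentation_eq: "U \<in> ON \<Longrightarrow> (\<Sum>C\<in>carrier (G Mod U). a U C) = lin (\<lambda>_. 1) (cvec U a)"
  using lin_vec_of_bit[OF finite_quotient, of U "\<lambda>_. 1" "a U"] unfolding cvec_def mult_1_right by simp

lemma AI_iff: "a \<in> AI \<longleftrightarrow> a \<in> carrier CA \<and> (\<forall>U\<in>ON. lin (\<lambda>_. 1 :: bit) (cvec U a) = 0)"
  by (auto simp: augmentation_ideal_def augmentation_eq)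

lemma glm_AI: "g \<in> carrier G \<Longrightarrow> glm g \<in> AI"
  by (simp add: AI_iff glm_closed cvec_glm lin_add)

lemma AP_0: "AP 0 = carrier CA"
  by (simp add: augmentation_power_def nat_pow_def ideals_set_def)

lemma AP_Suc: "AP (Suc n) = ideal_prod CA (AP n) AI"
  by (simp add: augmentation_power_def nat_pow_def ideals_set_def)

text \<open>Convolution is the bilinear extension of the product of cosets: for given A and C, the
  equation A B = C has the single solution B = A^(-1) C.\<close>

lemma cvec_mult:
  assumes U: "U \<in> ON"
  shows "cvec U (a \<otimes>\<^bsub>CA\<^esub> b) = lin (\<lambda>A. lin (\<lambda>B. unit_vec (A <#> B)) (cvec U b)) (cvec U a)"
proof (rule poly_mapping_eqI)
  fix C
  let ?Q = "G Mod U"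
  interpret U: normal U G by (rule ON_normal[OF U])
  interpret Q: group ?Q by (rule U.factorgroup_is_group)
  have fin: "finite (carrier ?Q)" by (rule finite_quotient[OF U])
  have "plookup (lin (\<lambda>A. lin (\<lambda>B. unit_vec (A <#> B)) (cvec U b)) (cvec U a)) C
      = lin (\<lambda>A. lin (\<lambda>B. if A <#> B = C then 1 else 0) (cvec U b)) (cvec U a)"
    unfolding lookup_lin by (intro lin_cong) (simp add: lookup_single when_def)
  also have "\<dots> = (\<Sum>A\<in>carrier ?Q. a U A * (\<Sum>B\<in>carrier ?Q. b U B * (if A <#> B = C then 1 else 0)))"
    unfolding cvec_def lin_vec_of_bit[OF fin] ..
  also have "\<dots> = (if C \<in> carrier ?Q then \<Sum>A\<in>carrier ?Q. a U A * b U (inv\<^bsub>?Q\<^esub> A \<otimes>\<^bsub>?Q\<^esub> C) else 0)"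
  proof (cases "C \<in> carrier ?Q")
    case True
    have "(\<Sum>B\<in>carrier ?Q. b U B * (if A <#> B = C then 1 else 0)) = b U (inv\<^bsub>?Q\<^esub> A \<otimes>\<^bsub>?Q\<^esub> C)"
      if A: "A \<in> carrier ?Q" for A
    proof -
      have "A <#> B = C \<longleftrightarrow> B = inv\<^bsub>?Q\<^esub> A \<otimes>\<^bsub>?Q\<^esub> C" if "B \<in> carrier ?Q" for B
        using Q.inv_solve_left[OF that A True] by (auto simp: eq_commute)
      then have "(\<Sum>B\<in>carrier ?Q. b U B * (if A <#> B = C then 1 else 0))
          = (\<Sum>B\<in>carrier ?Q. if B = inv\<^bsub>?Q\<^esub> A \<otimes>\<^bsub>?Q\<^esub> C then b U B else 0)"
        by (intro sum.cong) auto
      then show ?thesis using fin Q.m_closed[OF Q.inv_closed[OF A] True] by simp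
    qed
    then show ?thesis using True by simp
  next
    case False
    have "A <#> B \<noteq> C" if "A \<in> carrier ?Q" "B \<in> carrier ?Q" for A B
      using Q.m_closed[OF that] False by auto
    then have "(\<Sum>A\<in>carrier ?Q. a U A * (\<Sum>B\<in>carrier ?Q. b U B * (if A <#> B = C then 1 else 0))) = 0"
      by (intro sum.neutral ballI) (simp add: sum.neutral)
    then show ?thesis using False by simp
  qed
  also have "\<dots> = plookup (cvec U (a \<otimes>\<^bsub>CA\<^esub> b)) C"
    using U fin by (simp add: cvec_def lookup_vec_of completed_group_algebra_def group_algebra_def)
  finally show "plookup (cvec U (a \<otimes>\<^bsub>CA\<^esub> b)) C = plookup (lin (\<lambda>A. lin (\<lambda>B. unit_vec (A <#> B)) (cvec U b)) (cvec U a)) C"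
    by simp
qed

subsection \<open>Elements of the Zassenhaus filtration raise filtrations of representations\<close>

text \<open>The representation factors through G Mod U, so the completed group algebra acts through
  its component at U. An element of augmentation zero acts as a sum of operators g - 1, so it raises
  the filtration by one, and products of n of them by n.\<close>

lemma zassenhaus_raises:
  fixes \<rho> :: "'g \<Rightarrow> 'v::char_two \<Rightarrow> 'v"
  assumes F: "filt F"
    and \<rho>_add: "\<And>g. g \<in> carrier G \<Longrightarrow> add_map (\<rho> g)"
    and \<rho>_mult: "\<And>g h v. g \<in> carrier G \<Longrightarrow> h \<in> carrier G \<Longrightarrow> \<rho> (g \<otimes> h) v = \<rho> g (\<rho> h v)"
    and U: "U \<in> ON" and \<rho>_U: "\<And>u v. u \<in> U \<Longrightarrow> \<rho> u v = v"
    and \<rho>_raises: "\<And>g. g \<in> carrier G \<Longrightarrow> filt.raises F 1 (\<lambda>v. \<rho> g v + v)"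
    and g: "g \<in> zassenhaus G T n" and v: "v \<in> F k"
  shows "\<rho> g v + v \<in> F (k + n)"
proof -
  interpret F: filt F by fact
  interpret U: normal U G by (rule ON_normal[OF U])
  interpret Q: group "G Mod U" by (rule U.factorgroup_is_group)
  define r where "r = (\<lambda>C. SOME g. g \<in> carrier G \<and> C = U #> g)"
  define R where "R = (\<lambda>C. \<rho> (r C))"
  have r: "r C \<in> carrier G \<and> C = U #> r C" if "C \<in> carrier (G Mod U)" for C
    unfolding r_def by (rule someI_ex) (use that coset_cases in blast)
  have \<rho>_cong: "\<rho> g v = \<rho> h v" if gh: "g \<in> carrier G" "h \<in> carrier G" "U #> g = U #> h" for g h v
  proof -
    have "g \<otimes> inv h \<in> U" using U.coset_eq_iff gh by blast
    moreover have "\<rho> g v = \<rho> (g \<otimes> inv h) (\<rho> h v)" using gh \<rho>_mult[of "g \<otimes> inv h" h v] by (simp add: m_assoc)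
    ultimately show ?thesis using \<rho>_U by simp
  qed
  have R: "R (U #> g) = \<rho> g" if "g \<in> carrier G" for g
    unfolding R_def using r[OF coset_carrier[OF U that]] \<rho>_cong that by blast
  have R_mult: "R (A <#> B) v = R A (R B v)" if AB: "A \<in> carrier (G Mod U)" "B \<in> carrier (G Mod U)" for A B v
  proof -
    obtain a b where ab: "a \<in> carrier G" "A = U #> a" "b \<in> carrier G" "B = U #> b" using AB coset_cases by metis
    then show ?thesis using U.rcos_sum[of a b] R \<rho>_mult by simp
  qed
  define act where "act = (\<lambda>a v. lin (\<lambda>C. R C v) (cvec U a))"
  have act_add: "act (a \<oplus>\<^bsub>CA\<^esub> b) v = act a v + act b v" for a b v
    by (simp add: act_def cvec_add[OF U] lin_add)
  have act_mult: "act (a \<otimes>\<^bsub>CA\<^esub> b) v = act a (act b v)" for a b v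
  proof -
    have "act (a \<otimes>\<^bsub>CA\<^esub> b) v = lin (\<lambda>A. lin (\<lambda>B. R (A <#> B) v) (cvec U b)) (cvec U a)"
      by (simp add: act_def cvec_mult[OF U] lin_lin)
    also have "\<dots> = lin (\<lambda>A. R A (act b v)) (cvec U a)"
    proof (rule lin_cong)
      fix A assume "A \<in> pkeys (cvec U a)"
      then have A: "A \<in> carrier (G Mod U)" using cvec_keys[OF U] by blast
      then have "add_map (R A)" using \<rho>_add R coset_cases by metis
      then have "R A (act b v) = lin (\<lambda>B. R A (R B v)) (cvec U b)"
        unfolding act_def by (rule lin_comp)
      also have "\<dots> = lin (\<lambda>B. R (A <#> B) v) (cvec U b)"
        using R_mult[OF A] cvec_keys[OF U, of b] by (intro lin_cong) auto
      finally show "lin (\<lambda>B. R (A <#> B) v) (cvec U b) = R A (act b v)" by simp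
    qed
    finally show ?thesis by (simp add: act_def)
  qed
  have AI: "F.raises 1 (act a)" if a: "a \<in> AI" for a
    unfolding F.raises_def
  proof (intro allI ballI)
    fix k v assume v: "v \<in> F k"
    \<comment> \<open>Augmentation zero means an even number of cosets in the support; hence adding
      v to every summand does not change the sum.\<close>
    have e: "even (card (pkeys (cvec U a)))"
    proof -
      have "lin (\<lambda>_. 1 :: bit) (cvec U a) = 0" using a U by (simp add: AI_iff)
      then have "(of_nat (card (pkeys (cvec U a))) :: bit) = 0" by (simp add: lin_def)
      moreover have "(of_nat m :: bit) = of_bool (odd m)" for m by (induction m) auto
      ultimately show ?thesis by (simp split: if_splits)
    qed
    have "lin (\<lambda>_. v) (cvec U a) = 0"
    proof -
      have "(\<Sum>x\<in>A. v) = (if even (card A) then 0 else v)" if "finite A" for A :: "'g set set"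
        using that by (induction A rule: finite_induct) auto
      then show ?thesis using e by (simp add: lin_def)
    qed
    then have "act a v = lin (\<lambda>C. R C v + v) (cvec U a)" by (simp add: act_def lin_plus)
    also have "\<dots> \<in> F (k + 1)"
    proof (rule lin_in[OF _ F.F_zero F.F_add])
      fix C assume "C \<in> pkeys (cvec U a)"
      then obtain g where "g \<in> carrier G" "C = U #> g" using cvec_keys[OF U] coset_cases by blast
      then show "R C v + v \<in> F (k + 1)" using F.raisesD[OF \<rho>_raises v] R by simp
    qed
    finally show "act a v \<in> F (k + 1)" .
  qed
  have AP: "a \<in> AP n \<Longrightarrow> F.raises n (act a)" for a n
  proof (induction n arbitrary: a)
    case 0
    have "act a v \<in> F k" if v: "v \<in> F k" for k v
      unfolding act_def
    proof (rule lin_in[OF _ F.F_zero F.F_add])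
      fix C assume "C \<in> pkeys (cvec U a)"
      then obtain g where g: "g \<in> carrier G" "C = U #> g" using cvec_keys[OF U] coset_cases by blast
      have "\<rho> g v + v \<in> F k" using F.raisesD[OF \<rho>_raises[OF g(1)] v] F.F_Suc by auto
      then have "(\<rho> g v + v) + v \<in> F k" using v F.F_add by blast
      then show "R C v \<in> F k" using R g by (simp add: add_ac)
    qed
    then show ?case by (simp add: F.raises_def)
  next
    case (Suc n)
    have "a \<in> ideal_prod CA (AP n) AI" using Suc.prems by (simp add: AP_Suc)
    then show ?case
    proof (induction rule: ideal_prod.induct)
      case (prod i j)
      then have "F.raises (n + 1) (\<lambda>v. act i (act j v))" using Suc.IH AI by (intro F.raises_comp)
      then show ?case by (simp add: F.raises_def act_mult)
    next
      case (sum a b)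
      then show ?case using F.raises_add[OF sum(3,4)] by (simp add: F.raises_def act_add)
    qed
  qed
  have gG: "g \<in> carrier G" and "glm g \<in> AP n" using g by (auto simp: zassenhaus_def glm_def)
  then have "act (glm g) v \<in> F (k + n)" using AP F.raisesD v by blast
  moreover have "act (glm g) v = \<rho> g v + v"
    using R[OF gG] R[OF one_closed] coset_one[OF U] \<rho>_U[OF U.one_closed]
    by (simp add: act_def cvec_glm[OF U gG] lin_add)
  ultimately show ?thesis by simp
qed

subsection \<open>Powers of the augmentation ideal are closed\<close>

text \<open>
  \<open>IP V x U n\<close> is the left ideal of the group algebra of \<open>G Mod U\<close> generated by the products of \<open>n\<close> factors \<open>x i - 1\<close>.
  Coefficients that exist modulo every \<open>U\<close> can be chosen compatibly, because there are finitely many choices for each \<open>U\<close>.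
\<close>

definition rt :: "'g \<Rightarrow> ('g set \<Rightarrow>\<^sub>0 bit) \<Rightarrow> ('g set \<Rightarrow>\<^sub>0 bit)" where
  "rt g v = lin (\<lambda>C. unit_vec (C #> g)) v + v"

lemma add_map_rt: "add_map (rt g)"
  by (simp add: add_map_def rt_def lin_add add_ac)

lemma cvec_mult_glm:
  assumes U: "U \<in> ON" and g: "g \<in> carrier G"
  shows "cvec U (a \<otimes>\<^bsub>CA\<^esub> glm g) = rt g (cvec U a)"
proof -
  interpret U: normal U G by (rule ON_normal[OF U])
  have "cvec U (a \<otimes>\<^bsub>CA\<^esub> glm g) = lin (\<lambda>A. unit_vec (A <#> (U #> g)) + unit_vec (A <#> U)) (cvec U a)"
    by (simp add: cvec_mult[OF U] cvec_glm[OF U g] lin_add)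
  also have "\<dots> = lin (\<lambda>A. unit_vec (A #> g) + unit_vec A) (cvec U a)"
  proof (rule lin_cong)
    fix A assume "A \<in> pkeys (cvec U a)"
    then obtain h where h: "h \<in> carrier G" "A = U #> h" using cvec_keys[OF U] coset_cases by blast
    have "A <#> (U #> g) = A #> g" using U.rcos_sum[OF h(1) g] h g by (simp add: coset_mult_assoc U.subset)
    moreover have "A <#> U = A" using U.rcos_sum[OF h(1) one_closed] h coset_one[OF U] by simp
    ultimately show "unit_vec (A <#> (U #> g)) + unit_vec (A <#> U) = unit_vec (A #> g) + unit_vec A" by simp
  qed
  finally show ?thesis by (simp add: rt_def lin_plus)
qed

lemma push_rt:
  assumes UW: "U \<in> ON" "W \<in> ON" "U \<subseteq> W" "pkeys v \<subseteq> carrier (G Mod U)" and g: "g \<in> carrier G"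
  shows "push W (rt g v) = rt g (push W v)"
proof -
  interpret U: normal U G by (rule ON_normal[OF UW(1)])
  interpret W: normal W G by (rule ON_normal[OF UW(2)])
  have "lin (\<lambda>C. unit_vec (W <#> (C #> g))) v = lin (\<lambda>C. unit_vec ((W <#> C) #> g)) v"
  proof (rule lin_cong)
    fix C assume "C \<in> pkeys v"
    then obtain h where h: "h \<in> carrier G" "C = U #> h" using UW(4) coset_cases by blast
    then show "unit_vec (W <#> (C #> g)) = unit_vec ((W <#> C) #> g)"
      using set_mult_coset[OF UW(1-3)] g by (simp add: coset_mult_assoc U.subset W.subset)
  qed
  then show ?thesis by (simp add: push_def rt_def lin_add lin_lin)
qed

primrec IP :: "'i set \<Rightarrow> ('i \<Rightarrow> 'g) \<Rightarrow> 'g set \<Rightarrow> nat \<Rightarrow> ('g set \<Rightarrow>\<^sub>0 bit) set" where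
  "IP V x U 0 = {v. pkeys v \<subseteq> carrier (G Mod U)}"
| "IP V x U (Suc n) = {\<Sum>i\<in>V. rt (x i) (p i) | p. \<forall>i\<in>V. p i \<in> IP V x U n}"

context
  fixes V :: "'i set" and x :: "'i \<Rightarrow> 'g"
  assumes fin_V: "finite V" and x: "\<And>i. i \<in> V \<Longrightarrow> x i \<in> carrier G"
begin

lemma rt_keys:
  assumes U: "U \<in> ON" and g: "g \<in> carrier G" and v: "pkeys v \<subseteq> carrier (G Mod U)"
  shows "pkeys (rt g v) \<subseteq> carrier (G Mod U)"
  unfolding rt_def
proof (rule keys_add_subset[OF keys_lin_subset v])
  interpret U: normal U G by (rule ON_normal[OF U])
  fix C assume "C \<in> pkeys v"
  then obtain h where h: "h \<in> carrier G" "C = U #> h" using v coset_cases by blast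
  then show "pkeys (unit_vec (C #> g)) \<subseteq> carrier (G Mod U)"
    using g by (simp add: coset_mult_assoc U.subset coset_carrier[OF U])
qed

lemma IP_keys: "U \<in> ON \<Longrightarrow> v \<in> IP V x U n \<Longrightarrow> pkeys v \<subseteq> carrier (G Mod U)"
proof (induction n arbitrary: v)
  case (Suc n)
  then obtain p where p: "v = (\<Sum>i\<in>V. rt (x i) (p i))" "\<forall>i\<in>V. p i \<in> IP V x U n" by auto
  have "v \<in> {v. pkeys v \<subseteq> carrier (G Mod U)}"
    unfolding p(1)
  proof (rule sum_in)
    show "rt (x i) (p i) \<in> {v. pkeys v \<subseteq> carrier (G Mod U)}" if "i \<in> V" for i
      using rt_keys[OF Suc.prems(1) x[OF that]] Suc.IH[OF Suc.prems(1)] p(2) that by simp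
  qed (simp_all add: keys_add_subset)
  then show ?case by simp
qed simp

lemma IP_push: "U \<in> ON \<Longrightarrow> W \<in> ON \<Longrightarrow> U \<subseteq> W \<Longrightarrow> v \<in> IP V x U n \<Longrightarrow> push W v \<in> IP V x W n"
proof (induction n arbitrary: v)
  case 0
  then show ?case using push_keys by simp
next
  case (Suc n)
  then obtain p where p: "v = (\<Sum>i\<in>V. rt (x i) (p i))" "\<forall>i\<in>V. p i \<in> IP V x U n" by auto
  have "push W v = (\<Sum>i\<in>V. rt (x i) (push W (p i)))"
    unfolding p(1) add_map_sum[OF add_map_push]
  proof (rule sum.cong)
    fix i assume "i \<in> V"
    then show "push W (rt (x i) (p i)) = rt (x i) (push W (p i))"
      using push_rt[OF Suc.prems(1-3) IP_keys[OF Suc.prems(1)] x] p(2) by blast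
  qed simp
  then show ?case using Suc p by auto
qed

lemma IP_zero: "0 \<in> IP V x U n"
proof (induction n)
  case (Suc n)
  have "0 = (\<Sum>i\<in>V. rt (x i) 0)" using add_map_zero[OF add_map_rt] by simp
  then show ?case using Suc by auto
qed simp

lemma IP_add: "u \<in> IP V x U n \<Longrightarrow> v \<in> IP V x U n \<Longrightarrow> u + v \<in> IP V x U n"
proof (induction n arbitrary: u v)
  case 0
  then show ?case by (simp add: keys_add_subset)
next
  case (Suc n)
  then obtain p q where p: "u = (\<Sum>i\<in>V. rt (x i) (p i))" "\<forall>i\<in>V. p i \<in> IP V x U n"
    "v = (\<Sum>i\<in>V. rt (x i) (q i))" "\<forall>i\<in>V. q i \<in> IP V x U n" by auto
  have "u + v = (\<Sum>i\<in>V. rt (x i) (p i + q i))"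
    by (simp add: p(1,3) sum.distrib add_mapD[OF add_map_rt])
  then show ?case using Suc.IH p(2,4) by auto
qed

lemma IP_rt: "i \<in> V \<Longrightarrow> v \<in> IP V x U n \<Longrightarrow> rt (x i) v \<in> IP V x U (Suc n)"
proof -
  assume i: "i \<in> V" and v: "v \<in> IP V x U n"
  have "rt (x i) v = (\<Sum>j\<in>V. rt (x j) (if j = i then v else 0))"
    using fin_V i add_map_zero[OF add_map_rt] by (simp add: if_distrib[of "rt _"] cong: if_cong)
  then show ?thesis using v IP_zero by (auto intro!: exI[of _ "\<lambda>j. if j = i then v else 0"])
qed

lemma AP_zero: "\<zero>\<^bsub>CA\<^esub> \<in> AP n"
proof (induction n)
  case 0
  then show ?case by (simp add: AP_0 CA_zero_closed)
next
  case (Suc n)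
  have "\<zero>\<^bsub>CA\<^esub> \<in> AI" by (simp add: AI_iff CA_zero_closed cvec_zero)
  then have "\<zero>\<^bsub>CA\<^esub> \<otimes>\<^bsub>CA\<^esub> \<zero>\<^bsub>CA\<^esub> \<in> AP (Suc n)" unfolding AP_Suc using Suc by (rule ideal_prod.prod[rotated])
  moreover have "\<zero>\<^bsub>CA\<^esub> \<otimes>\<^bsub>CA\<^esub> \<zero>\<^bsub>CA\<^esub> = \<zero>\<^bsub>CA\<^esub>"
    by (rule CA_ext[OF mult_ext CA_carrier_ext[OF CA_zero_closed]]) (simp add: cvec_mult cvec_zero)
  ultimately show ?case by simp
qed

text \<open>Induction on n. Compatible coefficients define elements a_i of the completed algebra,
  which lie in the n-th power by induction, and a is the finite sum of the products a_i (x_i -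
  1).\<close>

lemma IP_closed: "a \<in> carrier CA \<Longrightarrow> (\<And>U. U \<in> ON \<Longrightarrow> cvec U a \<in> IP V x U n) \<Longrightarrow> a \<in> AP n"
proof (induction n arbitrary: a)
  case 0
  then show ?case by (simp add: AP_0)
next
  case (Suc n)
  \<comment> \<open>All ways to write the component of \<open>a\<close> at U with coefficients in
    \<open>IP V x U n\<close>. The set is finite as V and G Mod U are, and the pushforward respects
    it.\<close>
  define Z where "Z = (\<lambda>U. {p \<in> V \<rightarrow>\<^sub>E IP V x U n. (\<Sum>i\<in>V. rt (x i) (p i)) = cvec U a})"
  define \<pi> where "\<pi> = (\<lambda>W p. \<lambda>i\<in>V. push W (p i))"
  obtain q where q: "\<And>U. U \<in> ON \<Longrightarrow> q U \<in> Z U" "\<And>U W. U \<in> ON \<Longrightarrow> W \<in> ON \<Longrightarrow> U \<subseteq> W \<Longrightarrow> \<pi> W (q U) = q W"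
  proof (rule finite_inverse_limit[of ON Z \<pi>])
    show "ON \<noteq> {}" using ON_carrier by blast
    show "U \<inter> W \<in> ON" if "U \<in> ON" "W \<in> ON" for U W by (rule ON_Int[OF that])
    show "finite (Z U)" if U: "U \<in> ON" for U
    proof -
      have "finite (IP V x U n)"
        by (rule finite_subset[OF _ finite_vectors[OF finite_quotient[OF U]]]) (use IP_keys[OF U] in blast)
      then have "finite (V \<rightarrow>\<^sub>E IP V x U n)" using fin_V by (intro finite_PiE) auto
      then show ?thesis by (rule rev_finite_subset) (auto simp: Z_def)
    qed
    show "Z U \<noteq> {}" if U: "U \<in> ON" for U
    proof -
      obtain p where p: "cvec U a = (\<Sum>i\<in>V. rt (x i) (p i))" "\<forall>i\<in>V. p i \<in> IP V x U n"
        using Suc.prems(2)[OF U] by auto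
      then have "restrict p V \<in> Z U" by (auto simp: Z_def)
      then show ?thesis by blast
    qed
    show "\<pi> W p \<in> Z W" if UW: "U \<in> ON" "W \<in> ON" "U \<subseteq> W" and p: "p \<in> Z U" for U W p
    proof -
      have pi: "p i \<in> IP V x U n" if "i \<in> V" for i using p that by (auto simp: Z_def)
      have "(\<Sum>i\<in>V. rt (x i) (\<pi> W p i)) = (\<Sum>i\<in>V. push W (rt (x i) (p i)))"
        using push_rt[OF UW IP_keys[OF UW(1) pi] x] by (intro sum.cong) (auto simp: \<pi>_def)
      also have "\<dots> = push W (cvec U a)" using p by (simp add: Z_def flip: add_map_sum[OF add_map_push])
      also have "\<dots> = cvec W a" by (rule CA_carrier_push[OF Suc.prems(1) UW, symmetric])
      finally show ?thesis using pi IP_push[OF UW] by (auto simp: Z_def \<pi>_def)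
    qed
    show "\<pi> W' (\<pi> W p) = \<pi> W' p" if UW: "U \<in> ON" "W \<in> ON" "W' \<in> ON" "U \<subseteq> W" "W \<subseteq> W'" and p: "p \<in> Z U" for U W W' p
    proof -
      have "p i \<in> IP V x U n" if "i \<in> V" for i using p that by (auto simp: Z_def)
      then have "push W' (push W (p i)) = push W' (p i)" if "i \<in> V" for i
        using push_comp[OF UW IP_keys[OF UW(1)]] that by blast
      then show ?thesis
        unfolding \<pi>_def by (intro restrict_ext) simp
    qed
  next
    fix q assume "\<And>U. U \<in> ON \<Longrightarrow> q U \<in> Z U" "\<And>U W. U \<in> ON \<Longrightarrow> W \<in> ON \<Longrightarrow> U \<subseteq> W \<Longrightarrow> \<pi> W (q U) = q W"
    then show thesis by (rule that)
  qed
  define mk :: "('g set \<Rightarrow> 'g set \<Rightarrow>\<^sub>0 bit) \<Rightarrow> 'g set \<Rightarrow> 'g set \<Rightarrow> bit" where "mk = (\<lambda>p. \<lambda>U\<in>ON. \<lambda>C\<in>carrier (G Mod U). plookup (p U) C)"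
  have cvec_mk: "cvec U (mk p) = p U" if "U \<in> ON" "pkeys (p U) \<subseteq> carrier (G Mod U)" for p U
  proof (rule poly_mapping_eqI)
    fix C show "plookup (cvec U (mk p)) C = plookup (p U) C"
      using that by (auto simp: cvec_def lookup_vec_of finite_quotient mk_def in_keys_iff)
  qed
  have mk_ext: "mk p \<in> (\<Pi>\<^sub>E U\<in>ON. carrier (G Mod U) \<rightarrow>\<^sub>E UNIV)" for p by (auto simp: mk_def)
  have qI: "q U i \<in> IP V x U n" if "U \<in> ON" "i \<in> V" for U i using q(1)[OF that(1)] that(2) by (auto simp: Z_def)
  have ai: "cvec U (mk (\<lambda>U. q U i)) = q U i" if "U \<in> ON" "i \<in> V" for U i
    using cvec_mk[of U "\<lambda>U. q U i"] IP_keys[OF that(1) qI[OF that]] that(1) by simp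
  have aiAP: "mk (\<lambda>U. q U i) \<in> AP n" if i: "i \<in> V" for i
  proof (rule Suc.IH)
    show "mk (\<lambda>U. q U i) \<in> carrier CA"
      unfolding CA_carrier_iff
    proof (intro conjI mk_ext ballI impI)
      fix U W assume UW: "U \<in> ON" "W \<in> ON" "U \<subseteq> W"
      have "q W i = push W (q U i)" using q(2)[OF UW] i by (auto simp: \<pi>_def dest: fun_cong[of _ _ i])
      then show "cvec W (mk (\<lambda>U. q U i)) = push W (cvec U (mk (\<lambda>U. q U i)))" using ai UW i by simp
    qed
    show "cvec U (mk (\<lambda>U. q U i)) \<in> IP V x U n" if "U \<in> ON" for U using ai qI that i by simp
  qed
  \<comment> \<open>Elements of \<open>ideal_prod\<close> are generated by single products and
    binary sums, so the finite sum is assembled one index at a time.\<close>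
  have "F \<subseteq> V \<Longrightarrow> mk (\<lambda>U. \<Sum>i\<in>F. rt (x i) (q U i)) \<in> AP (Suc n)" if "finite F" for F
    using that
  proof (induction F rule: finite_induct)
    case empty
    have "mk (\<lambda>U. 0) = \<zero>\<^bsub>CA\<^esub>"
      by (rule CA_ext[OF mk_ext CA_carrier_ext[OF CA_zero_closed]]) (simp add: cvec_mk cvec_zero)
    then show ?case using AP_zero by simp
  next
    case (insert i F)
    have k: "pkeys (rt (x j) (q U j)) \<subseteq> carrier (G Mod U)" if "U \<in> ON" "j \<in> insert i F" for U j
    proof -
      have "j \<in> V" using that insert.prems by blast
      then show ?thesis using rt_keys[OF that(1) x IP_keys[OF that(1) qI[OF that(1)]]] by blast
    qed
    have kF: "pkeys (\<Sum>j\<in>F'. rt (x j) (q U j)) \<subseteq> carrier (G Mod U)" if "U \<in> ON" "F' \<subseteq> insert i F" for U F'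
    proof -
      have "(\<Sum>j\<in>F'. rt (x j) (q U j)) \<in> {v. pkeys v \<subseteq> carrier (G Mod U)}"
      proof (rule sum_in)
        show "rt (x j) (q U j) \<in> {v. pkeys v \<subseteq> carrier (G Mod U)}" if "j \<in> F'" for j
          using k[OF \<open>U \<in> ON\<close>, of j] \<open>F' \<subseteq> insert i F\<close> that by blast
      qed (simp_all add: keys_add_subset)
      then show ?thesis by simp
    qed
    have "mk (\<lambda>U. \<Sum>i\<in>insert i F. rt (x i) (q U i))
        = (mk (\<lambda>U. q U i) \<otimes>\<^bsub>CA\<^esub> glm (x i)) \<oplus>\<^bsub>CA\<^esub> mk (\<lambda>U. \<Sum>i\<in>F. rt (x i) (q U i))"
    proof (rule CA_ext[OF mk_ext add_ext])
      fix U assume U: "U \<in> ON"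
      have "cvec U (mk (\<lambda>U. \<Sum>i\<in>insert i F. rt (x i) (q U i))) = (\<Sum>i\<in>insert i F. rt (x i) (q U i))"
        using cvec_mk[of U "\<lambda>U. \<Sum>i\<in>insert i F. rt (x i) (q U i)"] kF[OF U subset_refl] U by blast
      moreover have "cvec U (mk (\<lambda>U. \<Sum>i\<in>F. rt (x i) (q U i))) = (\<Sum>i\<in>F. rt (x i) (q U i))"
        using cvec_mk[of U "\<lambda>U. \<Sum>i\<in>F. rt (x i) (q U i)"] kF[OF U, of F] U by blast
      ultimately show "cvec U (mk (\<lambda>U. \<Sum>i\<in>insert i F. rt (x i) (q U i)))
        = cvec U ((mk (\<lambda>U. q U i) \<otimes>\<^bsub>CA\<^esub> glm (x i)) \<oplus>\<^bsub>CA\<^esub> mk (\<lambda>U. \<Sum>i\<in>F. rt (x i) (q U i)))"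
        using insert U x ai by (simp add: cvec_add cvec_mult_glm)
    qed
    moreover have "mk (\<lambda>U. q U i) \<otimes>\<^bsub>CA\<^esub> glm (x i) \<in> AP (Suc n)"
      unfolding AP_Suc using insert.prems aiAP glm_AI x by (intro ideal_prod.prod) auto
    ultimately show ?case
      using insert unfolding AP_Suc by (auto intro: ideal_prod.sum)
  qed
  from this[OF fin_V] have "mk (\<lambda>U. \<Sum>i\<in>V. rt (x i) (q U i)) \<in> AP (Suc n)" by simp
  moreover have "mk (\<lambda>U. \<Sum>i\<in>V. rt (x i) (q U i)) = a"
  proof (rule CA_ext[OF mk_ext])
    show "a \<in> (\<Pi>\<^sub>E U\<in>ON. carrier (G Mod U) \<rightarrow>\<^sub>E UNIV)" by (rule CA_carrier_ext[OF Suc.prems(1)])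
    fix U assume U: "U \<in> ON"
    have "(\<Sum>i\<in>V. rt (x i) (q U i)) = cvec U a" using q(1)[OF U] by (simp add: Z_def)
    then show "cvec U (mk (\<lambda>U. \<Sum>i\<in>V. rt (x i) (q U i))) = cvec U a"
      using cvec_mk[OF U, of "\<lambda>U. \<Sum>i\<in>V. rt (x i) (q U i)"] cvec_keys[OF U] by simp
  qed
  ultimately show ?case by simp
qed

end

end

section \<open>The Zassenhaus filtration read off from the action on the empty list\<close>

section \<open>The Zassenhaus filtration of the right-angled Artin group\<close>

context graph
begin

lemma wop_pair_commute:
  assumes "{u, v} \<in> E"
  shows "wop (XN N) [u] (wop (XN N) [v] m) = wop (XN N) [v] (wop (XN N) [u] m)"
  using XN_commute[OF assms] by (simp add: add_mapD[OF add_map_Xop] add_ac)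

lemma ex_rep:
  "\<exists>R. (\<forall>g\<in>carrier GV. R g \<in> wop (XN N) ` lists V) \<and>
     (\<forall>g\<in>carrier GV. \<forall>h\<in>carrier GV. R (g \<otimes>\<^bsub>GV\<^esub> h) = R g \<circ> R h) \<and>
     (\<forall>w\<in>lists V. R (word_prod GV gen w) = wop (XN N) w) \<and>
     {g \<in> carrier GV. R g = id} \<in> open_normal GV TV"
proof -
  interpret n: nilpotent_ops "FilN N" V "XN N" "Suc N" by (rule nilpotent_XN)
  let ?Q = "word_group V (XN N)"
  interpret Q: group ?Q by (rule n.group_word_group)
  obtain k where k: "card (carrier ?Q) = 2 ^ k" using n.word_group_card by blast
  have fQ: "wop (XN N) [i] \<in> carrier ?Q" if "i \<in> V" for i
    using that by (auto simp: word_group_def simp del: wop.simps)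
  obtain R where R: "R \<in> hom GV ?Q" "\<And>i. i \<in> V \<Longrightarrow> R (gen i) = wop (XN N) [i]" "kernel GV ?Q R \<in> open_normal GV TV"
  proof (rule GV_universal[OF n.group_word_group k fQ])
    show "wop (XN N) [u] \<otimes>\<^bsub>?Q\<^esub> wop (XN N) [v] = wop (XN N) [v] \<otimes>\<^bsub>?Q\<^esub> wop (XN N) [u]" if "{u, v} \<in> E" for u v
      using wop_pair_commute[OF that] by (auto simp: word_group_def fun_eq_iff simp del: wop.simps)
  next
    fix R assume "R \<in> hom GV ?Q" "\<And>i. i \<in> V \<Longrightarrow> R (gen i) = wop (XN N) [i]" "kernel GV ?Q R \<in> open_normal GV TV"
    then show thesis by (rule that)
  qed
  interpret R: group_hom GV ?Q R using R(1) by unfold_locales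
  have w: "R (word_prod GV gen w) = wop (XN N) w" if "w \<in> lists V" for w
    using that
  proof (induction w)
    case Nil
    then show ?case using R.hom_one by (simp add: word_group_def wop_Nil)
  next
    case (Cons i w)
    have "R (gen i \<otimes>\<^bsub>GV\<^esub> word_prod GV gen w) = wop (XN N) [i] \<circ> wop (XN N) w"
      using Cons R.hom_mult[of "gen i" "word_prod GV gen w"] GV.word_prod_closed[of w V gen] gen_closed R(2)
      by (simp add: word_group_def del: wop.simps)
    then show ?case by (simp add: fun_eq_iff)
  qed
  show ?thesis
  proof (intro exI[of _ R] conjI ballI)
    show "R g \<in> wop (XN N) ` lists V" if "g \<in> carrier GV" for g
      using R.hom_closed[OF that] by (simp add: word_group_def)
    show "R (g \<otimes>\<^bsub>GV\<^esub> h) = R g \<circ> R h" if "g \<in> carrier GV" "h \<in> carrier GV" for g h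
      using R.hom_mult[OF that] by (simp add: word_group_def)
    show "{g \<in> carrier GV. R g = id} \<in> open_normal GV TV"
      using R(3) by (simp add: kernel_def word_group_def)
  qed (rule w)
qed

definition rep :: "nat \<Rightarrow> 'x pro2_raag_elem \<Rightarrow> ((nat \<times> 'x frl) list \<Rightarrow>\<^sub>0 bit) \<Rightarrow> ((nat \<times> 'x frl) list \<Rightarrow>\<^sub>0 bit)" where
  "rep N = (SOME R. (\<forall>g\<in>carrier GV. R g \<in> wop (XN N) ` lists V) \<and>
     (\<forall>g\<in>carrier GV. \<forall>h\<in>carrier GV. R (g \<otimes>\<^bsub>GV\<^esub> h) = R g \<circ> R h) \<and>
     (\<forall>w\<in>lists V. R (word_prod GV gen w) = wop (XN N) w) \<and>
     {g \<in> carrier GV. R g = id} \<in> open_normal GV TV)"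

lemma rep_props:
  shows rep_word: "g \<in> carrier GV \<Longrightarrow> \<exists>w\<in>lists V. rep N g = wop (XN N) w"
    and rep_mult: "g \<in> carrier GV \<Longrightarrow> h \<in> carrier GV \<Longrightarrow> rep N (g \<otimes>\<^bsub>GV\<^esub> h) v = rep N g (rep N h v)"
    and rep_word_prod: "w \<in> lists V \<Longrightarrow> rep N (word_prod GV gen w) = wop (XN N) w"
    and rep_kernel: "{g \<in> carrier GV. rep N g = id} \<in> open_normal GV TV"
  using someI_ex[OF ex_rep[of N], folded rep_def] by auto

lemma rep_one: "rep N \<one>\<^bsub>GV\<^esub> v = v"
  using rep_word_prod[of "[]" N] by simp

lemma add_map_rep: "g \<in> carrier GV \<Longrightarrow> add_map (rep N g)"
  using rep_word[of g N] add_map_wop[of "XN N", OF add_map_Xop] by auto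

lemma rep_filtered: "g \<in> carrier GV \<Longrightarrow> Fil.raises 1 (\<lambda>v. rep N g v + v)"
  using rep_word[of g N] wop_filtered[of "\<lambda>S. deg S < N"] by (auto simp: add.commute)

lemma rep_Fil: "g \<in> carrier GV \<Longrightarrow> v \<in> Fil k \<Longrightarrow> rep N g v \<in> Fil k"
  using rep_word[of g N] wop_Fil[of v k] by auto

sublocale TG: top_group GV TV
  by unfold_locales (use topspace_TV finite_GV_quotient in auto)

lemma unit_vec_Nil_Fil: "unit_vec [] \<in> Fil k \<longleftrightarrow> k = 0"
  by (auto simp: Fil_def)

lemma rep_of_zassenhaus:
  assumes "g \<in> zassenhaus GV TV n"
  shows "rep N g (unit_vec []) + unit_vec [] \<in> Fil n"
proof -
  have "rep N g (unit_vec []) + unit_vec [] \<in> Fil (0 + n)"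
  proof (rule TG.zassenhaus_raises[where \<rho> = "rep N", OF Fil.filt_axioms _ _ rep_kernel[of N] _ _ assms])
    show "unit_vec [] \<in> Fil 0" by (simp add: unit_vec_Nil_Fil)
  qed (auto simp: rep_mult add_map_rep rep_filtered[simplified])
  then show ?thesis by simp
qed

end

subsection \<open>Elements acting trivially to high order\<close>

context top_group
begin

text \<open>Left multiplication by x i - 1 on the group algebra of G Mod U. It is zero on other sets
  and for other indices, so that it becomes a total additive operator to which the universal
  property applies.\<close>

definition lt :: "'i set \<Rightarrow> ('i \<Rightarrow> 'g) \<Rightarrow> 'g set \<Rightarrow> 'i \<Rightarrow> ('g set \<Rightarrow>\<^sub>0 bit) \<Rightarrow> ('g set \<Rightarrow>\<^sub>0 bit)" where
  "lt V x U i = lin (\<lambda>C. if i \<in> V \<and> C \<in> carrier (G Mod U) then unit_vec ((U #> x i) <#> C) + unit_vec C else 0)"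

text \<open>The span of the products of at least k factors x i - 1. It is built by left
  multiplications, so that the operators \<open>lt\<close> raise it, whereas \<open>IP\<close> is
  built by right multiplications.\<close>

definition Mon :: "'i set \<Rightarrow> ('i \<Rightarrow> 'g) \<Rightarrow> 'g set \<Rightarrow> nat \<Rightarrow> ('g set \<Rightarrow>\<^sub>0 bit) set" where
  "Mon V x U k = {lin (\<lambda>w. foldr (lt V x U) w (unit_vec U)) p | p. pkeys p \<subseteq> {w \<in> lists V. k \<le> length w}}"

context
  fixes V :: "'i set" and x :: "'i \<Rightarrow> 'g" and U :: "'g set"
  assumes fin_V: "finite V" and x: "\<And>i. i \<in> V \<Longrightarrow> x i \<in> carrier G" and U: "U \<in> ON"
begin

interpretation U: normal U G by (rule ON_normal[OF U])
interpretation Q: group "G Mod U" by (rule U.factorgroup_is_group)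

lemma add_map_lt: "add_map (lt V x U i)"
  unfolding lt_def by (rule add_map_lin)

lemma lt_coset: "i \<in> V \<Longrightarrow> g \<in> carrier G \<Longrightarrow> lt V x U i (unit_vec (U #> g)) = unit_vec (U #> (x i \<otimes> g)) + unit_vec (U #> g)"
  using coset_carrier[OF U] x by (simp add: lt_def U.rcos_sum)

lemma lt_keys: "pkeys (lt V x U i v) \<subseteq> carrier (G Mod U)"
  unfolding lt_def
proof (rule keys_lin_subset)
  fix C
  have "(U #> x i) <#> C \<in> carrier (G Mod U)" if "i \<in> V" "C \<in> carrier (G Mod U)"
    using Q.m_closed[OF coset_carrier[OF U x] that(2)] that(1) by simp
  then show "pkeys (if i \<in> V \<and> C \<in> carrier (G Mod U) then unit_vec ((U #> x i) <#> C) + unit_vec C else 0)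
      \<subseteq> carrier (G Mod U)"
    using keys_add_subset[of "unit_vec ((U #> x i) <#> C)" "carrier (G Mod U)" "unit_vec C"] by simp
qed

lemma lt_commute:
  assumes "i \<in> V" "j \<in> V" "x i \<otimes> x j = x j \<otimes> x i"
  shows "lt V x U i (lt V x U j v) = lt V x U j (lt V x U i v)"
proof (rule add_map_eqI[OF add_map_comp[OF add_map_lt add_map_lt] add_map_comp[OF add_map_lt add_map_lt]])
  fix C
  show "lt V x U i (lt V x U j (unit_vec C)) = lt V x U j (lt V x U i (unit_vec C))"
  proof (cases "C \<in> carrier (G Mod U)")
    case True
    then obtain g where g: "g \<in> carrier G" "C = U #> g" using coset_cases by blast
    have "x i \<otimes> (x j \<otimes> g) = x j \<otimes> (x i \<otimes> g)" using assms x g by (metis m_assoc)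
    then show ?thesis using assms x g by (simp add: lt_coset add_mapD[OF add_map_lt] add_ac)
  next
    case False
    then have "lt V x U k (unit_vec C) = 0" for k by (simp add: lt_def)
    then show ?thesis using add_map_zero[OF add_map_lt] by simp
  qed
qed

lemma lt_rt:
  assumes g: "g \<in> carrier G" and v: "pkeys v \<subseteq> carrier (G Mod U)"
  shows "lt V x U i (rt g v) = rt g (lt V x U i v)"
proof (rule add_map_eqI[OF add_map_comp[OF add_map_lt add_map_rt] add_map_comp[OF add_map_rt add_map_lt]])
  fix C assume "C \<in> pkeys v"
  then obtain h where h: "h \<in> carrier G" "C = U #> h" using v coset_cases by blast
  show "lt V x U i (rt g (unit_vec C)) = rt g (lt V x U i (unit_vec C))"
  proof (cases "i \<in> V")
    case True
    then show ?thesis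
      using g h x[OF True]
      by (simp add: rt_def lt_coset add_mapD[OF add_map_lt] lin_add coset_mult_assoc U.subset m_assoc add_ac)
  qed (simp add: lt_def lin_const_zero rt_def)
qed

lemma wop_lt: "w \<in> lists V \<Longrightarrow> wop (lt V x U) w (unit_vec U) = unit_vec (U #> word_prod G x w)"
proof (induction w)
  case Nil
  then show ?case by (simp add: coset_one[OF U])
next
  case (Cons i w)
  then show ?case using word_prod_closed[of w V x] x by (simp add: lt_coset add_ac)
qed

text \<open>On the class of 1, left multiplication by x i - 1 agrees with right multiplication,
  which commutes with all the other left multiplications. So the last letter can be moved outside as
  a right factor, as \<open>IP\<close> requires.\<close>

lemma monomial_IP: "w \<in> lists V \<Longrightarrow> k \<le> length w \<Longrightarrow> foldr (lt V x U) w (unit_vec U) \<in> IP V x U k"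
proof (induction k arbitrary: w)
  case 0
  have UQ: "U \<in> carrier (G Mod U)" using Q.one_closed by simp
  show ?case using lt_keys UQ by (cases w) (simp_all add: IP.simps)
next
  case (Suc k)
  then obtain u i where w: "w = u @ [i]" by (cases w rule: rev_cases) auto
  then have ui: "u \<in> lists V" "i \<in> V" "k \<le> length u" using Suc.prems by auto
  have UQ: "U \<in> carrier (G Mod U)" using Q.one_closed by simp
  have k: "pkeys (foldr (lt V x U) u (unit_vec U)) \<subseteq> carrier (G Mod U)" for u
    using lt_keys UQ by (cases u) auto
  have "lt V x U i (unit_vec U) = rt (x i) (unit_vec U)"
    using lt_coset[OF ui(2) one_closed] x[OF ui(2)] by (simp add: coset_one[OF U] rt_def)
  moreover have "foldr (lt V x U) u (rt (x i) (unit_vec U)) = rt (x i) (foldr (lt V x U) u (unit_vec U))" for u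
    by (induction u) (use lt_rt[OF x[OF ui(2)] k] in auto)
  ultimately have "foldr (lt V x U) w (unit_vec U) = rt (x i) (foldr (lt V x U) u (unit_vec U))" by (simp add: w)
  then show ?case using IP_rt[OF fin_V x ui(2)] Suc.IH[OF ui(1,3)] by simp
qed

lemma filt_Mon: "filt (Mon V x U)"
proof
  fix k u v assume "u \<in> Mon V x U k" "v \<in> Mon V x U k"
  then obtain p q where "u = lin (\<lambda>w. foldr (lt V x U) w (unit_vec U)) p" "v = lin (\<lambda>w. foldr (lt V x U) w (unit_vec U)) q"
    "pkeys p \<subseteq> {w \<in> lists V. k \<le> length w}" "pkeys q \<subseteq> {w \<in> lists V. k \<le> length w}"
    by (auto simp: Mon_def)
  then show "u + v \<in> Mon V x U k" unfolding Mon_def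
    by (intro CollectI exI[of _ "p + q"]) (simp add: lin_add keys_add_subset)
next
  show "0 \<in> Mon V x U k" for k unfolding Mon_def by (intro CollectI exI[of _ 0]) simp
  show "Mon V x U (Suc k) \<subseteq> Mon V x U k" for k unfolding Mon_def by fastforce
qed

lemma lt_Mon: "filt.raises (Mon V x U) 1 (lt V x U i)"
  unfolding filt.raises_def[OF filt_Mon]
proof (intro allI ballI)
  fix k v assume "v \<in> Mon V x U k"
  then obtain p where p: "v = lin (\<lambda>w. foldr (lt V x U) w (unit_vec U)) p" "pkeys p \<subseteq> {w \<in> lists V. k \<le> length w}"
    by (auto simp: Mon_def)
  show "lt V x U i v \<in> Mon V x U (k + 1)"
  proof (cases "i \<in> V")
    case True
    have "lt V x U i v = lin (\<lambda>w. foldr (lt V x U) w (unit_vec U)) (lin (\<lambda>w. unit_vec (i # w)) p)"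
      unfolding p(1) lin_comp[OF add_map_lt] lin_lin by simp
    moreover have "pkeys (lin (\<lambda>w. unit_vec (i # w)) p) \<subseteq> {w \<in> lists V. k + 1 \<le> length w}"
      by (rule keys_lin_subset) (use p(2) True in auto)
    ultimately show ?thesis unfolding Mon_def by blast
  next
    case False
    then have "lt V x U i v = 0" by (simp add: lt_def lin_const_zero)
    then show ?thesis using filt.F_zero[OF filt_Mon] by simp
  qed
qed

lemma Mon_IP: "Mon V x U k \<subseteq> IP V x U k"
proof
  fix v assume "v \<in> Mon V x U k"
  then obtain p where p: "v = lin (\<lambda>w. foldr (lt V x U) w (unit_vec U)) p" "pkeys p \<subseteq> {w \<in> lists V. k \<le> length w}"
    by (auto simp: Mon_def)
  show "v \<in> IP V x U k" unfolding p(1)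
  proof (rule lin_in)
    show "foldr (lt V x U) w (unit_vec U) \<in> IP V x U k" if "w \<in> pkeys p" for w
      using p(2) that by (intro monomial_IP) auto
  qed (use IP_zero[OF fin_V x] IP_add[OF fin_V x] in auto)
qed

end

end

context graph
begin

text \<open>
  Modulo an open normal subgroup, \<open>g\<close> is a positive word \<open>w\<close> in the generators. The module map \<open>phi\<close> from the
  enveloping algebra to the group algebra of the quotient sends \<open>wop X w []\<close> to the class of \<open>f g\<close>, and elements of
  degree at least \<open>n\<close> to sums of products of at least \<open>n\<close> factors \<open>f (gen i) - 1\<close>.
\<close>

lemma zassenhaus_of_rep:
  fixes H (structure)
  assumes H: "top_group H TH" and f: "f \<in> hom GV H"
    and cont: "\<And>U. U \<in> open_normal H TH \<Longrightarrow> {g \<in> carrier GV. f g \<in> U} \<in> open_normal GV TV"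
    and g: "g \<in> carrier GV" and n: "n \<le> Suc N" and gn: "rep N g (unit_vec []) + unit_vec [] \<in> Fil n"
  shows "f g \<in> zassenhaus H TH n"
proof -
  interpret H: top_group H TH by fact
  interpret f: group_hom GV H f using f by unfold_locales
  define x where "x = (\<lambda>i. f (gen i))"
  have x: "x i \<in> carrier H" if "i \<in> V" for i using gen_closed[OF that] by (simp add: x_def)
  have fg: "f g \<in> carrier H" using g by simp
  have "H.glm (f g) \<in> H.AP n"
  proof (rule H.IP_closed[OF finite_V x H.glm_closed[OF fg]])
    fix U assume U: "U \<in> H.ON"
    interpret U: normal U H by (rule H.ON_normal[OF U])
    \<comment> \<open>Modulo this subgroup the image of g in H Mod U and its truncated action are
      both determined, so one word w represents g for both purposes.\<close>
    define W where "W = {g \<in> carrier GV. f g \<in> U} \<inter> {g \<in> carrier GV. rep N g = id}"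
    have W: "W \<in> open_normal GV TV" unfolding W_def by (rule TG.ON_Int[OF cont[OF U] rep_kernel])
    interpret W: normal W GV by (rule TG.ON_normal[OF W])
    obtain w where w: "w \<in> lists V" "W #>\<^bsub>GV\<^esub> g = W #>\<^bsub>GV\<^esub> word_prod GV gen w"
      using GV_dense[OF W g] by blast
    let ?h = "word_prod GV gen w"
    have h: "?h \<in> carrier GV" by (rule GV.word_prod_closed[OF w(1) gen_closed])
    have gh: "g \<otimes>\<^bsub>GV\<^esub> inv\<^bsub>GV\<^esub> ?h \<in> W" using w(2) unfolding W.coset_eq_iff[OF g h] .
    then have "f (g \<otimes>\<^bsub>GV\<^esub> inv\<^bsub>GV\<^esub> ?h) \<in> U" unfolding W_def by blast
    then have "f g \<otimes> inv (f ?h) \<in> U" by (simp only: f.hom_mult[OF g GV.inv_closed[OF h]] f.hom_inv[OF h])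
    then have fU: "U #> f g = U #> f ?h" unfolding U.coset_eq_iff[OF fg f.hom_closed[OF h]] .
    have "rep N g v = rep N ?h v" for v
    proof -
      have 1: "rep N (g \<otimes>\<^bsub>GV\<^esub> inv\<^bsub>GV\<^esub> ?h) = id" using gh unfolding W_def by blast
      have 2: "(g \<otimes>\<^bsub>GV\<^esub> inv\<^bsub>GV\<^esub> ?h) \<otimes>\<^bsub>GV\<^esub> ?h = g" by (metis g h GV.m_assoc GV.inv_closed GV.l_inv GV.r_one)
      show ?thesis using rep_mult[OF GV.m_closed[OF g GV.inv_closed[OF h]] h, of N v] unfolding 1 2 by simp
    qed
    then have rw: "wop (XN N) w (unit_vec []) + unit_vec [] \<in> Fil n" using gn rep_word_prod[OF w(1), of N] by simp
    \<comment> \<open>Truncation alters the action of w on [] in degrees above N only, and n \<le>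
      Suc N.\<close>
    have "wop X w (unit_vec []) + wop (XN N) w (unit_vec []) \<in> Fil n"
      using wop_X_XN[of "unit_vec []" w N] Fil.F_mono[OF n] by auto
    from Fil.F_add[OF this rw] have u: "wop X w (unit_vec []) + unit_vec [] \<in> Fil n" by (simp add: add_ac)
    let ?lt = "H.lt V x U"
    note lt_add = H.add_map_lt[OF finite_V x U]
    have comm: "?lt i (?lt j m) = ?lt j (?lt i m)" if e: "{i, j} \<in> E" for i j m
    proof (rule H.lt_commute[OF finite_V x U])
      have ij: "i \<in> V" "j \<in> V" using edge_V[OF e] by auto
      then show "i \<in> V" "j \<in> V" by auto
      show "x i \<otimes> x j = x j \<otimes> x i"
        using gen_commute[OF e] gen_closed ij f.hom_mult[of "gen i" "gen j"] f.hom_mult[of "gen j" "gen i"] by (simp add: x_def)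
    qed
    have "lin (phi ?lt (unit_vec U)) (wop X w (unit_vec []) + unit_vec []) = wop ?lt w (unit_vec U) + unit_vec U"
      using phi_wop[of ?lt, OF lt_add comm w(1)] by (simp add: lin_add phi_def)
    also have "\<dots> = unit_vec (U #> word_prod H x w) + unit_vec U"
      by (simp add: H.wop_lt[OF finite_V x U w(1)])
    also have "word_prod H x w = f ?h"
      using f.word_prod_hom[OF w(1) gen_closed] by (simp add: x_def)
    finally have e: "H.cvec U (H.glm (f g)) = lin (phi ?lt (unit_vec U)) (wop X w (unit_vec []) + unit_vec [])"
      using H.cvec_glm[OF U fg] fU by simp
    interpret M: filt "H.Mon V x U" by (rule H.filt_Mon[OF finite_V x U])
    \<comment> \<open>Each letter b is homogeneous of degree \<open>fst b\<close>, so its operator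
      raises the filtration by that amount; along S the degrees add up.\<close>
    have phi: "phi ?lt (unit_vec U) S \<in> H.Mon V x U (deg S)" if "S \<in> vlist BB" for S
      using that
    proof (induction S)
      case Nil
      show ?case unfolding H.Mon_def by (auto simp: phi_def intro!: exI[of _ "unit_vec []"])
    next
      case (Cons b S)
      have b: "b \<in> BB" "S \<in> vlist BB" using Cons.prems by (auto simp: vlist_def)
      have "snd b \<in> Hom (fst b)" using BB_Hom[of "fst b" "snd b"] b by simp
      then obtain t where t: "snd b = abs_frl t" "rl_homogeneous (fst b) t" by (auto simp: Hom_def)
      have "intp ?lt t (phi ?lt (unit_vec U) S) \<in> H.Mon V x U (deg S + fst b)"
        using M.raisesD[OF M.intp_raises[OF H.lt_Mon[OF finite_V x U] t(2)] Cons.IH[OF b(2)]] .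
      then show ?case using fintp_abs[of ?lt, OF lt_add, of t] by (simp add: phi_def t(1) add.commute)
    qed
    have "lin (phi ?lt (unit_vec U)) (wop X w (unit_vec []) + unit_vec []) \<in> H.Mon V x U n"
    proof (rule lin_in[OF _ M.F_zero M.F_add])
      fix S assume "S \<in> pkeys (wop X w (unit_vec []) + unit_vec [])"
      then have "S \<in> vlist BB" "n \<le> deg S" using u by (auto simp: Fil_def)
      then show "phi ?lt (unit_vec U) S \<in> H.Mon V x U n" using phi M.F_mono by blast
    qed
    then show "H.cvec U (H.glm (f g)) \<in> H.IP V x U n"
      unfolding e by (rule subsetD[OF H.Mon_IP[OF finite_V _ U], rotated]) (rule x)
  qed
  then show ?thesis using fg by (simp add: zassenhaus_def H.glm_def)
qed

text \<open>One direction holds since g - 1 in the n-th power raises degrees by n; for the other,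
  \<open>zassenhaus_of_rep\<close> is applied to the identity map of the group.\<close>

lemma zassenhaus_GV_iff:
  assumes "n \<le> Suc N"
  shows "g \<in> zassenhaus GV TV n \<longleftrightarrow> g \<in> carrier GV \<and> rep N g (unit_vec []) + unit_vec [] \<in> Fil n"
proof
  assume "g \<in> zassenhaus GV TV n"
  then show "g \<in> carrier GV \<and> rep N g (unit_vec []) + unit_vec [] \<in> Fil n"
    using rep_of_zassenhaus by (auto simp: zassenhaus_def)
next
  assume g: "g \<in> carrier GV \<and> rep N g (unit_vec []) + unit_vec [] \<in> Fil n"
  have "(\<lambda>g. g) g \<in> zassenhaus GV TV n"
  proof (rule zassenhaus_of_rep[OF TG.top_group_axioms _ _ _ assms])
    show "(\<lambda>g. g) \<in> hom GV GV" by (simp add: hom_def)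
    show "{g \<in> carrier GV. g \<in> U} \<in> open_normal GV TV" if "U \<in> open_normal GV TV" for U
    proof -
      have "{g \<in> carrier GV. g \<in> U} = U"
        using subgroup.subset[OF normal_imp_subgroup[OF TG.ON_normal[OF that]]] by blast
      then show ?thesis using that by simp
    qed
  qed (use g in auto)
  then show "g \<in> zassenhaus GV TV n" .
qed

end

section \<open>The induced representation of the semidirect product and its two filtrations\<close>

section \<open>Delta-RAAGs\<close>

lemma (in group) rep_kernel_normal:
  assumes m: "\<And>g h v. g \<in> carrier G \<Longrightarrow> h \<in> carrier G \<Longrightarrow> \<rho> (g \<otimes> h) v = \<rho> g (\<rho> h v)"
    and one: "\<And>v. \<rho> \<one> v = v"
  shows "{g \<in> carrier G. \<forall>v. \<rho> g v = v} \<lhd> G"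
proof -
  have inv: "\<rho> (inv g) (\<rho> g v) = v" "\<rho> g (\<rho> (inv g) v) = v" if "g \<in> carrier G" for g v
    using m[of "inv g" g v] m[of g "inv g" v] one that by auto
  have "subgroup {g \<in> carrier G. \<forall>v. \<rho> g v = v} G"
  proof (rule subgroupI)
    fix g assume "g \<in> {g \<in> carrier G. \<forall>v. \<rho> g v = v}"
    then show "inv g \<in> {g \<in> carrier G. \<forall>v. \<rho> g v = v}" using inv(1)[of g] by auto
  qed (use m one in auto)
  moreover have "g \<otimes> h \<otimes> inv g \<in> {g \<in> carrier G. \<forall>v. \<rho> g v = v}"
    if "g \<in> carrier G" "h \<in> {g \<in> carrier G. \<forall>v. \<rho> g v = v}" for g h
    using that by (simp add: m inv)
  ultimately show ?thesis unfolding normal_inv_iff by blast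
qed

lemma (in group_hom) normal_vimage:
  assumes "N \<lhd> H"
  shows "{g \<in> carrier G. h g \<in> N} \<lhd> G"
proof -
  interpret N: normal N H by fact
  interpret p: group_hom G "H Mod N" "\<lambda>g. N #>\<^bsub>H\<^esub> h g"
  proof -
    have "(\<lambda>x. N #>\<^bsub>H\<^esub> x) \<circ> h \<in> hom G (H Mod N)"
      by (rule Group.hom_compose[OF homh N.r_coset_hom_Mod])
    then show "group_hom G (H Mod N) (\<lambda>g. N #>\<^bsub>H\<^esub> h g)"
      using N.factorgroup_is_group by (simp add: group_hom_def group_hom_axioms_def comp_def)
  qed
  have "kernel G (H Mod N) (\<lambda>g. N #>\<^bsub>H\<^esub> h g) = {g \<in> carrier G. h g \<in> N}"
    by (simp add: kernel_def N.coset_eq_self_iff cong: conj_cong)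
  then show ?thesis using p.normal_kernel by simp
qed

lemma carrier_Delta: "carrier Delta = {0, 1}"
  by (auto simp: Delta_def carrier_integer_mod_group)

lemma mult_Delta: "s \<otimes>\<^bsub>Delta\<^esub> t = (s + t) mod 2"
  by (simp add: Delta_def)

lemma one_Delta: "\<one>\<^bsub>Delta\<^esub> = 0"
  by (simp add: Delta_def)

locale delta_graph = graph V E for V :: "'x set" and E :: "'x set set" +
  fixes z :: "'x \<Rightarrow> 'x pro2_raag_elem" and \<delta> :: "int \<Rightarrow> 'x pro2_raag_elem \<Rightarrow> 'x pro2_raag_elem"
  assumes z: "i \<in> V \<Longrightarrow> z i \<in> carrier GV"
    and action: "delta_raag_action V E z \<delta>"
begin

abbreviation "\<sigma> \<equiv> \<delta> 1"
abbreviation "GD \<equiv> delta_raag V E \<delta>"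
abbreviation "TD \<equiv> delta_raag_topology V E"

lemma \<delta>_auto: "s \<in> {0, 1} \<Longrightarrow> \<delta> s \<in> hom GV GV" "s \<in> {0, 1} \<Longrightarrow> \<delta> s \<in> Bij (carrier GV)"
  using action by (auto simp: delta_raag_action_def hom_def AutoGroup_def auto_def carrier_Delta)

lemma \<delta>_group_hom: "s \<in> {0, 1} \<Longrightarrow> group_hom GV GV (\<delta> s)"
  using \<delta>_auto(1) by (simp add: group_hom_def group_hom_axioms_def)

lemma \<delta>_closed: "s \<in> {0, 1} \<Longrightarrow> g \<in> carrier GV \<Longrightarrow> \<delta> s g \<in> carrier GV"
  using \<delta>_auto(1) by (auto simp: hom_def)

lemma \<delta>_mult: "s \<in> {0, 1} \<Longrightarrow> g \<in> carrier GV \<Longrightarrow> h \<in> carrier GV \<Longrightarrow> \<delta> s (g \<otimes>\<^bsub>GV\<^esub> h) = \<delta> s g \<otimes>\<^bsub>GV\<^esub> \<delta> s h"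
  using \<delta>_auto(1) by (auto simp: hom_def)

lemma \<delta>_comp:
  assumes "s \<in> {0, 1}" "t \<in> {0, 1}" "g \<in> carrier GV"
  shows "\<delta> ((s + t) mod 2) g = \<delta> s (\<delta> t g)"
proof -
  have "\<delta> \<in> hom Delta (AutoGroup GV)" using action by (simp add: delta_raag_action_def)
  then have "\<delta> (s \<otimes>\<^bsub>Delta\<^esub> t) = \<delta> s \<otimes>\<^bsub>AutoGroup GV\<^esub> \<delta> t"
    by (rule hom_mult) (use assms in \<open>auto simp: carrier_Delta\<close>)
  also have "\<dots> = compose (carrier GV) (\<delta> s) (\<delta> t)"
    using \<delta>_auto(2) assms by (simp add: AutoGroup_def BijGroup_def)
  finally show ?thesis using assms(3) by (simp add: mult_Delta compose_eq)
qed

text \<open>The map \<delta> 0 is idempotent, as 0 + 0 = 0, and injective.\<close>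

lemma \<delta>_zero: "g \<in> carrier GV \<Longrightarrow> \<delta> 0 g = g"
proof -
  assume g: "g \<in> carrier GV"
  have "\<delta> 0 (\<delta> 0 g) = \<delta> 0 g" using \<delta>_comp[of 0 0 g] g by simp
  moreover have "inj_on (\<delta> 0) (carrier GV)" using \<delta>_auto(2)[of 0] by (simp add: Bij_def bij_betw_def)
  ultimately show ?thesis using g \<delta>_closed[of 0 g] by (simp add: inj_on_def)
qed

lemma \<sigma>_\<sigma>: "g \<in> carrier GV \<Longrightarrow> \<sigma> (\<sigma> g) = g"
  using \<delta>_comp[of 1 1 g] \<delta>_zero[of g] by simp

sublocale \<sigma>: group_hom GV GV \<sigma>
  by (rule \<delta>_group_hom) simp

lemma \<sigma>_gen: "i \<in> V \<Longrightarrow> \<sigma> (gen i) = inv\<^bsub>GV\<^esub> (z i) \<otimes>\<^bsub>GV\<^esub> inv\<^bsub>GV\<^esub> (gen i) \<otimes>\<^bsub>GV\<^esub> z i"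
  using action by (simp add: delta_raag_action_def Delta_gen_def)

lemma \<sigma>_continuous: "continuous_map TV TV \<sigma>"
  using action by (simp add: delta_raag_action_def carrier_Delta homeomorphic_imp_continuous_map)

lemma carrier_GD: "carrier GD = carrier GV \<times> {0, 1}"
  by (simp add: delta_raag_def semidirect_def carrier_Delta)

lemma mult_GD: "(g, s) \<otimes>\<^bsub>GD\<^esub> (h, t) = (g \<otimes>\<^bsub>GV\<^esub> \<delta> s h, (s + t) mod 2)"
  by (simp add: delta_raag_def semidirect_def mult_Delta)

lemma one_GD: "\<one>\<^bsub>GD\<^esub> = (\<one>\<^bsub>GV\<^esub>, 0)"
  by (simp add: delta_raag_def semidirect_def one_Delta)

lemma group_GD: "group GD"
proof (rule groupI)
  fix x y w assume "x \<in> carrier GD" "y \<in> carrier GD"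
  then obtain g s h t where x: "x = (g, s)" "g \<in> carrier GV" "s \<in> {0, 1}" and y: "y = (h, t)" "h \<in> carrier GV" "t \<in> {0, 1}"
    by (auto simp: carrier_GD)
  show "x \<otimes>\<^bsub>GD\<^esub> y \<in> carrier GD"
    using x y \<delta>_closed[of s h] by (auto simp: carrier_GD mult_GD)
  assume "w \<in> carrier GD"
  then obtain k u where w: "w = (k, u)" "k \<in> carrier GV" "u \<in> {0, 1}" by (auto simp: carrier_GD)
  have "(s + t) mod 2 \<in> {0, 1}" by auto
  then show "x \<otimes>\<^bsub>GD\<^esub> y \<otimes>\<^bsub>GD\<^esub> w = x \<otimes>\<^bsub>GD\<^esub> (y \<otimes>\<^bsub>GD\<^esub> w)"
    using x y w by (simp add: mult_GD GV.m_assoc \<delta>_closed \<delta>_mult \<delta>_comp mod_add_left_eq mod_add_right_eq add.assoc del: insert_iff)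
next
  show "\<one>\<^bsub>GD\<^esub> \<in> carrier GD" by (simp add: carrier_GD one_GD)
  fix x assume "x \<in> carrier GD"
  then obtain g s where x: "x = (g, s)" "g \<in> carrier GV" "s \<in> {0, 1}" by (auto simp: carrier_GD)
  then show "\<one>\<^bsub>GD\<^esub> \<otimes>\<^bsub>GD\<^esub> x = x" by (auto simp: one_GD mult_GD \<delta>_zero)
  show "\<exists>y\<in>carrier GD. y \<otimes>\<^bsub>GD\<^esub> x = \<one>\<^bsub>GD\<^esub>"
  proof
    let ?y = "(\<delta> s (inv\<^bsub>GV\<^esub> g), s)"
    show "?y \<in> carrier GD" using x \<delta>_closed by (simp add: carrier_GD)
    have "\<delta> s (inv\<^bsub>GV\<^esub> g) \<otimes>\<^bsub>GV\<^esub> \<delta> s g = \<one>\<^bsub>GV\<^esub>"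
      using \<delta>_mult[OF x(3), of "inv\<^bsub>GV\<^esub> g" g] x group_hom.hom_one[OF \<delta>_group_hom[OF x(3)]] by simp
    moreover have "(s + s) mod 2 = 0" by presburger
    ultimately show "?y \<otimes>\<^bsub>GD\<^esub> x = \<one>\<^bsub>GD\<^esub>" by (simp add: x mult_GD one_GD)
  qed
qed

sublocale GD: group GD
  by (rule group_GD)

lemma embed_hom: "raag_embed \<in> hom GV GD"
  by (rule homI) (auto simp: raag_embed_def one_Delta carrier_GD mult_GD \<delta>_zero)

sublocale emb: group_hom GV GD raag_embed
  using embed_hom by unfold_locales

lemma snd_hom: "snd \<in> hom GD Delta"
  by (rule homI) (auto simp: carrier_GD carrier_Delta mult_GD mult_Delta)

lemma topspace_TD: "topspace TD = carrier GD"
  by (simp add: delta_raag_topology_def topspace_TV carrier_GD carrier_Delta)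

lemma embed_continuous: "continuous_map TV TD raag_embed"
  by (simp add: delta_raag_topology_def raag_embed_def one_Delta continuous_map_pairwise comp_def carrier_Delta)

lemma embed_open_normal:
  assumes "U \<in> open_normal GD TD"
  shows "{g \<in> carrier GV. raag_embed g \<in> U} \<in> open_normal GV TV"
proof -
  have "openin TV {g \<in> topspace TV. raag_embed g \<in> U}"
    using assms by (intro openin_continuous_map_preimage[OF embed_continuous]) (simp add: open_normal_def)
  then show ?thesis
    using emb.normal_vimage[of U] assms by (simp add: open_normal_def topspace_TV)
qed

lemma finite_GD_quotient:
  assumes U: "U \<in> open_normal GD TD"
  shows "finite (carrier (GD Mod U))"
proof -
  interpret U: normal U GD using U by (simp add: open_normal_def)
  define W where "W = {g \<in> carrier GV. raag_embed g \<in> U}"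
  have W: "W \<in> open_normal GV TV" unfolding W_def by (rule embed_open_normal[OF U])
  interpret W: normal W GV by (rule TG.ON_normal[OF W])
  define r where "r = (\<lambda>C. SOME g. g \<in> carrier GV \<and> C = W #>\<^bsub>GV\<^esub> g)"
  have "carrier (GD Mod U) \<subseteq> (\<lambda>(C, s). (U #>\<^bsub>GD\<^esub> raag_embed (r C)) <#>\<^bsub>GD\<^esub> (U #>\<^bsub>GD\<^esub> (\<one>\<^bsub>GV\<^esub>, s))) ` (carrier (GV Mod W) \<times> {0, 1})"
  proof
    fix Y assume "Y \<in> carrier (GD Mod U)"
    then obtain g s where gs: "Y = U #>\<^bsub>GD\<^esub> (g, s)" "g \<in> carrier GV" "s \<in> {0, 1}"
      by (auto simp: carrier_FactGroup carrier_GD)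
    let ?C = "W #>\<^bsub>GV\<^esub> g"
    have "r ?C \<in> carrier GV \<and> ?C = W #>\<^bsub>GV\<^esub> r ?C" unfolding r_def by (rule someI_ex) (use gs in blast)
    then have r: "r ?C \<in> carrier GV" "g \<otimes>\<^bsub>GV\<^esub> inv\<^bsub>GV\<^esub> (r ?C) \<in> W" using W.coset_eq_iff[OF gs(2)] by blast+
    then have "raag_embed (g \<otimes>\<^bsub>GV\<^esub> inv\<^bsub>GV\<^esub> (r ?C)) \<in> U" unfolding W_def by blast
    then have "raag_embed g \<otimes>\<^bsub>GD\<^esub> inv\<^bsub>GD\<^esub> (raag_embed (r ?C)) \<in> U"
      by (simp only: emb.hom_mult[OF gs(2) GV.inv_closed[OF r(1)]] emb.hom_inv[OF r(1)])
    then have "U #>\<^bsub>GD\<^esub> raag_embed g = U #>\<^bsub>GD\<^esub> raag_embed (r ?C)"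
      unfolding U.coset_eq_iff[OF emb.hom_closed[OF gs(2)] emb.hom_closed[OF r(1)]] .
    moreover have "(g, s) = raag_embed g \<otimes>\<^bsub>GD\<^esub> (\<one>\<^bsub>GV\<^esub>, s)"
      using gs by (auto simp: raag_embed_def one_Delta mult_GD \<delta>_zero)
    moreover have "(\<one>\<^bsub>GV\<^esub>, s) \<in> carrier GD" "raag_embed g \<in> carrier GD" using gs by (auto simp: carrier_GD raag_embed_def one_Delta)
    ultimately have "Y = (U #>\<^bsub>GD\<^esub> raag_embed (r ?C)) <#>\<^bsub>GD\<^esub> (U #>\<^bsub>GD\<^esub> (\<one>\<^bsub>GV\<^esub>, s))"
      using U.rcos_sum[of "raag_embed g" "(\<one>\<^bsub>GV\<^esub>, s)"] gs(1) by simp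
    moreover have "(?C, s) \<in> carrier (GV Mod W) \<times> {0, 1}" using gs by (auto simp: carrier_FactGroup)
    ultimately show "Y \<in> (\<lambda>(C, s). (U #>\<^bsub>GD\<^esub> raag_embed (r C)) <#>\<^bsub>GD\<^esub> (U #>\<^bsub>GD\<^esub> (\<one>\<^bsub>GV\<^esub>, s))) ` (carrier (GV Mod W) \<times> {0, 1})"
      by (intro image_eqI[of _ _ "(?C, s)"]) auto
  qed
  then show ?thesis by (rule finite_subset) (simp add: finite_GV_quotient[OF W])
qed

sublocale TGD: top_group GD TD
  by unfold_locales (use topspace_TD finite_GD_quotient in auto)

subsection \<open>The induced representation\<close>

text \<open>The automorphism \<open>\<sigma>\<close> acts trivially on the associated graded Lie algebra, as it inverts the generators
  up to conjugation and the characteristic is two.\<close>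

lemma rep_mult_cong:
  assumes "g \<in> carrier GV" "h \<in> carrier GV"
  shows "Fil.raises 2 (\<lambda>v. (rep N (g \<otimes>\<^bsub>GV\<^esub> h) v + v) + ((rep N g v + v) + (rep N h v + v)))"
proof -
  \<comment> \<open>(g - 1)(h - 1) = (g h - 1) - (g - 1) - (h - 1): modulo operators raising by two,
    g - 1 is additive in g.\<close>
  have "Fil.raises (1 + 1) (\<lambda>v. rep N g (rep N h v + v) + (rep N h v + v))"
    by (rule Fil.raises_comp[OF rep_filtered[OF assms(1)] rep_filtered[OF assms(2)]])
  moreover have "rep N g (rep N h v + v) + (rep N h v + v)
      = (rep N (g \<otimes>\<^bsub>GV\<^esub> h) v + v) + ((rep N g v + v) + (rep N h v + v))" for v
    using assms by (simp add: rep_mult add_mapD[OF add_map_rep] add_ac)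
  ultimately show ?thesis by (simp add: numeral_2_eq_2)
qed

lemma rep_inv_cong:
  assumes "g \<in> carrier GV"
  shows "Fil.raises 2 (\<lambda>v. rep N (inv\<^bsub>GV\<^esub> g) v + rep N g v)"
  using rep_mult_cong[of g "inv\<^bsub>GV\<^esub> g" N] assms by (simp add: rep_one add_ac)

lemma rep_\<sigma>_gen:
  assumes i: "i \<in> V"
  shows "Fil.raises 2 (\<lambda>v. rep N (\<sigma> (gen i)) v + rep N (gen i) v)"
proof -
  let ?z = "z i" and ?x = "gen i"
  have c: "?z \<in> carrier GV" "?x \<in> carrier GV" using z gen_closed i by auto
  let ?a = "inv\<^bsub>GV\<^esub> ?z \<otimes>\<^bsub>GV\<^esub> inv\<^bsub>GV\<^esub> ?x"
  \<comment> \<open>The congruences for the two products and the two inverses are added up; all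
    contributions of \<open>z i\<close> cancel, and only the actions of \<sigma> (gen i) and of gen
    i remain.\<close>
  have "Fil.raises 2 (\<lambda>v. ((rep N (?a \<otimes>\<^bsub>GV\<^esub> ?z) v + v) + ((rep N ?a v + v) + (rep N ?z v + v)))
    + ((rep N ?a v + v) + ((rep N (inv\<^bsub>GV\<^esub> ?z) v + v) + (rep N (inv\<^bsub>GV\<^esub> ?x) v + v)))
    + ((rep N (inv\<^bsub>GV\<^esub> ?z) v + rep N ?z v) + (rep N (inv\<^bsub>GV\<^esub> ?x) v + rep N ?x v)))"
    using c by (intro Fil.raises_add rep_mult_cong rep_inv_cong) auto
  then show ?thesis unfolding \<sigma>_gen[OF i] by (simp add: add_ac)
qed

text \<open>A single open normal subgroup on which both \<open>rep N\<close> and its twist by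
  \<sigma> are trivial; it is here that the continuity of \<sigma> enters.\<close>

lemma continuous_\<sigma>_kernel: "{g \<in> carrier GV. rep N g = id} \<inter> {g \<in> carrier GV. rep N (\<sigma> g) = id} \<in> open_normal GV TV"
proof (rule TG.ON_Int[OF rep_kernel])
  let ?K = "{g \<in> carrier GV. rep N g = id}"
  have e: "{g \<in> carrier GV. rep N (\<sigma> g) = id} = {g \<in> carrier GV. \<sigma> g \<in> ?K}" by auto
  have "openin TV {g \<in> topspace TV. \<sigma> g \<in> ?K}"
    using rep_kernel[of N] by (intro openin_continuous_map_preimage[OF \<sigma>_continuous]) (simp add: open_normal_def)
  then show "{g \<in> carrier GV. rep N (\<sigma> g) = id} \<in> open_normal GV TV"
    unfolding e using \<sigma>.normal_vimage[of ?K] rep_kernel[of N] by (simp add: open_normal_def topspace_TV)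
qed

text \<open>Both actions factor through a common finite quotient, so g may be replaced by a positive
  word. For words, one letter at a time is exchanged by \<open>rep_\<sigma>_gen\<close>.\<close>

lemma rep_\<sigma>_cong:
  assumes g: "g \<in> carrier GV"
  shows "Fil.raises 2 (\<lambda>v. rep N (\<sigma> g) v + rep N g v)"
proof -
  define W where "W = {g \<in> carrier GV. rep N g = id} \<inter> {g \<in> carrier GV. rep N (\<sigma> g) = id}"
  have W: "W \<in> open_normal GV TV" unfolding W_def by (rule continuous_\<sigma>_kernel)
  interpret W: normal W GV by (rule TG.ON_normal[OF W])
  obtain w where w: "w \<in> lists V" "W #>\<^bsub>GV\<^esub> g = W #>\<^bsub>GV\<^esub> word_prod GV gen w"
    using GV_dense[OF W g] by blast
  have wc: "word_prod GV gen w \<in> carrier GV" if "w \<in> lists V" for w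
    by (rule GV.word_prod_closed[OF that gen_closed])
  let ?h = "word_prod GV gen w"
  define k where "k = g \<otimes>\<^bsub>GV\<^esub> inv\<^bsub>GV\<^esub> ?h"
  have k: "k \<in> W" unfolding k_def using w(2) unfolding W.coset_eq_iff[OF g wc[OF w(1)]] .
  then have kc: "k \<in> carrier GV" "rep N k = id" "rep N (\<sigma> k) = id" unfolding W_def by blast+
  have gk: "g = k \<otimes>\<^bsub>GV\<^esub> ?h" unfolding k_def using g wc[OF w(1)] by (simp add: GV.m_assoc)
  have e: "rep N g = rep N ?h" "rep N (\<sigma> g) = rep N (\<sigma> ?h)"
    unfolding gk using kc wc[OF w(1)] by (auto simp: fun_eq_iff rep_mult)
  have "Fil.raises 2 (\<lambda>v. rep N (\<sigma> (word_prod GV gen u)) v + rep N (word_prod GV gen u) v)" if "u \<in> lists V" for u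
    using that
  proof (induction u)
    case Nil
    then show ?case by (simp add: rep_one Fil.raises_zero)
  next
    case (Cons i u)
    let ?h = "word_prod GV gen u"
    have c: "i \<in> V" "gen i \<in> carrier GV" "?h \<in> carrier GV" using Cons.hyps gen_closed wc by auto
    have r: "Fil.raises 0 (rep N (\<sigma> ?h))" "Fil.raises 0 (rep N (gen i))"
      using rep_Fil c by (auto simp: Fil.raises_def)
    have "Fil.raises (2 + 0) (\<lambda>v. rep N (\<sigma> (gen i)) (rep N (\<sigma> ?h) v) + rep N (gen i) (rep N (\<sigma> ?h) v))"
      by (rule Fil.raises_comp[OF rep_\<sigma>_gen[OF c(1)] r(1)])
    moreover have "Fil.raises (0 + 2) (\<lambda>v. rep N (gen i) (rep N (\<sigma> ?h) v + rep N ?h v))"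
      by (rule Fil.raises_comp[OF r(2) Cons.IH])
    ultimately have "Fil.raises 2 (\<lambda>v. (rep N (\<sigma> (gen i)) (rep N (\<sigma> ?h) v) + rep N (gen i) (rep N (\<sigma> ?h) v))
        + rep N (gen i) (rep N (\<sigma> ?h) v + rep N ?h v))"
      unfolding add_0_right add_0_left by (rule Fil.raises_add)
    then show ?case using c by (simp add: rep_mult add_mapD[OF add_map_rep] add_ac)
  qed
  from this[OF w(1)] show ?thesis by (simp add: e)
qed

text \<open>The representation induced from \<open>rep N\<close>, on two copies of its space: G acts
  on the second copy through \<sigma>, and the generator of \<open>Delta\<close> swaps the
  copies.\<close>

definition repD :: "nat \<Rightarrow> 'x pro2_raag_elem \<times> int \<Rightarrow>
    ((nat \<times> 'x frl) list \<Rightarrow>\<^sub>0 bit) \<times> ((nat \<times> 'x frl) list \<Rightarrow>\<^sub>0 bit) \<Rightarrow>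
    ((nat \<times> 'x frl) list \<Rightarrow>\<^sub>0 bit) \<times> ((nat \<times> 'x frl) list \<Rightarrow>\<^sub>0 bit)" where
  "repD N x v = (if snd x = 0 then (rep N (fst x) (fst v), rep N (\<sigma> (fst x)) (snd v))
     else (rep N (fst x) (snd v), rep N (\<sigma> (fst x)) (fst v)))"

lemma add_map_repD: "x \<in> carrier GD \<Longrightarrow> add_map (repD N x)"
  using add_mapD[OF add_map_rep, of "fst x" N] add_mapD[OF add_map_rep, of "\<sigma> (fst x)" N]
  by (auto simp: add_map_def repD_def carrier_GD)

lemma repD_mult: "x \<in> carrier GD \<Longrightarrow> y \<in> carrier GD \<Longrightarrow> repD N (x \<otimes>\<^bsub>GD\<^esub> y) v = repD N x (repD N y v)"
  by (auto simp: carrier_GD mult_GD repD_def rep_mult \<delta>_zero \<sigma>_\<sigma>)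

lemma repD_one: "repD N \<one>\<^bsub>GD\<^esub> v = v"
  by (simp add: repD_def one_GD rep_one)

text \<open>The condition on the second component presents the set as the product of an open
  subgroup with {0}, which makes its openness visible; it is normal as the intersection of two
  kernels.\<close>

lemma repD_kernel: "{x \<in> carrier GD. snd x = 0 \<and> (\<forall>v. repD N x v = v)} \<in> open_normal GD TD"
proof -
  let ?K = "{x \<in> carrier GD. snd x = 0 \<and> (\<forall>v. repD N x v = v)}"
  interpret s: group_hom GD Delta snd
    using snd_hom group_integer_mod_group[of 2] by (simp add: group_hom_def group_hom_axioms_def Delta_def)
  have "\<Inter>{kernel GD Delta snd, {x \<in> carrier GD. \<forall>v. repD N x v = v}} \<lhd> GD"
    by (rule GD.normal_Inter) (use s.normal_kernel GD.rep_kernel_normal[of "repD N", OF repD_mult repD_one] in auto)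
  also have "\<Inter>{kernel GD Delta snd, {x \<in> carrier GD. \<forall>v. repD N x v = v}} = ?K"
    by (auto simp: kernel_def one_Delta)
  finally have "?K \<lhd> GD" .
  moreover have "?K = ({g \<in> carrier GV. rep N g = id} \<inter> {g \<in> carrier GV. rep N (\<sigma> g) = id}) \<times> {0}"
    by (auto simp: carrier_GD repD_def fun_eq_iff)
  then have "openin TD ?K"
    using continuous_\<sigma>_kernel[of N] by (simp add: delta_raag_topology_def openin_prod_Times_iff open_normal_def carrier_Delta)
  ultimately show ?thesis by (simp add: open_normal_def)
qed

text \<open>
  The swap raises \<open>FilD\<close> by one, since \<open>(a, b)\<close> and \<open>(b, a)\<close> differ by \<open>(a + b, a + b)\<close>. The shift \<open>FilD'\<close> allows the
  vector \<open>([], 0)\<close>, which detects the component in the group of order two.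
\<close>

definition FilD :: "nat \<Rightarrow> (((nat \<times> 'x frl) list \<Rightarrow>\<^sub>0 bit) \<times> ((nat \<times> 'x frl) list \<Rightarrow>\<^sub>0 bit)) set" where
  "FilD k = {(a, b). a \<in> Fil k \<and> b \<in> Fil k \<and> a + b \<in> Fil (Suc k)}"

definition FilD' :: "nat \<Rightarrow> (((nat \<times> 'x frl) list \<Rightarrow>\<^sub>0 bit) \<times> ((nat \<times> 'x frl) list \<Rightarrow>\<^sub>0 bit)) set" where
  "FilD' k = (case k of 0 \<Rightarrow> Fil 0 \<times> Fil 0 | Suc j \<Rightarrow> FilD j)"

lemma FilD_add: "x \<in> FilD k \<Longrightarrow> y \<in> FilD k \<Longrightarrow> x + y \<in> FilD k"
proof -
  assume "x \<in> FilD k" "y \<in> FilD k"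
  then obtain a b c d where "x = (a, b)" "y = (c, d)" "a \<in> Fil k" "b \<in> Fil k" "c \<in> Fil k" "d \<in> Fil k"
    "a + b \<in> Fil (Suc k)" "c + d \<in> Fil (Suc k)" by (auto simp: FilD_def)
  moreover from this have "(a + b) + (c + d) \<in> Fil (Suc k)" by (rule_tac Fil.F_add)
  ultimately show ?thesis using Fil.F_add by (auto simp: FilD_def add_ac)
qed

lemma filt_FilD: "filt FilD"
proof
  show "FilD (Suc k) \<subseteq> FilD k" for k using Fil.F_Suc by (auto simp: FilD_def)
  show "0 \<in> FilD k" for k by (simp add: FilD_def zero_prod_def Fil.F_zero)
qed (rule FilD_add)

lemma filt_FilD': "filt FilD'"
proof
  show "0 \<in> FilD' k" for k using filt.F_zero[OF filt_FilD] Fil.F_zero by (simp add: FilD'_def zero_prod_def split: nat.split)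
  show "x + y \<in> FilD' k" if "x \<in> FilD' k" "y \<in> FilD' k" for x y k
    using that FilD_add Fil.F_add by (auto simp: FilD'_def split: nat.splits)
  show "FilD' (Suc k) \<subseteq> FilD' k" for k
    using filt.F_Suc[OF filt_FilD] by (auto simp: FilD'_def FilD_def split: nat.splits)
qed

context
  fixes N :: nat and g :: "'x pro2_raag_elem"
  assumes g: "g \<in> carrier GV"
begin

lemma rep_raise: "a \<in> Fil k \<Longrightarrow> rep N g a + a \<in> Fil (Suc k)" "a \<in> Fil k \<Longrightarrow> rep N (\<sigma> g) a + a \<in> Fil (Suc k)"
  using Fil.raisesD[OF rep_filtered[OF g]] Fil.raisesD[OF rep_filtered[OF \<sigma>.hom_closed[OF g]]] by auto

lemma rep_raise2: "a \<in> Fil k \<Longrightarrow> rep N (\<sigma> g) a + rep N g a \<in> Fil (Suc (Suc k))"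
  using Fil.raisesD[OF rep_\<sigma>_cong[OF g]] by simp

text \<open>The two components are moved by g and by \<sigma> g. As these agree to second order, the
  sum of the components stays one degree ahead, as \<open>FilD\<close> demands.\<close>

lemma repD_raise:
  assumes "s \<in> {0, 1}" "(a, b) \<in> FilD k"
  shows "repD N (g, s) (a, b) + (a, b) \<in> FilD (Suc k)"
proof -
  have ab: "a \<in> Fil k" "b \<in> Fil k" "a + b \<in> Fil (Suc k)" using assms by (auto simp: FilD_def)
  have s: "rep N g (a + b) + (a + b) \<in> Fil (Suc (Suc k))" by (rule rep_raise(1)[OF ab(3)])
  have addg: "rep N g (a + b) = rep N g a + rep N g b" by (rule add_mapD[OF add_map_rep[OF g]])
  show ?thesis
  proof (cases "s = 0")
    case True
    have "(rep N g (a + b) + (a + b)) + (rep N (\<sigma> g) b + rep N g b) \<in> Fil (Suc (Suc k))"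
      by (intro Fil.F_add s rep_raise2 ab)
    then have "(rep N g a + a) + (rep N (\<sigma> g) b + b) \<in> Fil (Suc (Suc k))" by (simp add: addg add_ac)
    then show ?thesis using True rep_raise ab by (simp add: repD_def FilD_def)
  next
    case False
    have 1: "(rep N g b + b) + (a + b) \<in> Fil (Suc k)" "(rep N (\<sigma> g) a + a) + (a + b) \<in> Fil (Suc k)"
      by (intro Fil.F_add rep_raise ab)+
    have "(rep N g (a + b) + (a + b)) + (rep N (\<sigma> g) a + rep N g a) \<in> Fil (Suc (Suc k))"
      by (intro Fil.F_add s rep_raise2 ab)
    then have "(rep N g b + a) + (rep N (\<sigma> g) a + b) \<in> Fil (Suc (Suc k))" by (simp add: addg add_ac)
    then show ?thesis using False 1 by (simp add: repD_def FilD_def add_ac)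
  qed
qed

text \<open>The first step of \<open>FilD'\<close>, from pairs whose sum is not yet constrained to
  those in \<open>FilD 0\<close>.\<close>

lemma repD_raise0:
  assumes "s \<in> {0, 1}" "a \<in> Fil 0" "b \<in> Fil 0"
  shows "repD N (g, s) (a, b) + (a, b) \<in> FilD 0"
proof -
  have r: "rep N g a + a \<in> Fil 1" "rep N g b + b \<in> Fil 1" "rep N (\<sigma> g) a + a \<in> Fil 1" "rep N (\<sigma> g) b + b \<in> Fil 1"
    using rep_raise assms by auto
  have F: "u \<in> Fil 1 \<Longrightarrow> u \<in> Fil 0" for u using Fil.F_Suc[of 0] by auto
  have ab: "a + b \<in> Fil 0" by (intro Fil.F_add assms)
  show ?thesis
  proof (cases "s = 0")
    case True
    have "(rep N g a + a) + (rep N (\<sigma> g) b + b) \<in> Fil 1" by (intro Fil.F_add r)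
    then show ?thesis using True r F by (simp add: repD_def FilD_def)
  next
    case False
    have "(rep N g b + b) + (a + b) \<in> Fil 0" "(rep N (\<sigma> g) a + a) + (a + b) \<in> Fil 0"
      by (intro Fil.F_add ab F r)+
    moreover have "(rep N g b + b) + (rep N (\<sigma> g) a + a) \<in> Fil 1" by (intro Fil.F_add r)
    ultimately show ?thesis using False by (simp add: repD_def FilD_def add_ac)
  qed
qed

end

lemma repD_filtered: "x \<in> carrier GD \<Longrightarrow> filt.raises FilD 1 (\<lambda>v. repD N x v + v)"
  unfolding filt.raises_def[OF filt_FilD] using repD_raise by (auto simp: carrier_GD)

lemma repD_filtered': "x \<in> carrier GD \<Longrightarrow> filt.raises FilD' 1 (\<lambda>v. repD N x v + v)"
  unfolding filt.raises_def[OF filt_FilD'] using repD_raise repD_raise0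
  by (auto simp: carrier_GD FilD'_def split: nat.splits)

theorem zassenhaus_GD_iff:
  assumes n: "2 \<le> n" "n \<le> Suc N"
  shows "x \<in> zassenhaus GD TD n \<longleftrightarrow> snd x = 0 \<and> fst x \<in> carrier GV \<and> rep N (fst x) (unit_vec []) + unit_vec [] \<in> Fil n"
proof
  assume x: "x \<in> zassenhaus GD TD n"
  then obtain g s where gs: "x = (g, s)" "g \<in> carrier GV" "s \<in> {0, 1}" by (auto simp: zassenhaus_def carrier_GD)
  have raise: "repD N x v + v \<in> F (k + n)"
    if F: "filt F" "\<And>x. x \<in> carrier GD \<Longrightarrow> filt.raises F 1 (\<lambda>v. repD N x v + v)" "v \<in> F k" for F v k
    by (rule TGD.zassenhaus_raises[where \<rho> = "repD N", OF F(1) _ _ repD_kernel[of N] _ F(2) x F(3)])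
      (auto simp: add_map_repD repD_mult)
  \<comment> \<open>Otherwise the first copy of [] is moved to the second one, and x v - v has first
    component [], of degree 0. But x v - v lies in \<open>FilD' 2\<close>, which is
    \<open>FilD 1\<close> and only admits components of degree at least 1. This is where n \<ge> 2
    is used.\<close>
  have s: "s = 0"
  proof (rule ccontr)
    assume "s \<noteq> 0"
    have "repD N x (unit_vec [], 0) + (unit_vec [], 0) \<in> FilD' (0 + n)"
      by (rule raise[OF filt_FilD' repD_filtered']) (auto simp: FilD'_def unit_vec_Nil_Fil Fil.F_zero)
    moreover have "FilD' (0 + n) \<subseteq> FilD' 2" using filt.F_mono[OF filt_FilD'] n by simp
    ultimately have "unit_vec [] \<in> Fil 1"
      using \<open>s \<noteq> 0\<close> add_map_zero[OF add_map_rep[OF gs(2)]] by (auto simp: repD_def gs(1) FilD'_def FilD_def numeral_2_eq_2)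
    then show False by (simp add: unit_vec_Nil_Fil)
  qed
  \<comment> \<open>The diagonal vector lies in \<open>FilD 0\<close>, so the unshifted filtration
    applies and gives the full degree n; the shifted one would give n - 1.\<close>
  have "repD N x (unit_vec [], unit_vec []) + (unit_vec [], unit_vec []) \<in> FilD (0 + n)"
    by (rule raise[OF filt_FilD repD_filtered]) (auto simp: FilD_def unit_vec_Nil_Fil Fil.F_zero)
  then show "snd x = 0 \<and> fst x \<in> carrier GV \<and> rep N (fst x) (unit_vec []) + unit_vec [] \<in> Fil n"
    using gs s by (simp add: repD_def FilD_def)
next
  assume x: "snd x = 0 \<and> fst x \<in> carrier GV \<and> rep N (fst x) (unit_vec []) + unit_vec [] \<in> Fil n"
  then have "raag_embed (fst x) \<in> zassenhaus GD TD n"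
    using zassenhaus_of_rep[OF TGD.top_group_axioms embed_hom embed_open_normal _ n(2)] by blast
  then show "x \<in> zassenhaus GD TD n" using x by (cases x) (simp add: raag_embed_def one_Delta)
qed

theorem embed_zassenhaus:
  assumes n: "2 \<le> n"
  shows "raag_embed ` zassenhaus GV TV n = zassenhaus GD TD n"
proof (intro equalityI subsetI)
  fix x assume "x \<in> raag_embed ` zassenhaus GV TV n"
  then show "x \<in> zassenhaus GD TD n"
    using zassenhaus_GV_iff[of n n] zassenhaus_GD_iff[OF n, of n] by (auto simp: raag_embed_def one_Delta)
next
  fix x assume "x \<in> zassenhaus GD TD n"
  then have "snd x = 0" "fst x \<in> zassenhaus GV TV n"
    using zassenhaus_GV_iff[of n n] zassenhaus_GD_iff[OF n, of n] by auto
  then show "x \<in> raag_embed ` zassenhaus GV TV n"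
    by (intro image_eqI[of _ _ "fst x"]) (auto simp: raag_embed_def one_Delta prod_eq_iff)
qed

end

section \<open>The graph Lie algebra as the associated graded object, by leading terms\<close>

section \<open>The graded Lie algebra\<close>

context graph
begin

text \<open>For \<open>a\<close> in \<open>FV\<close> this is the element of
  \<open>free_rlie V\<close> corresponding to \<open>a\<close>. It carries computations in the type
  \<open>frl\<close> over to sets of terms.\<close>

definition fcls :: "'x frl \<Rightarrow> 'x rl_term set" where
  "fcls a = {t \<in> rl_terms V. abs_frl t = a}"

abbreviation "FL \<equiv> free_rlie V"
abbreviation "KL \<equiv> raag_lie_kernel V E"

lemma rl_class: "t \<in> rl_terms V \<Longrightarrow> rl_rel V `` {t} = fcls (abs_frl t)"
  by (auto simp: rl_rel_def fcls_def rl_eq_iff)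

lemma carrier_FL: "carrier FL = fcls ` FV"
  by (auto simp: free_rlie_def quotient_def rl_class FV_def)

lemma fcls_term: "a \<in> FV \<Longrightarrow> \<exists>t\<in>rl_terms V. abs_frl t = a \<and> t \<in> fcls a"
  by (auto simp: FV_def fcls_def)

lemma fcls_inj: "a \<in> FV \<Longrightarrow> fcls a = fcls b \<Longrightarrow> a = b"
  using fcls_term[of a] by (auto simp: fcls_def)

lemma FV_closed:
  "0 \<in> FV" "a \<in> FV \<Longrightarrow> b \<in> FV \<Longrightarrow> a + b \<in> FV" "a \<in> FV \<Longrightarrow> b \<in> FV \<Longrightarrow> fbr a b \<in> FV"
  "a \<in> FV \<Longrightarrow> fsq a \<in> FV" "i \<in> V \<Longrightarrow> fgen i \<in> FV"
proof -
  show "0 \<in> FV" using FV_abs[of RZero] by (simp add: abs_frl_simps rl_terms_def)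
  show "i \<in> V \<Longrightarrow> fgen i \<in> FV" using FV_abs[of "RGen i"] by (simp add: abs_frl_simps rl_terms_def)
  assume "a \<in> FV"
  then obtain s where s: "s \<in> rl_terms V" "a = abs_frl s" by (auto simp: FV_def)
  show "fsq a \<in> FV" using FV_abs[of "RSquare s"] s by (simp add: abs_frl_simps rl_terms_def)
  assume "b \<in> FV"
  then obtain t where t: "t \<in> rl_terms V" "b = abs_frl t" by (auto simp: FV_def)
  show "a + b \<in> FV" using FV_abs[of "RPlus s t"] s t by (simp add: abs_frl_simps rl_terms_def)
  show "fbr a b \<in> FV" using FV_abs[of "RBracket s t"] s t by (simp add: abs_frl_simps rl_terms_def)
qed

lemma one_FL: "\<one>\<^bsub>FL\<^esub> = fcls 0"
  using rl_class[of RZero] by (simp add: free_rlie_def abs_frl_simps rl_terms_def)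

lemma mult_FL: "a \<in> FV \<Longrightarrow> b \<in> FV \<Longrightarrow> fcls a \<otimes>\<^bsub>FL\<^esub> fcls b = fcls (a + b)"
proof -
  assume ab: "a \<in> FV" "b \<in> FV"
  have "rl_rel V `` {RPlus s t} = fcls (a + b)" if "s \<in> fcls a" "t \<in> fcls b" for s t
    using rl_class[of "RPlus s t"] that by (auto simp: fcls_def abs_frl_simps rl_terms_def)
  then have "fcls a \<otimes>\<^bsub>FL\<^esub> fcls b = (\<Union>s\<in>fcls a. \<Union>t\<in>fcls b. fcls (a + b))" by (simp add: free_rlie_def)
  then show ?thesis using fcls_term[OF ab(1)] fcls_term[OF ab(2)] by auto
qed

lemma bracket_FL: "a \<in> FV \<Longrightarrow> b \<in> FV \<Longrightarrow> bracket FL (fcls a) (fcls b) = fcls (fbr a b)"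
proof -
  assume ab: "a \<in> FV" "b \<in> FV"
  have "rl_rel V `` {RBracket s t} = fcls (fbr a b)" if "s \<in> fcls a" "t \<in> fcls b" for s t
    using rl_class[of "RBracket s t"] that by (auto simp: fcls_def abs_frl_simps rl_terms_def)
  then have "bracket FL (fcls a) (fcls b) = (\<Union>s\<in>fcls a. \<Union>t\<in>fcls b. fcls (fbr a b))" by (simp add: free_rlie_def)
  then show ?thesis using fcls_term[OF ab(1)] fcls_term[OF ab(2)] by auto
qed

lemma two_map_FL: "a \<in> FV \<Longrightarrow> two_map FL (fcls a) = fcls (fsq a)"
proof -
  assume a: "a \<in> FV"
  have "rl_rel V `` {RSquare s} = fcls (fsq a)" if "s \<in> fcls a" for s
    using rl_class[of "RSquare s"] that by (auto simp: fcls_def abs_frl_simps rl_terms_def)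
  then have "two_map FL (fcls a) = (\<Union>s\<in>fcls a. fcls (fsq a))" by (simp add: free_rlie_def)
  then show ?thesis using fcls_term[OF a] by auto
qed

lemma gen_FL: "i \<in> V \<Longrightarrow> free_rlie_gen V i = fcls (fgen i)"
  using rl_class[of "RGen i"] by (simp add: free_rlie_gen_def abs_frl_simps rl_terms_def)

sublocale FL: comm_group FL
proof (rule comm_groupI)
  show "\<one>\<^bsub>FL\<^esub> \<in> carrier FL" using FV_closed by (auto simp: carrier_FL one_FL)
  fix x assume "x \<in> carrier FL"
  then obtain a where a: "a \<in> FV" "x = fcls a" by (auto simp: carrier_FL)
  show "\<one>\<^bsub>FL\<^esub> \<otimes>\<^bsub>FL\<^esub> x = x" using a FV_closed by (simp add: one_FL mult_FL)
  show "\<exists>y\<in>carrier FL. y \<otimes>\<^bsub>FL\<^esub> x = \<one>\<^bsub>FL\<^esub>"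
    using a by (intro bexI[of _ x]) (simp_all add: one_FL mult_FL carrier_FL)
  fix y assume "y \<in> carrier FL"
  then obtain b where b: "b \<in> FV" "y = fcls b" by (auto simp: carrier_FL)
  show "x \<otimes>\<^bsub>FL\<^esub> y \<in> carrier FL" using a b FV_closed by (auto simp: mult_FL carrier_FL)
  show "x \<otimes>\<^bsub>FL\<^esub> y = y \<otimes>\<^bsub>FL\<^esub> x" using a b by (simp add: mult_FL add.commute)
  fix w assume "w \<in> carrier FL"
  then obtain c where c: "c \<in> FV" "w = fcls c" by (auto simp: carrier_FL)
  show "x \<otimes>\<^bsub>FL\<^esub> y \<otimes>\<^bsub>FL\<^esub> w = x \<otimes>\<^bsub>FL\<^esub> (y \<otimes>\<^bsub>FL\<^esub> w)"
    using a b c FV_closed by (simp add: mult_FL add.assoc)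
qed

lemma inv_FL: "a \<in> FV \<Longrightarrow> inv\<^bsub>FL\<^esub> (fcls a) = fcls a"
  by (rule FL.inv_equality) (auto simp: mult_FL one_FL carrier_FL)

lemma KE_FV: "a \<in> KE \<Longrightarrow> a \<in> FV"
  by (induction rule: KE.induct) (use FV_closed edge_V in blast)+

text \<open>The image of \<open>KE\<close> is a restricted ideal that contains the edge brackets,
  and rule induction shows that it lies in every such ideal.\<close>

lemma KL_eq: "KL = fcls ` KE"
proof
  let ?A = "{bracket FL (free_rlie_gen V u) (free_rlie_gen V v) | u v. {u, v} \<in> E}"
  have br: "bracket FL (free_rlie_gen V u) (free_rlie_gen V v) = fcls (fbr (fgen u) (fgen v))" if "{u, v} \<in> E" for u v
    using edge_V[OF that] FV_closed by (simp add: gen_FL bracket_FL)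
  have "rlie_ideal FL (fcls ` KE)"
    unfolding rlie_ideal_def
  proof (intro conjI ballI)
    show "subgroup (fcls ` KE) FL"
    proof (rule FL.subgroupI)
      show "fcls ` KE \<subseteq> carrier FL" using KE_FV by (auto simp: carrier_FL)
      show "fcls ` KE \<noteq> {}" using KE.zero by blast
    qed (use KE_FV KE.plus in \<open>auto simp: inv_FL mult_FL\<close>)
    fix x assume "x \<in> fcls ` KE"
    then obtain k where k: "k \<in> KE" "x = fcls k" by blast
    show "two_map FL x \<in> fcls ` KE" using k KE.sq KE_FV by (simp add: two_map_FL)
    fix y assume "y \<in> carrier FL"
    then obtain a where "a \<in> FV" "y = fcls a" by (auto simp: carrier_FL)
    then show "bracket FL y x \<in> fcls ` KE" using k KE.br KE_FV by (simp add: bracket_FL)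
  qed
  moreover have "?A \<subseteq> fcls ` KE" using br KE.edge by blast
  ultimately show "KL \<subseteq> fcls ` KE" unfolding raag_lie_kernel_def rlie_ideal_generated_def by blast
  show "fcls ` KE \<subseteq> KL"
    unfolding raag_lie_kernel_def rlie_ideal_generated_def
  proof (intro Inter_greatest subsetI)
    fix J x assume J: "J \<in> {J. rlie_ideal FL J \<and> ?A \<subseteq> J}" and "x \<in> fcls ` KE"
    then obtain k where k: "k \<in> KE" "x = fcls k" by blast
    have sub: "subgroup J FL" and id: "\<And>a b. a \<in> carrier FL \<Longrightarrow> b \<in> J \<Longrightarrow> bracket FL a b \<in> J" "\<And>b. b \<in> J \<Longrightarrow> two_map FL b \<in> J"
      and A: "?A \<subseteq> J" using J by (auto simp: rlie_ideal_def)
    have "fcls k \<in> J" using k(1)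
    proof (induction rule: KE.induct)
      case zero
      then show ?case using subgroup.one_closed[OF sub] by (simp add: one_FL)
    next
      case (plus a b)
      then show ?case using subgroup.m_closed[OF sub, of "fcls a" "fcls b"] KE_FV by (simp add: mult_FL)
    next
      case (edge u v)
      then show ?case using A br[OF edge] by auto
    next
      case (br a b)
      then show ?case using id(1)[of "fcls a" "fcls b"] KE_FV by (simp add: bracket_FL carrier_FL)
    next
      case (sq a)
      then show ?case using id(2)[of "fcls a"] KE_FV by (simp add: two_map_FL)
    qed
    then show "x \<in> J" by (simp add: k)
  qed
qed

lemma KL_subgroup: "subgroup KL FL"
  unfolding KL_eq
proof (rule FL.subgroupI)
  show "fcls ` KE \<subseteq> carrier FL" using KE_FV by (auto simp: carrier_FL)
  show "fcls ` KE \<noteq> {}" using KE.zero by blast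
qed (use KE_FV KE.plus in \<open>auto simp: inv_FL mult_FL\<close>)

sublocale KL: normal KL FL
  by (rule FL.subgroup_imp_normal[OF KL_subgroup])

definition lcos :: "'x frl \<Rightarrow> 'x rl_term set set" where
  "lcos a = KL #>\<^bsub>FL\<^esub> fcls a"

lemma lcos_eq_iff:
  assumes "a \<in> FV" "b \<in> FV"
  shows "lcos a = lcos b \<longleftrightarrow> a + b \<in> KE"
proof -
  have "fcls a \<in> carrier FL" "fcls b \<in> carrier FL" using assms by (auto simp: carrier_FL)
  then have "lcos a = lcos b \<longleftrightarrow> fcls (a + b) \<in> KL"
    using KL.coset_eq_iff[of "fcls a" "fcls b"] assms by (simp add: lcos_def inv_FL mult_FL)
  also have "\<dots> \<longleftrightarrow> a + b \<in> KE"
    using fcls_inj[OF FV_closed(2)[OF assms]] by (auto simp: KL_eq)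
  finally show ?thesis .
qed

lemma lcos_mult: "a \<in> FV \<Longrightarrow> b \<in> FV \<Longrightarrow> lcos a <#>\<^bsub>FL\<^esub> lcos b = lcos (a + b)"
  using KL.rcos_sum[of "fcls a" "fcls b"] by (simp add: lcos_def carrier_FL mult_FL)

abbreviation "LC n \<equiv> raag_lie_component V E n"

lemma carrier_LC: "carrier (LC n) = lcos ` Hom n"
proof -
  have "free_rlie_component V n = fcls ` Hom n"
  proof -
    have "free_rlie_component V n = (\<lambda>t. rl_rel V `` {t}) ` {t \<in> rl_terms V. rl_homogeneous n t}"
      by (auto simp: free_rlie_component_def)
    then show ?thesis by (simp add: Hom_def image_image rl_class cong: image_cong_simp)
  qed
  then show ?thesis by (auto simp: raag_lie_component_def lcos_def)
qed

lemma mult_LC: "a \<in> Hom n \<Longrightarrow> b \<in> Hom n \<Longrightarrow> lcos a \<otimes>\<^bsub>LC n\<^esub> lcos b = lcos (a + b)"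
  using lcos_mult[of a b] Hom_subset by (auto simp: raag_lie_component_def raag_lie_def rlie_quotient_def)

lemma one_LC: "\<one>\<^bsub>LC n\<^esub> = lcos 0"
  using KL.coset_eq_self_iff[of "fcls 0"] FV_closed KE.zero
  by (auto simp: raag_lie_component_def raag_lie_def rlie_quotient_def lcos_def KL_eq carrier_FL)

lemma group_LC: "group (LC n)"
proof (rule groupI)
  show "\<one>\<^bsub>LC n\<^esub> \<in> carrier (LC n)" using Hom_zero by (auto simp: carrier_LC one_LC)
  fix x assume "x \<in> carrier (LC n)"
  then obtain a where a: "a \<in> Hom n" "x = lcos a" by (auto simp: carrier_LC)
  show "\<one>\<^bsub>LC n\<^esub> \<otimes>\<^bsub>LC n\<^esub> x = x" using a Hom_zero by (simp add: one_LC mult_LC)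
  show "\<exists>y\<in>carrier (LC n). y \<otimes>\<^bsub>LC n\<^esub> x = \<one>\<^bsub>LC n\<^esub>"
    using a by (intro bexI[of _ x]) (simp_all add: one_LC mult_LC carrier_LC)
  fix y assume "y \<in> carrier (LC n)"
  then obtain b where b: "b \<in> Hom n" "y = lcos b" by (auto simp: carrier_LC)
  show "x \<otimes>\<^bsub>LC n\<^esub> y \<in> carrier (LC n)" using a b Hom_plus by (auto simp: mult_LC carrier_LC)
  fix w assume "w \<in> carrier (LC n)"
  then obtain c where c: "c \<in> Hom n" "w = lcos c" by (auto simp: carrier_LC)
  show "x \<otimes>\<^bsub>LC n\<^esub> y \<otimes>\<^bsub>LC n\<^esub> w = x \<otimes>\<^bsub>LC n\<^esub> (y \<otimes>\<^bsub>LC n\<^esub> w)"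
    using a b c Hom_plus by (simp add: mult_LC add.assoc)
qed

subsection \<open>Leading terms of group elements\<close>

text \<open>The part of degree n, read as an element of the Lie algebra. For group elements of that
  order all lists involved are singletons by \<open>disp_singleton\<close>, so taking the head loses
  nothing.\<close>

definition lead :: "nat \<Rightarrow> ((nat \<times> 'x frl) list \<Rightarrow>\<^sub>0 bit) \<Rightarrow> (nat \<times> 'x frl \<Rightarrow>\<^sub>0 bit)" where
  "lead n = lin (\<lambda>S. if deg S = n then unit_vec (hd S) else 0)"

lemma lead_add: "lead n (u + v) = lead n u + lead n v"
  by (simp add: lead_def lin_add)

lemma lead_Fil: "u \<in> Fil (Suc n) \<Longrightarrow> lead n u = 0"
proof -
  assume "u \<in> Fil (Suc n)"
  then have "lead n u = lin (\<lambda>S. 0) u" unfolding lead_def by (intro lin_cong) (auto simp: Fil_def)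
  then show ?thesis by (simp add: lin_const_zero)
qed

text \<open>Truncation at N = n suffices to test membership in the terms n and n + 1 of the
  filtration at the same time.\<close>

definition disp :: "nat \<Rightarrow> 'x pro2_raag_elem \<Rightarrow> ((nat \<times> 'x frl) list \<Rightarrow>\<^sub>0 bit)" where
  "disp n g = rep n g (unit_vec []) + unit_vec []"

text \<open>The difference is (g - 1)(h - 1) [], one degree higher than (h - 1) [].\<close>

lemma disp_mult:
  assumes "g \<in> carrier GV" "h \<in> carrier GV" "disp n h \<in> Fil k"
  shows "disp n (g \<otimes>\<^bsub>GV\<^esub> h) + (disp n g + disp n h) \<in> Fil (Suc k)"
proof -
  have "rep n g (disp n h) + disp n h \<in> Fil (Suc k)"
    using Fil.raisesD[OF rep_filtered[OF assms(1)] assms(3)] by simp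
  moreover have "rep n g (disp n h) + disp n h = disp n (g \<otimes>\<^bsub>GV\<^esub> h) + (disp n g + disp n h)"
    using assms by (simp add: disp_def rep_mult add_mapD[OF add_map_rep] add_ac)
  ultimately show ?thesis by simp
qed

lemma disp_mult_Fil:
  assumes "g \<in> carrier GV" "h \<in> carrier GV" "disp n g \<in> Fil k" "disp n h \<in> Fil k"
  shows "disp n (g \<otimes>\<^bsub>GV\<^esub> h) \<in> Fil k"
proof -
  have "disp n (g \<otimes>\<^bsub>GV\<^esub> h) + (disp n g + disp n h) \<in> Fil k"
    using disp_mult[OF assms(1,2,4)] Fil.F_Suc by blast
  then have "(disp n (g \<otimes>\<^bsub>GV\<^esub> h) + (disp n g + disp n h)) + (disp n g + disp n h) \<in> Fil k"
    using assms Fil.F_add by blast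
  then show ?thesis by (simp add: add_ac)
qed

lemma disp_inv:
  assumes "g \<in> carrier GV" "disp n g \<in> Fil k"
  shows "disp n (inv\<^bsub>GV\<^esub> g) \<in> Fil k"
proof -
  have "rep n (inv\<^bsub>GV\<^esub> g) (disp n g) = disp n (inv\<^bsub>GV\<^esub> g)"
    using assms rep_mult[of "inv\<^bsub>GV\<^esub> g" g n "unit_vec []"]
    by (simp add: disp_def add_mapD[OF add_map_rep] rep_one add_ac)
  then show ?thesis using rep_Fil[of "inv\<^bsub>GV\<^esub> g" "disp n g" k n] assms by simp
qed

lemma disp_singleton:
  assumes "g \<in> carrier GV" "1 \<le> n" "disp n g \<in> Fil n" "S \<in> pkeys (disp n g)" "deg S = n"
  shows "\<exists>b\<in>BB. S = [b]"
proof -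
  obtain w where w: "w \<in> lists V" "rep n g = wop (XN n) w" using rep_word[OF assms(1)] by blast
  then have "disp n g = unit_vec [] + wop (XN n) w (unit_vec [])" by (simp add: disp_def add.commute)
  then show ?thesis using leading_term_primitive_XN[OF w(1), of n n S] assms by simp
qed

lemma lead_keys:
  assumes "g \<in> carrier GV" "1 \<le> n" "disp n g \<in> Fil n"
  shows "pkeys (lead n (disp n g)) \<subseteq> {x \<in> BB. fst x = n}"
  unfolding lead_def
proof (rule keys_lin_subset)
  fix S assume "S \<in> pkeys (disp n g)"
  then show "pkeys (if deg S = n then unit_vec (hd S) else 0) \<subseteq> {x \<in> BB. fst x = n}"
    using disp_singleton[OF assms, of S] by auto
qed

text \<open>Distinct singleton lists have distinct heads, so nothing cancels in the leading
  term.\<close>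

lemma lead_eq_zero:
  assumes "g \<in> carrier GV" "1 \<le> n" "disp n g \<in> Fil n" "lead n (disp n g) = 0"
  shows "disp n g \<in> Fil (Suc n)"
proof -
  have "deg S \<noteq> n" if S: "S \<in> pkeys (disp n g)" for S
  proof
    assume d: "deg S = n"
    then obtain b where b: "S = [b]" using disp_singleton[OF assms(1-3) S] by blast
    have "plookup (lead n (disp n g)) b = lin (\<lambda>T. if T = S then 1 else 0) (disp n g)"
      unfolding lead_def lookup_lin
    proof (rule lin_cong)
      fix T assume "T \<in> pkeys (disp n g)"
      then show "plookup (if deg T = n then unit_vec (hd T) else 0) b = (if T = S then 1 else 0)"
        using disp_singleton[OF assms(1-3), of T] b d by (auto simp: lookup_single when_def split: if_splits)
    qed
    also have "\<dots> = 1" using S by (simp add: lin_indicator in_keys_iff)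
    finally show False using assms(4) by simp
  qed
  moreover have "n \<le> deg S" "S \<in> vlist BB" if "S \<in> pkeys (disp n g)" for S
    using assms(3) that by (auto simp: Fil_def)
  ultimately show ?thesis by (fastforce simp: Fil_def)
qed

text \<open>A word with the prescribed leading operator is applied to []. In degree n the truncated
  operator agrees with the action of a in the enveloping algebra, which sends [] to the coordinates
  of a as singleton lists.\<close>

lemma realize_Hom:
  assumes a: "a \<in> Hom n" and n: "1 \<le> n"
  shows "\<exists>g\<in>carrier GV. disp n g \<in> Fil n \<and> lead n (disp n g) = crd n a"
proof -
  obtain t where t: "t \<in> rl_terms V" "rl_homogeneous n t" "a = abs_frl t" using a by (auto simp: Hom_def)
  obtain w where w: "w \<in> lists V" "Fil.raises n (\<lambda>v. v + wop (XN n) w v)"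
    "Fil.raises (Suc n) (\<lambda>v. v + wop (XN n) w v + intp (XN n) t v)"
    using realize_leading_term[OF t(2,1)] by blast
  let ?g = "word_prod GV gen w" and ?e = "unit_vec []"
  have g: "?g \<in> carrier GV" by (rule GV.word_prod_closed[OF w(1) gen_closed])
  have d: "disp n ?g = ?e + wop (XN n) w ?e" using rep_word_prod[OF w(1)] by (simp add: disp_def add.commute)
  have e0: "?e \<in> Fil 0" by (simp add: unit_vec_Nil_Fil)
  have 1: "disp n ?g \<in> Fil n" using Fil.raisesD[OF w(2) e0] by (simp add: d)
  have "disp n ?g + intp (XN n) t ?e \<in> Fil (Suc n)" using Fil.raisesD[OF w(3) e0] by (simp add: d)
  moreover have "intp X t ?e + intp (XN n) t ?e \<in> Fil (Suc n)" by (rule intp_XN_Fil) simp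
  ultimately have "(disp n ?g + intp (XN n) t ?e) + (intp X t ?e + intp (XN n) t ?e) \<in> Fil (Suc n)" by (rule Fil.F_add)
  then have "disp n ?g + intp X t ?e \<in> Fil (Suc n)" by (simp add: add_ac)
  then have "disp n ?g + vop (crd n a) ?e \<in> Fil (Suc n)" using vop_eq_intp[OF t(2,1), of ?e] t(3) by simp
  then have "lead n (disp n ?g) = lead n (vop (crd n a) ?e)"
    using lead_Fil by (metis lead_add add_eq_zero_iff_char_two)
  also have "\<dots> = lin (\<lambda>b. lead n (unit_vec [b])) (crd n a)"
    by (simp add: vop_of_unit_vec lead_def lin_lin)
  also have "\<dots> = lin unit_vec (crd n a)"
    by (rule lin_cong) (use crd_keys[OF n a] in \<open>auto simp: lead_def\<close>)
  finally have "lead n (disp n ?g) = crd n a" by simp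
  then show ?thesis using g 1 by blast
qed

end

context delta_graph
begin

text \<open>Taking leading terms is a homomorphism by \<open>disp_mult\<close> and onto by
  \<open>realize_Hom\<close>. Its kernel is the next term of the filtration, since
  \<open>crd\<close> recovers a leading term from its class modulo \<open>KE\<close>.\<close>

theorem zassenhaus_quotient_iso:
  assumes n: "2 \<le> n"
  shows "zassenhaus_quotient GD TD n \<cong> LC n"
proof -
  let ?Z = "zassenhaus GD TD n"
  have Z: "x \<in> ?Z \<longleftrightarrow> snd x = 0 \<and> fst x \<in> carrier GV \<and> disp n (fst x) \<in> Fil n" for x
    using zassenhaus_GD_iff[of n n x] n by (simp add: disp_def)
  have Z': "x \<in> zassenhaus GD TD (Suc n) \<longleftrightarrow> snd x = 0 \<and> fst x \<in> carrier GV \<and> disp n (fst x) \<in> Fil (Suc n)" for x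
    using zassenhaus_GD_iff[of "Suc n" n x] n by (simp add: disp_def)
  have emb: "snd x = 0 \<Longrightarrow> x = raag_embed (fst x)" for x :: "'x pro2_raag_elem \<times> int"
    by (cases x) (simp add: raag_embed_def one_Delta)
  have mult: "x \<otimes>\<^bsub>GD\<^esub> y = (fst x \<otimes>\<^bsub>GV\<^esub> fst y, 0)" if "x \<in> ?Z" "y \<in> ?Z" for x y
    using that by (cases x; cases y) (simp add: Z mult_GD \<delta>_zero)
  have sub: "subgroup ?Z GD"
  proof (rule GD.subgroupI)
    show "?Z \<subseteq> carrier GD" by (auto simp: zassenhaus_def)
    have "disp n \<one>\<^bsub>GV\<^esub> = 0" by (simp add: disp_def rep_one)
    then have "(\<one>\<^bsub>GV\<^esub>, 0) \<in> ?Z" by (simp add: Z Fil.F_zero)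
    then show "?Z \<noteq> {}" by blast
    fix x assume x: "x \<in> ?Z"
    then have "inv\<^bsub>GD\<^esub> x = raag_embed (inv\<^bsub>GV\<^esub> (fst x))" using emb[of x] by (metis Z emb.hom_inv)
    then show "inv\<^bsub>GD\<^esub> x \<in> ?Z" using x disp_inv by (simp add: Z raag_embed_def one_Delta)
    fix y assume y: "y \<in> ?Z"
    show "x \<otimes>\<^bsub>GD\<^esub> y \<in> ?Z" unfolding mult[OF x y] using x y disp_mult_Fil by (simp add: Z)
  qed
  let ?G = "GD\<lparr>carrier := ?Z\<rparr>"
  interpret G: group ?G by (rule subgroup.subgroup_is_group[OF sub group_GD])
  interpret L: group "LC n" by (rule group_LC)
  define h where "h = (\<lambda>x :: 'x pro2_raag_elem \<times> int. lcos (val (lead n (disp n (fst x)))))"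
  have n1: "1 \<le> n" using n by simp
  have vH: "val (lead n (disp n (fst x))) \<in> Hom n" if "x \<in> ?Z" for x
    using that lead_keys[OF _ n1] by (intro val_Hom) (auto simp: Z)
  have "h \<in> hom ?G (LC n)"
  proof (rule homI)
    show "h x \<in> carrier (LC n)" if "x \<in> carrier ?G" for x
      using vH that by (auto simp: h_def carrier_LC)
    fix x y assume "x \<in> carrier ?G" "y \<in> carrier ?G"
    then have xy: "x \<in> ?Z" "y \<in> ?Z" by auto
    have "disp n (fst x \<otimes>\<^bsub>GV\<^esub> fst y) + (disp n (fst x) + disp n (fst y)) \<in> Fil (Suc n)"
      using xy by (intro disp_mult) (auto simp: Z)
    then have "lead n (disp n (fst x \<otimes>\<^bsub>GV\<^esub> fst y)) = lead n (disp n (fst x)) + lead n (disp n (fst y))"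
      using lead_Fil by (metis lead_add add_eq_zero_iff_char_two)
    then show "h (x \<otimes>\<^bsub>?G\<^esub> y) = h x \<otimes>\<^bsub>LC n\<^esub> h y"
      using mult[OF xy] vH xy by (simp add: h_def mult_LC val_add)
  qed
  then interpret h: group_hom ?G "LC n" h by unfold_locales
  have onto: "h ` carrier ?G = carrier (LC n)"
  proof
    show "h ` carrier ?G \<subseteq> carrier (LC n)" using h.hom_closed by blast
    show "carrier (LC n) \<subseteq> h ` carrier ?G"
    proof
      fix y assume "y \<in> carrier (LC n)"
      then obtain a where a: "a \<in> Hom n" "y = lcos a" by (auto simp: carrier_LC)
      obtain g where g: "g \<in> carrier GV" "disp n g \<in> Fil n" "lead n (disp n g) = crd n a"
        using realize_Hom[OF a(1) n1] by blast
      have x: "(g, 0) \<in> ?Z" using g by (simp add: Z)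
      have "val (crd n a) + a \<in> KE" using val_crd[OF a(1)] by (simp add: add.commute)
      moreover have "val (crd n a) \<in> FV" using vH[OF x] g(3) Hom_subset by auto
      ultimately have "lcos (val (crd n a)) = lcos a" using lcos_eq_iff a(1) Hom_subset by blast
      then have "h (g, 0) = y" using g a by (simp add: h_def)
      then show "y \<in> h ` carrier ?G" using x by force
    qed
  qed
  have "h x = \<one>\<^bsub>LC n\<^esub> \<longleftrightarrow> x \<in> zassenhaus GD TD (Suc n)" if x: "x \<in> ?Z" for x
  proof -
    have "h x = \<one>\<^bsub>LC n\<^esub> \<longleftrightarrow> val (lead n (disp n (fst x))) \<in> KE"
      using lcos_eq_iff[of "val (lead n (disp n (fst x)))" 0] vH[OF x] Hom_subset FV_closed(1) by (auto simp: h_def one_LC)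
    also have "\<dots> \<longleftrightarrow> lead n (disp n (fst x)) = 0"
    proof
      assume "val (lead n (disp n (fst x))) \<in> KE"
      then have "crd n (val (lead n (disp n (fst x)))) = 0" using vH[OF x] by (intro crd_KE)
      then show "lead n (disp n (fst x)) = 0" using crd_val[of "lead n (disp n (fst x))" n] lead_keys[OF _ n1] x by (simp add: Z)
    qed (simp add: val_def KE.zero)
    also have "\<dots> \<longleftrightarrow> disp n (fst x) \<in> Fil (Suc n)"
      using lead_eq_zero[OF _ n1] lead_Fil x by (auto simp: Z)
    also have "\<dots> \<longleftrightarrow> x \<in> zassenhaus GD TD (Suc n)" using x by (simp add: Z Z')
    finally show ?thesis .
  qed
  moreover have "zassenhaus GD TD (Suc n) \<subseteq> ?Z" using subsetD[OF Fil.F_Suc[of n]] by (auto simp: Z Z')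
  ultimately have "kernel ?G (LC n) h = zassenhaus GD TD (Suc n)" by (auto simp: kernel_def)
  then show ?thesis
    using h.FactGroup_iso[OF onto] by (simp add: zassenhaus_quotient_def)
qed

end

theorem proposition1p3:
  fixes d :: nat
    and E :: "nat set set"
    and z :: "nat \<Rightarrow> nat pro2_raag_elem"
    and \<delta> :: "int \<Rightarrow> nat pro2_raag_elem \<Rightarrow> nat pro2_raag_elem"
  assumes graph: "E \<subseteq> {e. e \<subseteq> {1..d} \<and> card e = 2}"
    and z: "\<forall>i \<in> {1..d}. z i \<in> carrier (raag {1..d} E)"
    and action: "delta_raag_action {1..d} E z \<delta>"
  shows "(\<forall>n \<ge> 2.
            raag_embed ` zassenhaus (raag {1..d} E) (raag_topology {1..d} E) n =
            zassenhaus (delta_raag {1..d} E \<delta>) (delta_raag_topology {1..d} E) n) \<and>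
         (\<forall>n \<ge> 2.
            zassenhaus_quotient (delta_raag {1..d} E \<delta>) (delta_raag_topology {1..d} E) n \<cong>
            raag_lie_component {1..d} E n)"
proof -
  interpret delta_graph "{1..d}" E z \<delta>
    by unfold_locales (use assms in auto)
  show ?thesis
    using embed_zassenhaus zassenhaus_quotient_iso by blast
qed

end
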